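(* Let $1<p<\infty$. For every $S\in\mathcal B(X_{00})$ and every $\varepsilon>0$, there are $A,B\in\mathcal B(X_{00})$ and a scalar $c\in\mathbb R$ such that $$AB=\mathrm{Id}_{X_{00}},\qquad \|ASB-c\,\mathrm{Id}_{X_{00}}\|_{\mathcal B(X_{00})}<\varepsilon.$$ Moreover, $A$ and $B$ may be chosen so that $\|A\|\,\|B\|\le 1+\varepsilon$.
   Context: Scalars are real. $\mathcal D$ is the collection of dyadic intervals in $[0,1)$; for $I\in\mathcal D$ with dyadic children $I^+,I^-$, the Haar function is $h_I=\mathbf 1_{I^+}-\mathbf 1_{I^-}$. For functions $f,g$ on $[0,1]$, $(f\otimes g)(s,t)=f(s)g(t)$. $L_p(L_1)$ is the Bochner space $L_p([0,1];L_1[0,1])$ (outer variable $s$, inner variable $t$), and $X_{00}$ is the closed linear span of $\{h_I\otimes h_J: I,J\in\mathcal D\}$ in $L_p(L_1)$. $\mathcal B(X_{00})$ denotes the bounded linear operators on $X_{00}$. *)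

theory Defs
  imports "HOL-Analysis.Analysis"
begin

section \<open>Strongly measurable functions on the unit interval, modulo null sets\<close>

abbreviation unit_leb :: "real measure" where
  "unit_leb \<equiv> lebesgue_on {0..1}"

definition strongly_measurable :: "(real \<Rightarrow> 'b::real_normed_vector) \<Rightarrow> bool" where
  "strongly_measurable f \<longleftrightarrow>
     (\<exists>u. (\<forall>i::nat. simple_function unit_leb (u i)) \<and>
          (AE s in unit_leb. (\<lambda>i. u i s) \<longlonglongrightarrow> f s))"

lemma strongly_measurable_const [intro, simp]: "strongly_measurable (\<lambda>_. c)"
  unfolding strongly_measurable_def by (rule exI[of _ "\<lambda>_ _. c"]) simp

lemma strongly_measurable_simple:
  "simple_function unit_leb f \<Longrightarrow> strongly_measurable f"
  unfolding strongly_measurable_def by (rule exI[of _ "\<lambda>_. f"]) simp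

lemma strongly_measurable_add:
  assumes "strongly_measurable f" "strongly_measurable g"
  shows "strongly_measurable (\<lambda>s. f s + g s)"
proof -
  obtain u where
    u: "\<And>i. simple_function unit_leb (u i)" "AE s in unit_leb. (\<lambda>i. u i s) \<longlonglongrightarrow> f s"
    using assms(1) unfolding strongly_measurable_def by metis
  obtain v where
    v: "\<And>i. simple_function unit_leb (v i)" "AE s in unit_leb. (\<lambda>i. v i s) \<longlonglongrightarrow> g s"
    using assms(2) unfolding strongly_measurable_def by metis
  have "AE s in unit_leb. (\<lambda>i. u i s + v i s) \<longlonglongrightarrow> f s + g s"
    using u(2) v(2) by eventually_elim (rule tendsto_add)
  then show ?thesis
    unfolding strongly_measurable_def
    by (intro exI[of _ "\<lambda>i s. u i s + v i s"] conjI allI simple_function_add u(1) v(1))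
qed

lemma strongly_measurable_scaleR:
  assumes "strongly_measurable f"
  shows "strongly_measurable (\<lambda>s. c *\<^sub>R f s)"
proof -
  from assms obtain u where
    u: "\<And>i. simple_function unit_leb (u i)" "AE s in unit_leb. (\<lambda>i. u i s) \<longlonglongrightarrow> f s"
    unfolding strongly_measurable_def by metis
  have "AE s in unit_leb. (\<lambda>i. c *\<^sub>R u i s) \<longlonglongrightarrow> c *\<^sub>R f s"
    using u(2) by eventually_elim (rule tendsto_scaleR[OF tendsto_const])
  then show ?thesis
    unfolding strongly_measurable_def
    by (intro exI[of _ "\<lambda>i s. c *\<^sub>R u i s"] conjI allI
        simple_function_compose1[OF u(1), of "scaleR c"])
qed

lemma strongly_measurable_uminus:
  "strongly_measurable f \<Longrightarrow> strongly_measurable (\<lambda>s. - f s)"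
  using strongly_measurable_scaleR[of f "-1"] by simp

lemma strongly_measurable_diff:
  "strongly_measurable f \<Longrightarrow> strongly_measurable g \<Longrightarrow> strongly_measurable (\<lambda>s. f s - g s)"
  using strongly_measurable_add[of f "\<lambda>s. - g s"] strongly_measurable_uminus[of g] by simp

lemma strongly_measurable_norm_AE:
  assumes "strongly_measurable f"
  obtains g :: "real \<Rightarrow> real"
  where "g \<in> borel_measurable unit_leb" "AE s in unit_leb. norm (f s) = g s"
proof -
  from assms obtain u where
    u: "\<And>i. simple_function unit_leb (u i)" "AE s in unit_leb. (\<lambda>i. u i s) \<longlonglongrightarrow> f s"
    unfolding strongly_measurable_def by metis
  have [measurable]: "(\<lambda>s. norm (u i s)) \<in> borel_measurable unit_leb" for i
    using simple_function_compose1[OF u(1), of norm i]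
    by (intro borel_measurable_simple_function) simp
  have meas: "(\<lambda>s. lim (\<lambda>i. norm (u i s))) \<in> borel_measurable unit_leb"
    by measurable
  have ae: "AE s in unit_leb. norm (f s) = lim (\<lambda>i. norm (u i s))"
    using u(2)
  proof eventually_elim
    case (elim s)
    then show ?case using tendsto_norm[OF elim] by (simp add: limI)
  qed
  show ?thesis by (rule that[OF meas ae])
qed

quotient_type (overloaded) 'b L0 = "real \<Rightarrow> 'b::real_normed_vector" /
  partial: "\<lambda>f g. strongly_measurable f \<and> strongly_measurable g \<and> (AE s in unit_leb. f s = g s)"
proof (rule part_equivpI)
  show "\<exists>f::real \<Rightarrow> 'b. strongly_measurable f \<and> strongly_measurable f \<and> (AE s in unit_leb. f s = f s)"
    by (rule exI[of _ "\<lambda>_. 0"]) simp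
  show "symp (\<lambda>f g::real \<Rightarrow> 'b. strongly_measurable f \<and> strongly_measurable g \<and> (AE s in unit_leb. f s = g s))"
    by (rule sympI) (auto elim: eventually_mono)
  show "transp (\<lambda>f g::real \<Rightarrow> 'b. strongly_measurable f \<and> strongly_measurable g \<and> (AE s in unit_leb. f s = g s))"
    by (rule transpI) (auto elim: eventually_elim2)
qed

instantiation L0 :: (real_normed_vector) real_vector
begin

lift_definition zero_L0 :: "'a L0" is "\<lambda>_. 0" by simp

lift_definition plus_L0 :: "'a L0 \<Rightarrow> 'a L0 \<Rightarrow> 'a L0" is "\<lambda>f g s. f s + g s"
  by (auto intro: strongly_measurable_add elim: eventually_elim2)

lift_definition minus_L0 :: "'a L0 \<Rightarrow> 'a L0 \<Rightarrow> 'a L0" is "\<lambda>f g s. f s - g s"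
  by (auto intro: strongly_measurable_diff elim: eventually_elim2)

lift_definition uminus_L0 :: "'a L0 \<Rightarrow> 'a L0" is "\<lambda>f s. - f s"
  by (auto intro: strongly_measurable_uminus)

lift_definition scaleR_L0 :: "real \<Rightarrow> 'a L0 \<Rightarrow> 'a L0" is "\<lambda>c f s. c *\<^sub>R f s"
  by (auto intro: strongly_measurable_scaleR elim: eventually_mono)

instance
  by standard
    (transfer; auto simp: algebra_simps scaleR_add_left scaleR_add_right
       intro!: strongly_measurable_add strongly_measurable_scaleR strongly_measurable_diff
         strongly_measurable_uminus)+

end


section \<open>Bochner spaces\<close>

lift_definition Lp_integral :: "real \<Rightarrow> 'b::real_normed_vector L0 \<Rightarrow> ennreal" is
  "\<lambda>p f. \<integral>\<^sup>+ s. ennreal (norm (f s) powr p) \<partial>unit_leb"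
  by (rule nn_integral_cong_AE) (auto elim: eventually_mono)

definition Lp_space :: "real \<Rightarrow> 'b::real_normed_vector L0 set" where
  "Lp_space p = {F. Lp_integral p F < \<infinity>}"

text \<open>Only meaningful on \<^const>\<open>Lp_space\<close>: an infinite integral is sent to \<open>0\<close>.\<close>
definition Lp_norm :: "real \<Rightarrow> 'b::real_normed_vector L0 \<Rightarrow> real" where
  "Lp_norm p F = enn2real (Lp_integral p F) powr (1 / p)"

lemma Lp_integral_zero: "Lp_integral p 0 = 0"
  by transfer simp

lemma Lp_integral_1_add_le: "Lp_integral 1 (F + G) \<le> Lp_integral 1 F + Lp_integral 1 G"
proof (transfer, clarsimp)
  fix f g :: "real \<Rightarrow> 'a"
  assume fg: "strongly_measurable f" "strongly_measurable g"
  obtain f' where f': "f' \<in> borel_measurable unit_leb" "AE s in unit_leb. norm (f s) = f' s"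
    using strongly_measurable_norm_AE[OF fg(1)] .
  obtain g' where g': "g' \<in> borel_measurable unit_leb" "AE s in unit_leb. norm (g s) = g' s"
    using strongly_measurable_norm_AE[OF fg(2)] .
  have ae: "AE s in unit_leb. ennreal (norm (f s + g s)) \<le> ennreal (f' s) + ennreal (g' s)"
    using f'(2) g'(2)
    by eventually_elim
      (metis ennreal_leI ennreal_plus norm_ge_zero norm_triangle_ineq)
  have "(\<integral>\<^sup>+ s. ennreal (norm (f s + g s)) \<partial>unit_leb)
      \<le> (\<integral>\<^sup>+ s. ennreal (f' s) + ennreal (g' s) \<partial>unit_leb)"
    by (rule nn_integral_mono_AE[OF ae])
  also have "\<dots> = (\<integral>\<^sup>+ s. ennreal (f' s) \<partial>unit_leb) + (\<integral>\<^sup>+ s. ennreal (g' s) \<partial>unit_leb)"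
    using f'(1) g'(1) by (intro nn_integral_add) auto
  also have "(\<integral>\<^sup>+ s. ennreal (f' s) \<partial>unit_leb) = (\<integral>\<^sup>+ s. ennreal (norm (f s)) \<partial>unit_leb)"
    using f'(2) by (intro nn_integral_cong_AE) (auto elim: eventually_mono)
  also have "(\<integral>\<^sup>+ s. ennreal (g' s) \<partial>unit_leb) = (\<integral>\<^sup>+ s. ennreal (norm (g s)) \<partial>unit_leb)"
    using g'(2) by (intro nn_integral_cong_AE) (auto elim: eventually_mono)
  finally show "(\<integral>\<^sup>+ s. ennreal (norm (f s + g s)) \<partial>unit_leb)
    \<le> (\<integral>\<^sup>+ s. ennreal (norm (f s)) \<partial>unit_leb) + (\<integral>\<^sup>+ s. ennreal (norm (g s)) \<partial>unit_leb)" .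
qed

lemma Lp_integral_1_scaleR: "Lp_integral 1 (c *\<^sub>R F) = ennreal \<bar>c\<bar> * Lp_integral 1 F"
proof (transfer, clarsimp)
  fix c :: real and f :: "real \<Rightarrow> 'a"
  assume f: "strongly_measurable f"
  obtain f' where f': "f' \<in> borel_measurable unit_leb" "AE s in unit_leb. norm (f s) = f' s"
    using strongly_measurable_norm_AE[OF f] .
  have "(\<integral>\<^sup>+ s. ennreal (\<bar>c\<bar> * norm (f s)) \<partial>unit_leb) = (\<integral>\<^sup>+ s. ennreal \<bar>c\<bar> * ennreal (f' s) \<partial>unit_leb)"
    using f'(2) by (intro nn_integral_cong_AE) (auto simp: ennreal_mult' elim!: eventually_mono)
  also have "\<dots> = ennreal \<bar>c\<bar> * (\<integral>\<^sup>+ s. ennreal (f' s) \<partial>unit_leb)"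
    using f'(1) by (intro nn_integral_cmult) auto
  also have "(\<integral>\<^sup>+ s. ennreal (f' s) \<partial>unit_leb) = (\<integral>\<^sup>+ s. ennreal (norm (f s)) \<partial>unit_leb)"
    using f'(2) by (intro nn_integral_cong_AE) (auto elim: eventually_mono)
  finally show "(\<integral>\<^sup>+ s. ennreal (\<bar>c\<bar> * norm (f s)) \<partial>unit_leb)
    = ennreal \<bar>c\<bar> * (\<integral>\<^sup>+ s. ennreal (norm (f s)) \<partial>unit_leb)" .
qed

lemma Lp_integral_1_eq_0:
  fixes F :: "'b::real_normed_vector L0"
  assumes "Lp_integral 1 F = 0"
  shows "F = 0"
  using assms
proof (transfer, clarsimp)
  fix f :: "real \<Rightarrow> 'b"
  assume f: "strongly_measurable f" and 0: "(\<integral>\<^sup>+ s. ennreal (norm (f s)) \<partial>unit_leb) = 0"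
  obtain f' where f': "f' \<in> borel_measurable unit_leb" "AE s in unit_leb. norm (f s) = f' s"
    using strongly_measurable_norm_AE[OF f] .
  have "(\<integral>\<^sup>+ s. ennreal (f' s) \<partial>unit_leb) = (\<integral>\<^sup>+ s. ennreal (norm (f s)) \<partial>unit_leb)"
    using f'(2) by (intro nn_integral_cong_AE) (auto elim: eventually_mono)
  with 0 f'(1) have "AE s in unit_leb. ennreal (f' s) = 0"
    by (subst nn_integral_0_iff_AE[symmetric]) auto
  with f'(2) show "AE s in unit_leb. f s = 0"
    by eventually_elim (metis ennreal_eq_0_iff norm_le_zero_iff)
qed


section \<open>The scalar space of integrable functions on the unit interval\<close>

typedef L1 = "Lp_space 1 :: real L0 set"
  by (rule exI[of _ 0]) (simp add: Lp_space_def Lp_integral_zero)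

setup_lifting type_definition_L1

instantiation L1 :: real_normed_vector
begin

lift_definition zero_L1 :: L1 is 0
  by (simp add: Lp_space_def Lp_integral_zero)

lift_definition plus_L1 :: "L1 \<Rightarrow> L1 \<Rightarrow> L1" is "(+)"
  unfolding Lp_space_def
  by (auto intro: le_less_trans[OF Lp_integral_1_add_le])

lift_definition scaleR_L1 :: "real \<Rightarrow> L1 \<Rightarrow> L1" is "scaleR"
  unfolding Lp_space_def by (auto simp: Lp_integral_1_scaleR ennreal_mult_less_top)

lift_definition uminus_L1 :: "L1 \<Rightarrow> L1" is uminus
proof -
  fix F :: "real L0"
  assume "F \<in> Lp_space 1"
  then show "- F \<in> Lp_space 1"
    using Lp_integral_1_scaleR[of "-1" F] by (simp add: Lp_space_def)
qed

lift_definition minus_L1 :: "L1 \<Rightarrow> L1 \<Rightarrow> L1" is minus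
proof -
  fix F G :: "real L0"
  assume "F \<in> Lp_space 1" "G \<in> Lp_space 1"
  then show "F - G \<in> Lp_space 1"
    using Lp_integral_1_add_le[of F "- G"] Lp_integral_1_scaleR[of "-1" G]
    by (auto simp: Lp_space_def intro: le_less_trans)
qed

lift_definition norm_L1 :: "L1 \<Rightarrow> real" is "Lp_norm 1" .

definition sgn_L1 :: "L1 \<Rightarrow> L1" where "sgn_L1 x = inverse (norm x) *\<^sub>R x"

definition dist_L1 :: "L1 \<Rightarrow> L1 \<Rightarrow> real" where "dist_L1 x y = norm (x - y)"

definition uniformity_L1 :: "(L1 \<times> L1) filter" where
  "uniformity_L1 = (INF e\<in>{0<..}. principal {(x, y). dist x y < e})"

definition open_L1 :: "L1 set \<Rightarrow> bool" where
  "open_L1 U \<longleftrightarrow> (\<forall>x\<in>U. eventually (\<lambda>(x', y). x' = x \<longrightarrow> y \<in> U) uniformity)"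

instance
proof
  fix x y z :: L1 and a b :: real
  show "x + y + z = x + (y + z)" "x + y = y + x" "0 + x = x" "- x + x = 0" "x - y = x + - y"
    "a *\<^sub>R (x + y) = a *\<^sub>R x + a *\<^sub>R y" "(a + b) *\<^sub>R x = a *\<^sub>R x + b *\<^sub>R x"
    "a *\<^sub>R b *\<^sub>R x = (a * b) *\<^sub>R x" "1 *\<^sub>R x = x"
    by (transfer; simp add: algebra_simps scaleR_add_left scaleR_add_right)+
  show "norm x = 0 \<longleftrightarrow> x = 0"
    by transfer
      (auto simp: Lp_norm_def Lp_space_def Lp_integral_zero enn2real_eq_0_iff
        intro: Lp_integral_1_eq_0)
  show "norm (x + y) \<le> norm x + norm y"
  proof transfer
    fix F G :: "real L0"
    assume FG: "F \<in> Lp_space 1" "G \<in> Lp_space 1"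
    then have "enn2real (Lp_integral 1 (F + G)) \<le> enn2real (Lp_integral 1 F + Lp_integral 1 G)"
      by (intro enn2real_mono Lp_integral_1_add_le) (auto simp: Lp_space_def)
    also have "\<dots> = enn2real (Lp_integral 1 F) + enn2real (Lp_integral 1 G)"
      using FG by (intro enn2real_plus) (auto simp: Lp_space_def)
    finally show "Lp_norm 1 (F + G) \<le> Lp_norm 1 F + Lp_norm 1 G"
      by (simp add: Lp_norm_def)
  qed
  show "norm (a *\<^sub>R x) = \<bar>a\<bar> * norm x"
    by transfer (simp add: Lp_norm_def Lp_integral_1_scaleR enn2real_mult)
qed (simp_all add: sgn_L1_def dist_L1_def uniformity_L1_def open_L1_def)

end


section \<open>The Haar system and its biparameter span\<close>

text \<open>\<open>dyadic n k\<close> with \<open>k < 2 ^ n\<close> ranges exactly once over the dyadic intervals in \<open>[0,1)\<close>;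
  its children are \<open>dyadic (n + 1) (2 * k)\<close> and \<open>dyadic (n + 1) (2 * k + 1)\<close>.  The left child is
  the positive one; the opposite choice replaces \<open>h\<^sub>I\<close> by \<open>- h\<^sub>I\<close> and leaves \<open>X00\<close> unchanged.\<close>
definition dyadic :: "nat \<Rightarrow> nat \<Rightarrow> real set" where
  "dyadic n k = {real k / 2 ^ n ..< (real k + 1) / 2 ^ n}"

definition haar :: "nat \<Rightarrow> nat \<Rightarrow> real \<Rightarrow> real" where
  "haar n k s = indicator (dyadic (n + 1) (2 * k)) s - indicator (dyadic (n + 1) (2 * k + 1)) s"

definition tensor :: "(real \<Rightarrow> real) \<Rightarrow> (real \<Rightarrow> real) \<Rightarrow> real \<times> real \<Rightarrow> real" where
  "tensor f g = (\<lambda>(s, t). f s * g t)"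

text \<open>A function \<open>K\<close> of \<open>(s, t)\<close> is viewed as the class of \<open>s \<mapsto> K(s, \<cdot>)\<close>.  The two quotient maps are
  meaningful only when each slice is integrable and the slice map is strongly measurable.\<close>
definition vector_valued :: "(real \<times> real \<Rightarrow> real) \<Rightarrow> L1 L0" where
  "vector_valued K = abs_L0 (\<lambda>s. Abs_L1 (abs_L0 (\<lambda>t. K (s, t))))"

definition haar_tensors :: "L1 L0 set" where
  "haar_tensors =
     {vector_valued (tensor (haar m j) (haar n k)) | m j n k. j < 2 ^ m \<and> k < 2 ^ n}"

definition X00 :: "real \<Rightarrow> L1 L0 set" where
  "X00 p = {F \<in> Lp_space p. \<forall>e>0. \<exists>G \<in> span haar_tensors. Lp_norm p (F - G) < e}"

lemma simple_function_haar: "simple_function unit_leb (haar n k)"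
proof -
  let ?h = "\<lambda>s. indicator (dyadic (n + 1) (2 * k) \<inter> {0..1}) s
              - indicator (dyadic (n + 1) (2 * k + 1) \<inter> {0..1}) s :: real"
  have "dyadic i j \<inter> {0..1} \<in> sets unit_leb" for i j
    by (auto simp: dyadic_def sets_restrict_space)
  then have "simple_function unit_leb ?h"
    by (intro simple_function_diff simple_function_indicator)
  also have "simple_function unit_leb ?h \<longleftrightarrow> simple_function unit_leb (haar n k)"
    by (intro simple_function_cong) (auto simp: haar_def indicator_def)
  finally show ?thesis .
qed

text \<open>The slices of \<open>h\<^sub>I \<otimes> h\<^sub>J\<close> satisfy the conditions required above.\<close>

lemma haar_slice_integrable: "abs_L0 (\<lambda>t. tensor (haar m j) (haar n k) (s, t)) \<in> Lp_space 1"
proof -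
  let ?f = "\<lambda>t. haar m j s * haar n k t"
  have "strongly_measurable ?f"
    by (intro strongly_measurable_simple simple_function_mult simple_function_const simple_function_haar)
  then have "Lp_integral 1 (abs_L0 ?f) = (\<integral>\<^sup>+ t. ennreal (norm (?f t) powr 1) \<partial>unit_leb)"
    by (intro Lp_integral.abs_eq) simp
  also have "\<dots> \<le> (\<integral>\<^sup>+ t. ennreal 1 \<partial>unit_leb)"
    by (intro nn_integral_mono ennreal_leI) (auto simp: haar_def indicator_def)
  also have "\<dots> < \<infinity>"
    by (simp add: emeasure_restrict_space)
  finally show ?thesis
    by (simp add: Lp_space_def tensor_def)
qed

lemma haar_tensor_measurable:
  "strongly_measurable (\<lambda>s. Abs_L1 (abs_L0 (\<lambda>t. tensor (haar m j) (haar n k) (s, t))))"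
proof -
  have "simple_function unit_leb ((\<lambda>c. Abs_L1 (abs_L0 (\<lambda>t. c * haar n k t))) \<circ> haar m j)"
    by (intro simple_function_compose simple_function_haar)
  then show ?thesis
    by (intro strongly_measurable_simple) (simp add: comp_def tensor_def)
qed


section \<open>Bounded operators on a normed subspace\<close>

text \<open>A normed space is given as a linear subspace \<open>V\<close> of an ambient real vector space together
  with a function \<open>N\<close> restricting to a norm on \<open>V\<close>.  Operators are functions on the ambient space of which
  only the restriction to \<open>V\<close> matters.\<close>

definition bounded_operators ::
  "'v::real_vector set \<Rightarrow> ('v \<Rightarrow> real) \<Rightarrow> ('v \<Rightarrow> 'v) set" where
  "bounded_operators V N =
     {T. T ` V \<subseteq> V \<and>
         (\<forall>x\<in>V. \<forall>y\<in>V. T (x + y) = T x + T y) \<and>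
         (\<forall>c. \<forall>x\<in>V. T (c *\<^sub>R x) = c *\<^sub>R T x) \<and>
         (\<exists>C. \<forall>x\<in>V. N (T x) \<le> C * N x)}"

definition op_norm :: "'v::real_vector set \<Rightarrow> ('v \<Rightarrow> real) \<Rightarrow> ('v \<Rightarrow> 'v) \<Rightarrow> real" where
  "op_norm V N T = (SUP x\<in>{x \<in> V. N x \<le> 1}. N (T x))"

end

theory Submission
  imports Defs
begin

text \<open>The space is spanned by the products \<open>w\<^sub>A(s) w\<^sub>B(t)\<close> of Walsh functions with \<open>A\<close>, \<open>B\<close> nonempty. The
  operator \<open>B\<close> substitutes for the \<open>r\<close>-th binary digits of \<open>s\<close> and \<open>t\<close> the values of Rademacher functions
  \<open>\<rho>\<^sub>r(s)\<close>, \<open>\<sigma>\<^sub>r(t)\<close> of rapidly increasing levels, multiplied on each dyadic cell by a random sign; \<open>A\<close> is the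
  adjoint of \<open>B\<close>, a conditional expectation, so that \<open>AB = Id\<close> and both have norm at most one.

  Averaging over the random signs and passing to the limit along an ultrafilter, level after level, turns the
  Walsh matrix of \<open>ASB\<close>, up to summable errors, into \<open>g + v + w\<close>: here \<open>g\<close> depends on the two symmetric
  differences of the index sets only, \<open>v\<close> and \<open>w\<close> on one symmetric difference and the indices of the other
  variable. All three are small unless the indices agree, which leaves the multiple \<open>c = g(\<emptyset>, \<emptyset>)\<close> of the
  identity, provided that the two iterated traces giving \<open>g\<close> coincide. If they did not, choosing the levels of
  \<open>\<rho>\<close> and \<open>\<sigma>\<close> in alternating order would make \<open>S\<close> act on a Riesz product, which is bounded in \<open>L\<^sub>1\<close>, like a
  martingale transform that is unbounded on Riesz products.\<close>


section \<open>Averages over subsets and random signs\<close>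

text \<open>The obstacle is the inner L_1. In s the pairing is that of L_q with L_p, so functionals
  and vectors both decay on small cells, the former because 1 < p. In t it is that of L_infinity
  with L_1: restricting a functional to a small cell of t gains nothing in norm. Vanishing of
  functionals in t is therefore only qualitative and needs two arguments of its own: S F is a fixed
  element of L_p(L_1) and has little mass on thin strips; and disjoint pieces in t can be tested
  against M Rademacher functions in s, whose sum has L_p norm o(M) as p is finite. Likewise the
  corrections v and w cannot be dismissed as small entries. Errors governed by all four index sets
  are summable in absolute value, but v is small only in terms of C = A' \<triangle> A and of B', B,
  so it does not decay in A, and w does not decay in B. The sum over the free index must be carried
  out first; it is a pairing with a Walsh multiple of a partial Walsh coefficient of F, whose norm F
  controls.\<close>

definition sg :: "'a set \<Rightarrow> 'a \<Rightarrow> real" where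
  "sg Z a = (if a \<in> Z then -1 else 1)"

text \<open>The expectation of F over a uniformly random subset of X. For X a set of digit positions
  this is integration over the Cantor space; for X a set of cells it averages over independent signs
  on the cells.\<close>

definition avg :: "'a set \<Rightarrow> ('a set \<Rightarrow> real) \<Rightarrow> real" where
  "avg X F = (\<Sum>Z\<in>Pow X. F Z) / 2 ^ card X"

lemma sg_mult_self [simp]: "sg Z a * sg Z a = 1"
  by (simp add: sg_def)

lemma abs_sg [simp]: "\<bar>sg Z a\<bar> = 1"
  by (simp add: sg_def)

lemma sg_insert: "sg (insert z Z) a = (if a = z then -1 else sg Z a)"
  by (auto simp: sg_def)

lemma avg_empty [simp]: "avg {} F = F {}"
  by (simp add: avg_def)

lemma sum_Pow_insert:
  fixes F :: "'a set \<Rightarrow> real"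
  assumes "finite X" "z \<notin> X"
  shows "(\<Sum>Z\<in>Pow (insert z X). F Z) = (\<Sum>Z\<in>Pow X. F Z) + (\<Sum>Z\<in>Pow X. F (insert z Z))"
proof -
  have inj: "inj_on (insert z) (Pow X)"
    using assms by (auto simp: inj_on_def)
  have "(\<Sum>Z\<in>Pow (insert z X). F Z) = (\<Sum>Z\<in>Pow X. F Z) + (\<Sum>Z\<in>insert z ` Pow X. F Z)"
    unfolding Pow_insert using assms by (intro sum.union_disjoint) auto
  also have "(\<Sum>Z\<in>insert z ` Pow X. F Z) = (\<Sum>Z\<in>Pow X. F (insert z Z))"
    by (subst sum.reindex[OF inj]) simp
  finally show ?thesis .
qed

lemma avg_insert:
  assumes "finite X" "z \<notin> X"
  shows "avg (insert z X) F = (avg X F + avg X (\<lambda>Z. F (insert z Z))) / 2"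
  using assms by (simp add: avg_def sum_Pow_insert[OF assms] field_simps)

lemma avg_add: "avg X (\<lambda>Z. F Z + G Z) = avg X F + avg X G"
  by (simp add: avg_def sum.distrib add_divide_distrib)

lemma avg_diff: "avg X (\<lambda>Z. F Z - G Z) = avg X F - avg X G"
  by (simp add: avg_def sum_subtractf diff_divide_distrib)

lemma avg_cmult: "avg X (\<lambda>Z. c * F Z) = c * avg X F"
  by (simp add: avg_def sum_distrib_left)

lemma avg_mult_const: "avg X (\<lambda>Z. F Z * c) = avg X F * c"
  by (simp add: avg_def sum_distrib_right)

lemma avg_const [simp]: "finite X \<Longrightarrow> avg X (\<lambda>_. c) = c"
  by (simp add: avg_def card_Pow)

lemma avg_sum: "avg X (\<lambda>Z. \<Sum>i\<in>I. F i Z) = (\<Sum>i\<in>I. avg X (F i))"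
  unfolding avg_def by (subst sum.swap) (simp add: sum_divide_distrib)

lemma avg_cong: "(\<And>Z. Z \<subseteq> X \<Longrightarrow> F Z = G Z) \<Longrightarrow> avg X F = avg X G"
  unfolding avg_def by (auto intro!: arg_cong[where f = "\<lambda>u. u / _"] sum.cong)

lemma avg_mono: "(\<And>Z. Z \<subseteq> X \<Longrightarrow> F Z \<le> G Z) \<Longrightarrow> avg X F \<le> avg X G"
  unfolding avg_def by (auto intro!: divide_right_mono sum_mono)

lemma avg_nonneg: "(\<And>Z. Z \<subseteq> X \<Longrightarrow> 0 \<le> F Z) \<Longrightarrow> 0 \<le> avg X F"
  unfolding avg_def by (auto intro!: divide_nonneg_nonneg sum_nonneg)

lemma abs_avg_le: "\<bar>avg X F\<bar> \<le> avg X (\<lambda>Z. \<bar>F Z\<bar>)"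
  unfolding avg_def by (simp add: abs_divide divide_right_mono sum_abs)

lemma avg_swap: "avg X (\<lambda>x. avg Y (\<lambda>y. F x y)) = avg Y (\<lambda>y. avg X (\<lambda>x. F x y))"
proof -
  have "(\<Sum>x\<in>Pow X. \<Sum>y\<in>Pow Y. F x y) = (\<Sum>y\<in>Pow Y. \<Sum>x\<in>Pow X. F x y)"
    by (rule sum.swap)
  then show ?thesis
    unfolding avg_def by (simp add: sum_divide_distrib[symmetric])
qed

lemma avg_attained:
  assumes "finite X" shows "\<exists>Z. Z \<subseteq> X \<and> avg X F \<le> F Z"
proof (rule ccontr)
  assume "\<not> ?thesis"
  then have *: "\<And>Z. Z \<subseteq> X \<Longrightarrow> F Z < avg X F" by auto
  have "(\<Sum>Z\<in>Pow X. F Z) < (\<Sum>Z\<in>Pow X. avg X F)"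
    using assms * by (intro sum_strict_mono) auto
  also have "\<dots> = 2 ^ card X * avg X F"
    using assms by (simp add: card_Pow)
  also have "\<dots> = (\<Sum>Z\<in>Pow X. F Z)"
    by (simp add: avg_def)
  finally show False by simp
qed

section \<open>Moments of linear and quadratic forms in random signs\<close>

lemma avg_linear_sign: "finite X \<Longrightarrow> avg X (\<lambda>Z. \<Sum>a\<in>X. c a * sg Z a) = 0"
proof (induction X rule: finite_induct)
  case (insert z X)
  have 1: "avg X (\<lambda>Z. \<Sum>a\<in>insert z X. c a * sg Z a) = avg X (\<lambda>Z. c z + (\<Sum>a\<in>X. c a * sg Z a))"
    using insert.hyps by (intro avg_cong) (auto simp: sg_def)
  have 2: "avg X (\<lambda>Z. \<Sum>a\<in>insert z X. c a * sg (insert z Z) a) = avg X (\<lambda>Z. - c z + (\<Sum>a\<in>X. c a * sg Z a))"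
    using insert.hyps by (intro avg_cong) (auto simp: sg_insert intro!: sum.cong)
  show ?case
    unfolding avg_insert[OF insert.hyps] 1 2 avg_add using insert by simp
qed simp

lemma avg_linear_sign_sq:
  "finite X \<Longrightarrow> avg X (\<lambda>Z. (\<Sum>a\<in>X. c a * sg Z a)\<^sup>2) = (\<Sum>a\<in>X. (c a)\<^sup>2)"
proof (induction X rule: finite_induct)
  case (insert z X)
  let ?L = "\<lambda>Z. \<Sum>a\<in>X. c a * sg Z a"
  have 1: "avg X (\<lambda>Z. (\<Sum>a\<in>insert z X. c a * sg Z a)\<^sup>2) = avg X (\<lambda>Z. (c z)\<^sup>2 + (2 * c z * ?L Z + (?L Z)\<^sup>2))"
    using insert.hyps by (intro avg_cong) (auto simp: sg_def power2_sum algebra_simps)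
  have L: "(\<Sum>a\<in>X. c a * sg (insert z Z) a) = ?L Z" for Z
    using insert.hyps by (intro sum.cong) (auto simp: sg_insert)
  have 2: "avg X (\<lambda>Z. (\<Sum>a\<in>insert z X. c a * sg (insert z Z) a)\<^sup>2)
      = avg X (\<lambda>Z. (c z)\<^sup>2 + ((-2 * c z) * ?L Z + (?L Z)\<^sup>2))"
    using insert.hyps by (intro avg_cong) (simp add: L, simp add: sg_def power2_sum power2_diff)
  show ?case
    unfolding avg_insert[OF insert.hyps] 1 2 avg_add avg_cmult avg_linear_sign[OF insert.hyps(1)]
    using insert by simp
qed simp

text \<open>A variance bound. Splitting off the sign of z turns the centered form Q into Q + L or Q
  - L with L linear, and the squares of these average to Q^2 + L^2, without cross term. The factor 2
  pays for the entries \<open>t a z\<close> and \<open>t z a\<close> sharing one coefficient of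
  L.\<close>

lemma avg_quadratic_sign_sq:
  "finite X \<Longrightarrow>
   avg X (\<lambda>Z. ((\<Sum>a\<in>X. \<Sum>b\<in>X. t a b * sg Z a * sg Z b) - (\<Sum>a\<in>X. t a a))\<^sup>2)
     \<le> 2 * (\<Sum>a\<in>X. \<Sum>b\<in>X. (t a b)\<^sup>2)"
proof (induction X rule: finite_induct)
  case (insert z X)
  let ?Q = "\<lambda>Z. (\<Sum>a\<in>X. \<Sum>b\<in>X. t a b * sg Z a * sg Z b) - (\<Sum>a\<in>X. t a a)"
  let ?L = "\<lambda>Z. \<Sum>a\<in>X. (t a z + t z a) * sg Z a"
  have exp: "(\<Sum>a\<in>insert z X. \<Sum>b\<in>insert z X. t a b * s a * s b) - (\<Sum>a\<in>insert z X. t a a)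
      = ((\<Sum>a\<in>X. \<Sum>b\<in>X. t a b * s a * s b) - (\<Sum>a\<in>X. t a a)) + s z * (\<Sum>a\<in>X. (t a z + t z a) * s a)"
    if "s z * s z = 1" for s
  proof -
    have "t z z * s z * s z = t z z" using that by (simp add: mult.assoc)
    then show ?thesis
      using insert.hyps
      by (simp add: sum.distrib sum_distrib_left algebra_simps)
  qed
  have 1: "avg X (\<lambda>Z. ((\<Sum>a\<in>insert z X. \<Sum>b\<in>insert z X. t a b * sg Z a * sg Z b) - (\<Sum>a\<in>insert z X. t a a))\<^sup>2)
      = avg X (\<lambda>Z. (?Q Z + ?L Z)\<^sup>2)"
  proof (rule avg_cong)
    fix Z assume "Z \<subseteq> X"
    then have "sg Z z = 1" using insert.hyps by (auto simp: sg_def)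
    then show "((\<Sum>a\<in>insert z X. \<Sum>b\<in>insert z X. t a b * sg Z a * sg Z b) - (\<Sum>a\<in>insert z X. t a a))\<^sup>2
      = (?Q Z + ?L Z)\<^sup>2"
      by (subst exp) auto
  qed
  have 2: "avg X (\<lambda>Z. ((\<Sum>a\<in>insert z X. \<Sum>b\<in>insert z X. t a b * sg (insert z Z) a * sg (insert z Z) b)
        - (\<Sum>a\<in>insert z X. t a a))\<^sup>2) = avg X (\<lambda>Z. (?Q Z - ?L Z)\<^sup>2)"
  proof (rule avg_cong)
    fix Z assume "Z \<subseteq> X"
    have s: "sg (insert z Z) a = sg Z a" if "a \<in> X" for a
      using that insert.hyps by (auto simp: sg_insert)
    have z: "sg (insert z Z) z = -1" by (simp add: sg_def)
    have "(\<Sum>a\<in>X. \<Sum>b\<in>X. t a b * sg (insert z Z) a * sg (insert z Z) b) = (\<Sum>a\<in>X. \<Sum>b\<in>X. t a b * sg Z a * sg Z b)"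
      "(\<Sum>a\<in>X. (t a z + t z a) * sg (insert z Z) a) = ?L Z"
      by (intro sum.cong refl; simp add: s)+
    then show "((\<Sum>a\<in>insert z X. \<Sum>b\<in>insert z X. t a b * sg (insert z Z) a * sg (insert z Z) b)
        - (\<Sum>a\<in>insert z X. t a a))\<^sup>2 = (?Q Z - ?L Z)\<^sup>2"
      by (subst exp) (auto simp: z)
  qed
  have "avg (insert z X) (\<lambda>Z. ((\<Sum>a\<in>insert z X. \<Sum>b\<in>insert z X. t a b * sg Z a * sg Z b) - (\<Sum>a\<in>insert z X. t a a))\<^sup>2)
      = (avg X (\<lambda>Z. (?Q Z + ?L Z)\<^sup>2) + avg X (\<lambda>Z. (?Q Z - ?L Z)\<^sup>2)) / 2"
    unfolding avg_insert[OF insert.hyps] 1 2 ..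
  also have "\<dots> = avg X (\<lambda>Z. ((?Q Z + ?L Z)\<^sup>2 + (?Q Z - ?L Z)\<^sup>2) * (1/2))"
    by (simp only: avg_mult_const avg_add)
  also have "\<dots> = avg X (\<lambda>Z. (?Q Z)\<^sup>2 + (?L Z)\<^sup>2)"
    by (intro avg_cong) (simp add: power2_sum power2_diff)
  also have "\<dots> = avg X (\<lambda>Z. (?Q Z)\<^sup>2) + (\<Sum>a\<in>X. (t a z + t z a)\<^sup>2)"
    by (simp only: avg_add avg_linear_sign_sq[OF insert.hyps(1)])
  also have "\<dots> \<le> 2 * (\<Sum>a\<in>X. \<Sum>b\<in>X. (t a b)\<^sup>2) + (\<Sum>a\<in>X. 2 * ((t a z)\<^sup>2 + (t z a)\<^sup>2))"
    using sum_squares_bound[of "t _ z" "t z _"]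
    by (intro add_mono insert.IH sum_mono) (simp add: power2_sum algebra_simps)
  also have "\<dots> \<le> 2 * (\<Sum>a\<in>insert z X. \<Sum>b\<in>insert z X. (t a b)\<^sup>2)"
    using insert.hyps by (simp add: sum.distrib sum_distrib_left algebra_simps)
  finally show ?case .
qed simp


section \<open>A nonprincipal ultrafilter\<close>

text \<open>Zorn's lemma for proper filters under reversed inclusion. Along an ultrafilter every
  bounded sequence converges and limits stay linear, which spares the choice of subsequences that
  work for all test functions.\<close>

lemma ultrafilter_exists:
  "\<exists>U::nat filter. U \<le> sequentially \<and> U \<noteq> bot \<and> (\<forall>P. eventually P U \<or> eventually (\<lambda>n. \<not> P n) U)"
proof -
  define A where "A = {U :: nat filter. U \<le> sequentially \<and> U \<noteq> bot}"
  have "\<exists>U\<in>A. \<forall>F\<in>A. F \<le> U \<longrightarrow> F = U"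
  proof (rule predicate_Zorn)
    show "partial_order_on A (relation_of (\<lambda>F G. G \<le> F) A)"
      by (rule partial_order_on_relation_ofI) auto
    fix C assume "C \<in> Chains (relation_of (\<lambda>F G. G \<le> F) A)"
    then have C: "C \<subseteq> A" and chain: "\<And>F G. F \<in> C \<Longrightarrow> G \<in> C \<Longrightarrow> F \<le> G \<or> G \<le> F"
      by (auto simp: Chains_def relation_of_def)
    show "\<exists>U\<in>A. \<forall>F\<in>C. U \<le> F"
    proof (cases "C = {}")
      case True
      then show ?thesis by (auto simp: A_def)
    next
      case False
      \<comment> \<open>A chain is directed downwards, so its infimum is proper when all its members
        are.\<close>
      have "\<exists>x\<in>C. x \<le> inf F G" if "F \<in> C" "G \<in> C" for F G
        using chain[OF that] that by (auto simp: inf_absorb1 inf_absorb2)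
      from eventually_Inf_base[OF False this, of "\<lambda>_. False"]
      have "Inf C \<noteq> bot" using C by (auto simp: A_def trivial_limit_def)
      moreover have "Inf C \<le> sequentially" using C False by (auto simp: A_def intro: Inf_lower2)
      ultimately show ?thesis by (intro bexI[of _ "Inf C"] ballI Inf_lower) (simp_all add: A_def)
    qed
  qed
  then obtain U where U: "U \<in> A" "\<And>F. F \<in> A \<Longrightarrow> F \<le> U \<Longrightarrow> F = U" by blast
  have "eventually P U" if P: "\<not> eventually (\<lambda>n. \<not> P n) U" for P
  proof -
    have "inf U (principal {n. P n}) \<in> A"
      using U(1) P by (auto simp: A_def trivial_limit_def eventually_inf_principal intro: le_infI1)
    from U(2)[OF this] have "U = inf U (principal {n. P n})" by simp
    then have "eventually P U \<longleftrightarrow> eventually P (inf U (principal {n. P n}))" by (rule arg_cong)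
    then show ?thesis by (simp add: eventually_inf_principal)
  qed
  then show ?thesis using U(1) by (auto simp: A_def)
qed

definition ufilter :: "nat filter" where
  "ufilter = (SOME U. U \<le> sequentially \<and> U \<noteq> bot \<and> (\<forall>P. eventually P U \<or> eventually (\<lambda>n. \<not> P n) U))"

lemma ufilter_le: "ufilter \<le> sequentially"
  and ufilter_nonbot [simp]: "ufilter \<noteq> bot"
  and ufilter_ultra: "eventually P ufilter \<or> eventually (\<lambda>n. \<not> P n) ufilter"
  using someI_ex[OF ultrafilter_exists, folded ufilter_def] by blast+

lemma eventually_ufilter: "eventually P sequentially \<Longrightarrow> eventually P ufilter"
  using ufilter_le by (simp add: le_filter_def)

lemma tendsto_ufilter: "X \<longlonglongrightarrow> l \<Longrightarrow> (X \<longlongrightarrow> l) ufilter"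
  by (rule filterlim_mono[OF _ order_refl ufilter_le])

text \<open>Compactness gives a cluster point of the image filter. For an ultrafilter it is a limit,
  since either a neighbourhood or its complement is eventual.\<close>

lemma tendsto_Lim_ufilter:
  fixes X :: "nat \<Rightarrow> real"
  assumes "eventually (\<lambda>n. \<bar>X n\<bar> \<le> K) ufilter"
  shows "(X \<longlongrightarrow> Lim ufilter X) ufilter"
proof -
  have "compact {-K..K}" by simp
  moreover have "filtermap X ufilter \<noteq> bot" by (simp add: filtermap_bot_iff)
  moreover have "eventually (\<lambda>x. x \<in> {-K..K}) (filtermap X ufilter)"
    unfolding eventually_filtermap by (rule eventually_mono[OF assms]) auto
  ultimately obtain x where x: "inf (nhds x) (filtermap X ufilter) \<noteq> bot"
    unfolding compact_filter by blast
  have "(X \<longlongrightarrow> x) ufilter"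
  proof (rule topological_tendstoI)
    fix S assume S: "open S" "x \<in> S"
    show "eventually (\<lambda>n. X n \<in> S) ufilter"
    proof (rule ccontr)
      assume "\<not> ?thesis"
      then have "eventually (\<lambda>n. X n \<notin> S) ufilter" using ufilter_ultra by blast
      then have "eventually (\<lambda>y. y \<notin> S) (filtermap X ufilter)" by (simp add: eventually_filtermap)
      moreover have "eventually (\<lambda>y. y \<in> S) (nhds x)" using S by (rule eventually_nhds_in_open)
      ultimately have "eventually (\<lambda>_. False) (inf (nhds x) (filtermap X ufilter))"
        unfolding eventually_inf by blast
      then show False using x by (simp add: trivial_limit_def)
    qed
  qed
  then show ?thesis
    by (simp add: tendsto_Lim)
qed

lemma Lim_ufilter_le:
  fixes X :: "nat \<Rightarrow> real"
  assumes "eventually (\<lambda>n. \<bar>X n\<bar> \<le> K) ufilter"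
  shows "\<bar>Lim ufilter X\<bar> \<le> K"
  using tendsto_rabs[OF tendsto_Lim_ufilter[OF assms]] assms
  by (rule tendsto_upperbound) simp


section \<open>Step functions on the Cantor space and random Rademacher functions\<close>

text \<open>A point of the Cantor space is the set of positions of its binary digits equal to \<open>1\<close>.\<close>

definition dep :: "nat \<Rightarrow> (nat set \<Rightarrow> 'b) \<Rightarrow> bool" where
  "dep N f \<longleftrightarrow> (\<forall>x. f (x \<inter> {..<N}) = f x)"

definition step_fun :: "(nat set \<Rightarrow> real) \<Rightarrow> bool" where
  "step_fun f \<longleftrightarrow> (\<exists>N. dep N f)"

lemma dep_mono: "dep N f \<Longrightarrow> N \<le> M \<Longrightarrow> dep M f"
  unfolding dep_def by (metis Int_assoc inf.absorb_iff2 lessThan_subset_iff inf_commute)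

lemma depD: "dep N f \<Longrightarrow> x \<inter> {..<N} = y \<inter> {..<N} \<Longrightarrow> f x = f y"
  unfolding dep_def by metis

lemma dep_const [simp]: "dep N (\<lambda>_. c)"
  and dep_compose: "dep N f \<Longrightarrow> dep N (\<lambda>x. h (f x))"
  and dep_compose2: "dep N f \<Longrightarrow> dep N g \<Longrightarrow> dep N (\<lambda>x. k (f x) (g x))"
  by (auto simp: dep_def)

lemma dep_add: "dep N f \<Longrightarrow> dep N g \<Longrightarrow> dep N (\<lambda>x. f x + g x :: real)"
  and dep_mult: "dep N f \<Longrightarrow> dep N g \<Longrightarrow> dep N (\<lambda>x. f x * g x :: real)"
  by (auto simp: dep_def)

lemma dep_prod: "(\<And>i. i \<in> I \<Longrightarrow> dep N (f i)) \<Longrightarrow> dep N (\<lambda>x. \<Prod>i\<in>I. f i x :: real)"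
  by (simp add: dep_def)

lemma dep_sg: "n < N \<Longrightarrow> dep N (\<lambda>x. sg x n)"
  by (simp add: dep_def sg_def)

lemma dep_Int: "n \<le> N \<Longrightarrow> dep N (\<lambda>x. x \<inter> {..<n})"
  by (auto simp: dep_def)

lemma step_fun_common: "step_fun f \<Longrightarrow> step_fun g \<Longrightarrow> \<exists>N. dep N f \<and> dep N g"
  unfolding step_fun_def by (metis dep_mono nat_le_linear)

lemma step_fun_const [simp]: "step_fun (\<lambda>_. c)"
  by (auto simp: step_fun_def)

lemma step_fun_compose2: "step_fun f \<Longrightarrow> step_fun g \<Longrightarrow> step_fun (\<lambda>x. h (f x) (g x))"
  using step_fun_common[of f g] by (auto simp: step_fun_def intro: dep_compose2)

lemma step_fun_add: "step_fun f \<Longrightarrow> step_fun g \<Longrightarrow> step_fun (\<lambda>x. f x + g x)"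
  and step_fun_diff: "step_fun f \<Longrightarrow> step_fun g \<Longrightarrow> step_fun (\<lambda>x. f x - g x)"
  and step_fun_mult: "step_fun f \<Longrightarrow> step_fun g \<Longrightarrow> step_fun (\<lambda>x. f x * g x)"
  by (rule step_fun_compose2; assumption)+

lemma step_fun_cmult: "step_fun f \<Longrightarrow> step_fun (\<lambda>x. c * f x)"
  by (rule step_fun_mult) auto

lemma step_fun_sum: "(\<And>i. i \<in> I \<Longrightarrow> step_fun (f i)) \<Longrightarrow> step_fun (\<lambda>x. \<Sum>i\<in>I. f i x)"
  by (induction I rule: infinite_finite_induct) (auto intro: step_fun_add)

lemma step_fun_prod: "(\<And>i. i \<in> I \<Longrightarrow> step_fun (f i)) \<Longrightarrow> step_fun (\<lambda>x. \<Prod>i\<in>I. f i x)"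
  by (induction I rule: infinite_finite_induct) (auto intro: step_fun_mult)

lemma step_fun_bounded: "step_fun f \<Longrightarrow> \<exists>c>0. \<forall>x. \<bar>f x\<bar> \<le> c"
proof -
  assume "step_fun f"
  then obtain N where N: "dep N f" by (auto simp: step_fun_def)
  let ?c = "1 + (\<Sum>A\<in>Pow {..<N}. \<bar>f A\<bar>)"
  have "\<bar>f x\<bar> \<le> ?c" for x
  proof -
    have "\<bar>f x\<bar> = \<bar>f (x \<inter> {..<N})\<bar>" using N by (simp add: dep_def)
    also have "\<dots> \<le> (\<Sum>A\<in>Pow {..<N}. \<bar>f A\<bar>)"
      by (rule member_le_sum) auto
    finally show ?thesis by simp
  qed
  moreover have "?c > 0" by (simp add: sum_nonneg add_pos_nonneg)
  ultimately show ?thesis by blast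
qed

lemma avg_level:
  assumes "dep n f" "n \<le> N"
  shows "avg {..<N} f = avg {..<n} f"
  using assms(2)
proof (induction N rule: dec_induct)
  case (step N)
  have "f (insert N Z) = f Z" for Z
    using step(1) by (intro depD[OF assms(1)]) auto
  then show ?case
    using step by (simp add: lessThan_Suc avg_insert)
qed simp

text \<open>The digit at position n is independent of the digits below n.\<close>

lemma avg_dep_mult_sg:
  assumes "dep n f" "n < N"
  shows "avg {..<N} (\<lambda>x. f x * sg x n) = 0"
proof -
  have "avg {..<N} (\<lambda>x. f x * sg x n) = avg {..<Suc n} (\<lambda>x. f x * sg x n)"
    using assms by (intro avg_level dep_mult dep_mono[OF assms(1)] dep_sg) auto
  also have "\<dots> = (avg {..<n} (\<lambda>x. f x * 1) + avg {..<n} (\<lambda>x. f x * (-1))) / 2"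
  proof -
    have "f (insert n Z) = f Z" for Z
      by (intro depD[OF assms(1)]) auto
    then show ?thesis
      by (auto simp: lessThan_Suc avg_insert sg_def intro!: arg_cong2[where f="(+)"] avg_cong)
  qed
  also have "\<dots> = 0"
    by (simp only: avg_mult_const) simp
  finally show ?thesis .
qed

lemma avg_cell:
  assumes "a \<subseteq> {..<n}" "n \<le> N"
  shows "avg {..<N} (\<lambda>x. if x \<inter> {..<n} = a then 1 else 0) = 1 / 2 ^ n"
proof -
  have "avg {..<N} (\<lambda>x. if x \<inter> {..<n} = a then 1 else 0) = avg {..<n} (\<lambda>x. if x \<inter> {..<n} = a then 1 else 0)"
    by (intro avg_level dep_compose[OF dep_Int, of _ _ "\<lambda>z. if z = a then 1 else 0"] assms) auto
  also have "\<dots> = avg {..<n} (\<lambda>x. if x = a then 1 else 0)"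
    by (intro avg_cong) (simp add: Int_absorb2)
  also have "\<dots> = 1 / 2 ^ n"
    using assms by (simp add: avg_def)
  finally show ?thesis .
qed

section \<open>Haar functions of single cells and randomly signed Rademacher functions\<close>

definition hcell :: "nat \<Rightarrow> nat set \<Rightarrow> nat set \<Rightarrow> real" where
  "hcell n a x = (if x \<inter> {..<n} = a then sg x n else 0)"

text \<open>The Rademacher function of level n, reversed on the cells of level n listed in Z.
  Whatever Z is, its product with a function of the first n digits has mean zero.\<close>

definition signed_rad :: "nat \<Rightarrow> nat set set \<Rightarrow> nat set \<Rightarrow> real" where
  "signed_rad n Z x = sg Z (x \<inter> {..<n}) * sg x n"

lemma dep_hcell: "dep (Suc n) (hcell n a)"
  by (auto simp: dep_def hcell_def sg_def Int_assoc)

lemma step_fun_hcell [simp]: "step_fun (hcell n a)"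
  using dep_hcell by (auto simp: step_fun_def)

lemma dep_signed_rad: "dep (Suc n) (signed_rad n Z)"
  by (auto simp: dep_def signed_rad_def sg_def Int_assoc Int_absorb1 lessThan_subset_iff)

lemma step_fun_signed_rad [simp]: "step_fun (signed_rad n Z)"
  using dep_signed_rad by (auto simp: step_fun_def)

lemma signed_rad_sum: "signed_rad n Z = (\<lambda>x. \<Sum>a\<in>Pow {..<n}. sg Z a * hcell n a x)"
proof
  fix x
  have "(\<Sum>a\<in>Pow {..<n}. sg Z a * hcell n a x) = (\<Sum>a\<in>Pow {..<n}. if a = x \<inter> {..<n} then sg Z a * sg x n else 0)"
    by (intro sum.cong) (auto simp: hcell_def)
  also have "\<dots> = signed_rad n Z x"
    by (subst sum.delta) (auto simp: signed_rad_def)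
  finally show "signed_rad n Z x = (\<Sum>a\<in>Pow {..<n}. sg Z a * hcell n a x)" ..
qed

lemma signed_rad_cases: "signed_rad n Z x = 1 \<or> signed_rad n Z x = -1"
  by (auto simp: signed_rad_def sg_def)

lemma abs_signed_rad [simp]: "\<bar>signed_rad n Z x\<bar> = 1"
  by (simp add: signed_rad_def abs_mult)

text \<open>The filter of properties of \<^term>\<open>signed_rad n Z\<close> whose probability over a random \<open>Z\<close> tends to
  \<open>1\<close> along \<^term>\<open>ufilter\<close>.\<close>

definition random_rad :: "(nat set \<Rightarrow> real) filter" where
  "random_rad = Abs_filter (\<lambda>P.
     ((\<lambda>n. avg (Pow {..<n}) (\<lambda>Z. if P (signed_rad n Z) then 0 else 1)) \<longlongrightarrow> 0) ufilter)"

text \<open>Closure under conjunction is the union bound for failure probabilities. Having a filter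
  lets finitely many requirements on one random function be met together without keeping track of
  probabilities.\<close>

lemma eventually_random_rad:
  "eventually P random_rad \<longleftrightarrow>
     ((\<lambda>n. avg (Pow {..<n}) (\<lambda>Z. if P (signed_rad n Z) then 0 else 1)) \<longlongrightarrow> 0) ufilter"
proof -
  let ?p = "\<lambda>P n. avg (Pow {..<n}) (\<lambda>Z. if P (signed_rad n Z) then 0 else 1 :: real)"
  have nonneg: "\<forall>\<^sub>F n in ufilter. 0 \<le> ?p P n" for P
    by (intro always_eventually allI avg_nonneg) simp
  have "is_filter (\<lambda>P. (?p P \<longlongrightarrow> 0) ufilter)"
  proof
    show "(?p (\<lambda>_. True) \<longlongrightarrow> 0) ufilter" by simp
  next
    fix P Q
    assume "(?p P \<longlongrightarrow> 0) ufilter" "(?p Q \<longlongrightarrow> 0) ufilter"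
    then have PQ: "((\<lambda>n. ?p P n + ?p Q n) \<longlongrightarrow> 0) ufilter"
      using tendsto_add by fastforce
    have "\<forall>\<^sub>F n in ufilter. ?p (\<lambda>f. P f \<and> Q f) n \<le> ?p P n + ?p Q n"
      unfolding avg_add[symmetric] by (intro always_eventually allI avg_mono) simp
    then show "(?p (\<lambda>f. P f \<and> Q f) \<longlongrightarrow> 0) ufilter"
      by (rule tendsto_sandwich[OF nonneg _ tendsto_const PQ])
  next
    fix P Q :: "(nat set \<Rightarrow> real) \<Rightarrow> bool"
    assume imp: "\<forall>x. P x \<longrightarrow> Q x" and P: "(?p P \<longlongrightarrow> 0) ufilter"
    have "\<forall>\<^sub>F n in ufilter. ?p Q n \<le> ?p P n"
      using imp by (intro always_eventually allI avg_mono) simp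
    then show "(?p Q \<longlongrightarrow> 0) ufilter"
      by (rule tendsto_sandwich[OF nonneg _ tendsto_const P])
  qed
  from eventually_Abs_filter[OF this, of P] show ?thesis
    unfolding random_rad_def .
qed

lemma random_rad_nonbot [simp]: "random_rad \<noteq> bot"
proof
  assume "random_rad = bot"
  then have "eventually (\<lambda>_. False) random_rad" by (simp only: eventually_bot)
  then have "((\<lambda>n::nat. 1::real) \<longlongrightarrow> 0) ufilter"
    unfolding eventually_random_rad by (simp only: if_False avg_const[OF finite_Pow_iff[THEN iffD2, OF finite_lessThan]])
  then show False
    using tendsto_unique[OF ufilter_nonbot tendsto_const[of "1::real"]] by fastforce
qed

lemma eventually_random_radI:
  assumes "\<And>n Z. n \<ge> N \<Longrightarrow> P (signed_rad n Z)"
  shows "eventually P random_rad"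
  unfolding eventually_random_rad
proof (rule tendsto_eventually)
  have "\<forall>\<^sub>F n in ufilter. n \<ge> N"
    by (intro eventually_ufilter eventually_ge_at_top)
  then show "\<forall>\<^sub>F n in ufilter. avg (Pow {..<n}) (\<lambda>Z. if P (signed_rad n Z) then 0 else 1) = 0"
    by eventually_elim (simp add: assms)
qed

lemma random_rad_level: "eventually (\<lambda>f. \<exists>n\<ge>N. \<exists>Z. f = signed_rad n Z) random_rad"
  by (rule eventually_random_radI[of N]) (rule exI, rule conjI, assumption, rule exI, rule refl)

text \<open>Chebyshev's inequality around a moving centre: once \<open>c n\<close> is within
  \<delta>/2 of l, failure forces a deviation of at least \<delta>/2 from \<open>c n\<close>, whence
  the factor 4/\<delta>^2.\<close>

lemma random_rad_chebyshev:
  assumes "((\<lambda>n. avg (Pow {..<n}) (\<lambda>Z. (q (signed_rad n Z) - c n)\<^sup>2)) \<longlongrightarrow> 0) ufilter"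
    and "(c \<longlongrightarrow> l) ufilter" and "\<delta> > 0"
  shows "eventually (\<lambda>f. \<bar>q f - l\<bar> \<le> \<delta>) random_rad"
  unfolding eventually_random_rad
proof (rule tendsto_sandwich[OF _ _ tendsto_const, rotated 2])
  show "((\<lambda>n. 4 / \<delta>\<^sup>2 * avg (Pow {..<n}) (\<lambda>Z. (q (signed_rad n Z) - c n)\<^sup>2)) \<longlongrightarrow> 0) ufilter"
    by (rule tendsto_mult_right_zero[OF assms(1)])
  have "\<forall>\<^sub>F n in ufilter. dist (c n) l < \<delta> / 2"
    using assms(3) by (intro tendstoD[OF assms(2)]) simp
  then show "\<forall>\<^sub>F n in ufilter. avg (Pow {..<n}) (\<lambda>Z. if \<bar>q (signed_rad n Z) - l\<bar> \<le> \<delta> then 0 else 1)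
      \<le> 4 / \<delta>\<^sup>2 * avg (Pow {..<n}) (\<lambda>Z. (q (signed_rad n Z) - c n)\<^sup>2)"
  proof eventually_elim
    case (elim n)
    show ?case unfolding avg_cmult[symmetric]
    proof (rule avg_mono)
      fix Z
      let ?d = "\<bar>q (signed_rad n Z) - c n\<bar>"
      show "(if \<bar>q (signed_rad n Z) - l\<bar> \<le> \<delta> then 0 else 1) \<le> 4 / \<delta>\<^sup>2 * (q (signed_rad n Z) - c n)\<^sup>2"
      proof (cases "\<bar>q (signed_rad n Z) - l\<bar> \<le> \<delta>")
        case False
        then have "\<delta> / 2 \<le> ?d" using elim by (auto simp: dist_real_def abs_if split: if_splits)
        then have "(\<delta> / 2)\<^sup>2 \<le> ?d\<^sup>2" using assms(3) by (intro power_mono) auto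
        then show ?thesis using False assms(3) by (simp add: field_simps power_divide)
      qed (use assms(3) in auto)
    qed
  qed
qed (intro always_eventually allI avg_nonneg, auto)


section \<open>Linear functionals and bilinear forms of random Rademacher functions\<close>

definition linear_on_steps :: "((nat set \<Rightarrow> real) \<Rightarrow> real) \<Rightarrow> bool" where
  "linear_on_steps \<psi> \<longleftrightarrow>
     (\<forall>f g. step_fun f \<longrightarrow> step_fun g \<longrightarrow> \<psi> (\<lambda>x. f x + g x) = \<psi> f + \<psi> g) \<and>
     (\<forall>c f. step_fun f \<longrightarrow> \<psi> (\<lambda>x. c * f x) = c * \<psi> f)"

lemma linear_on_steps_add:
    "linear_on_steps \<psi> \<Longrightarrow> step_fun f \<Longrightarrow> step_fun g \<Longrightarrow> \<psi> (\<lambda>x. f x + g x) = \<psi> f + \<psi> g"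
  and linear_on_steps_cmult: "linear_on_steps \<psi> \<Longrightarrow> step_fun f \<Longrightarrow> \<psi> (\<lambda>x. c * f x) = c * \<psi> f"
  by (auto simp: linear_on_steps_def)

lemma linear_on_steps_zero: "linear_on_steps \<psi> \<Longrightarrow> \<psi> (\<lambda>_. 0) = 0"
  using linear_on_steps_cmult[of \<psi> "\<lambda>_. 0" 0] by simp

lemma linear_on_steps_sum:
  assumes "linear_on_steps \<psi>" "finite I" "\<And>i. i \<in> I \<Longrightarrow> step_fun (f i)"
  shows "\<psi> (\<lambda>x. \<Sum>i\<in>I. c i * f i x) = (\<Sum>i\<in>I. c i * \<psi> (f i))"
  using assms(2,3)
proof (induction I rule: finite_induct)
  case (insert i I)
  have "step_fun (\<lambda>x. \<Sum>i\<in>I. c i * f i x)"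
    using insert by (intro step_fun_sum step_fun_cmult) auto
  then have "\<psi> (\<lambda>x. c i * f i x + (\<Sum>i\<in>I. c i * f i x)) = c i * \<psi> (f i) + \<psi> (\<lambda>x. \<Sum>i\<in>I. c i * f i x)"
    using insert.prems
    by (simp add: linear_on_steps_add[OF assms(1)] linear_on_steps_cmult[OF assms(1)] step_fun_cmult)
  then show ?case using insert by simp
qed (simp add: linear_on_steps_zero[OF assms(1)])

text \<open>The cell of level \<open>0\<close> is everything.\<close>

definition loc :: "nat \<Rightarrow> nat set \<Rightarrow> (nat set \<Rightarrow> real) \<Rightarrow> bool" where
  "loc n a f \<longleftrightarrow> step_fun f \<and> (\<forall>x. \<bar>f x\<bar> \<le> (if x \<inter> {..<n} = a then 1 else 0))"

abbreviation unit_bounded :: "(nat set \<Rightarrow> real) \<Rightarrow> bool" where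
  "unit_bounded f \<equiv> loc 0 {} f"

lemma unit_bounded_iff: "unit_bounded f \<longleftrightarrow> step_fun f \<and> (\<forall>x. \<bar>f x\<bar> \<le> 1)"
  by (simp add: loc_def)

lemma loc_step: "loc n a f \<Longrightarrow> step_fun f"
  by (simp add: loc_def)

lemma locI: "step_fun f \<Longrightarrow> (\<And>x. \<bar>f x\<bar> \<le> (if x \<inter> {..<n} = a then 1 else 0)) \<Longrightarrow> loc n a f"
  by (simp add: loc_def)

lemma loc_bound: "loc n a f \<Longrightarrow> \<bar>f x\<bar> \<le> (if x \<inter> {..<n} = a then 1 else 0)"
  by (simp add: loc_def)

lemma unit_bounded_bound: "unit_bounded f \<Longrightarrow> \<bar>f x\<bar> \<le> 1"
  using loc_bound[of 0 "{}" f x] by simp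

lemma loc_mult:
  assumes "loc n a f" "unit_bounded w"
  shows "loc n a (\<lambda>x. f x * w x)"
proof (rule locI)
  show "step_fun (\<lambda>x. f x * w x)"
    using assms by (intro step_fun_mult loc_step)
  fix x
  have "\<bar>f x\<bar> * \<bar>w x\<bar> \<le> (if x \<inter> {..<n} = a then 1 else 0) * 1"
    using loc_bound[OF assms(1)] unit_bounded_bound[OF assms(2)] by (rule mult_mono) auto
  then show "\<bar>f x * w x\<bar> \<le> (if x \<inter> {..<n} = a then 1 else 0)"
    by (simp add: abs_mult)
qed

lemma loc_mult':
  assumes "loc n a f" "unit_bounded w"
  shows "loc n a (\<lambda>x. w x * f x)"
  using loc_mult[OF assms] by (simp add: mult.commute)

lemma loc_imp_unit_bounded:
  assumes "loc n a f" shows "unit_bounded f"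
proof (rule locI)
  fix x show "\<bar>f x\<bar> \<le> (if x \<inter> {..<0} = {} then 1 else 0)"
    using loc_bound[OF assms, of x] by (auto split: if_splits)
qed (rule loc_step[OF assms])

lemma loc_hcell [simp]: "loc n a (hcell n a)"
  by (auto simp: loc_def hcell_def)

lemma unit_bounded_one [simp]: "unit_bounded (\<lambda>_. 1)"
  by (simp add: loc_def)

lemma unit_bounded_sign_sum:
  assumes "\<And>a. \<bar>s a\<bar> \<le> 1"
  shows "unit_bounded (\<lambda>x. \<Sum>a\<in>Pow {..<n}. s a * hcell n a x)"
  unfolding unit_bounded_iff
proof (intro conjI allI step_fun_sum step_fun_cmult step_fun_hcell)
  fix x
  have "(\<Sum>a\<in>Pow {..<n}. s a * hcell n a x) = (\<Sum>a\<in>Pow {..<n}. if a = x \<inter> {..<n} then s a * sg x n else 0)"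
    by (intro sum.cong) (auto simp: hcell_def)
  also have "\<dots> = s (x \<inter> {..<n}) * sg x n"
    by (subst sum.delta) auto
  finally show "\<bar>\<Sum>a\<in>Pow {..<n}. s a * hcell n a x\<bar> \<le> 1"
    using assms by (simp add: abs_mult)
qed

text \<open>Haar functions of one level have disjoint supports, so combining them with the signs of
  their values under \<psi> gives a unit-bounded test function.\<close>

lemma linear_abs_sum_le:
  assumes "linear_on_steps \<psi>" "\<And>f. unit_bounded f \<Longrightarrow> \<bar>\<psi> f\<bar> \<le> K"
  shows "(\<Sum>a\<in>Pow {..<n}. \<bar>\<psi> (hcell n a)\<bar>) \<le> K"
proof -
  let ?s = "\<lambda>a. sgn (\<psi> (hcell n a))"
  have "(\<Sum>a\<in>Pow {..<n}. \<bar>\<psi> (hcell n a)\<bar>) = (\<Sum>a\<in>Pow {..<n}. ?s a * \<psi> (hcell n a))"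
    by (simp add: mult.commute abs_sgn)
  also have "\<dots> = \<psi> (\<lambda>x. \<Sum>a\<in>Pow {..<n}. ?s a * hcell n a x)"
    by (subst linear_on_steps_sum[OF assms(1)]) auto
  also have "\<dots> \<le> K"
    using assms(2)[OF unit_bounded_sign_sum[of ?s n]] by (simp add: abs_sgn_eq abs_le_iff)
  finally show ?thesis .
qed

lemma linear_signed_rad:
  "linear_on_steps \<psi> \<Longrightarrow> \<psi> (signed_rad n Z) = (\<Sum>a\<in>Pow {..<n}. \<psi> (hcell n a) * sg Z a)"
  unfolding signed_rad_sum by (subst linear_on_steps_sum) (auto simp: mult.commute)

lemma linear_bound_scale:
  assumes "linear_on_steps \<psi>" "\<And>f. unit_bounded f \<Longrightarrow> \<bar>\<psi> f\<bar> \<le> K" "step_fun f" "c > 0" "\<And>x. \<bar>f x\<bar> \<le> c"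
  shows "\<bar>\<psi> f\<bar> \<le> c * K"
proof -
  have "\<bar>\<psi> (\<lambda>x. inverse c * f x)\<bar> \<le> K"
  proof (intro assms(2))
    show "unit_bounded (\<lambda>x. inverse c * f x)"
      unfolding unit_bounded_iff
    proof (intro conjI allI)
      show "\<bar>inverse c * f x\<bar> \<le> 1" for x
        using assms(4) assms(5)[of x] by (simp add: abs_mult field_simps)
    qed (rule step_fun_cmult[OF assms(3)])
  qed
  then have "inverse c * \<bar>\<psi> f\<bar> \<le> K"
    unfolding linear_on_steps_cmult[OF assms(1,3)] using assms(4) by (simp only: abs_mult) simp
  then show ?thesis
    using assms(4) by (simp add: field_simps)
qed

text \<open>The finitely additive analogue of a bounded measure without atoms: its variation on a
  cell tends to zero, uniformly over the cells of a level.\<close>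

definition diffuse :: "((nat set \<Rightarrow> real) \<Rightarrow> real) \<Rightarrow> bool" where
  "diffuse \<psi> \<longleftrightarrow> linear_on_steps \<psi> \<and> (\<exists>K. \<forall>f. unit_bounded f \<longrightarrow> \<bar>\<psi> f\<bar> \<le> K) \<and>
     (\<forall>\<delta>>0. \<forall>\<^sub>F n in sequentially. \<forall>a f. loc n a f \<longrightarrow> \<bar>\<psi> f\<bar> \<le> \<delta>)"

lemma diffuse_mult:
  assumes "diffuse \<psi>" "unit_bounded w"
  shows "diffuse (\<lambda>f. \<psi> (\<lambda>x. f x * w x))"
  unfolding diffuse_def
proof (intro conjI)
  have w: "step_fun w" using assms(2) by (rule loc_step)
  have lin: "linear_on_steps \<psi>" using assms(1) by (simp add: diffuse_def)
  show "linear_on_steps (\<lambda>f. \<psi> (\<lambda>x. f x * w x))"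
    unfolding linear_on_steps_def
  proof (intro conjI allI impI)
    fix f g :: "nat set \<Rightarrow> real" assume "step_fun f" "step_fun g"
    then show "\<psi> (\<lambda>x. (f x + g x) * w x) = \<psi> (\<lambda>x. f x * w x) + \<psi> (\<lambda>x. g x * w x)"
      using w by (subst linear_on_steps_add[OF lin, symmetric]) (auto intro: step_fun_mult simp: algebra_simps)
  next
    fix c and f :: "nat set \<Rightarrow> real" assume "step_fun f"
    then show "\<psi> (\<lambda>x. c * f x * w x) = c * \<psi> (\<lambda>x. f x * w x)"
      using w by (subst linear_on_steps_cmult[OF lin, symmetric]) (auto intro: step_fun_mult simp: algebra_simps)
  qed
  show "\<exists>K. \<forall>f. unit_bounded f \<longrightarrow> \<bar>\<psi> (\<lambda>x. f x * w x)\<bar> \<le> K"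
    using assms loc_mult unfolding diffuse_def by blast
  show "\<forall>\<delta>>0. \<forall>\<^sub>F n in sequentially. \<forall>a f. loc n a f \<longrightarrow> \<bar>\<psi> (\<lambda>x. f x * w x)\<bar> \<le> \<delta>"
  proof (intro allI impI)
    fix \<delta> :: real assume "\<delta> > 0"
    then have "\<forall>\<^sub>F n in sequentially. \<forall>a f. loc n a f \<longrightarrow> \<bar>\<psi> f\<bar> \<le> \<delta>"
      using assms(1) unfolding diffuse_def by blast
    then show "\<forall>\<^sub>F n in sequentially. \<forall>a f. loc n a f \<longrightarrow> \<bar>\<psi> (\<lambda>x. f x * w x)\<bar> \<le> \<delta>"
      by eventually_elim (use assms(2) loc_mult in blast)
  qed
qed

text \<open>The second moment of \<psi> over random signs is the square sum of its values on the
  Haar functions of the level. It is at most the largest value, which tends to zero, times their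
  absolute sum, which stays bounded.\<close>

lemma diffuse_random_rad:
  assumes "diffuse \<psi>" "\<delta> > 0"
  shows "eventually (\<lambda>f. \<bar>\<psi> f\<bar> \<le> \<delta>) random_rad"
proof -
  from assms(1) obtain K where lin: "linear_on_steps \<psi>" and K: "\<And>f. unit_bounded f \<Longrightarrow> \<bar>\<psi> f\<bar> \<le> K"
    and small: "\<And>\<delta>. \<delta> > 0 \<Longrightarrow> \<forall>\<^sub>F n in sequentially. \<forall>a f. loc n a f \<longrightarrow> \<bar>\<psi> f\<bar> \<le> \<delta>"
    by (auto simp: diffuse_def)
  have K0: "K \<ge> 0" using K[OF unit_bounded_one] by linarith
  have "(\<lambda>n. \<Sum>a\<in>Pow {..<n}. (\<psi> (hcell n a))\<^sup>2) \<longlonglongrightarrow> 0"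
  proof (rule tendstoI)
    fix e :: real assume e: "e > 0"
    let ?d = "e / (2 * (K + 1))"
    have d: "?d > 0" using e K0 by simp
    show "\<forall>\<^sub>F n in sequentially. dist (\<Sum>a\<in>Pow {..<n}. (\<psi> (hcell n a))\<^sup>2) 0 < e"
      using small[OF d]
    proof eventually_elim
      case (elim n)
      have "(\<Sum>a\<in>Pow {..<n}. (\<psi> (hcell n a))\<^sup>2) \<le> (\<Sum>a\<in>Pow {..<n}. ?d * \<bar>\<psi> (hcell n a)\<bar>)"
      proof (rule sum_mono)
        fix a
        have "\<bar>\<psi> (hcell n a)\<bar> * \<bar>\<psi> (hcell n a)\<bar> \<le> ?d * \<bar>\<psi> (hcell n a)\<bar>"
          using elim loc_hcell[of n a] by (intro mult_right_mono abs_ge_zero) blast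
        then show "(\<psi> (hcell n a))\<^sup>2 \<le> ?d * \<bar>\<psi> (hcell n a)\<bar>"
          by (simp add: power2_eq_square)
      qed
      also have "\<dots> \<le> ?d * K"
        unfolding sum_distrib_left[symmetric] using d
        by (intro mult_left_mono linear_abs_sum_le lin K) auto
      also have "\<dots> < e"
      proof -
        have "0 \<le> K * e" using e K0 by simp
        then show ?thesis using e K0 by (simp add: field_simps add_nonneg_pos)
      qed
      finally show ?case by (simp add: sum_nonneg)
    qed
  qed
  then have "((\<lambda>n. avg (Pow {..<n}) (\<lambda>Z. (\<psi> (signed_rad n Z) - 0)\<^sup>2)) \<longlongrightarrow> 0) ufilter"
    by (intro tendsto_ufilter) (simp add: linear_signed_rad[OF lin] avg_linear_sign_sq)
  from random_rad_chebyshev[OF this tendsto_const assms(2)] show ?thesis by simp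
qed

text \<open>\<kappa> divides the decay between the slots as in the pairing of L_q with L_p, where
  \<kappa> = 1/q: cells of levels n' and n have indicators of norms 2^(-\<kappa> n') and
  2^(-(1-\<kappa>) n). The value \<kappa> = 0 stands for L_infinity against L_1.\<close>

definition biform :: "real \<Rightarrow> real \<Rightarrow> ((nat set \<Rightarrow> real) \<Rightarrow> (nat set \<Rightarrow> real) \<Rightarrow> real) \<Rightarrow> bool" where
  "biform \<kappa> K T \<longleftrightarrow>
     (\<forall>f. step_fun f \<longrightarrow> linear_on_steps (T f)) \<and> (\<forall>f. step_fun f \<longrightarrow> linear_on_steps (\<lambda>g. T g f)) \<and>
     (\<forall>n' a' f' n a f. loc n' a' f' \<longrightarrow> loc n a f \<longrightarrow>
        \<bar>T f' f\<bar> \<le> K * 2 powr (- \<kappa> * real n' - (1 - \<kappa>) * real n))"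

text \<open>The limit of the sums of diagonal Haar entries. The weight f is attached to the first
  slot, but on fine cells a step function is constant, so the second would do as well.\<close>

definition trace_form :: "((nat set \<Rightarrow> real) \<Rightarrow> (nat set \<Rightarrow> real) \<Rightarrow> real) \<Rightarrow> (nat set \<Rightarrow> real) \<Rightarrow> real" where
  "trace_form T f = Lim ufilter (\<lambda>n. \<Sum>a\<in>Pow {..<n}. T (\<lambda>x. f x * hcell n a x) (hcell n a))"

section \<open>Bilinear forms and their traces\<close>

lemma biform_bound:
  "biform \<kappa> K T \<Longrightarrow> loc n' a' f' \<Longrightarrow> loc n a f \<Longrightarrow>
    \<bar>T f' f\<bar> \<le> K * 2 powr (- \<kappa> * real n' - (1 - \<kappa>) * real n)"
  by (auto simp: biform_def)

lemma biform_lin1: "biform \<kappa> K T \<Longrightarrow> step_fun f \<Longrightarrow> linear_on_steps (\<lambda>g. T g f)"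
  and biform_lin2: "biform \<kappa> K T \<Longrightarrow> step_fun f \<Longrightarrow> linear_on_steps (T f)"
  by (auto simp: biform_def)

lemma biform_K_nonneg: "biform \<kappa> K T \<Longrightarrow> K \<ge> 0"
  using biform_bound[of \<kappa> K T 0 "{}" "\<lambda>_. 1" 0 "{}" "\<lambda>_. 1"] by simp

text \<open>The exponents of the two slots add up to one, so a diagonal entry at level N is at most
  K/2^N for every \<kappa>, and only the 2^(N-n) cells inside the support of f contribute.\<close>

lemma trace_sum_bound:
  assumes T: "biform \<kappa> K T" and f: "loc n a f" and "n \<le> N"
  shows "\<bar>\<Sum>A\<in>Pow {..<N}. T (\<lambda>x. f x * hcell N A x) (hcell N A)\<bar> \<le> K / 2 ^ n"
proof -
  have zero: "T (\<lambda>x. f x * hcell N A x) (hcell N A) = 0" if "A \<inter> {..<n} \<noteq> a" for A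
  proof -
    have "f x * hcell N A x = 0" for x
    proof (cases "x \<inter> {..<N} = A")
      case True
      then have "x \<inter> {..<n} \<noteq> a"
        using that \<open>n \<le> N\<close> by (metis inf.absorb2 inf_assoc lessThan_subset_iff)
      moreover have "\<bar>f x\<bar> \<le> (if x \<inter> {..<n} = a then 1 else 0)" using f by (simp add: loc_def)
      ultimately show ?thesis by simp
    qed (simp add: hcell_def)
    then have "(\<lambda>x. f x * hcell N A x) = (\<lambda>_. 0)" by (rule ext)
    then show ?thesis
      using linear_on_steps_zero[OF biform_lin1[OF T step_fun_hcell]] by simp
  qed
  have le: "\<bar>T (\<lambda>x. f x * hcell N A x) (hcell N A)\<bar> \<le> (if A \<inter> {..<n} = a then 1 else 0) * (K / 2 ^ N)" for A
  proof (cases "A \<inter> {..<n} = a")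
    case True
    have "\<bar>T (\<lambda>x. f x * hcell N A x) (hcell N A)\<bar> \<le> K * 2 powr (- \<kappa> * real N - (1 - \<kappa>) * real N)"
      by (rule biform_bound[OF T loc_mult'[OF loc_hcell loc_imp_unit_bounded[OF f]] loc_hcell])
    also have "- \<kappa> * real N - (1 - \<kappa>) * real N = - real N" by (simp add: algebra_simps)
    finally show ?thesis using True by (simp add: powr_minus powr_realpow field_simps)
  qed (simp add: zero)
  show ?thesis
  proof (cases "a \<subseteq> {..<n}")
    case False
    then have "A \<inter> {..<n} \<noteq> a" for A by auto
    then show ?thesis using biform_K_nonneg[OF T] by (simp add: zero)
  next
    case True
    have "\<bar>\<Sum>A\<in>Pow {..<N}. T (\<lambda>x. f x * hcell N A x) (hcell N A)\<bar>
        \<le> (\<Sum>A\<in>Pow {..<N}. (if A \<inter> {..<n} = a then 1 else 0) * (K / 2 ^ N))"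
      by (intro order_trans[OF sum_abs] sum_mono le)
    also have "\<dots> = K * avg {..<N} (\<lambda>A. if A \<inter> {..<n} = a then 1 else 0)"
      unfolding sum_distrib_right[symmetric] by (simp add: avg_def)
    also have "\<dots> = K / 2 ^ n"
      using avg_cell[OF True \<open>n \<le> N\<close>] by simp
    finally show ?thesis .
  qed
qed

lemma trace_form_bound:
  assumes "biform \<kappa> K T" "loc n a f"
  shows "\<bar>trace_form T f\<bar> \<le> K / 2 ^ n"
  unfolding trace_form_def
proof (intro Lim_ufilter_le eventually_ufilter)
  show "\<forall>\<^sub>F N in sequentially. \<bar>\<Sum>A\<in>Pow {..<N}. T (\<lambda>x. f x * hcell N A x) (hcell N A)\<bar> \<le> K / 2 ^ n"
    using eventually_ge_at_top[of n] by eventually_elim (rule trace_sum_bound[OF assms])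
qed

lemma linear_on_steps_trace_sum:
  assumes T: "biform \<kappa> K T"
  shows "linear_on_steps (\<lambda>f. \<Sum>A\<in>Pow {..<N}. T (\<lambda>x. f x * hcell N A x) (hcell N A))"
  unfolding linear_on_steps_def
proof (intro conjI allI impI)
  note lin = biform_lin1[OF T step_fun_hcell]
  fix f g :: "nat set \<Rightarrow> real" assume "step_fun f" "step_fun g"
  then show "(\<Sum>A\<in>Pow {..<N}. T (\<lambda>x. (f x + g x) * hcell N A x) (hcell N A))
    = (\<Sum>A\<in>Pow {..<N}. T (\<lambda>x. f x * hcell N A x) (hcell N A)) + (\<Sum>A\<in>Pow {..<N}. T (\<lambda>x. g x * hcell N A x) (hcell N A))"
    unfolding sum.distrib[symmetric]
    by (intro sum.cong refl)
      (simp add: linear_on_steps_add[OF lin, symmetric] step_fun_mult distrib_right)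
next
  note lin = biform_lin1[OF T step_fun_hcell]
  fix c and f :: "nat set \<Rightarrow> real" assume "step_fun f"
  then show "(\<Sum>A\<in>Pow {..<N}. T (\<lambda>x. c * f x * hcell N A x) (hcell N A))
    = c * (\<Sum>A\<in>Pow {..<N}. T (\<lambda>x. f x * hcell N A x) (hcell N A))"
    unfolding sum_distrib_left
    by (intro sum.cong refl)
      (simp add: linear_on_steps_cmult[OF lin, symmetric] step_fun_mult mult.assoc)
qed

lemma trace_form_tendsto:
  assumes T: "biform \<kappa> K T" and f: "step_fun f"
  shows "((\<lambda>n. \<Sum>a\<in>Pow {..<n}. T (\<lambda>x. f x * hcell n a x) (hcell n a)) \<longlongrightarrow> trace_form T f) ufilter"
proof -
  obtain c where "c > 0" "\<And>x. \<bar>f x\<bar> \<le> c" using step_fun_bounded[OF f] by auto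
  then have "\<bar>\<Sum>a\<in>Pow {..<n}. T (\<lambda>x. f x * hcell n a x) (hcell n a)\<bar> \<le> c * K" for n
    using trace_sum_bound[OF T, of 0 "{}" _ n]
    by (intro linear_bound_scale[OF linear_on_steps_trace_sum[OF T] _ f]) auto
  then show ?thesis
    unfolding trace_form_def by (intro tendsto_Lim_ufilter always_eventually) blast
qed

lemma linear_on_steps_tendsto:
  assumes "\<And>n. linear_on_steps (\<psi> n)" "\<And>f. step_fun f \<Longrightarrow> ((\<lambda>n. \<psi> n f) \<longlongrightarrow> \<phi> f) ufilter"
  shows "linear_on_steps \<phi>"
  unfolding linear_on_steps_def
proof (intro conjI allI impI)
  fix f g :: "nat set \<Rightarrow> real" assume fg: "step_fun f" "step_fun g"
  have "((\<lambda>n. \<psi> n f + \<psi> n g) \<longlongrightarrow> \<phi> f + \<phi> g) ufilter"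
    by (intro tendsto_add assms fg)
  then show "\<phi> (\<lambda>x. f x + g x) = \<phi> f + \<phi> g"
    using assms(2)[OF step_fun_add[OF fg]] fg
    by (intro tendsto_unique[OF ufilter_nonbot]) (simp_all add: linear_on_steps_add[OF assms(1)])
next
  fix c and f :: "nat set \<Rightarrow> real" assume f: "step_fun f"
  have "((\<lambda>n. c * \<psi> n f) \<longlongrightarrow> c * \<phi> f) ufilter"
    by (intro tendsto_mult tendsto_const assms f)
  then show "\<phi> (\<lambda>x. c * f x) = c * \<phi> f"
    using assms(2)[OF step_fun_cmult[OF f]] f
    by (intro tendsto_unique[OF ufilter_nonbot]) (simp_all add: linear_on_steps_cmult[OF assms(1)])
qed

lemma linear_on_steps_trace_form: "biform \<kappa> K T \<Longrightarrow> linear_on_steps (trace_form T)"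
  by (rule linear_on_steps_tendsto[OF linear_on_steps_trace_sum trace_form_tendsto])

lemma powr_two_tendsto_0:
  assumes "(\<kappa>::real) > 0"
  shows "(\<lambda>n. c * 2 powr (- \<kappa> * real n)) \<longlonglongrightarrow> 0"
proof -
  have "(\<lambda>n. c * (2 powr (- \<kappa>)) ^ n) \<longlonglongrightarrow> c * 0"
    using assms by (intro tendsto_mult tendsto_const LIMSEQ_realpow_zero) (auto simp: powr_less_one)
  then show ?thesis
    by (simp add: powr_realpow[symmetric] powr_powr)
qed

lemma diffuse_powr:
  assumes "linear_on_steps \<psi>" "\<kappa> > 0" "\<And>n a f. loc n a f \<Longrightarrow> \<bar>\<psi> f\<bar> \<le> K * 2 powr (- \<kappa> * real n)"
  shows "diffuse \<psi>"
  unfolding diffuse_def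
proof (intro conjI allI impI)
  show "\<exists>K. \<forall>f. unit_bounded f \<longrightarrow> \<bar>\<psi> f\<bar> \<le> K"
    using assms(3)[of 0 "{}"] by auto
  fix \<delta> :: real assume "\<delta> > 0"
  then have "\<forall>\<^sub>F n in sequentially. dist (K * 2 powr (- \<kappa> * real n)) 0 < \<delta>"
    by (intro tendstoD powr_two_tendsto_0 assms)
  then show "\<forall>\<^sub>F n in sequentially. \<forall>a f. loc n a f \<longrightarrow> \<bar>\<psi> f\<bar> \<le> \<delta>"
    by eventually_elim (use assms(3) in \<open>fastforce simp: dist_real_def\<close>)
qed (rule assms)

lemma diffuse_trace_form: "biform \<kappa> K T \<Longrightarrow> diffuse (trace_form T)"
  by (rule diffuse_powr[of _ 1 K])
    (auto simp: linear_on_steps_trace_form powr_minus powr_realpow divide_inverse dest: trace_form_bound)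

lemma powr_exponent_simp: "- \<kappa> * real 0 - (1 - \<kappa>) * real n = - (1 - \<kappa>) * real n"
  by (simp add: algebra_simps)

lemma diffuse_biform2:
  assumes "biform \<kappa> K T" "\<kappa> < 1" "unit_bounded w"
  shows "diffuse (T w)"
proof (rule diffuse_powr)
  show "linear_on_steps (T w)" using assms by (intro biform_lin2 loc_step)
  show "\<bar>T w f\<bar> \<le> K * 2 powr (- (1 - \<kappa>) * real n)" if "loc n a f" for n a f
    using biform_bound[OF assms(1,3) that, unfolded powr_exponent_simp] .
qed (use assms in simp)

lemma diffuse_biform1:
  assumes "biform \<kappa> K T" "\<kappa> > 0" "unit_bounded w"
  shows "diffuse (\<lambda>f. T f w)"
proof (rule diffuse_powr)
  show "linear_on_steps (\<lambda>f. T f w)" using assms by (intro biform_lin1 loc_step)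
  show "\<bar>T f w\<bar> \<le> K * 2 powr (- \<kappa> * real n)" if "loc n a f" for n a f
    using biform_bound[OF assms(1) that assms(3)] by simp
qed (use assms in simp)

lemma biform_mult:
  assumes T: "biform \<kappa> K T" and w: "unit_bounded w'" "unit_bounded w"
  shows "biform \<kappa> K (\<lambda>f' f. T (\<lambda>x. f' x * w' x) (\<lambda>x. f x * w x))"
proof -
  have lin: "linear_on_steps (\<lambda>f. \<psi> (\<lambda>x. f x * u x))" if "linear_on_steps \<psi>" "step_fun u" for \<psi> u
    unfolding linear_on_steps_def
  proof (intro conjI allI impI)
    fix f g :: "nat set \<Rightarrow> real" assume "step_fun f" "step_fun g"
    then show "\<psi> (\<lambda>x. (f x + g x) * u x) = \<psi> (\<lambda>x. f x * u x) + \<psi> (\<lambda>x. g x * u x)"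
      using that by (subst linear_on_steps_add[OF that(1), symmetric]) (auto intro: step_fun_mult simp: algebra_simps)
  next
    fix c and f :: "nat set \<Rightarrow> real" assume "step_fun f"
    then show "\<psi> (\<lambda>x. c * f x * u x) = c * \<psi> (\<lambda>x. f x * u x)"
      using that by (subst linear_on_steps_cmult[OF that(1), symmetric]) (auto intro: step_fun_mult simp: algebra_simps)
  qed
  have st: "step_fun w'" "step_fun w" using w by (auto intro: loc_step)
  show ?thesis
    unfolding biform_def
    by (intro conjI allI impI lin[OF biform_lin1[OF T]] lin[OF biform_lin2[OF T]] biform_bound[OF T] loc_mult
        step_fun_mult st w)
qed

text \<open>A quadratic form in random signs concentrates at its diagonal sum, since its variance is
  at most twice the square sum of its entries. One factor of each square is at most K/2^n; the sum
  of the others over a is bounded by testing the first slot at level 0, and summing over the 2^n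
  cells b leaves K^2 2^(-(1-\<kappa>)n). This tends to zero because \<kappa> < 1.\<close>

lemma biform_random_rad_trace:
  assumes T: "biform \<kappa> K T" and \<kappa>: "\<kappa> < 1" and "\<delta> > 0"
  shows "eventually (\<lambda>f. \<bar>T f f - trace_form T (\<lambda>_. 1)\<bar> \<le> \<delta>) random_rad"
proof -
  let ?t = "\<lambda>n a b. T (hcell n a) (hcell n b)"
  have K0: "K \<ge> 0" by (rule biform_K_nonneg[OF T])
  have ex: "T (signed_rad n Z) (signed_rad n Z) = (\<Sum>a\<in>Pow {..<n}. \<Sum>b\<in>Pow {..<n}. ?t n a b * sg Z a * sg Z b)" for n Z
  proof -
    have "T (signed_rad n Z) (signed_rad n Z) = (\<Sum>a\<in>Pow {..<n}. T (hcell n a) (signed_rad n Z) * sg Z a)"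
      by (rule linear_signed_rad[OF biform_lin1[OF T step_fun_signed_rad]])
    also have "\<dots> = (\<Sum>a\<in>Pow {..<n}. (\<Sum>b\<in>Pow {..<n}. ?t n a b * sg Z b) * sg Z a)"
      unfolding linear_signed_rad[OF biform_lin2[OF T step_fun_hcell]] ..
    finally show ?thesis by (simp add: sum_distrib_left sum_distrib_right mult_ac)
  qed
  have sq: "(\<Sum>a\<in>Pow {..<n}. \<Sum>b\<in>Pow {..<n}. (?t n a b)\<^sup>2) \<le> K\<^sup>2 * 2 powr (- (1 - \<kappa>) * real n)" for n
  proof -
    have t: "\<bar>?t n a b\<bar> \<le> K / 2 ^ n" for a b
    proof -
      have "\<bar>?t n a b\<bar> \<le> K * 2 powr (- \<kappa> * real n - (1 - \<kappa>) * real n)"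
        by (rule biform_bound[OF T loc_hcell loc_hcell])
      also have "- \<kappa> * real n - (1 - \<kappa>) * real n = - real n" by (simp add: algebra_simps)
      finally show ?thesis by (simp add: powr_minus powr_realpow field_simps)
    qed
    have "(\<Sum>a\<in>Pow {..<n}. \<Sum>b\<in>Pow {..<n}. (?t n a b)\<^sup>2) \<le> (\<Sum>a\<in>Pow {..<n}. \<Sum>b\<in>Pow {..<n}. K / 2 ^ n * \<bar>?t n a b\<bar>)"
    proof (intro sum_mono)
      fix a b
      have "\<bar>?t n a b\<bar> * \<bar>?t n a b\<bar> \<le> K / 2 ^ n * \<bar>?t n a b\<bar>"
        by (intro mult_right_mono t) auto
      then show "(?t n a b)\<^sup>2 \<le> K / 2 ^ n * \<bar>?t n a b\<bar>" by (simp add: power2_eq_square)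
    qed
    also have "\<dots> = K / 2 ^ n * (\<Sum>b\<in>Pow {..<n}. \<Sum>a\<in>Pow {..<n}. \<bar>?t n a b\<bar>)"
      by (subst sum.swap) (simp add: sum_distrib_left)
    also have "\<dots> \<le> K / 2 ^ n * (\<Sum>b\<in>Pow {..<n}. K * 2 powr (- (1 - \<kappa>) * real n))"
    proof (intro mult_left_mono sum_mono)
      fix b :: "nat set"
      show "(\<Sum>a\<in>Pow {..<n}. \<bar>?t n a b\<bar>) \<le> K * 2 powr (- (1 - \<kappa>) * real n)"
        by (rule linear_abs_sum_le[OF biform_lin1[OF T step_fun_hcell]])
          (rule biform_bound[OF T _ loc_hcell, of 0 "{}", unfolded powr_exponent_simp])
    qed (use K0 in auto)
    also have "\<dots> = K\<^sup>2 * 2 powr (- (1 - \<kappa>) * real n)"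
      by (simp add: card_Pow power2_eq_square)
    finally show ?thesis .
  qed
  have "((\<lambda>n. avg (Pow {..<n}) (\<lambda>Z. (T (signed_rad n Z) (signed_rad n Z) - (\<Sum>a\<in>Pow {..<n}. ?t n a a))\<^sup>2)) \<longlongrightarrow> 0) ufilter"
  proof (rule tendsto_sandwich[OF _ _ tendsto_const])
    show "((\<lambda>n. (2 * K\<^sup>2) * 2 powr (- (1 - \<kappa>) * real n)) \<longlongrightarrow> 0) ufilter"
      using \<kappa> by (intro tendsto_ufilter powr_two_tendsto_0) auto
    show "\<forall>\<^sub>F n in ufilter. avg (Pow {..<n}) (\<lambda>Z. (T (signed_rad n Z) (signed_rad n Z) - (\<Sum>a\<in>Pow {..<n}. ?t n a a))\<^sup>2)
        \<le> (2 * K\<^sup>2) * 2 powr (- (1 - \<kappa>) * real n)"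
    proof (intro always_eventually allI)
      fix n
      have "avg (Pow {..<n}) (\<lambda>Z. (T (signed_rad n Z) (signed_rad n Z) - (\<Sum>a\<in>Pow {..<n}. ?t n a a))\<^sup>2)
          \<le> 2 * (\<Sum>a\<in>Pow {..<n}. \<Sum>b\<in>Pow {..<n}. (?t n a b)\<^sup>2)"
        unfolding ex by (rule avg_quadratic_sign_sq) simp
      also note sq
      finally show "avg (Pow {..<n}) (\<lambda>Z. (T (signed_rad n Z) (signed_rad n Z) - (\<Sum>a\<in>Pow {..<n}. ?t n a a))\<^sup>2)
        \<le> (2 * K\<^sup>2) * 2 powr (- (1 - \<kappa>) * real n)" by simp
    qed
  qed (intro always_eventually allI avg_nonneg, auto)
  moreover have "((\<lambda>n. \<Sum>a\<in>Pow {..<n}. ?t n a a) \<longlongrightarrow> trace_form T (\<lambda>_. 1)) ufilter"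
    using trace_form_tendsto[OF T step_fun_const[of 1]] by simp
  ultimately show ?thesis
    by (rule random_rad_chebyshev) fact
qed


section \<open>Four-linear forms\<close>

type_synonym form4 =
  "(nat set \<Rightarrow> real) \<Rightarrow> (nat set \<Rightarrow> real) \<Rightarrow> (nat set \<Rightarrow> real) \<Rightarrow> (nat set \<Rightarrow> real) \<Rightarrow> real"

definition level_weight :: "real \<Rightarrow> nat \<Rightarrow> nat \<Rightarrow> real" where
  "level_weight \<kappa> n' n = 2 powr (- \<kappa> * real n' - (1 - \<kappa>) * real n)"

lemma level_weight_0 [simp]: "level_weight \<kappa> 0 0 = 1"
  by (simp add: level_weight_def)

text \<open>\<^term>\<open>\<phi> f' f g' g\<close> stands for the pairing of \<open>f' \<otimes> g'\<close> with the image of \<open>f \<otimes> g\<close>.\<close>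

definition quad_form :: "real \<Rightarrow> real \<Rightarrow> real \<Rightarrow> form4 \<Rightarrow> bool" where
  "quad_form \<kappa>\<^sub>1 \<kappa>\<^sub>2 K \<phi> \<longleftrightarrow>
     (\<forall>f g' g. step_fun f \<longrightarrow> step_fun g' \<longrightarrow> step_fun g \<longrightarrow> linear_on_steps (\<lambda>f'. \<phi> f' f g' g)) \<and>
     (\<forall>f' g' g. step_fun f' \<longrightarrow> step_fun g' \<longrightarrow> step_fun g \<longrightarrow> linear_on_steps (\<lambda>f. \<phi> f' f g' g)) \<and>
     (\<forall>f' f g. step_fun f' \<longrightarrow> step_fun f \<longrightarrow> step_fun g \<longrightarrow> linear_on_steps (\<lambda>g'. \<phi> f' f g' g)) \<and>
     (\<forall>f' f g'. step_fun f' \<longrightarrow> step_fun f \<longrightarrow> step_fun g' \<longrightarrow> linear_on_steps (\<lambda>g. \<phi> f' f g' g)) \<and>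
     (\<forall>n' a' f' n a f m' b' g' m b g. loc n' a' f' \<longrightarrow> loc n a f \<longrightarrow> loc m' b' g' \<longrightarrow> loc m b g \<longrightarrow>
        \<bar>\<phi> f' f g' g\<bar> \<le> K * level_weight \<kappa>\<^sub>1 n' n * level_weight \<kappa>\<^sub>2 m' m)"

definition swap4 :: "form4 \<Rightarrow> form4" where
  "swap4 \<phi> = (\<lambda>g' g f' f. \<phi> f' f g' g)"

lemma swap4_swap4 [simp]: "swap4 (swap4 \<phi>) = \<phi>"
  by (simp add: swap4_def)

context
  fixes \<kappa>\<^sub>1 \<kappa>\<^sub>2 K :: real and \<phi> :: form4
  assumes quad: "quad_form \<kappa>\<^sub>1 \<kappa>\<^sub>2 K \<phi>"
begin

lemma quad_lin1: "step_fun f \<Longrightarrow> step_fun g' \<Longrightarrow> step_fun g \<Longrightarrow> linear_on_steps (\<lambda>f'. \<phi> f' f g' g)"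
  and quad_lin2: "step_fun f' \<Longrightarrow> step_fun g' \<Longrightarrow> step_fun g \<Longrightarrow> linear_on_steps (\<lambda>f. \<phi> f' f g' g)"
  and quad_lin3: "step_fun f' \<Longrightarrow> step_fun f \<Longrightarrow> step_fun g \<Longrightarrow> linear_on_steps (\<lambda>g'. \<phi> f' f g' g)"
  and quad_lin4: "step_fun f' \<Longrightarrow> step_fun f \<Longrightarrow> step_fun g' \<Longrightarrow> linear_on_steps (\<lambda>g. \<phi> f' f g' g)"
  using quad unfolding quad_form_def by simp_all

lemma quad_bound: "loc n' a' f' \<Longrightarrow> loc n a f \<Longrightarrow> loc m' b' g' \<Longrightarrow> loc m b g \<Longrightarrow>
    \<bar>\<phi> f' f g' g\<bar> \<le> K * level_weight \<kappa>\<^sub>1 n' n * level_weight \<kappa>\<^sub>2 m' m"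
  using quad unfolding quad_form_def by simp

lemma quad_form_swap4: "quad_form \<kappa>\<^sub>2 \<kappa>\<^sub>1 K (swap4 \<phi>)"
  unfolding quad_form_def swap4_def
proof (intro conjI allI impI)
  fix n' a' f' n a f m' b' g' m b g
  assume "loc n' a' f'" "loc n a f" "loc m' b' g'" "loc m b g"
  from quad_bound[OF this(3,4,1,2)]
  show "\<bar>\<phi> g' g f' f\<bar> \<le> K * level_weight \<kappa>\<^sub>2 n' n * level_weight \<kappa>\<^sub>1 m' m" by (simp add: mult_ac)
qed (rule quad_lin1 quad_lin2 quad_lin3 quad_lin4; assumption)+

lemma quad_biform_loc:
  assumes "loc m' b' g'" "loc m b g"
  shows "biform \<kappa>\<^sub>1 (K * level_weight \<kappa>\<^sub>2 m' m) (\<lambda>f' f. \<phi> f' f g' g)"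
  unfolding biform_def
proof (intro conjI allI impI)
  fix n' a' f' n a f
  assume "loc n' a' f'" "loc n a f"
  from quad_bound[OF this assms]
  show "\<bar>\<phi> f' f g' g\<bar> \<le> K * level_weight \<kappa>\<^sub>2 m' m * 2 powr (- \<kappa>\<^sub>1 * real n' - (1 - \<kappa>\<^sub>1) * real n)"
    by (simp add: level_weight_def mult_ac)
qed (rule quad_lin1 quad_lin2; (assumption | rule loc_step[OF assms(1)] loc_step[OF assms(2)]))+

lemma quad_biform:
  assumes g': "step_fun g'" and g: "step_fun g"
  shows "\<exists>K'. biform \<kappa>\<^sub>1 K' (\<lambda>f' f. \<phi> f' f g' g)"
proof -
  obtain c' where c': "c' > 0" "\<And>x. \<bar>g' x\<bar> \<le> c'" using step_fun_bounded[OF g'] by blast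
  obtain c where c: "c > 0" "\<And>x. \<bar>g x\<bar> \<le> c" using step_fun_bounded[OF g] by blast
  have "biform \<kappa>\<^sub>1 (c * (c' * K)) (\<lambda>f' f. \<phi> f' f g' g)"
    unfolding biform_def
  proof (intro conjI allI impI)
    fix n' a' f' n a f
    assume f: "loc n' a' f'" "loc n a f"
    have "\<bar>\<phi> f' f g' g\<bar> \<le> c * (c' * (K * level_weight \<kappa>\<^sub>1 n' n))"
    proof (rule linear_bound_scale[OF quad_lin4 _ g c])
      fix u assume u: "unit_bounded u"
      show "\<bar>\<phi> f' f g' u\<bar> \<le> c' * (K * level_weight \<kappa>\<^sub>1 n' n)"
      proof (rule linear_bound_scale[OF quad_lin3 _ g' c'])
        fix u' assume u': "unit_bounded u'"
        show "\<bar>\<phi> f' f u' u\<bar> \<le> K * level_weight \<kappa>\<^sub>1 n' n"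
          using quad_bound[OF f u' u] by simp
      qed (use f u in \<open>auto intro: loc_step\<close>)
    qed (use f g' in \<open>auto intro: loc_step\<close>)
    then show "\<bar>\<phi> f' f g' g\<bar> \<le> c * (c' * K) * 2 powr (- \<kappa>\<^sub>1 * real n' - (1 - \<kappa>\<^sub>1) * real n)"
      by (simp add: level_weight_def mult_ac)
  qed (rule quad_lin1 quad_lin2; (assumption | rule g g'))+
  then show ?thesis by blast
qed

end

text \<open>The slots of the first variable are traced out. Applied to \<open>swap4 \<phi>\<close>,
  the same definition traces out the second variable.\<close>

definition partial_trace :: "form4 \<Rightarrow> (nat set \<Rightarrow> real) \<Rightarrow> (nat set \<Rightarrow> real) \<Rightarrow> (nat set \<Rightarrow> real) \<Rightarrow> real" where
  "partial_trace \<phi> f g' g = trace_form (\<lambda>f' f. \<phi> f' f g' g) f"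

text \<open>The order of the limits is part of the definition: the first variable is traced first,
  and \<open>full_trace (swap4 \<phi>)\<close> uses the opposite order. Their agreement needs the
  boundedness of the operator.\<close>

definition full_trace :: "form4 \<Rightarrow> (nat set \<Rightarrow> real) \<Rightarrow> (nat set \<Rightarrow> real) \<Rightarrow> real" where
  "full_trace \<phi> f g = trace_form (partial_trace \<phi> f) g"

lemma linear_on_steps_sum_fun:
  assumes "\<And>i. i \<in> I \<Longrightarrow> linear_on_steps (\<psi> i)"
  shows "linear_on_steps (\<lambda>f. \<Sum>i\<in>I. \<psi> i f)"
  unfolding linear_on_steps_def
proof (intro conjI allI impI)
  fix f g :: "nat set \<Rightarrow> real" assume "step_fun f" "step_fun g"
  then have "(\<Sum>i\<in>I. \<psi> i (\<lambda>x. f x + g x)) = (\<Sum>i\<in>I. \<psi> i f + \<psi> i g)"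
    by (intro sum.cong refl linear_on_steps_add assms)
  then show "(\<Sum>i\<in>I. \<psi> i (\<lambda>x. f x + g x)) = (\<Sum>i\<in>I. \<psi> i f) + (\<Sum>i\<in>I. \<psi> i g)"
    by (simp add: sum.distrib)
next
  fix c and f :: "nat set \<Rightarrow> real" assume "step_fun f"
  then have "(\<Sum>i\<in>I. \<psi> i (\<lambda>x. c * f x)) = (\<Sum>i\<in>I. c * \<psi> i f)"
    by (intro sum.cong refl linear_on_steps_cmult assms)
  then show "(\<Sum>i\<in>I. \<psi> i (\<lambda>x. c * f x)) = c * (\<Sum>i\<in>I. \<psi> i f)"
    by (simp add: sum_distrib_left)
qed

context
  fixes \<kappa>\<^sub>1 \<kappa>\<^sub>2 K :: real and \<phi> :: form4
  assumes quad: "quad_form \<kappa>\<^sub>1 \<kappa>\<^sub>2 K \<phi>"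
begin

section \<open>Bounds and diffuseness of the traces of a four-linear form\<close>

lemma partial_trace_tendsto:
  assumes "step_fun f" "step_fun g'" "step_fun g"
  shows "((\<lambda>n. \<Sum>a\<in>Pow {..<n}. \<phi> (\<lambda>x. f x * hcell n a x) (hcell n a) g' g) \<longlongrightarrow> partial_trace \<phi> f g' g) ufilter"
proof -
  obtain K' where "biform \<kappa>\<^sub>1 K' (\<lambda>f' f. \<phi> f' f g' g)" using quad_biform[OF quad assms(2,3)] by blast
  from trace_form_tendsto[OF this assms(1)] show ?thesis unfolding partial_trace_def .
qed

lemma partial_trace_lin1:
  assumes "step_fun g'" "step_fun g"
  shows "linear_on_steps (\<lambda>f. partial_trace \<phi> f g' g)"
proof -
  obtain K' where "biform \<kappa>\<^sub>1 K' (\<lambda>f' f. \<phi> f' f g' g)" using quad_biform[OF quad assms] by blast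
  from linear_on_steps_trace_form[OF this] show ?thesis unfolding partial_trace_def .
qed

lemma partial_trace_lin2:
  assumes "step_fun f" "step_fun g"
  shows "linear_on_steps (\<lambda>g'. partial_trace \<phi> f g' g)"
proof (rule linear_on_steps_tendsto)
  show "linear_on_steps (\<lambda>g'. \<Sum>a\<in>Pow {..<n}. \<phi> (\<lambda>x. f x * hcell n a x) (hcell n a) g' g)" for n
    by (intro linear_on_steps_sum_fun quad_lin3[OF quad] step_fun_mult step_fun_hcell assms)
qed (rule partial_trace_tendsto[OF assms(1) _ assms(2)])

lemma partial_trace_lin3:
  assumes "step_fun f" "step_fun g'"
  shows "linear_on_steps (\<lambda>g. partial_trace \<phi> f g' g)"
proof (rule linear_on_steps_tendsto)
  show "linear_on_steps (\<lambda>g. \<Sum>a\<in>Pow {..<n}. \<phi> (\<lambda>x. f x * hcell n a x) (hcell n a) g' g)" for n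
    by (intro linear_on_steps_sum_fun quad_lin4[OF quad] step_fun_mult step_fun_hcell assms)
qed (rule partial_trace_tendsto[OF assms])

lemma partial_trace_bound:
  assumes "loc n a f" "loc m' b' g'" "loc m b g"
  shows "\<bar>partial_trace \<phi> f g' g\<bar> \<le> K / 2 ^ n * level_weight \<kappa>\<^sub>2 m' m"
  using trace_form_bound[OF quad_biform_loc[OF quad assms(2,3)] assms(1)]
  unfolding partial_trace_def by simp

lemma partial_trace_biform_loc:
  assumes "loc n a f"
  shows "biform \<kappa>\<^sub>2 (K / 2 ^ n) (partial_trace \<phi> f)"
  unfolding biform_def
proof (intro conjI allI impI)
  fix m' b' g' m b g
  assume "loc m' b' g'" "loc m b g"
  from partial_trace_bound[OF assms this]
  show "\<bar>partial_trace \<phi> f g' g\<bar> \<le> K / 2 ^ n * 2 powr (- \<kappa>\<^sub>2 * real m' - (1 - \<kappa>\<^sub>2) * real m)"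
    by (simp only: level_weight_def)
qed (rule partial_trace_lin2 partial_trace_lin3; (assumption | rule loc_step[OF assms]))+

lemma partial_trace_biform:
  assumes "step_fun f"
  shows "\<exists>K'. biform \<kappa>\<^sub>2 K' (partial_trace \<phi> f)"
proof -
  obtain c where c: "c > 0" "\<And>x. \<bar>f x\<bar> \<le> c" using step_fun_bounded[OF assms] by blast
  have "biform \<kappa>\<^sub>2 (c * K) (partial_trace \<phi> f)"
    unfolding biform_def
  proof (intro conjI allI impI)
    fix m' b' g' m b g
    assume g: "loc m' b' g'" "loc m b g"
    have "\<bar>partial_trace \<phi> f g' g\<bar> \<le> c * (K * level_weight \<kappa>\<^sub>2 m' m)"
    proof (rule linear_bound_scale[OF partial_trace_lin1 _ assms c])
      fix u assume u: "unit_bounded u"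
      show "\<bar>partial_trace \<phi> u g' g\<bar> \<le> K * level_weight \<kappa>\<^sub>2 m' m"
        using partial_trace_bound[OF u g] by simp
    qed (use g in \<open>auto intro: loc_step\<close>)
    then show "\<bar>partial_trace \<phi> f g' g\<bar> \<le> c * K * 2 powr (- \<kappa>\<^sub>2 * real m' - (1 - \<kappa>\<^sub>2) * real m)"
      by (simp add: level_weight_def mult_ac)
  qed (rule partial_trace_lin2 partial_trace_lin3; (assumption | rule assms))+
  then show ?thesis by blast
qed

lemma full_trace_tendsto:
  assumes "step_fun f" "step_fun g"
  shows "((\<lambda>n. \<Sum>b\<in>Pow {..<n}. partial_trace \<phi> f (\<lambda>x. g x * hcell n b x) (hcell n b)) \<longlongrightarrow> full_trace \<phi> f g) ufilter"
proof -
  obtain K' where "biform \<kappa>\<^sub>2 K' (partial_trace \<phi> f)" using partial_trace_biform[OF assms(1)] by blast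
  from trace_form_tendsto[OF this assms(2)] show ?thesis unfolding full_trace_def .
qed

lemma full_trace_lin1:
  assumes "step_fun g"
  shows "linear_on_steps (\<lambda>f. full_trace \<phi> f g)"
proof (rule linear_on_steps_tendsto)
  show "linear_on_steps (\<lambda>f. \<Sum>b\<in>Pow {..<n}. partial_trace \<phi> f (\<lambda>x. g x * hcell n b x) (hcell n b))" for n
    by (intro linear_on_steps_sum_fun partial_trace_lin1 step_fun_mult step_fun_hcell assms)
qed (rule full_trace_tendsto[OF _ assms])

lemma full_trace_bound:
  assumes "loc n a f" "loc m b g"
  shows "\<bar>full_trace \<phi> f g\<bar> \<le> K / 2 ^ n / 2 ^ m"
  unfolding full_trace_def by (rule trace_form_bound[OF partial_trace_biform_loc assms(2)]) fact

lemma diffuse_full_trace2: "unit_bounded f \<Longrightarrow> diffuse (\<lambda>g. full_trace \<phi> f g)"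
  unfolding full_trace_def by (rule diffuse_trace_form[OF partial_trace_biform_loc])

lemma diffuse_full_trace1:
  assumes "unit_bounded g"
  shows "diffuse (\<lambda>f. full_trace \<phi> f g)"
proof (rule diffuse_powr)
  show "linear_on_steps (\<lambda>f. full_trace \<phi> f g)" by (intro full_trace_lin1 loc_step[OF assms])
  show "\<bar>full_trace \<phi> f g\<bar> \<le> K * 2 powr (- 1 * real n)" if "loc n a f" for n a f
    using full_trace_bound[OF that assms] by (simp add: powr_minus powr_realpow divide_inverse)
qed simp

lemma diffuse_partial_trace1:
  assumes "unit_bounded g'" "unit_bounded g"
  shows "diffuse (\<lambda>f. partial_trace \<phi> f g' g)"
  unfolding partial_trace_def by (rule diffuse_trace_form[OF quad_biform_loc[OF quad assms]])

end

text \<open>Beyond the level on which w' and w depend they are constant on cells and can be pulled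
  out of their slots. Traces thus see only the product of the weights, which for products of signs
  means the symmetric difference of index sets.\<close>

lemma trace_form_mult:
  assumes T: "biform \<kappa> K T" and w: "unit_bounded w'" "unit_bounded w"
  shows "trace_form (\<lambda>f' f. T (\<lambda>x. f' x * w' x) (\<lambda>x. f x * w x)) (\<lambda>_. 1) = trace_form T (\<lambda>x. w' x * w x)"
proof -
  have st: "step_fun w'" "step_fun w" by (rule loc_step[OF w(1)], rule loc_step[OF w(2)])
  then obtain N where N: "dep N w'" "dep N w" using step_fun_common by blast
  let ?T = "\<lambda>f' f. T (\<lambda>x. f' x * w' x) (\<lambda>x. f x * w x)"
  have eq: "?T (\<lambda>x. 1 * hcell n a x) (hcell n a) = T (\<lambda>x. w' x * w x * hcell n a x) (hcell n a)"
    if "n \<ge> N" for n a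
  proof (cases "a \<subseteq> {..<n}")
    case False
    then have "hcell n a = (\<lambda>_. 0)" by (auto simp: hcell_def fun_eq_iff)
    then show ?thesis
      using linear_on_steps_zero[OF biform_lin1[OF T step_fun_const[of 0]]] by simp
  next
    case True
    have c: "u x * hcell n a x = u a * hcell n a x" if "dep N u" for u :: "nat set \<Rightarrow> real" and x
    proof (cases "x \<inter> {..<n} = a")
      case True
      then have "x \<inter> {..<N} = a \<inter> {..<N}" using \<open>n \<ge> N\<close> by auto
      from depD[OF that this] show ?thesis by simp
    qed (simp add: hcell_def)
    have "?T (\<lambda>x. 1 * hcell n a x) (hcell n a) = T (\<lambda>x. w' a * hcell n a x) (\<lambda>x. w a * hcell n a x)"
    proof -
      have "(\<lambda>x. hcell n a x * u x) = (\<lambda>x. u a * hcell n a x)" if "dep N u" for u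
        by (rule ext) (subst mult.commute, rule c[OF that])
      then show ?thesis using N by simp
    qed
    also have "\<dots> = w' a * (w a * T (hcell n a) (hcell n a))"
      by (simp add: linear_on_steps_cmult[OF biform_lin1[OF T]] linear_on_steps_cmult[OF biform_lin2[OF T]] step_fun_cmult)
    also have "\<dots> = (w' a * w a) * T (hcell n a) (hcell n a)"
      by simp
    also have "\<dots> = T (\<lambda>x. (w' a * w a) * hcell n a x) (hcell n a)"
      by (simp only: linear_on_steps_cmult[OF biform_lin1[OF T]] step_fun_hcell)
    also have "(\<lambda>x. (w' a * w a) * hcell n a x) = (\<lambda>x. w' x * w x * hcell n a x)"
      by (rule ext) (rule c[OF dep_mult[OF N], symmetric])
    finally show ?thesis .
  qed
  have "((\<lambda>n. \<Sum>a\<in>Pow {..<n}. ?T (\<lambda>x. 1 * hcell n a x) (hcell n a)) \<longlongrightarrow> trace_form ?T (\<lambda>_. 1)) ufilter"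
    by (rule trace_form_tendsto[OF biform_mult[OF T w] step_fun_const])
  moreover have "((\<lambda>n. \<Sum>a\<in>Pow {..<n}. T (\<lambda>x. w' x * w x * hcell n a x) (hcell n a)) \<longlongrightarrow> trace_form T (\<lambda>x. w' x * w x)) ufilter"
    by (rule trace_form_tendsto[OF T step_fun_mult[OF st]])
  moreover have "\<forall>\<^sub>F n in ufilter. (\<Sum>a\<in>Pow {..<n}. ?T (\<lambda>x. 1 * hcell n a x) (hcell n a))
      = (\<Sum>a\<in>Pow {..<n}. T (\<lambda>x. w' x * w x * hcell n a x) (hcell n a))"
    by (rule eventually_ufilter, rule eventually_mono[OF eventually_ge_at_top[of N]], intro sum.cong refl eq)
  ultimately have "((\<lambda>n. \<Sum>a\<in>Pow {..<n}. T (\<lambda>x. w' x * w x * hcell n a x) (hcell n a)) \<longlongrightarrow> trace_form ?T (\<lambda>_. 1)) ufilter"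
    by (rule_tac Lim_transform_eventually)
  then show ?thesis
    using \<open>((\<lambda>n. \<Sum>a\<in>Pow {..<n}. T (\<lambda>x. w' x * w x * hcell n a x) (hcell n a)) \<longlongrightarrow> trace_form T (\<lambda>x. w' x * w x)) ufilter\<close>
    by (rule tendsto_unique[OF ufilter_nonbot])
qed

lemma biform_random_rad_mult:
  assumes T: "biform \<kappa> K T" and "\<kappa> < 1" and w: "unit_bounded w'" "unit_bounded w" and "\<delta> > 0"
  shows "eventually (\<lambda>f. \<bar>T (\<lambda>x. f x * w' x) (\<lambda>x. f x * w x) - trace_form T (\<lambda>x. w' x * w x)\<bar> \<le> \<delta>) random_rad"
  using biform_random_rad_trace[OF biform_mult[OF T w] assms(2,5)]
  unfolding trace_form_mult[OF T w] .


section \<open>Inductive choice of two independent systems of signs\<close>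

text \<open>What is needed to choose one more sign in the first variable. Diffuseness in the
  functional slot is demanded separately because the norm bound yields none when
  \<open>\<kappa>\<^sub>1 = 0\<close>, which is the situation of the variable t.\<close>

definition nice_form :: "form4 \<Rightarrow> bool" where
  "nice_form \<phi> \<longleftrightarrow> (\<exists>\<kappa>\<^sub>1 \<kappa>\<^sub>2 K. \<kappa>\<^sub>1 < 1 \<and> quad_form \<kappa>\<^sub>1 \<kappa>\<^sub>2 K \<phi>) \<and>
     (\<forall>f g' g. unit_bounded f \<longrightarrow> unit_bounded g' \<longrightarrow> unit_bounded g \<longrightarrow> diffuse (\<lambda>f'. \<phi> f' f g' g)) \<and>
     (\<forall>g f. unit_bounded g \<longrightarrow> unit_bounded f \<longrightarrow> diffuse (\<lambda>f'. partial_trace (swap4 \<phi>) g f' f))"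

text \<open>A new sign \<rho> must nearly annihilate each form in which it occurs once and turn each
  form in which it occurs in both slots into a trace. W and V hold the products of the signs chosen
  before, in the variable of \<rho> and in the other one.\<close>

definition good_sign :: "form4 \<Rightarrow> (nat set \<Rightarrow> real) set \<Rightarrow> (nat set \<Rightarrow> real) set \<Rightarrow> real \<Rightarrow> (nat set \<Rightarrow> real) \<Rightarrow> bool" where
  "good_sign \<phi> W V \<delta> \<rho> \<longleftrightarrow> (\<forall>w'\<in>W. \<forall>w\<in>W. \<forall>v'\<in>V. \<forall>v\<in>V.
     \<bar>\<phi> (\<lambda>x. \<rho> x * w' x) w v' v\<bar> \<le> \<delta> \<and>
     \<bar>\<phi> w' (\<lambda>x. \<rho> x * w x) v' v\<bar> \<le> \<delta> \<and>
     \<bar>\<phi> (\<lambda>x. \<rho> x * w' x) (\<lambda>x. \<rho> x * w x) v' v - partial_trace \<phi> (\<lambda>x. w' x * w x) v' v\<bar> \<le> \<delta> \<and>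
     \<bar>partial_trace \<phi> (\<lambda>x. \<rho> x * w x) v' v\<bar> \<le> \<delta> \<and>
     \<bar>partial_trace (swap4 \<phi>) v (\<lambda>x. \<rho> x * w' x) w\<bar> \<le> \<delta> \<and>
     \<bar>partial_trace (swap4 \<phi>) v w' (\<lambda>x. \<rho> x * w x)\<bar> \<le> \<delta> \<and>
     \<bar>partial_trace (swap4 \<phi>) v (\<lambda>x. \<rho> x * w' x) (\<lambda>x. \<rho> x * w x) - full_trace (swap4 \<phi>) v (\<lambda>x. w' x * w x)\<bar> \<le> \<delta> \<and>
     \<bar>full_trace (swap4 \<phi>) v (\<lambda>x. \<rho> x * w x)\<bar> \<le> \<delta> \<and>
     \<bar>full_trace \<phi> (\<lambda>x. \<rho> x * w x) v\<bar> \<le> \<delta>)"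

text \<open>Each of the nine estimates holds with probability tending to one: single occurrences by
  diffuseness, double occurrences by concentration at the trace.\<close>

lemma eventually_good_sign:
  assumes nice: "nice_form \<phi>" and fin: "finite W" "finite V"
    and W: "\<And>w. w \<in> W \<Longrightarrow> unit_bounded w" and V: "\<And>v. v \<in> V \<Longrightarrow> unit_bounded v" and \<delta>: "\<delta> > 0"
  shows "eventually (good_sign \<phi> W V \<delta>) random_rad"
proof -
  obtain \<kappa>\<^sub>1 \<kappa>\<^sub>2 K where \<kappa>: "\<kappa>\<^sub>1 < 1" and q: "quad_form \<kappa>\<^sub>1 \<kappa>\<^sub>2 K \<phi>"
    using nice unfolding nice_form_def by blast
  have d1: "diffuse (\<lambda>f'. \<phi> f' f g' g)" if "unit_bounded f" "unit_bounded g'" "unit_bounded g" for f g' g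
    using nice that unfolding nice_form_def by simp
  have d2: "diffuse (\<lambda>f'. partial_trace (swap4 \<phi>) g f' f)" if "unit_bounded g" "unit_bounded f" for f g
    using nice that unfolding nice_form_def by simp
  note q' = quad_form_swap4[OF q]
  show ?thesis
    unfolding good_sign_def
  proof (intro eventually_ball_finite fin ballI eventually_conj)
    fix w' w v' v assume "w' \<in> W" "w \<in> W" "v' \<in> V" "v \<in> V"
    then have w: "unit_bounded w'" "unit_bounded w" and v: "unit_bounded v'" "unit_bounded v"
      using W V by auto
    show "\<forall>\<^sub>F \<rho> in random_rad. \<bar>\<phi> (\<lambda>x. \<rho> x * w' x) w v' v\<bar> \<le> \<delta>"
      by (rule diffuse_random_rad[OF diffuse_mult[OF d1[OF w(2) v] w(1)] \<delta>])
    show "\<forall>\<^sub>F \<rho> in random_rad. \<bar>\<phi> w' (\<lambda>x. \<rho> x * w x) v' v\<bar> \<le> \<delta>"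
      by (rule diffuse_random_rad[OF diffuse_mult[OF diffuse_biform2[OF quad_biform_loc[OF q v] \<kappa> w(1)] w(2)] \<delta>])
    show "\<forall>\<^sub>F \<rho> in random_rad. \<bar>\<phi> (\<lambda>x. \<rho> x * w' x) (\<lambda>x. \<rho> x * w x) v' v - partial_trace \<phi> (\<lambda>x. w' x * w x) v' v\<bar> \<le> \<delta>"
      unfolding partial_trace_def by (rule biform_random_rad_mult[OF quad_biform_loc[OF q v] \<kappa> w \<delta>])
    show "\<forall>\<^sub>F \<rho> in random_rad. \<bar>partial_trace \<phi> (\<lambda>x. \<rho> x * w x) v' v\<bar> \<le> \<delta>"
      by (rule diffuse_random_rad[OF diffuse_mult[OF diffuse_partial_trace1[OF q v] w(2)] \<delta>])
    show "\<forall>\<^sub>F \<rho> in random_rad. \<bar>partial_trace (swap4 \<phi>) v (\<lambda>x. \<rho> x * w' x) w\<bar> \<le> \<delta>"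
      by (rule diffuse_random_rad[OF diffuse_mult[OF d2[OF v(2) w(2)] w(1)] \<delta>])
    show "\<forall>\<^sub>F \<rho> in random_rad. \<bar>partial_trace (swap4 \<phi>) v w' (\<lambda>x. \<rho> x * w x)\<bar> \<le> \<delta>"
      by (rule diffuse_random_rad[OF diffuse_mult[OF diffuse_biform2[OF partial_trace_biform_loc[OF q' v(2)] \<kappa> w(1)] w(2)] \<delta>])
    show "\<forall>\<^sub>F \<rho> in random_rad. \<bar>partial_trace (swap4 \<phi>) v (\<lambda>x. \<rho> x * w' x) (\<lambda>x. \<rho> x * w x)
        - full_trace (swap4 \<phi>) v (\<lambda>x. w' x * w x)\<bar> \<le> \<delta>"
      unfolding full_trace_def by (rule biform_random_rad_mult[OF partial_trace_biform_loc[OF q' v(2)] \<kappa> w \<delta>])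
    show "\<forall>\<^sub>F \<rho> in random_rad. \<bar>full_trace (swap4 \<phi>) v (\<lambda>x. \<rho> x * w x)\<bar> \<le> \<delta>"
      by (rule diffuse_random_rad[OF diffuse_mult[OF diffuse_full_trace2[OF q' v(2)] w(2)] \<delta>])
    show "\<forall>\<^sub>F \<rho> in random_rad. \<bar>full_trace \<phi> (\<lambda>x. \<rho> x * w x) v\<bar> \<le> \<delta>"
      by (rule diffuse_random_rad[OF diffuse_mult[OF diffuse_full_trace1[OF q v(2)] w(2)] \<delta>])
  qed
qed

definition sign_system :: "(nat \<Rightarrow> nat set \<Rightarrow> real) \<Rightarrow> bool" where
  "sign_system \<rho> \<longleftrightarrow> (\<exists>n Z. strict_mono n \<and> (\<forall>r. \<rho> r = signed_rad (n r) (Z r)))"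

definition sign_prod :: "(nat \<Rightarrow> nat set \<Rightarrow> real) \<Rightarrow> nat set \<Rightarrow> nat set \<Rightarrow> real" where
  "sign_prod \<rho> A x = (\<Prod>i\<in>A. \<rho> i x)"

lemma unit_bounded_sign_prod:
  assumes "\<And>i. i \<in> A \<Longrightarrow> \<exists>n Z. \<rho> i = signed_rad n Z"
  shows "unit_bounded (sign_prod \<rho> A)"
proof (rule locI)
  show "step_fun (sign_prod \<rho> A)"
    unfolding sign_prod_def
  proof (rule step_fun_prod)
    fix i assume "i \<in> A"
    then obtain n Z where "\<rho> i = signed_rad n Z" using assms by blast
    then show "step_fun (\<rho> i)" by simp
  qed
  fix x
  have "(\<Prod>i\<in>A. \<bar>\<rho> i x\<bar>) \<le> 1"
  proof (rule prod_le_1)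
    fix i assume "i \<in> A"
    then obtain n Z where "\<rho> i = signed_rad n Z" using assms by blast
    then show "0 \<le> \<bar>\<rho> i x\<bar> \<and> \<bar>\<rho> i x\<bar> \<le> 1" by simp
  qed
  then show "\<bar>sign_prod \<rho> A x\<bar> \<le> (if x \<inter> {..<0} = {} then 1 else 0)"
    by (simp add: sign_prod_def abs_prod)
qed

lemma sign_prod_cong: "(\<And>i. i \<in> A \<Longrightarrow> \<rho> i = \<rho>' i) \<Longrightarrow> sign_prod \<rho> A = sign_prod \<rho>' A"
  by (simp add: sign_prod_def fun_eq_iff)

text \<open>The order of choice is \<open>\<rho> 0\<close>, \<open>\<sigma> 0\<close>,
  \<open>\<rho> 1\<close>, \<open>\<sigma> 1\<close>, and so on, so \<open>\<sigma> r\<close> is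
  tested against products that may contain \<open>\<rho> r\<close>. Hence the asymmetry between
  \<open>{..<r}\<close> and \<open>{..<Suc r}\<close>, which later decides which iterated trace an
  entry sees.\<close>

theorem sign_systems_exist:
  assumes nice: "nice_form \<phi>" "nice_form (swap4 \<phi>)" and \<delta>: "\<And>r. \<delta> r > (0::real)"
  shows "\<exists>\<rho> \<sigma>. sign_system \<rho> \<and> sign_system \<sigma> \<and>
    (\<forall>r. good_sign \<phi> (sign_prod \<rho> ` Pow {..<r}) (sign_prod \<sigma> ` Pow {..<r}) (\<delta> r) (\<rho> r) \<and>
         good_sign (swap4 \<phi>) (sign_prod \<sigma> ` Pow {..<r}) (sign_prod \<rho> ` Pow {..<Suc r}) (\<delta> r) (\<sigma> r))"
proof -
  define R where "R = (\<lambda>u :: (nat \<times> nat set set) \<times> (nat \<times> nat set set). signed_rad (fst (fst u)) (snd (fst u)))"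
  define S where "S = (\<lambda>u :: (nat \<times> nat set set) \<times> (nat \<times> nat set set). signed_rad (fst (snd u)) (snd (snd u)))"
  \<comment> \<open>P may consult h only below r. The candidate u for stage r contains both new
    signs, so the \<rho> of stage r has to be read from u.\<close>
  define P where "P = (\<lambda>h r u. (\<forall>i<r. fst (fst (h i)) < fst (fst u) \<and> fst (snd (h i)) < fst (snd u)) \<and>
     good_sign \<phi> (sign_prod (\<lambda>i. R (h i)) ` Pow {..<r}) (sign_prod (\<lambda>i. S (h i)) ` Pow {..<r}) (\<delta> r) (R u) \<and>
     good_sign (swap4 \<phi>) (sign_prod (\<lambda>i. S (h i)) ` Pow {..<r})
       (sign_prod (\<lambda>i. if i < r then R (h i) else R u) ` Pow {..<Suc r}) (\<delta> r) (S u))"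
  have "\<exists>h. \<forall>r. P h r (h r)"
  proof (rule dependent_wf_choice[OF wf_less])
    fix h h' :: "nat \<Rightarrow> (nat \<times> nat set set) \<times> (nat \<times> nat set set)" and r u
    assume eq: "\<And>z. (z, r) \<in> {(x, y). x < y} \<Longrightarrow> h z = h' z"
    have e: "h i = h' i" if "i < r" for i using eq[of i] that by simp
    have 1: "sign_prod (\<lambda>i. R (h i)) ` Pow {..<r} = sign_prod (\<lambda>i. R (h' i)) ` Pow {..<r}"
      "sign_prod (\<lambda>i. S (h i)) ` Pow {..<r} = sign_prod (\<lambda>i. S (h' i)) ` Pow {..<r}"
      by (intro image_cong refl sign_prod_cong; use e in \<open>auto simp: subset_iff\<close>)+
    have 2: "(\<lambda>i. if i < r then R (h i) else R u) = (\<lambda>i. if i < r then R (h' i) else R u)"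
      using e by auto
    have 3: "(\<forall>i<r. fst (fst (h i)) < fst (fst u) \<and> fst (snd (h i)) < fst (snd u))
       = (\<forall>i<r. fst (fst (h' i)) < fst (fst u) \<and> fst (snd (h' i)) < fst (snd u))"
      using e by auto
    show "P h r u = P h' r u" unfolding P_def 1 2 3 ..
  next
    fix r and h :: "nat \<Rightarrow> (nat \<times> nat set set) \<times> (nat \<times> nat set set)"
    have bd: "unit_bounded w" if "w \<in> sign_prod (\<lambda>i. signed_rad (n i) (Z i)) ` B" for w B n Z
      using that by (auto intro!: unit_bounded_sign_prod)
    \<comment> \<open>One more than the sum of all earlier levels exceeds each of them, which makes
      the levels strictly increasing.\<close>
    define N where "N = Suc (\<Sum>i<r. fst (fst (h i)))"
    define M where "M = Suc (\<Sum>i<r. fst (snd (h i)))"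
    have N: "fst (fst (h i)) < N" and M: "fst (snd (h i)) < M" if "i < r" for i
      unfolding N_def M_def using that by (auto simp: less_Suc_eq_le intro!: member_le_sum)
    have "eventually (\<lambda>\<rho>. good_sign \<phi> (sign_prod (\<lambda>i. R (h i)) ` Pow {..<r}) (sign_prod (\<lambda>i. S (h i)) ` Pow {..<r}) (\<delta> r) \<rho>
        \<and> (\<exists>n\<ge>N. \<exists>Z. \<rho> = signed_rad n Z)) random_rad"
      unfolding R_def S_def
      by (intro eventually_conj random_rad_level eventually_good_sign[OF nice(1)] \<delta>) (auto intro: bd)
    then obtain n Z where n: "n \<ge> N"
      and g1: "good_sign \<phi> (sign_prod (\<lambda>i. R (h i)) ` Pow {..<r}) (sign_prod (\<lambda>i. S (h i)) ` Pow {..<r}) (\<delta> r) (signed_rad n Z)"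
      using eventually_happens'[OF random_rad_nonbot] by blast
    define \<rho> where "\<rho> = (\<lambda>i. if i < r then R (h i) else signed_rad n Z)"
    have \<rho>: "\<exists>n Z. \<rho> i = signed_rad n Z" for i by (auto simp: \<rho>_def R_def)
    have "eventually (\<lambda>\<sigma>. good_sign (swap4 \<phi>) (sign_prod (\<lambda>i. S (h i)) ` Pow {..<r}) (sign_prod \<rho> ` Pow {..<Suc r}) (\<delta> r) \<sigma>
        \<and> (\<exists>n\<ge>M. \<exists>Z. \<sigma> = signed_rad n Z)) random_rad"
    proof (intro eventually_conj random_rad_level eventually_good_sign[OF nice(2)] \<delta>)
      show "unit_bounded v" if "v \<in> sign_prod \<rho> ` Pow {..<Suc r}" for v
        using that \<rho> by (auto intro!: unit_bounded_sign_prod)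
      show "unit_bounded v" if "v \<in> sign_prod (\<lambda>i. S (h i)) ` Pow {..<r}" for v
        using that unfolding S_def by (rule bd)
    qed auto
    then obtain m Y where m: "m \<ge> M"
      and g2: "good_sign (swap4 \<phi>) (sign_prod (\<lambda>i. S (h i)) ` Pow {..<r}) (sign_prod \<rho> ` Pow {..<Suc r}) (\<delta> r) (signed_rad m Y)"
      using eventually_happens'[OF random_rad_nonbot] by blast
    have R': "R ((n, Z), (m, Y)) = signed_rad n Z" by (simp add: R_def)
    have "P h r ((n, Z), (m, Y))"
      unfolding P_def R' using g1 g2 n m less_le_trans[OF N] less_le_trans[OF M] by (simp add: S_def \<rho>_def)
    then show "\<exists>u. P h r u" by blast
  qed
  then obtain h where h: "\<And>r. P h r (h r)" by blast
  let ?\<rho> = "\<lambda>r. R (h r)" and ?\<sigma> = "\<lambda>r. S (h r)"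
  have "sign_system ?\<rho>"
    unfolding sign_system_def R_def
    using h unfolding P_def by (intro exI[of _ "\<lambda>r. fst (fst (h r))"] exI[of _ "\<lambda>r. snd (fst (h r))"]) (auto simp: strict_mono_def)
  moreover have "sign_system ?\<sigma>"
    unfolding sign_system_def S_def
    using h unfolding P_def by (intro exI[of _ "\<lambda>r. fst (snd (h r))"] exI[of _ "\<lambda>r. snd (snd (h r))"]) (auto simp: strict_mono_def)
  moreover have "good_sign \<phi> (sign_prod ?\<rho> ` Pow {..<r}) (sign_prod ?\<sigma> ` Pow {..<r}) (\<delta> r) (?\<rho> r)" for r
    using h[of r] unfolding P_def by simp
  moreover have "good_sign (swap4 \<phi>) (sign_prod ?\<sigma> ` Pow {..<r}) (sign_prod ?\<rho> ` Pow {..<Suc r}) (\<delta> r) (?\<sigma> r)" for r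
  proof -
    have "sign_prod (\<lambda>i. if i < r then R (h i) else R (h r)) ` Pow {..<Suc r} = sign_prod ?\<rho> ` Pow {..<Suc r}"
      by (intro image_cong refl sign_prod_cong) (auto simp: subset_iff less_Suc_eq)
    then show ?thesis using h[of r] unfolding P_def by simp
  qed
  ultimately show ?thesis by (intro exI[of _ ?\<rho>] exI[of _ ?\<sigma>]) simp
qed


section \<open>Matrix entries of the compressed form\<close>

definition sdiff :: "nat set \<Rightarrow> nat set \<Rightarrow> nat set" where
  "sdiff A B = (A - B) \<union> (B - A)"

lemma sdiff_self [simp]: "sdiff A A = {}"
  and sdiff_empty [simp]: "sdiff A {} = A" "sdiff {} A = A"
  by (auto simp: sdiff_def)

lemma sdiff_eq_empty: "sdiff A B = {} \<longleftrightarrow> A = B"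
  by (auto simp: sdiff_def)

lemma sdiff_sdiff: "sdiff (sdiff A C) A = C"
  by (auto simp: sdiff_def)

lemma sdiff_sub: "A \<subseteq> X \<Longrightarrow> B \<subseteq> X \<Longrightarrow> sdiff A B \<subseteq> X"
  by (auto simp: sdiff_def)

lemma finite_sdiff: "finite A \<Longrightarrow> finite B \<Longrightarrow> finite (sdiff A B)"
  by (simp add: sdiff_def)

text \<open>\<^term>\<open>M A' A B' B\<close> are the matrix entries in the Walsh basis of the chosen signs, \<^term>\<open>V\<close> and \<^term>\<open>W\<close>
  their limits as the signs in one variable go to infinity, and \<^term>\<open>g1\<close>, \<^term>\<open>g2\<close> the two iterated limits.\<close>

locale entry_arrays =
  fixes M :: "nat set \<Rightarrow> nat set \<Rightarrow> nat set \<Rightarrow> nat set \<Rightarrow> real"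
    and V W :: "nat set \<Rightarrow> nat set \<Rightarrow> nat set \<Rightarrow> real"
    and g1 g2 :: "nat set \<Rightarrow> nat set \<Rightarrow> real"
    and \<delta> :: "nat \<Rightarrow> real"
  assumes nonneg: "0 \<le> \<delta> r"
    and s_M: "A' \<subseteq> {..<r} \<Longrightarrow> A \<subseteq> {..<r} \<Longrightarrow> B' \<subseteq> {..<r} \<Longrightarrow> B \<subseteq> {..<r} \<Longrightarrow>
      \<bar>M (insert r A') A B' B\<bar> \<le> \<delta> r \<and> \<bar>M A' (insert r A) B' B\<bar> \<le> \<delta> r \<and>
      \<bar>M (insert r A') (insert r A) B' B - V (sdiff A' A) B' B\<bar> \<le> \<delta> r"
    and s_V: "A \<subseteq> {..<r} \<Longrightarrow> B' \<subseteq> {..<r} \<Longrightarrow> B \<subseteq> {..<r} \<Longrightarrow> \<bar>V (insert r A) B' B\<bar> \<le> \<delta> r"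
    and s_W: "A' \<subseteq> {..<r} \<Longrightarrow> A \<subseteq> {..<r} \<Longrightarrow> B \<subseteq> {..<r} \<Longrightarrow>
      \<bar>W B (insert r A') A\<bar> \<le> \<delta> r \<and> \<bar>W B A' (insert r A)\<bar> \<le> \<delta> r \<and>
      \<bar>W B (insert r A') (insert r A) - g1 (sdiff A' A) B\<bar> \<le> \<delta> r"
    and s_g: "A \<subseteq> {..<r} \<Longrightarrow> B \<subseteq> {..<r} \<Longrightarrow> \<bar>g1 (insert r A) B\<bar> \<le> \<delta> r \<and> \<bar>g2 (insert r A) B\<bar> \<le> \<delta> r"
    and t_M: "A' \<subseteq> {..r} \<Longrightarrow> A \<subseteq> {..r} \<Longrightarrow> B' \<subseteq> {..<r} \<Longrightarrow> B \<subseteq> {..<r} \<Longrightarrow>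
      \<bar>M A' A (insert r B') B\<bar> \<le> \<delta> r \<and> \<bar>M A' A B' (insert r B)\<bar> \<le> \<delta> r \<and>
      \<bar>M A' A (insert r B') (insert r B) - W (sdiff B' B) A' A\<bar> \<le> \<delta> r"
    and t_W: "A' \<subseteq> {..r} \<Longrightarrow> A \<subseteq> {..r} \<Longrightarrow> B \<subseteq> {..<r} \<Longrightarrow> \<bar>W (insert r B) A' A\<bar> \<le> \<delta> r"
    and t_V: "A \<subseteq> {..r} \<Longrightarrow> B' \<subseteq> {..<r} \<Longrightarrow> B \<subseteq> {..<r} \<Longrightarrow>
      \<bar>V A (insert r B') B\<bar> \<le> \<delta> r \<and> \<bar>V A B' (insert r B)\<bar> \<le> \<delta> r \<and>
      \<bar>V A (insert r B') (insert r B) - g2 A (sdiff B' B)\<bar> \<le> \<delta> r"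
    and t_g: "A \<subseteq> {..r} \<Longrightarrow> B \<subseteq> {..<r} \<Longrightarrow> \<bar>g1 A (insert r B)\<bar> \<le> \<delta> r \<and> \<bar>g2 A (insert r B)\<bar> \<le> \<delta> r"
begin

section \<open>Reduction of an entry to its largest index\<close>

lemma minus_top: "X \<subseteq> {..r} \<Longrightarrow> X - {r} \<subseteq> {..<r :: nat}"
  by (auto simp: subset_iff intro!: le_neq_implies_less)

lemma without_top: "X \<subseteq> {..r} \<Longrightarrow> r \<notin> X \<Longrightarrow> X \<subseteq> {..<r :: nat}"
  by (metis Diff_empty Diff_insert0 minus_top)

lemma g_top_s:
  assumes "C \<subseteq> {..r}" "D \<subseteq> {..<r}" "r \<in> C"
  shows "\<bar>g1 C D\<bar> \<le> \<delta> r" "\<bar>g2 C D\<bar> \<le> \<delta> r"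
  using s_g[OF minus_top[OF assms(1)] assms(2)] assms(3) by (simp_all add: insert_absorb)

lemma g_top_t:
  assumes "C \<subseteq> {..r}" "D \<subseteq> {..r}" "r \<in> D"
  shows "\<bar>g1 C D\<bar> \<le> \<delta> r" "\<bar>g2 C D\<bar> \<le> \<delta> r"
  using t_g[OF assms(1) minus_top[OF assms(2)]] assms(3) by (simp_all add: insert_absorb)

lemma V_top_s:
  assumes "C \<subseteq> {..r}" "B' \<subseteq> {..<r}" "B \<subseteq> {..<r}" "r \<in> C"
  shows "\<bar>V C B' B\<bar> \<le> \<delta> r"
  using s_V[OF minus_top[OF assms(1)] assms(2,3)] assms(4) by (simp add: insert_absorb)

lemma W_top_t:
  assumes "A' \<subseteq> {..r}" "A \<subseteq> {..r}" "D \<subseteq> {..r}" "r \<in> D"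
  shows "\<bar>W D A' A\<bar> \<le> \<delta> r"
  using t_W[OF assms(1,2) minus_top[OF assms(3)]] assms(4) by (simp add: insert_absorb)

lemma sdiff_cases:
  assumes "r \<in> X' \<or> r \<in> X"
  obtains "r \<in> X'" "r \<in> X" "sdiff X' X = sdiff (X' - {r}) (X - {r})"
    | "r \<in> sdiff X' X" "r \<in> X'" "r \<notin> X"
    | "r \<in> sdiff X' X" "r \<notin> X'" "r \<in> X"
  using assms unfolding sdiff_def by blast

text \<open>An entry is governed by the sign chosen last among its indices. If r occurs on both
  sides, the entry is near the next limit. If it occurs on one side only, entry and limit are both
  small, the limit because r survives in the symmetric difference.\<close>

lemma V_approx:
  assumes "C \<subseteq> {..r}" "B' \<subseteq> {..r}" "B \<subseteq> {..r}" "(r \<in> B' \<or> r \<in> B) \<or> (r \<in> C \<and> r \<notin> B' \<and> r \<notin> B)"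
  shows "\<bar>V C B' B - g2 C (sdiff B' B)\<bar> \<le> 2 * \<delta> r"
  using assms(4)
proof
  assume "r \<in> C \<and> r \<notin> B' \<and> r \<notin> B"
  then have r: "r \<in> C" and B: "B' \<subseteq> {..<r}" "B \<subseteq> {..<r}"
    using without_top[OF assms(2)] without_top[OF assms(3)] by auto
  have "\<bar>V C B' B\<bar> \<le> \<delta> r" "\<bar>g2 C (sdiff B' B)\<bar> \<le> \<delta> r"
    by (rule V_top_s[OF assms(1) B r], rule g_top_s(2)[OF assms(1) sdiff_sub[OF B] r])
  then show ?thesis by linarith
next
  assume "r \<in> B' \<or> r \<in> B"
  then show ?thesis
  proof (cases rule: sdiff_cases)
    case 1
    from t_V[OF assms(1) minus_top[OF assms(2)] minus_top[OF assms(3)]]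
    have "\<bar>V C B' B - g2 C (sdiff B' B)\<bar> \<le> \<delta> r" using 1 by (simp add: insert_absorb)
    then show ?thesis using nonneg[of r] by linarith
  next
    case 2
    have "\<bar>V C B' B\<bar> \<le> \<delta> r"
      using t_V[OF assms(1) minus_top[OF assms(2)] without_top[OF assms(3) 2(3)]] 2(2) by (simp add: insert_absorb)
    moreover have "\<bar>g2 C (sdiff B' B)\<bar> \<le> \<delta> r"
      using assms 2 by (intro g_top_t sdiff_sub)
    ultimately show ?thesis by linarith
  next
    case 3
    have "\<bar>V C B' B\<bar> \<le> \<delta> r"
      using t_V[OF assms(1) without_top[OF assms(2) 3(2)] minus_top[OF assms(3)]] 3(3) by (simp add: insert_absorb)
    moreover have "\<bar>g2 C (sdiff B' B)\<bar> \<le> \<delta> r"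
      using assms 3 by (intro g_top_t sdiff_sub)
    ultimately show ?thesis by linarith
  qed
qed

text \<open>D holds indices of \<sigma>, so r in D takes precedence over r in A' or A:
  \<open>\<sigma> r\<close> was chosen after \<open>\<rho> r\<close> and its estimates admit
  it.\<close>

lemma W_approx:
  assumes "A' \<subseteq> {..r}" "A \<subseteq> {..r}" "D \<subseteq> {..r}" "r \<in> D \<or> ((r \<in> A' \<or> r \<in> A) \<and> r \<notin> D)"
  shows "\<bar>W D A' A - g1 (sdiff A' A) D\<bar> \<le> 2 * \<delta> r"
  using assms(4)
proof
  assume "r \<in> D"
  then have "\<bar>W D A' A\<bar> \<le> \<delta> r" "\<bar>g1 (sdiff A' A) D\<bar> \<le> \<delta> r"
    by (rule W_top_t[OF assms(1-3)], intro g_top_t(1)[OF sdiff_sub[OF assms(1,2)] assms(3)])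
  then show ?thesis by linarith
next
  assume "(r \<in> A' \<or> r \<in> A) \<and> r \<notin> D"
  then have r: "r \<in> A' \<or> r \<in> A" and D: "D \<subseteq> {..<r}" using without_top[OF assms(3)] by auto
  from r show ?thesis
  proof (cases rule: sdiff_cases)
    case 1
    from s_W[OF minus_top[OF assms(1)] minus_top[OF assms(2)] D]
    have "\<bar>W D A' A - g1 (sdiff A' A) D\<bar> \<le> \<delta> r" using 1 by (simp add: insert_absorb)
    then show ?thesis using nonneg[of r] by linarith
  next
    case 2
    have "\<bar>W D A' A\<bar> \<le> \<delta> r"
      using s_W[OF minus_top[OF assms(1)] without_top[OF assms(2) 2(3)] D] 2(2) by (simp add: insert_absorb)
    moreover have "\<bar>g1 (sdiff A' A) D\<bar> \<le> \<delta> r"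
      using assms 2 D by (intro g_top_s sdiff_sub)
    ultimately show ?thesis by linarith
  next
    case 3
    have "\<bar>W D A' A\<bar> \<le> \<delta> r"
      using s_W[OF without_top[OF assms(1) 3(2)] minus_top[OF assms(2)] D] 3(3) by (simp add: insert_absorb)
    moreover have "\<bar>g1 (sdiff A' A) D\<bar> \<le> \<delta> r"
      using assms 3 D by (intro g_top_s sdiff_sub)
    ultimately show ?thesis by linarith
  qed
qed

lemma M_approx_s:
  assumes "A' \<subseteq> {..r}" "A \<subseteq> {..r}" "B' \<subseteq> {..<r}" "B \<subseteq> {..<r}" "r \<in> A' \<or> r \<in> A"
  shows "\<bar>M A' A B' B - V (sdiff A' A) B' B\<bar> \<le> 2 * \<delta> r"
  using assms(5)
proof (cases rule: sdiff_cases)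
  case 1
  from s_M[OF minus_top[OF assms(1)] minus_top[OF assms(2)] assms(3,4)]
  have "\<bar>M A' A B' B - V (sdiff A' A) B' B\<bar> \<le> \<delta> r" using 1 by (simp add: insert_absorb)
  then show ?thesis using nonneg[of r] by linarith
next
  case 2
  have "\<bar>M A' A B' B\<bar> \<le> \<delta> r"
    using s_M[OF minus_top[OF assms(1)] without_top[OF assms(2) 2(3)] assms(3,4)] 2(2) by (simp add: insert_absorb)
  moreover have "\<bar>V (sdiff A' A) B' B\<bar> \<le> \<delta> r"
    using assms 2 by (intro V_top_s sdiff_sub)
  ultimately show ?thesis by linarith
next
  case 3
  have "\<bar>M A' A B' B\<bar> \<le> \<delta> r"
    using s_M[OF without_top[OF assms(1) 3(2)] minus_top[OF assms(2)] assms(3,4)] 3(3) by (simp add: insert_absorb)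
  moreover have "\<bar>V (sdiff A' A) B' B\<bar> \<le> \<delta> r"
    using assms 3 by (intro V_top_s sdiff_sub)
  ultimately show ?thesis by linarith
qed

lemma M_approx_t:
  assumes "A' \<subseteq> {..r}" "A \<subseteq> {..r}" "B' \<subseteq> {..r}" "B \<subseteq> {..r}" "r \<in> B' \<or> r \<in> B"
  shows "\<bar>M A' A B' B - W (sdiff B' B) A' A\<bar> \<le> 2 * \<delta> r"
  using assms(5)
proof (cases rule: sdiff_cases)
  case 1
  from t_M[OF assms(1,2) minus_top[OF assms(3)] minus_top[OF assms(4)]]
  have "\<bar>M A' A B' B - W (sdiff B' B) A' A\<bar> \<le> \<delta> r" using 1 by (simp add: insert_absorb)
  then show ?thesis using nonneg[of r] by linarith
next
  case 2
  have "\<bar>M A' A B' B\<bar> \<le> \<delta> r"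
    using t_M[OF assms(1,2) minus_top[OF assms(3)] without_top[OF assms(4) 2(3)]] 2(2) by (simp add: insert_absorb)
  moreover have "\<bar>W (sdiff B' B) A' A\<bar> \<le> \<delta> r"
    using assms 2 by (intro W_top_t sdiff_sub)
  ultimately show ?thesis by linarith
next
  case 3
  have "\<bar>M A' A B' B\<bar> \<le> \<delta> r"
    using t_M[OF assms(1,2) without_top[OF assms(3) 3(2)] minus_top[OF assms(4)]] 3(3) by (simp add: insert_absorb)
  moreover have "\<bar>W (sdiff B' B) A' A\<bar> \<le> \<delta> r"
    using assms 3 by (intro W_top_t sdiff_sub)
  ultimately show ?thesis by linarith
qed

lemma subset_atMost_Max: "finite X \<Longrightarrow> Y \<subseteq> X \<Longrightarrow> Y \<subseteq> {..Max X}"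
  by auto

lemma g_Max:
  assumes "finite C" "finite D" "C \<union> D \<noteq> {}"
  shows "\<bar>g1 C D\<bar> \<le> \<delta> (Max (C \<union> D))" "\<bar>g2 C D\<bar> \<le> \<delta> (Max (C \<union> D))"
proof -
  let ?r = "Max (C \<union> D)"
  have mem: "?r \<in> C \<union> D" using assms by (intro Max_in) auto
  have sub: "C \<subseteq> {..?r}" "D \<subseteq> {..?r}" using assms by (intro subset_atMost_Max; simp)+
  show "\<bar>g1 C D\<bar> \<le> \<delta> ?r" "\<bar>g2 C D\<bar> \<le> \<delta> ?r"
  proof (atomize (full), cases "?r \<in> D")
    case True
    show "\<bar>g1 C D\<bar> \<le> \<delta> ?r \<and> \<bar>g2 C D\<bar> \<le> \<delta> ?r"
      using g_top_t[OF sub True] by (rule conjI)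
  next
    case False
    then have "?r \<in> C" using mem by simp
    from g_top_s[OF sub(1) without_top[OF sub(2) False] this]
    show "\<bar>g1 C D\<bar> \<le> \<delta> ?r \<and> \<bar>g2 C D\<bar> \<le> \<delta> ?r" by (rule conjI)
  qed
qed

lemma V_Max:
  assumes "finite C" "finite B'" "finite B" "C \<union> B' \<union> B \<noteq> {}"
  shows "\<bar>V C B' B - g2 C (sdiff B' B)\<bar> \<le> 2 * \<delta> (Max (C \<union> B' \<union> B))"
proof -
  let ?r = "Max (C \<union> B' \<union> B)"
  have "?r \<in> C \<union> B' \<union> B" using assms by (intro Max_in) auto
  then show ?thesis
    using assms by (intro V_approx subset_atMost_Max) auto
qed

lemma W_Max:
  assumes "finite A'" "finite A" "finite D" "A' \<union> A \<union> D \<noteq> {}"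
  shows "\<bar>W D A' A - g1 (sdiff A' A) D\<bar> \<le> 2 * \<delta> (Max (A' \<union> A \<union> D))"
proof -
  let ?r = "Max (A' \<union> A \<union> D)"
  have "?r \<in> A' \<union> A \<union> D" using assms by (intro Max_in) auto
  then show ?thesis
    using assms by (intro W_approx subset_atMost_Max) auto
qed

text \<open>If the last sign is a \<sigma>, the entry is near W and V - g2 is negligible; if it is a
  \<rho>, the entry is near V and W - g1 is negligible. The equality of g1 and g2 lets one formula
  cover both cases.\<close>

lemma M_Max:
  assumes fin: "finite A'" "finite A" "finite B'" "finite B" and ne: "A' \<union> A \<union> B' \<union> B \<noteq> {}"
    and eq: "g1 (sdiff A' A) (sdiff B' B) = g2 (sdiff A' A) (sdiff B' B)"
  defines "C \<equiv> sdiff A' A" and "D \<equiv> sdiff B' B"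
  shows "\<bar>M A' A B' B - (g2 C D + (V C B' B - g2 C D) + (W D A' A - g1 C D))\<bar>
    \<le> 4 * \<delta> (Max (A' \<union> A \<union> B' \<union> B))"
proof -
  let ?r = "Max (A' \<union> A \<union> B' \<union> B)"
  have r: "?r \<in> A' \<union> A \<union> B' \<union> B" using fin ne by (intro Max_in) auto
  have sub: "A' \<subseteq> {..?r}" "A \<subseteq> {..?r}" "B' \<subseteq> {..?r}" "B \<subseteq> {..?r}"
    using fin by (intro subset_atMost_Max; auto)+
  have CD: "C \<subseteq> {..?r}" "D \<subseteq> {..?r}" unfolding C_def D_def using sub by (intro sdiff_sub; simp)+
  show ?thesis
  proof (cases "?r \<in> B' \<or> ?r \<in> B")
    case True
    have "\<bar>M A' A B' B - W D A' A\<bar> \<le> 2 * \<delta> ?r"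
      unfolding D_def by (rule M_approx_t[OF sub True])
    moreover have "\<bar>V C B' B - g2 C D\<bar> \<le> 2 * \<delta> ?r"
      unfolding D_def using True by (intro V_approx CD sub) simp
    ultimately show ?thesis using eq unfolding C_def D_def by linarith
  next
    case False
    then have B: "B' \<subseteq> {..<?r}" "B \<subseteq> {..<?r}" and A: "?r \<in> A' \<or> ?r \<in> A"
      using r without_top[OF sub(3)] without_top[OF sub(4)] by auto
    have "\<bar>M A' A B' B - V C B' B\<bar> \<le> 2 * \<delta> ?r"
      unfolding C_def by (rule M_approx_s[OF sub(1,2) B A])
    moreover have "\<bar>W D A' A - g1 C D\<bar> \<le> 2 * \<delta> ?r"
      unfolding C_def using False A by (intro W_approx CD sub) (auto simp: D_def sdiff_def)
    ultimately show ?thesis using eq unfolding C_def D_def by linarith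
  qed
qed

text \<open>Without equality of the iterated limits, the variable chosen last decides which of them is seen.\<close>

lemma M_order:
  assumes fin: "finite A'" "finite A" "finite B'" "finite B" and ne: "A' \<union> A \<noteq> {}" "B' \<union> B \<noteq> {}"
    and \<delta>: "\<And>r. \<delta> r = d"
  shows "\<bar>M A' A B' B - (if Max (A' \<union> A) > Max (B' \<union> B) then g2 else g1) (sdiff A' A) (sdiff B' B)\<bar> \<le> 4 * d"
proof -
  let ?a = "Max (A' \<union> A)" and ?b = "Max (B' \<union> B)"
  have a: "?a \<in> A' \<or> ?a \<in> A" and b: "?b \<in> B' \<or> ?b \<in> B"
    using Max_in[of "A' \<union> A"] Max_in[of "B' \<union> B"] fin ne by auto
  have subA: "A' \<subseteq> {..?a}" "A \<subseteq> {..?a}" and subB: "B' \<subseteq> {..?b}" "B \<subseteq> {..?b}"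
    using fin by (intro subset_atMost_Max; simp)+
  show ?thesis
  proof (cases "?a > ?b")
    case True
    then have sub: "{..?b} \<subseteq> {..<?a}" by auto
    have B: "B' \<subseteq> {..<?a}" "B \<subseteq> {..<?a}"
      by (rule subset_trans[OF subB(1) sub], rule subset_trans[OF subB(2) sub])
    have 1: "\<bar>M A' A B' B - V (sdiff A' A) B' B\<bar> \<le> 2 * d"
      using M_approx_s[OF subA B a] \<delta> by simp
    have "\<bar>V (sdiff A' A) B' B - g2 (sdiff A' A) (sdiff B' B)\<bar>
        \<le> 2 * \<delta> (Max (sdiff A' A \<union> B' \<union> B))"
      using fin ne by (intro V_Max finite_sdiff) auto
    then show ?thesis using 1 True \<delta> by simp
  next
    case False
    then have sub: "{..?a} \<subseteq> {..?b}" by auto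
    have A: "A' \<subseteq> {..?b}" "A \<subseteq> {..?b}"
      by (rule subset_trans[OF subA(1) sub], rule subset_trans[OF subA(2) sub])
    have 1: "\<bar>M A' A B' B - W (sdiff B' B) A' A\<bar> \<le> 2 * d"
      using M_approx_t[OF A subB b] \<delta> by simp
    have "\<bar>W (sdiff B' B) A' A - g1 (sdiff A' A) (sdiff B' B)\<bar>
        \<le> 2 * \<delta> (Max (A' \<union> A \<union> sdiff B' B))"
      using fin ne by (intro W_Max finite_sdiff) auto
    then show ?thesis using 1 False \<delta> by simp
  qed
qed

end

text \<open>The error of X is charged to the largest index r of X; the items charged to r lie among
  those with all indices in \<open>{..r}\<close>, which \<open>c r\<close> counts.\<close>

lemma sum_Max_le:
  fixes \<delta> :: "nat \<Rightarrow> real" and U :: "'a \<Rightarrow> nat set"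
  assumes fin: "finite I" and U: "\<And>X. X \<in> I \<Longrightarrow> U X \<noteq> {} \<and> U X \<subseteq> {..<N}"
    and c: "\<And>r. real (card {X \<in> I. U X \<subseteq> {..r}}) \<le> c r" and \<delta>: "\<And>r. 0 \<le> \<delta> r"
  shows "(\<Sum>X\<in>I. \<delta> (Max (U X))) \<le> (\<Sum>r<N. c r * \<delta> r)"
proof -
  have "(\<Sum>X\<in>I. \<delta> (Max (U X))) \<le> (\<Sum>X\<in>I. \<Sum>r<N. if U X \<subseteq> {..r} then \<delta> r else 0)"
  proof (rule sum_mono)
    fix X assume "X \<in> I"
    then have ne: "U X \<noteq> {}" and sub: "U X \<subseteq> {..<N}" using U by auto
    have f: "finite (U X)" using sub by (rule finite_subset) simp
    have "Max (U X) < N" using Max_in[OF f ne] sub by auto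
    then have "(if U X \<subseteq> {..Max (U X)} then \<delta> (Max (U X)) else 0) \<le> (\<Sum>r<N. if U X \<subseteq> {..r} then \<delta> r else 0)"
      by (intro member_le_sum) (auto simp: \<delta>)
    moreover have "U X \<subseteq> {..Max (U X)}" using f by auto
    ultimately show "\<delta> (Max (U X)) \<le> (\<Sum>r<N. if U X \<subseteq> {..r} then \<delta> r else 0)" by simp
  qed
  also have "\<dots> = (\<Sum>r<N. \<Sum>X\<in>I. if U X \<subseteq> {..r} then \<delta> r else 0)"
    by (rule sum.swap)
  also have "\<dots> = (\<Sum>r<N. real (card {X \<in> I. U X \<subseteq> {..r}}) * \<delta> r)"
    using fin by (intro sum.cong refl) (simp add: sum.If_cases Int_def)
  also have "\<dots> \<le> (\<Sum>r<N. c r * \<delta> r)"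
    by (intro sum_mono mult_right_mono c \<delta>)
  finally show ?thesis .
qed

lemma card_Pow_tuples:
  fixes r :: nat
  shows "card (Pow {..r} \<times> Pow {..r}) = 4 ^ Suc r"
    and "card (Pow {..r} \<times> Pow {..r} \<times> Pow {..r}) = 8 ^ Suc r"
    and "card (Pow {..r} \<times> Pow {..r} \<times> Pow {..r} \<times> Pow {..r}) = 16 ^ Suc r"
  by (simp_all add: card_cartesian_product card_Pow flip: power_mult_distrib)

text \<open>There are 16^(r+1) quadruples of subsets of \<open>{..r}\<close>. Weights
  \<epsilon>/32^(r+1) beat this count by 2^(-(r+1)), and these numbers sum to at most one.\<close>

lemma sum_weights_le:
  assumes "\<epsilon> \<ge> 0" "\<And>r. c r \<le> 16 ^ Suc r"
  shows "(\<Sum>r<N. c r * (\<epsilon> / 32 ^ Suc r)) \<le> (\<epsilon>::real)"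
proof -
  have "(\<Sum>r<N. c r * (\<epsilon> / 32 ^ Suc r)) \<le> (\<Sum>r<N. \<epsilon> * (1/2) ^ Suc r)"
  proof (rule sum_mono)
    fix r
    have "c r * (\<epsilon> / 32 ^ Suc r) \<le> 16 ^ Suc r * (\<epsilon> / 32 ^ Suc r)"
      using assms by (intro mult_right_mono) auto
    also have "\<dots> = \<epsilon> * (16 / 32) ^ Suc r"
      by (simp only: power_divide) simp
    finally show "c r * (\<epsilon> / 32 ^ Suc r) \<le> \<epsilon> * (1/2) ^ Suc r" by simp
  qed
  also have "\<dots> = \<epsilon> * (\<Sum>r<N. (1/2) ^ Suc r)"
    by (simp add: sum_distrib_left)
  also have "(\<Sum>r<N. (1/2) ^ Suc r) = 1 - (1/2 :: real) ^ N"
    by (induction N) auto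
  also have "\<epsilon> * (1 - (1/2) ^ N) \<le> \<epsilon>"
    using assms(1) by (simp add: mult_left_le)
  finally show ?thesis .
qed


section \<open>Walsh functions\<close>

definition walsh :: "nat set \<Rightarrow> nat set \<Rightarrow> real" where
  "walsh A x = (\<Prod>i\<in>A. sg x i)"

lemma abs_walsh [simp]: "\<bar>walsh A x\<bar> = 1"
  by (simp add: walsh_def abs_prod)

lemma walsh_empty [simp]: "walsh {} x = 1"
  by (simp add: walsh_def)

lemma walsh_mult:
  assumes "finite A" "finite B"
  shows "walsh A x * walsh B x = walsh (sdiff A B) x"
proof -
  have A: "walsh A x = walsh (A - B) x * walsh (A \<inter> B) x"
    unfolding walsh_def by (subst prod.union_disjoint[symmetric]) (use assms in \<open>auto intro!: prod.cong\<close>)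
  have B: "walsh B x = walsh (B - A) x * walsh (A \<inter> B) x"
    unfolding walsh_def by (subst prod.union_disjoint[symmetric]) (use assms in \<open>auto intro!: prod.cong\<close>)
  have 1: "walsh (A \<inter> B) x * walsh (A \<inter> B) x = 1"
    unfolding walsh_def prod.distrib[symmetric] by simp
  have "walsh (sdiff A B) x = walsh (A - B) x * walsh (B - A) x"
    unfolding walsh_def sdiff_def using assms by (intro prod.union_disjoint) auto
  moreover have "walsh A x * walsh B x = walsh (A - B) x * walsh (B - A) x * (walsh (A \<inter> B) x * walsh (A \<inter> B) x)"
    unfolding A B by simp
  ultimately show ?thesis using 1 by simp
qed

lemma dep_walsh: "A \<subseteq> {..<N} \<Longrightarrow> dep N (walsh A)"
  unfolding walsh_def by (rule dep_prod) (rule dep_sg, auto)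

text \<open>The reproducing kernel of the Walsh system. The sum factors into the terms 1 +
  \<open>sg x i * sg z i\<close>, one of which vanishes as soon as x and z differ in a digit below
  N.\<close>

lemma sum_walsh:
  "(\<Sum>A\<in>Pow {..<N}. walsh A x * walsh A z) = (if x \<inter> {..<N} = z \<inter> {..<N} then 2 ^ N else 0)"
proof -
  have "(\<Sum>A\<in>Pow {..<N}. walsh A x * walsh A z) = (\<Sum>A\<in>Pow {..<N}. prod (\<lambda>i. sg x i * sg z i) A * prod (\<lambda>_. 1) ({..<N} - A))"
    by (simp add: walsh_def prod.distrib)
  also have "\<dots> = (\<Prod>i<N. sg x i * sg z i + 1)"
    by (rule prod_add[symmetric]) simp
  also have "\<dots> = (if x \<inter> {..<N} = z \<inter> {..<N} then 2 ^ N else 0)"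
  proof (cases "x \<inter> {..<N} = z \<inter> {..<N}")
    case True
    then have "(\<Prod>i<N. sg x i * sg z i + 1) = (\<Prod>i<N. 2)"
      by (intro prod.cong refl) (auto simp: sg_def set_eq_iff)
    then show ?thesis using True by simp
  next
    case False
    then obtain i where "i < N" "i \<in> x \<longleftrightarrow> i \<notin> z" by auto
    then have "i \<in> {..<N}" "sg x i * sg z i + 1 = 0" by (auto simp: sg_def)
    then have "(\<Prod>i<N. sg x i * sg z i + 1) = 0" by (intro prod_zero) auto
    then show ?thesis using False by simp
  qed
  finally show ?thesis .
qed

lemma walsh_expand:
  assumes "dep N f"
  shows "(\<Sum>A\<in>Pow {..<N}. avg {..<N} (\<lambda>x. f x * walsh A x) * walsh A z) = f z"
proof -
  have "(\<Sum>A\<in>Pow {..<N}. avg {..<N} (\<lambda>x. f x * walsh A x) * walsh A z)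
      = avg {..<N} (\<lambda>x. \<Sum>A\<in>Pow {..<N}. f x * walsh A x * walsh A z)"
    by (simp only: avg_sum avg_mult_const)
  also have "\<dots> = avg {..<N} (\<lambda>x. f x * (if x \<inter> {..<N} = z \<inter> {..<N} then 2 ^ N else 0))"
    by (simp only: mult.assoc sum_distrib_left[symmetric] sum_walsh)
  also have "\<dots> = avg {..<N} (\<lambda>x. if x = z \<inter> {..<N} then f x * 2 ^ N else 0)"
    by (intro avg_cong) (auto simp: Int_absorb2)
  also have "\<dots> = f (z \<inter> {..<N})"
  proof -
    have "(\<Sum>x\<in>Pow {..<N}. if x = z \<inter> {..<N} then f x * 2 ^ N else 0) = f (z \<inter> {..<N}) * 2 ^ N"
      by (subst sum.delta) auto
    then show ?thesis by (simp only: avg_def) simp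
  qed
  also have "\<dots> = f z" using assms by (simp add: dep_def)
  finally show ?thesis .
qed

lemma avg_walsh:
  assumes "A \<subseteq> {..<N}"
  shows "avg {..<N} (walsh A) = (if A = {} then 1 else 0)"
proof (cases "A = {}")
  case False
  have fin: "finite A" using assms by (rule finite_subset) simp
  let ?r = "Max A"
  have r: "?r \<in> A" using fin False by simp
  have "walsh A = (\<lambda>x. walsh (A - {?r}) x * sg x ?r)"
    unfolding walsh_def using fin r by (intro ext) (simp add: prod.remove mult.commute)
  moreover have "dep ?r (walsh (A - {?r}))"
    using fin by (intro dep_walsh) (auto simp: less_le)
  moreover have "?r < N" using r assms by auto
  ultimately show ?thesis using False by (simp add: avg_dep_mult_sg)
next
  case True
  then have "walsh A = (\<lambda>_. 1)" by (simp add: fun_eq_iff)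
  then show ?thesis using True by simp
qed


section \<open>Step functions of two variables\<close>

definition dep2 :: "nat \<Rightarrow> (nat set \<Rightarrow> nat set \<Rightarrow> real) \<Rightarrow> bool" where
  "dep2 N F \<longleftrightarrow> (\<forall>x y. F (x \<inter> {..<N}) (y \<inter> {..<N}) = F x y)"

definition step2 :: "(nat set \<Rightarrow> nat set \<Rightarrow> real) \<Rightarrow> bool" where
  "step2 F \<longleftrightarrow> (\<exists>N. dep2 N F)"

definition avg2 :: "nat \<Rightarrow> (nat set \<Rightarrow> nat set \<Rightarrow> real) \<Rightarrow> real" where
  "avg2 N F = avg {..<N} (\<lambda>x. avg {..<N} (\<lambda>y. F x y))"

lemma dep2D: "dep2 N F \<Longrightarrow> F (x \<inter> {..<N}) (y \<inter> {..<N}) = F x y"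
  by (simp add: dep2_def)

lemma dep2_mono:
  assumes "dep2 N F" "N \<le> M" shows "dep2 M F"
  unfolding dep2_def
proof (intro allI)
  fix x y
  have e: "u \<inter> {..<M} \<inter> {..<N} = u \<inter> {..<N}" for u using assms(2) by auto
  show "F (x \<inter> {..<M}) (y \<inter> {..<M}) = F x y"
    using dep2D[OF assms(1), of "x \<inter> {..<M}" "y \<inter> {..<M}"] dep2D[OF assms(1), of x y] unfolding e by simp
qed

lemma step2I: "dep2 N F \<Longrightarrow> step2 F"
  by (auto simp: step2_def)

lemma step2_common:
  assumes "step2 F" "step2 G" shows "\<exists>N. dep2 N F \<and> dep2 N G"
proof -
  obtain N M where "dep2 N F" "dep2 M G" using assms unfolding step2_def by blast
  then have "dep2 (max N M) F \<and> dep2 (max N M) G" by (auto intro: dep2_mono)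
  then show ?thesis by blast
qed

lemma dep2_compose2: "dep2 N F \<Longrightarrow> dep2 N G \<Longrightarrow> dep2 N (\<lambda>x y. h (F x y) (G x y))"
  by (simp add: dep2_def)

lemma dep2_add: "dep2 N F \<Longrightarrow> dep2 N G \<Longrightarrow> dep2 N (\<lambda>x y. F x y + G x y)"
  and dep2_diff: "dep2 N F \<Longrightarrow> dep2 N G \<Longrightarrow> dep2 N (\<lambda>x y. F x y - G x y)"
  and dep2_mult: "dep2 N F \<Longrightarrow> dep2 N G \<Longrightarrow> dep2 N (\<lambda>x y. F x y * G x y)"
  by (simp_all add: dep2_def)

lemma dep2_const [simp]: "dep2 N (\<lambda>_ _. c)"
  and dep2_cmult: "dep2 N F \<Longrightarrow> dep2 N (\<lambda>x y. c * F x y)"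
  by (simp_all add: dep2_def)

lemma dep2_tensor: "dep N f \<Longrightarrow> dep N g \<Longrightarrow> dep2 N (\<lambda>x y. f x * g y)"
  by (simp add: dep2_def dep_def)

lemma step2_compose2:
  assumes "step2 F" "step2 G" shows "step2 (\<lambda>x y. h (F x y) (G x y))"
proof -
  obtain N where "dep2 N F" "dep2 N G" using step2_common[OF assms] by blast
  from step2I[OF dep2_compose2[OF this]] show ?thesis .
qed

lemma step2_const [simp]: "step2 (\<lambda>_ _. c)"
  by (rule step2I[OF dep2_const])

lemma step2_add: "step2 F \<Longrightarrow> step2 G \<Longrightarrow> step2 (\<lambda>x y. F x y + G x y)"
  and step2_diff: "step2 F \<Longrightarrow> step2 G \<Longrightarrow> step2 (\<lambda>x y. F x y - G x y)"
  and step2_mult: "step2 F \<Longrightarrow> step2 G \<Longrightarrow> step2 (\<lambda>x y. F x y * G x y)"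
  by (rule step2_compose2; assumption)+

lemma step2_cmult: "step2 F \<Longrightarrow> step2 (\<lambda>x y. c * F x y)"
  by (rule step2_mult) simp_all

lemma step2_sum: "(\<And>i. i \<in> I \<Longrightarrow> step2 (F i)) \<Longrightarrow> step2 (\<lambda>x y. \<Sum>i\<in>I. F i x y)"
  by (induction I rule: infinite_finite_induct) (simp_all add: step2_add)

lemma step2_tensor:
  assumes "step_fun f" "step_fun g" shows "step2 (\<lambda>x y. f x * g y)"
proof -
  obtain N where "dep N f" "dep N g" using step_fun_common[OF assms] by blast
  from step2I[OF dep2_tensor[OF this]] show ?thesis .
qed

lemma dep2_section: "dep2 N F \<Longrightarrow> dep N (F x)"
  and dep2_section': "dep2 N F \<Longrightarrow> dep N (\<lambda>x. F x y)"
proof -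
  assume F: "dep2 N F"
  have e: "u \<inter> {..<N} \<inter> {..<N} = u \<inter> {..<N}" for u by auto
  show "dep N (F x)" unfolding dep_def
  proof
    fix y show "F x (y \<inter> {..<N}) = F x y"
      using dep2D[OF F, of x "y \<inter> {..<N}"] dep2D[OF F, of x y] unfolding e by simp
  qed
  show "dep N (\<lambda>x. F x y)" unfolding dep_def
  proof
    fix x show "F (x \<inter> {..<N}) y = F x y"
      using dep2D[OF F, of "x \<inter> {..<N}" y] dep2D[OF F, of x y] unfolding e by simp
  qed
qed

lemma avg2_add: "avg2 N (\<lambda>x y. F x y + G x y) = avg2 N F + avg2 N G"
  and avg2_diff: "avg2 N (\<lambda>x y. F x y - G x y) = avg2 N F - avg2 N G"
  and avg2_cmult: "avg2 N (\<lambda>x y. c * F x y) = c * avg2 N F"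
  and avg2_mult_const: "avg2 N (\<lambda>x y. F x y * c) = avg2 N F * c"
  and avg2_sum: "avg2 N (\<lambda>x y. \<Sum>i\<in>I. H i x y) = (\<Sum>i\<in>I. avg2 N (H i))"
  unfolding avg2_def by (simp_all only: avg_add avg_diff avg_cmult avg_mult_const avg_sum)

lemma avg2_swap: "avg2 N F = avg {..<N} (\<lambda>y. avg {..<N} (\<lambda>x. F x y))"
  unfolding avg2_def by (rule avg_swap)

lemma avg2_mono: "(\<And>x y. F x y \<le> G x y) \<Longrightarrow> avg2 N F \<le> avg2 N G"
  unfolding avg2_def by (intro avg_mono) simp

lemma abs_avg2_le: "\<bar>avg2 N F\<bar> \<le> avg2 N (\<lambda>x y. \<bar>F x y\<bar>)"
  unfolding avg2_def by (rule order_trans[OF abs_avg_le avg_mono[OF abs_avg_le]])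

lemma dep2_row: "dep2 N F \<Longrightarrow> F (x \<inter> {..<N}) = F x"
  using dep2_section' by (fastforce simp: dep_def)

lemma avg2_level:
  assumes "dep2 n F" "n \<le> N"
  shows "avg2 N F = avg2 n F"
proof -
  have "avg2 N F = avg {..<N} (\<lambda>x. avg {..<n} (F x))"
    unfolding avg2_def by (intro avg_cong avg_level dep2_section assms)
  also have "\<dots> = avg {..<n} (\<lambda>x. avg {..<n} (F x))"
  proof (rule avg_level)
    show "dep n (\<lambda>x. avg {..<n} (F x))" using dep2_row[OF assms(1)] by (simp add: dep_def)
  qed fact
  finally show ?thesis by (simp add: avg2_def)
qed

definition coef :: "nat \<Rightarrow> (nat set \<Rightarrow> nat set \<Rightarrow> real) \<Rightarrow> nat set \<Rightarrow> nat set \<Rightarrow> real" where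
  "coef N F A B = avg2 N (\<lambda>x y. F x y * (walsh A x * walsh B y))"

lemma walsh_expand2:
  assumes "dep2 N F"
  shows "F x y = (\<Sum>A\<in>Pow {..<N}. \<Sum>B\<in>Pow {..<N}. coef N F A B * (walsh A x * walsh B y))"
proof -
  have "F x y = (\<Sum>A\<in>Pow {..<N}. avg {..<N} (\<lambda>x. F x y * walsh A x) * walsh A x)"
    using walsh_expand[OF dep2_section'[OF assms]] by simp
  also have "\<dots> = (\<Sum>A\<in>Pow {..<N}. (\<Sum>B\<in>Pow {..<N}. coef N F A B * walsh B y) * walsh A x)"
  proof (intro sum.cong refl arg_cong2[where f="(*)"])
    fix A assume "A \<in> Pow {..<N}"
    have d: "dep N (\<lambda>y. avg {..<N} (\<lambda>x. F x y * walsh A x))"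
      using dep2_section[OF assms] by (simp add: dep_def)
    have "avg {..<N} (\<lambda>x. F x y * walsh A x)
        = (\<Sum>B\<in>Pow {..<N}. avg {..<N} (\<lambda>y. avg {..<N} (\<lambda>x. F x y * walsh A x) * walsh B y) * walsh B y)"
      using walsh_expand[OF d] by simp
    also have "\<dots> = (\<Sum>B\<in>Pow {..<N}. coef N F A B * walsh B y)"
      unfolding coef_def avg2_swap by (simp only: avg_mult_const[symmetric] mult.assoc)
    finally show "avg {..<N} (\<lambda>x. F x y * walsh A x) = (\<Sum>B\<in>Pow {..<N}. coef N F A B * walsh B y)" .
  qed
  also have "\<dots> = (\<Sum>A\<in>Pow {..<N}. \<Sum>B\<in>Pow {..<N}. coef N F A B * (walsh A x * walsh B y))"
    by (simp add: sum_distrib_right sum_distrib_left mult_ac)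
  finally show ?thesis .
qed

text \<open>Multiplication by Walsh functions shifts coefficients by symmetric differences. A sum
  over all index pairs with prescribed differences C and D is therefore a single pairing, open to a
  norm estimate.\<close>

lemma parseval_mult:
  assumes F: "dep2 N F" and CD: "C \<subseteq> {..<N}" "D \<subseteq> {..<N}"
  shows "avg2 N (\<lambda>x y. G x y * (walsh C x * walsh D y * F x y))
    = (\<Sum>A\<in>Pow {..<N}. \<Sum>B\<in>Pow {..<N}. coef N G (sdiff A C) (sdiff B D) * coef N F A B)"
proof -
  have "avg2 N (\<lambda>x y. G x y * (walsh C x * walsh D y * F x y))
      = avg2 N (\<lambda>x y. \<Sum>A\<in>Pow {..<N}. \<Sum>B\<in>Pow {..<N}.
          G x y * (walsh (sdiff A C) x * walsh (sdiff B D) y) * coef N F A B)"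
  proof -
    have "G x y * (walsh C x * walsh D y * F x y) = (\<Sum>A\<in>Pow {..<N}. \<Sum>B\<in>Pow {..<N}.
          G x y * (walsh (sdiff A C) x * walsh (sdiff B D) y) * coef N F A B)" for x y
    proof -
      have "G x y * (walsh C x * walsh D y * F x y) = (\<Sum>A\<in>Pow {..<N}. \<Sum>B\<in>Pow {..<N}.
          G x y * (walsh C x * walsh D y * (coef N F A B * (walsh A x * walsh B y))))"
        by (subst walsh_expand2[OF F]) (simp only: sum_distrib_left)
      also have "\<dots> = (\<Sum>A\<in>Pow {..<N}. \<Sum>B\<in>Pow {..<N}.
          G x y * (walsh (sdiff A C) x * walsh (sdiff B D) y) * coef N F A B)"
      proof (intro sum.cong refl)
        fix A B assume "A \<in> Pow {..<N}" "B \<in> Pow {..<N}"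
        then have "finite A" "finite B" "finite C" "finite D" using CD by (auto intro: finite_subset)
        then have "walsh (sdiff A C) x = walsh A x * walsh C x" "walsh (sdiff B D) y = walsh B y * walsh D y"
          using walsh_mult by simp_all
        then show "G x y * (walsh C x * walsh D y * (coef N F A B * (walsh A x * walsh B y)))
          = G x y * (walsh (sdiff A C) x * walsh (sdiff B D) y) * coef N F A B"
          by (simp only: mult_ac)
      qed
      finally show ?thesis .
    qed
    then show ?thesis by simp
  qed
  then show ?thesis
    by (simp only: avg2_sum avg2_mult_const coef_def)
qed


section \<open>Compression along a system of signs\<close>

text \<open>The point whose digits are the new signs at x. Composing a Walsh function with this map
  gives the corresponding product of signs.\<close>

definition sign_map :: "(nat \<Rightarrow> nat set \<Rightarrow> real) \<Rightarrow> nat set \<Rightarrow> nat set" where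
  "sign_map \<rho> x = {r. \<rho> r x = -1}"

lemma sign_system_abs: "sign_system \<rho> \<Longrightarrow> \<rho> r x = 1 \<or> \<rho> r x = -1"
  unfolding sign_system_def using signed_rad_cases by metis

lemma sg_sign_map: "sign_system \<rho> \<Longrightarrow> sg (sign_map \<rho> x) r = \<rho> r x"
  using sign_system_abs[of \<rho> r x] by (auto simp: sg_def sign_map_def)

lemma sign_prod_walsh: "sign_system \<rho> \<Longrightarrow> sign_prod \<rho> A x = walsh A (sign_map \<rho> x)"
  by (simp add: sign_prod_def walsh_def sg_sign_map)

lemma unit_bounded_sign_prod': "sign_system \<rho> \<Longrightarrow> unit_bounded (sign_prod \<rho> A)"
  unfolding sign_system_def by (rule unit_bounded_sign_prod) blast

lemma sign_prod_mult: "sign_system \<rho> \<Longrightarrow> finite A \<Longrightarrow> finite B \<Longrightarrow>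
    sign_prod \<rho> A x * sign_prod \<rho> B x = sign_prod \<rho> (sdiff A B) x"
  by (simp add: sign_prod_walsh walsh_mult)

lemma sign_prod_empty [simp]: "sign_prod \<rho> {} = (\<lambda>_. 1)"
  by (simp add: sign_prod_def fun_eq_iff)

lemma sign_prod_insert: "finite A \<Longrightarrow> r \<notin> A \<Longrightarrow> sign_prod \<rho> (insert r A) x = \<rho> r x * sign_prod \<rho> A x"
  by (simp add: sign_prod_def)

lemma sign_system_levels:
  assumes "sign_system \<rho>"
  obtains n Z where "strict_mono n" "\<And>r. \<rho> r = signed_rad (n r) (Z r)" "\<And>r. r \<le> n r"
    "\<And>N A. A \<subseteq> {..<N} \<Longrightarrow> dep (n N) (sign_prod \<rho> A)"
    "\<And>N (f :: nat set \<Rightarrow> real). dep N f \<Longrightarrow> dep (n N) (\<lambda>x. f (sign_map \<rho> x))"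
proof -
  obtain n Z where n: "strict_mono n" and \<rho>: "\<And>r. \<rho> r = signed_rad (n r) (Z r)"
    using assms unfolding sign_system_def by blast
  have d\<rho>: "dep (n N) (\<rho> r)" if "r < N" for r N
  proof -
    have "Suc (n r) \<le> n N" using strict_monoD[OF n that] by simp
    from dep_mono[OF dep_signed_rad this] show ?thesis unfolding \<rho> .
  qed
  have 1: "dep (n N) (sign_prod \<rho> A)" if "A \<subseteq> {..<N}" for A N
    unfolding sign_prod_def using that by (intro dep_prod d\<rho>) auto
  have 2: "dep (n N) (\<lambda>x. f (sign_map \<rho> x))" if f: "dep N f" for f :: "nat set \<Rightarrow> real" and N
    unfolding dep_def
  proof
    fix x
    have "sign_map \<rho> (x \<inter> {..<n N}) \<inter> {..<N} = sign_map \<rho> x \<inter> {..<N}"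
      using d\<rho> by (auto simp: sign_map_def dep_def)
    from depD[OF f this] show "f (sign_map \<rho> (x \<inter> {..<n N})) = f (sign_map \<rho> x)" .
  qed
  show ?thesis
    by (rule that[OF n \<rho> strict_mono_imp_increasing[OF n] 1 2])
qed

text \<open>The sign of largest index changes with the digit at its level, on which neither f nor
  the other factors depend.\<close>

lemma avg_sign_prod:
  assumes \<rho>: "\<And>r. \<rho> r = signed_rad (n r) (Z r)" and n: "strict_mono n"
    and A: "finite A" "A \<noteq> {}" and f: "dep m f" "m \<le> n (Max A)" and N: "n (Max A) < N"
  shows "avg {..<N} (\<lambda>x. f x * sign_prod \<rho> A x) = 0"
proof -
  let ?r = "Max A"
  have r: "?r \<in> A" using A by simp
  have d: "dep (n ?r) (\<lambda>x. f x * (sign_prod \<rho> (A - {?r}) x * sg (Z ?r) (x \<inter> {..<n ?r})))"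
  proof (intro dep_mult)
    show "dep (n ?r) f" by (rule dep_mono[OF f])
    show "dep (n ?r) (sign_prod \<rho> (A - {?r}))"
      unfolding sign_prod_def
    proof (rule dep_prod)
      fix i assume "i \<in> A - {?r}"
      then have "i < ?r" using A by (auto simp: less_le)
      then have "Suc (n i) \<le> n ?r" using strict_monoD[OF n] by (simp add: Suc_leI)
      from dep_mono[OF dep_signed_rad this] show "dep (n ?r) (\<rho> i)" unfolding \<rho> .
    qed
    show "dep (n ?r) (\<lambda>x. sg (Z ?r) (x \<inter> {..<n ?r}))"
      by (rule dep_compose[OF dep_Int]) simp
  qed
  have "sign_prod \<rho> A x = sign_prod \<rho> (A - {?r}) x * sg (Z ?r) (x \<inter> {..<n ?r}) * sg x (n ?r)" for x
  proof -
    have "sign_prod \<rho> A x = \<rho> ?r x * sign_prod \<rho> (A - {?r}) x"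
      unfolding sign_prod_def by (rule prod.remove[OF A(1) r])
    then show ?thesis by (simp add: \<rho> signed_rad_def mult_ac)
  qed
  then have "(\<lambda>x. f x * sign_prod \<rho> A x) = (\<lambda>x. f x * (sign_prod \<rho> (A - {?r}) x * sg (Z ?r) (x \<inter> {..<n ?r})) * sg x (n ?r))"
    by (simp add: mult_ac)
  then show ?thesis using avg_dep_mult_sg[OF d N] by simp
qed

text \<open>The map preserves the uniform measure: in the Walsh expansion of f, only the constant
  term survives averaging, before the composition and after it.\<close>

lemma avg_sign_map:
  assumes \<rho>: "\<And>r. \<rho> r = signed_rad (n r) (Z r)" and n: "strict_mono n" and sys: "sign_system \<rho>"
    and f: "dep N f" and M: "n N \<le> M"
  shows "avg {..<M} (\<lambda>x. f (sign_map \<rho> x)) = avg {..<N} f"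
proof -
  let ?c = "\<lambda>A. avg {..<N} (\<lambda>x. f x * walsh A x)"
  have z: "avg {..<M} (sign_prod \<rho> A) = (if A = {} then 1 else 0)" if "A \<subseteq> {..<N}" for A
  proof (cases "A = {}")
    case False
    have fin: "finite A" using that by (rule finite_subset) simp
    have "Max A < N" using Max_in[OF fin False] that by auto
    then have "n (Max A) < M" using strict_monoD[OF n] M by (meson less_le_trans)
    then show ?thesis
      using avg_sign_prod[OF \<rho> n fin False dep_const[of 0 1]] False by simp
  qed simp
  have "avg {..<M} (\<lambda>x. f (sign_map \<rho> x)) = avg {..<M} (\<lambda>x. \<Sum>A\<in>Pow {..<N}. ?c A * sign_prod \<rho> A x)"
  proof (rule avg_cong)
    fix x
    show "f (sign_map \<rho> x) = (\<Sum>A\<in>Pow {..<N}. ?c A * sign_prod \<rho> A x)"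
      using walsh_expand[OF f, of "sign_map \<rho> x"] unfolding sign_prod_walsh[OF sys] by (rule sym)
  qed
  also have "\<dots> = (\<Sum>A\<in>Pow {..<N}. ?c A * (if A = {} then 1 else 0))"
    unfolding avg_sum avg_cmult by (intro sum.cong refl) (simp only: z Pow_iff)
  also have "\<dots> = (\<Sum>A\<in>Pow {..<N}. if A = {} then ?c {} else 0)"
    by (intro sum.cong) auto
  also have "\<dots> = ?c {}" by (subst sum.delta) auto
  finally show ?thesis by simp
qed


section \<open>Mixed norms and bounded forms\<close>

definition mixed_norm :: "real \<Rightarrow> nat \<Rightarrow> (nat set \<Rightarrow> nat set \<Rightarrow> real) \<Rightarrow> real" where
  "mixed_norm p N F = avg {..<N} (\<lambda>x. avg {..<N} (\<lambda>y. \<bar>F x y\<bar>) powr p) powr (1 / p)"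

lemma mixed_norm_nonneg [simp]: "0 \<le> mixed_norm p N F"
  by (simp add: mixed_norm_def)

lemma mixed_norm_le:
  assumes "p > 0" "\<And>x. avg {..<N} (\<lambda>y. \<bar>F x y\<bar>) \<le> h x"
  shows "mixed_norm p N F \<le> avg {..<N} (\<lambda>x. h x powr p) powr (1 / p)"
  unfolding mixed_norm_def
proof (rule powr_mono2)
  show "0 \<le> avg {..<N} (\<lambda>x. avg {..<N} (\<lambda>y. \<bar>F x y\<bar>) powr p)"
    by (intro avg_nonneg) simp
  show "avg {..<N} (\<lambda>x. avg {..<N} (\<lambda>y. \<bar>F x y\<bar>) powr p) \<le> avg {..<N} (\<lambda>x. h x powr p)"
    using assms by (intro avg_mono powr_mono2 avg_nonneg) auto
qed (use assms(1) in simp)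

lemma mixed_norm_le_const:
  assumes "p > 0" "\<And>x. avg {..<N} (\<lambda>y. \<bar>F x y\<bar>) \<le> c" "0 \<le> c"
  shows "mixed_norm p N F \<le> c"
  using mixed_norm_le[OF assms(1,2)] assms(1,3) by (simp add: powr_powr)

lemma avg_loc_le:
  assumes "loc m b g" "m \<le> N"
  shows "avg {..<N} (\<lambda>y. \<bar>g y\<bar>) \<le> 1 / 2 ^ m"
proof -
  have le: "avg {..<N} (\<lambda>y. \<bar>g y\<bar>) \<le> avg {..<N} (\<lambda>y. if y \<inter> {..<m} = b then 1 else 0)"
    by (intro avg_mono loc_bound[OF assms(1)])
  show ?thesis
  proof (cases "b \<subseteq> {..<m}")
    case True
    then show ?thesis using le avg_cell[OF True assms(2)] by simp
  next
    case False
    then have "y \<inter> {..<m} \<noteq> b" for y by auto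
    then show ?thesis using le by (simp add: order_trans[of _ 0])
  qed
qed

lemma mixed_norm_loc:
  assumes p: "p > 0" and f: "loc n a f" and g: "loc m b g" and N: "n \<le> N" "m \<le> N"
  shows "mixed_norm p N (\<lambda>x y. f x * g y) \<le> 2 powr (- real n / p) * 2 powr (- real m)"
proof -
  let ?i = "\<lambda>x. if x \<inter> {..<n} = a then 1 else 0 :: real"
  have i: "avg {..<N} ?i \<le> 1 / 2 ^ n"
  proof (cases "a \<subseteq> {..<n}")
    case False
    then have "?i = (\<lambda>_. 0)" by auto
    then show ?thesis by simp
  qed (simp add: avg_cell N)
  have "mixed_norm p N (\<lambda>x y. f x * g y) \<le> avg {..<N} (\<lambda>x. (?i x * (1 / 2 ^ m)) powr p) powr (1 / p)"
  proof (rule mixed_norm_le[OF p])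
    fix x
    have "avg {..<N} (\<lambda>y. \<bar>f x * g y\<bar>) = \<bar>f x\<bar> * avg {..<N} (\<lambda>y. \<bar>g y\<bar>)"
      by (simp only: abs_mult avg_cmult)
    also have "\<dots> \<le> ?i x * (1 / 2 ^ m)"
      by (intro mult_mono loc_bound[OF f] avg_loc_le[OF g N(2)] avg_nonneg) auto
    finally show "avg {..<N} (\<lambda>y. \<bar>f x * g y\<bar>) \<le> ?i x * (1 / 2 ^ m)" .
  qed
  also have "(\<lambda>x. (?i x * (1 / 2 ^ m)) powr p) = (\<lambda>x. (2 powr (- real m)) powr p * ?i x)"
    using p by (auto simp: powr_minus powr_realpow divide_inverse)
  also have "avg {..<N} \<dots> powr (1 / p) \<le> ((2 powr (- real m)) powr p * (1 / 2 ^ n)) powr (1 / p)"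
  proof (rule powr_mono2)
    show "0 \<le> avg {..<N} (\<lambda>x. (2 powr (- real m)) powr p * ?i x)" by (intro avg_nonneg) simp
    show "avg {..<N} (\<lambda>x. (2 powr (- real m)) powr p * ?i x) \<le> (2 powr (- real m)) powr p * (1 / 2 ^ n)"
      unfolding avg_cmult by (intro mult_left_mono i) simp
  qed (use p in simp)
  also have "\<dots> = 2 powr (- real n / p) * 2 powr (- real m)"
    using p by (simp add: powr_mult powr_powr powr_divide powr_realpow[symmetric] powr_minus_divide)
  finally show ?thesis .
qed

section \<open>Sums of random signs and decoupling\<close>

lemma avg_sg_mult:
  assumes "finite X" "a \<in> X" "b \<in> X"
  shows "avg X (\<lambda>Z. sg Z a * sg Z b) = (if a = b then 1 else 0)"
proof (cases "a = b")
  case False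
  define Y where "Y = X - {a}"
  have Y: "X = insert a Y" "a \<notin> Y" "finite Y" using assms by (auto simp: Y_def)
  have "avg X (\<lambda>Z. sg Z a * sg Z b)
      = (avg Y (\<lambda>Z. sg Z a * sg Z b) + avg Y (\<lambda>Z. sg (insert a Z) a * sg (insert a Z) b)) / 2"
    unfolding Y(1) by (rule avg_insert[OF Y(3,2)])
  also have "avg Y (\<lambda>Z. sg Z a * sg Z b) = avg Y (\<lambda>Z. 1 * sg Z b)"
    using Y(2) by (intro avg_cong) (auto simp: sg_def)
  also have "avg Y (\<lambda>Z. sg (insert a Z) a * sg (insert a Z) b) = avg Y (\<lambda>Z. (-1) * sg Z b)"
    using False by (intro avg_cong) (auto simp: sg_def)
  finally show ?thesis using False by (simp only: avg_cmult) simp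
qed (use assms in simp)

lemma avg_mult_signed_rad:
  assumes "dep n f" "n < N"
  shows "avg {..<N} (\<lambda>x. f x * signed_rad n Z x) = 0"
proof -
  have "dep n (\<lambda>x. f x * sg Z (x \<inter> {..<n}))"
    by (intro dep_mult assms(1) dep_compose[OF dep_Int]) simp
  from avg_dep_mult_sg[OF this assms(2)] show ?thesis
    by (simp add: signed_rad_def mult.assoc)
qed

lemma avg_signed_rad_mult:
  assumes "m \<noteq> n" "m < N" "n < N"
  shows "avg {..<N} (\<lambda>x. signed_rad m Y x * signed_rad n Z x) = 0"
proof (cases "m < n")
  case True
  then show ?thesis
    using dep_mono[OF dep_signed_rad, of m n Y] assms by (intro avg_mult_signed_rad) auto
next
  case False
  then have "n < m" using assms by simp
  then have "avg {..<N} (\<lambda>x. signed_rad n Z x * signed_rad m Y x) = 0"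
    using dep_mono[OF dep_signed_rad, of n m Z] assms by (intro avg_mult_signed_rad) auto
  then show ?thesis by (simp add: mult.commute)
qed

text \<open>All that matters is that the right-hand side is \<open>o(M\<^sup>p)\<close>.\<close>

lemma avg_powr_sum_signs:
  assumes p: "p \<ge> 0" and m: "\<And>k l. k < l \<Longrightarrow> l < M \<Longrightarrow> m k \<noteq> (m l :: nat)" and N: "\<And>k. k < M \<Longrightarrow> m k < N" and M: "M > 0"
  shows "avg {..<N} (\<lambda>x. \<bar>\<Sum>k<M. signed_rad (m k) (Z k) x\<bar> powr p)
    \<le> real M powr (3 / 4 * p) + real M powr (p - 1 / 2)"
proof -
  let ?R = "\<lambda>x. \<Sum>k<M. signed_rad (m k) (Z k) x"
  \<comment> \<open>Split at height M^(3/4). Above it R^2 exceeds M^(3/2), so the trivial bound M^p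
    is at most M^(p-3/2) R^2, and the mean of R^2 is M by orthogonality. This replaces a moment
    inequality of order p.\<close>
  have pt: "\<bar>?R x\<bar> powr p \<le> real M powr (3 / 4 * p) + real M powr (p - 3 / 2) * (?R x)\<^sup>2" for x
  proof (cases "\<bar>?R x\<bar> \<le> real M powr (3 / 4)")
    case True
    then have "\<bar>?R x\<bar> powr p \<le> (real M powr (3 / 4)) powr p"
      using p by (intro powr_mono2) auto
    also have "\<dots> = real M powr (3 / 4 * p)" by (simp add: powr_powr)
    finally show ?thesis by (simp add: add_increasing2)
  next
    case False
    have "\<bar>?R x\<bar> \<le> (\<Sum>k<M. \<bar>signed_rad (m k) (Z k) x\<bar>)" by (rule sum_abs)
    then have "\<bar>?R x\<bar> powr p \<le> real M powr p" using p by (intro powr_mono2) auto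
    also have "\<dots> = real M powr (p - 3 / 2) * (real M powr (3 / 4))\<^sup>2"
      using M by (simp add: power2_eq_square powr_add[symmetric])
    also have "\<dots> \<le> real M powr (p - 3 / 2) * (\<bar>?R x\<bar>)\<^sup>2"
      using False by (intro mult_left_mono power_mono) auto
    finally show ?thesis by (simp add: add_increasing)
  qed
  have sq: "avg {..<N} (\<lambda>x. (?R x)\<^sup>2) = real M"
  proof -
    have "avg {..<N} (\<lambda>x. (?R x)\<^sup>2)
        = (\<Sum>k<M. \<Sum>l<M. avg {..<N} (\<lambda>x. signed_rad (m k) (Z k) x * signed_rad (m l) (Z l) x))"
      by (simp only: power2_eq_square sum_product avg_sum)
    also have "\<dots> = (\<Sum>k<M. \<Sum>l<M. if k = l then 1 else 0)"
    proof (intro sum.cong refl)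
      fix k l assume kl: "k \<in> {..<M}" "l \<in> {..<M}"
      show "avg {..<N} (\<lambda>x. signed_rad (m k) (Z k) x * signed_rad (m l) (Z l) x) = (if k = l then 1 else 0)"
      proof (cases "k = l")
        case True
        have "signed_rad (m k) (Z k) x * signed_rad (m k) (Z k) x = 1" for x
          using signed_rad_cases[of "m k" "Z k" x] by auto
        then show ?thesis using True by simp
      next
        case False
        then have "m k \<noteq> m l" using m[of k l] m[of l k] kl by (cases "k < l") auto
        then show ?thesis using False kl N by (simp add: avg_signed_rad_mult)
      qed
    qed
    finally show ?thesis by simp
  qed
  have "avg {..<N} (\<lambda>x. \<bar>?R x\<bar> powr p) \<le> avg {..<N} (\<lambda>x. real M powr (3 / 4 * p) + real M powr (p - 3 / 2) * (?R x)\<^sup>2)"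
    by (intro avg_mono pt)
  also have "\<dots> = real M powr (3 / 4 * p) + real M powr (p - 3 / 2) * real M"
    by (simp only: avg_add avg_cmult sq) simp
  also have "real M powr (p - 3 / 2) * real M = real M powr (p - 1 / 2)"
  proof -
    have "real M powr (p - 3 / 2) * real M = real M powr (p - 3 / 2) * real M powr 1"
      using M by simp
    also have "\<dots> = real M powr (p - 1 / 2)" by (simp only: powr_add[symmetric]) simp
    finally show ?thesis .
  qed
  finally show ?thesis .
qed

text \<open>The parameters are fixed one after another. Given the earlier ones, the new off-diagonal
  terms have mean zero in the new parameter, so some value of it gains at least the mean of the new
  diagonal term.\<close>

lemma decoupled_choice:
  fixes M :: nat and \<tau> :: "nat \<Rightarrow> nat \<Rightarrow> 'a set \<Rightarrow> 'a set \<Rightarrow> real"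
  assumes fin: "\<And>k. finite (X k)"
    and z1: "\<And>k l z. k \<noteq> l \<Longrightarrow> avg (X k) (\<lambda>Z. \<tau> k l Z z) = 0"
    and z2: "\<And>k l z. k \<noteq> l \<Longrightarrow> avg (X l) (\<lambda>Z. \<tau> k l z Z) = 0"
  shows "\<exists>Z. (\<Sum>k<M. avg (X k) (\<lambda>z. \<tau> k k z z)) \<le> (\<Sum>k<M. \<Sum>l<M. \<tau> k l (Z k) (Z l))"
proof (induction M)
  case (Suc M)
  then obtain Z where Z: "(\<Sum>k<M. avg (X k) (\<lambda>z. \<tau> k k z z)) \<le> (\<Sum>k<M. \<Sum>l<M. \<tau> k l (Z k) (Z l))" by blast
  let ?h = "\<lambda>z. \<tau> M M z z + ((\<Sum>k<M. \<tau> k M (Z k) z) + (\<Sum>k<M. \<tau> M k z (Z k)))"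
  obtain z where z: "avg (X M) ?h \<le> ?h z" using avg_attained[OF fin, of M ?h] by blast
  have h: "avg (X M) ?h = avg (X M) (\<lambda>z. \<tau> M M z z)"
    unfolding avg_add avg_sum by (simp add: z1 z2)
  let ?Z = "Z(M := z)"
  have "(\<Sum>k<Suc M. \<Sum>l<Suc M. \<tau> k l (?Z k) (?Z l)) = (\<Sum>k<M. \<Sum>l<M. \<tau> k l (Z k) (Z l)) + ?h z"
    by (simp add: sum.distrib)
  then show ?case using Z z h by (intro exI[of _ ?Z]) simp
qed simp

text \<open>\<open>\<Phi> G F\<close> stands for the pairing of G with S F. The assumption
  \<open>bound\<close> is Hoelder's inequality for G living on a cell of s. The assumption
  \<open>small\<close> depends on F: it says that S F, as an element of L_p(L_1), has little mass on
  thin strips in t.\<close>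

locale bounded_form =
  fixes p C :: real and \<Phi> :: "(nat set \<Rightarrow> nat set \<Rightarrow> real) \<Rightarrow> (nat set \<Rightarrow> nat set \<Rightarrow> real) \<Rightarrow> real"
  assumes p: "1 < p"
    and add1: "step2 G \<Longrightarrow> step2 G' \<Longrightarrow> step2 F \<Longrightarrow> \<Phi> (\<lambda>x y. G x y + G' x y) F = \<Phi> G F + \<Phi> G' F"
    and cmult1: "step2 G \<Longrightarrow> step2 F \<Longrightarrow> \<Phi> (\<lambda>x y. c * G x y) F = c * \<Phi> G F"
    and add2: "step2 G \<Longrightarrow> step2 F \<Longrightarrow> step2 F' \<Longrightarrow> \<Phi> G (\<lambda>x y. F x y + F' x y) = \<Phi> G F + \<Phi> G F'"
    and cmult2: "step2 G \<Longrightarrow> step2 F \<Longrightarrow> \<Phi> G (\<lambda>x y. c * F x y) = c * \<Phi> G F"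
    and bound: "step2 G \<Longrightarrow> (\<And>x y. \<bar>G x y\<bar> \<le> (if x \<inter> {..<n} = a then 1 else 0)) \<Longrightarrow> dep2 N F \<Longrightarrow>
      \<bar>\<Phi> G F\<bar> \<le> C * 2 powr (- (1 - 1 / p) * real n) * mixed_norm p N F"
    and small: "step2 F \<Longrightarrow> \<epsilon> > 0 \<Longrightarrow> \<forall>\<^sub>F n in sequentially. \<forall>b G. step2 G \<longrightarrow>
      (\<forall>x y. \<bar>G x y\<bar> \<le> (if y \<inter> {..<n} = b then 1 else 0)) \<longrightarrow> \<bar>\<Phi> G F\<bar> \<le> \<epsilon>"
begin

lemma sum1:
  assumes "finite I" "\<And>i. i \<in> I \<Longrightarrow> step2 (H i)" "step2 F"
  shows "\<Phi> (\<lambda>x y. \<Sum>i\<in>I. c i * H i x y) F = (\<Sum>i\<in>I. c i * \<Phi> (H i) F)"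
  using assms(1,2)
proof (induction I rule: finite_induct)
  case empty
  then show ?case using cmult1[of "\<lambda>_ _. 0" F 0] assms(3) by simp
next
  case (insert i I)
  have "step2 (\<lambda>x y. \<Sum>i\<in>I. c i * H i x y)"
    using insert by (intro step2_sum step2_cmult) auto
  then have "\<Phi> (\<lambda>x y. c i * H i x y + (\<Sum>i\<in>I. c i * H i x y)) F = c i * \<Phi> (H i) F + \<Phi> (\<lambda>x y. \<Sum>i\<in>I. c i * H i x y) F"
    using insert.prems assms(3) by (simp add: add1 cmult1 step2_cmult)
  then show ?case using insert by simp
qed

lemma sum2:
  assumes "finite I" "\<And>i. i \<in> I \<Longrightarrow> step2 (H i)" "step2 G"
  shows "\<Phi> G (\<lambda>x y. \<Sum>i\<in>I. c i * H i x y) = (\<Sum>i\<in>I. c i * \<Phi> G (H i))"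
  using assms(1,2)
proof (induction I rule: finite_induct)
  case empty
  then show ?case using cmult2[of G "\<lambda>_ _. 0" 0] assms(3) by simp
next
  case (insert i I)
  have "step2 (\<lambda>x y. \<Sum>i\<in>I. c i * H i x y)"
    using insert by (intro step2_sum step2_cmult) auto
  then have "\<Phi> G (\<lambda>x y. c i * H i x y + (\<Sum>i\<in>I. c i * H i x y)) = c i * \<Phi> G (H i) + \<Phi> G (\<lambda>x y. \<Sum>i\<in>I. c i * H i x y)"
    using insert.prems assms(3) by (simp add: add2 cmult2 step2_cmult)
  then show ?case using insert by simp
qed

definition \<phi> :: form4 where
  "\<phi> f' f g' g = \<Phi> (\<lambda>x y. f' x * g' y) (\<lambda>x y. f x * g y)"

lemma C_nonneg: "0 \<le> C"
proof -
  have "mixed_norm p 0 (\<lambda>_ _. 1) = 1" by (simp add: mixed_norm_def)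
  then show ?thesis
    using bound[of "\<lambda>_ _. 0" 0 "{}" 0 "\<lambda>_ _. 1"] abs_ge_zero order_trans by fastforce
qed

text \<open>The exponents are those of indicators of rectangles in L_p(L_1) and in its dual. The
  functional slot of t contributes no decay, hence the second parameter 0.\<close>

lemma quad: "quad_form (1 - 1 / p) 0 C \<phi>"
  unfolding quad_form_def
proof (intro conjI allI impI)
  fix n' a' f' n a f m' b' g' m b g
  assume l: "loc n' a' f'" "loc n a f" "loc m' b' g'" "loc m b g"
  note st = loc_step[OF l(1)] loc_step[OF l(2)] loc_step[OF l(3)] loc_step[OF l(4)]
  obtain N0 where N0: "dep2 N0 (\<lambda>x y. f x * g y)" using step2_tensor[OF st(2,4)] by (auto simp: step2_def)
  define N where "N = N0 + n + m"
  have "\<bar>\<Phi> (\<lambda>x y. f' x * g' y) (\<lambda>x y. f x * g y)\<bar>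
      \<le> C * 2 powr (- (1 - 1 / p) * real n') * mixed_norm p N (\<lambda>x y. f x * g y)"
  proof (rule bound)
    show "step2 (\<lambda>x y. f' x * g' y)" by (intro step2_tensor st)
    show "dep2 N (\<lambda>x y. f x * g y)" by (rule dep2_mono[OF N0]) (simp add: N_def)
    fix x y
    have "\<bar>f' x\<bar> * \<bar>g' y\<bar> \<le> (if x \<inter> {..<n'} = a' then 1 else 0) * 1"
      using unit_bounded_bound[OF loc_imp_unit_bounded[OF l(3)]] by (intro mult_mono loc_bound[OF l(1)]) auto
    then show "\<bar>f' x * g' y\<bar> \<le> (if x \<inter> {..<n'} = a' then 1 else 0)" by (simp add: abs_mult)
  qed
  also have "\<dots> \<le> C * 2 powr (- (1 - 1 / p) * real n') * (2 powr (- real n / p) * 2 powr (- real m))"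
    using p C_nonneg by (intro mult_left_mono mixed_norm_loc[OF _ l(2,4)]) (auto simp: N_def)
  also have "\<dots> = C * level_weight (1 - 1 / p) n' n * level_weight 0 m' m"
  proof -
    have "2 powr (- (1 - 1 / p) * real n') * 2 powr (- real n / p) = level_weight (1 - 1 / p) n' n"
      unfolding level_weight_def powr_add[symmetric] by simp
    moreover have "2 powr (- real m) = level_weight 0 m' m" by (simp add: level_weight_def)
    ultimately show ?thesis by (simp only: mult.assoc[symmetric]) (simp only: mult.assoc)
  qed
  finally show "\<bar>\<phi> f' f g' g\<bar> \<le> C * level_weight (1 - 1 / p) n' n * level_weight 0 m' m"
    by (simp only: \<phi>_def)
next
  fix f g' g assume st: "step_fun f" "step_fun g'" "step_fun g"
  show "linear_on_steps (\<lambda>f'. \<phi> f' f g' g)"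
    unfolding linear_on_steps_def \<phi>_def using st
    by (simp add: distrib_right mult.assoc add1 cmult1 step2_tensor)
next
  fix f' g' g assume st: "step_fun f'" "step_fun g'" "step_fun g"
  show "linear_on_steps (\<lambda>f. \<phi> f' f g' g)"
    unfolding linear_on_steps_def \<phi>_def using st
    by (simp add: distrib_right mult.assoc add2 cmult2 step2_tensor)
next
  fix f' f g assume st: "step_fun f'" "step_fun f" "step_fun g"
  show "linear_on_steps (\<lambda>g'. \<phi> f' f g' g)"
    unfolding linear_on_steps_def \<phi>_def using st
    by (simp add: distrib_left mult.left_commute add1 cmult1 step2_tensor)
next
  fix f' f g' assume st: "step_fun f'" "step_fun f" "step_fun g'"
  show "linear_on_steps (\<lambda>g. \<phi> f' f g' g)"
    unfolding linear_on_steps_def \<phi>_def using st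
    by (simp add: distrib_left mult.left_commute add2 cmult2 step2_tensor)
qed

section \<open>Diffuseness in the second variable\<close>

lemma small_tensor:
  assumes "unit_bounded f'" "step_fun f" "step_fun g" "\<epsilon> > 0"
  shows "\<forall>\<^sub>F n in sequentially. \<forall>b u. loc n b u \<longrightarrow> \<bar>\<phi> f' f u g\<bar> \<le> \<epsilon>"
  using small[OF step2_tensor[OF assms(2,3)] assms(4)]
proof eventually_elim
  case (elim n)
  show ?case
  proof (intro allI impI)
    fix b u assume u: "loc n b u"
    have "\<bar>f' x * u y\<bar> \<le> (if y \<inter> {..<n} = b then 1 else 0)" for x y
    proof -
      have "\<bar>f' x\<bar> * \<bar>u y\<bar> \<le> 1 * (if y \<inter> {..<n} = b then 1 else 0)"
        using unit_bounded_bound[OF assms(1)] by (intro mult_mono loc_bound[OF u]) auto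
      then show ?thesis by (simp add: abs_mult)
    qed
    moreover have "step2 (\<lambda>x y. f' x * u y)"
      by (intro step2_tensor loc_step[OF assms(1)] loc_step[OF u])
    ultimately show "\<bar>\<phi> f' f u g\<bar> \<le> \<epsilon>"
      unfolding \<phi>_def by (intro elim[rule_format, of "\<lambda>x y. f' x * u y"])
  qed
qed

text \<open>Products of signs of different cells have mean zero, so averaging over random signs
  produces exactly the trace sum of level m.\<close>

lemma avg_signed_rad_form:
  assumes "unit_bounded f" "unit_bounded u" "unit_bounded g"
  shows "avg (Pow {..<m}) (\<lambda>Z. \<phi> (\<lambda>x. f x * signed_rad m Z x) (signed_rad m Z) u g)
    = (\<Sum>a\<in>Pow {..<m}. \<phi> (\<lambda>x. f x * hcell m a x) (hcell m a) u g)"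
proof -
  let ?T = "\<lambda>f' h. \<phi> (\<lambda>x. f' x * f x) (\<lambda>x. h x * 1) u g"
  have T: "biform (1 - 1 / p) (C * level_weight 0 0 0) ?T"
    by (rule biform_mult[OF quad_biform_loc[OF quad assms(2,3)] assms(1) unit_bounded_one])
  have "?T (signed_rad m Z) (signed_rad m Z)
      = (\<Sum>a\<in>Pow {..<m}. \<Sum>b\<in>Pow {..<m}. ?T (hcell m a) (hcell m b) * (sg Z a * sg Z b))" for Z
  proof -
    have "?T (signed_rad m Z) (signed_rad m Z) = (\<Sum>a\<in>Pow {..<m}. ?T (hcell m a) (signed_rad m Z) * sg Z a)"
      by (rule linear_signed_rad[OF biform_lin1[OF T step_fun_signed_rad]])
    also have "\<dots> = (\<Sum>a\<in>Pow {..<m}. (\<Sum>b\<in>Pow {..<m}. ?T (hcell m a) (hcell m b) * sg Z b) * sg Z a)"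
      unfolding linear_signed_rad[OF biform_lin2[OF T step_fun_hcell]] ..
    finally show ?thesis by (simp add: sum_distrib_left sum_distrib_right mult_ac)
  qed
  then have "avg (Pow {..<m}) (\<lambda>Z. ?T (signed_rad m Z) (signed_rad m Z))
      = (\<Sum>a\<in>Pow {..<m}. \<Sum>b\<in>Pow {..<m}. ?T (hcell m a) (hcell m b) * avg (Pow {..<m}) (\<lambda>Z. sg Z a * sg Z b))"
    by (simp only: avg_sum avg_cmult)
  also have "\<dots> = (\<Sum>a\<in>Pow {..<m}. \<Sum>b\<in>Pow {..<m}. if b = a then ?T (hcell m a) (hcell m b) else 0)"
    by (intro sum.cong refl) (auto simp: avg_sg_mult)
  also have "\<dots> = (\<Sum>a\<in>Pow {..<m}. ?T (hcell m a) (hcell m a))"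
    by (intro sum.cong refl) (simp add: sum.delta)
  finally show ?thesis by (simp add: mult.commute)
qed

lemma avg_signed_rad_zero:
  assumes "linear_on_steps \<psi>"
  shows "avg (Pow {..<m}) (\<lambda>Z. \<psi> (signed_rad m Z)) = 0"
  unfolding linear_signed_rad[OF assms] by (rule avg_linear_sign) simp

text \<open>Disjointly supported pieces \<^term>\<open>u k\<close> of the second variable can be tested simultaneously, at the
  cost of a sum of \<^term>\<open>M\<close> random signs, whose norm is \<open>o(M)\<close>.\<close>

lemma disjoint_pieces_bound:
  fixes u :: "nat \<Rightarrow> nat set \<Rightarrow> real"
  assumes f: "unit_bounded f" and g: "unit_bounded g" and u: "\<And>k. step_fun (u k)"
    and disj: "\<And>y. (\<Sum>k<M. \<bar>u k y\<bar>) \<le> 1" and m: "strict_mono m" and M: "M > 0"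
    and large: "\<And>k. k < M \<Longrightarrow> d \<le> \<bar>\<Sum>a\<in>Pow {..<m k}. \<phi> (\<lambda>x. f x * hcell (m k) a x) (hcell (m k) a) (u k) g\<bar>"
  shows "real M * d \<le> C * (real M powr (3 / 4 * p) + real M powr (p - 1 / 2)) powr (1 / p)"
proof -
  define y where "y k = (\<Sum>a\<in>Pow {..<m k}. \<phi> (\<lambda>x. f x * hcell (m k) a x) (hcell (m k) a) (u k) g)" for k
  \<comment> \<open>The factor \<open>sgn (y k)\<close> makes the mean of the k-th diagonal term
    equal to the absolute value of \<open>y k\<close>.\<close>
  define \<tau> where "\<tau> k l Z Y = sgn (y k) * (if k < M then \<phi> (\<lambda>x. f x * signed_rad (m k) Z x) (signed_rad (m l) Y) (u k) g else 0)" for k l Z Y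
  have stf: "step_fun f" and stg: "step_fun g" using f g by (auto intro: loc_step)
  have ub: "unit_bounded (u k)" if "k < M" for k
    unfolding unit_bounded_iff
  proof (intro conjI u allI)
    fix z
    have "\<bar>u k z\<bar> \<le> (\<Sum>k<M. \<bar>u k z\<bar>)" using that by (intro member_le_sum) auto
    then show "\<bar>u k z\<bar> \<le> 1" using disj[of z] by linarith
  qed
  have z1: "avg (Pow {..<m k}) (\<lambda>Z. \<tau> k l Z z) = 0" for k l z
  proof -
    have "linear_on_steps (\<lambda>h. \<phi> (\<lambda>x. f x * h x) (signed_rad (m l) z) (u k) g)"
    proof -
      have "linear_on_steps (\<lambda>f'. \<phi> f' (signed_rad (m l) z) (u k) g)"
        by (intro quad_lin1[OF quad] u stg step_fun_signed_rad)
      then show ?thesis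
        using stf unfolding linear_on_steps_def by (simp add: distrib_left step_fun_mult mult.left_commute)
    qed
    from avg_signed_rad_zero[OF this] show ?thesis
      unfolding \<tau>_def by (cases "k < M") (simp_all add: avg_cmult)
  qed
  have z2: "avg (Pow {..<m l}) (\<lambda>Z. \<tau> k l z Z) = 0" for k l z
  proof -
    have "linear_on_steps (\<lambda>h. \<phi> (\<lambda>x. f x * signed_rad (m k) z x) h (u k) g)"
      by (intro quad_lin2[OF quad] u stg step_fun_signed_rad step_fun_mult stf)
    from avg_signed_rad_zero[OF this] show ?thesis
      unfolding \<tau>_def by (cases "k < M") (simp_all add: avg_cmult)
  qed
  obtain Z where Z: "(\<Sum>k<M. avg (Pow {..<m k}) (\<lambda>z. \<tau> k k z z)) \<le> (\<Sum>k<M. \<Sum>l<M. \<tau> k l (Z k) (Z l))"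
    using decoupled_choice[of "\<lambda>k. Pow {..<m k}" \<tau> M, OF _ z1 z2] by auto
  have diag: "avg (Pow {..<m k}) (\<lambda>z. \<tau> k k z z) = \<bar>y k\<bar>" if "k < M" for k
    unfolding \<tau>_def using that by (simp add: avg_cmult avg_signed_rad_form[OF f ub g] y_def[symmetric] mult.commute abs_sgn)
  define G where "G = (\<lambda>x z. \<Sum>k<M. sgn (y k) * (f x * signed_rad (m k) (Z k) x * u k z))"
  define F where "F = (\<lambda>x z. \<Sum>l<M. 1 * (signed_rad (m l) (Z l) x * g z))"
  have stG': "step2 (\<lambda>x z. f x * signed_rad (m k) (Z k) x * u k z)" for k
    by (intro step2_tensor step_fun_mult stf step_fun_signed_rad u)
  have stF': "step2 (\<lambda>x z. signed_rad (m l) (Z l) x * g z)" for l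
    by (intro step2_tensor step_fun_signed_rad stg)
  have stG: "step2 G" unfolding G_def by (intro step2_sum step2_cmult stG')
  have stF: "step2 F" unfolding F_def by (intro step2_sum step2_cmult stF')
  have "\<Phi> G F = (\<Sum>k<M. sgn (y k) * \<Phi> (\<lambda>x z. f x * signed_rad (m k) (Z k) x * u k z) F)"
    unfolding G_def by (rule sum1) (auto intro: stG' stF)
  also have "\<dots> = (\<Sum>k<M. sgn (y k) * (\<Sum>l<M. 1 * \<Phi> (\<lambda>x z. f x * signed_rad (m k) (Z k) x * u k z)
      (\<lambda>x z. signed_rad (m l) (Z l) x * g z)))"
    unfolding F_def by (intro sum.cong refl arg_cong2[where f = "(*)"] sum2) (auto intro: stG' stF')
  also have "\<dots> = (\<Sum>k<M. \<Sum>l<M. \<tau> k l (Z k) (Z l))"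
    unfolding \<tau>_def \<phi>_def by (simp add: sum_distrib_left)
  finally have \<Phi>: "\<Phi> G F = (\<Sum>k<M. \<Sum>l<M. \<tau> k l (Z k) (Z l))" .
  obtain N0 where N0: "dep2 N0 F" using stF by (auto simp: step2_def)
  define N where "N = N0 + Suc (m M)"
  have mN: "m k < N" if "k < M" for k using strict_monoD[OF m that] by (simp add: N_def)
  have "real M * d = (\<Sum>k<M. d)" by simp
  also have "\<dots> \<le> (\<Sum>k<M. \<bar>y k\<bar>)"
    by (intro sum_mono) (use large in \<open>simp add: y_def\<close>)
  also have "\<dots> = (\<Sum>k<M. avg (Pow {..<m k}) (\<lambda>z. \<tau> k k z z))"
    by (intro sum.cong refl) (simp add: diag)
  also have "\<dots> \<le> \<Phi> G F" using Z \<Phi> by simp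
  also have "\<dots> \<le> C * 2 powr (- (1 - 1 / p) * real 0) * mixed_norm p N F"
  proof (rule order_trans[OF abs_ge_self bound[OF stG]])
    show "dep2 N F" by (rule dep2_mono[OF N0]) (simp add: N_def)
    fix x z
    have "\<bar>G x z\<bar> \<le> (\<Sum>k<M. \<bar>sgn (y k) * (f x * signed_rad (m k) (Z k) x * u k z)\<bar>)"
      unfolding G_def by (rule sum_abs)
    also have "\<dots> \<le> (\<Sum>k<M. \<bar>u k z\<bar>)"
    proof (rule sum_mono)
      fix k
      have "\<bar>sgn (y k)\<bar> * \<bar>f x\<bar> * \<bar>u k z\<bar> \<le> 1 * 1 * \<bar>u k z\<bar>"
        using unit_bounded_bound[OF f, of x] by (intro mult_mono) (auto simp: abs_sgn_eq)
      then show "\<bar>sgn (y k) * (f x * signed_rad (m k) (Z k) x * u k z)\<bar> \<le> \<bar>u k z\<bar>"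
        by (simp add: abs_mult mult_ac)
    qed
    finally show "\<bar>G x z\<bar> \<le> (if x \<inter> {..<0} = {} then 1 else 0)" using disj[of z] by simp
  qed
  also have "\<dots> = C * mixed_norm p N F" by simp
  also have "mixed_norm p N F \<le> avg {..<N} (\<lambda>x. \<bar>\<Sum>k<M. signed_rad (m k) (Z k) x\<bar> powr p) powr (1 / p)"
  proof (rule mixed_norm_le)
    fix x
    have "avg {..<N} (\<lambda>z. \<bar>F x z\<bar>) \<le> avg {..<N} (\<lambda>z. \<bar>\<Sum>k<M. signed_rad (m k) (Z k) x\<bar>)"
    proof (rule avg_mono)
      fix z
      have "\<bar>F x z\<bar> = \<bar>\<Sum>k<M. signed_rad (m k) (Z k) x\<bar> * \<bar>g z\<bar>"
        unfolding F_def by (simp add: sum_distrib_right[symmetric] abs_mult)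
      also have "\<dots> \<le> \<bar>\<Sum>k<M. signed_rad (m k) (Z k) x\<bar> * 1"
        using unit_bounded_bound[OF g] by (intro mult_left_mono) auto
      finally show "\<bar>F x z\<bar> \<le> \<bar>\<Sum>k<M. signed_rad (m k) (Z k) x\<bar>" by simp
    qed
    then show "avg {..<N} (\<lambda>z. \<bar>F x z\<bar>) \<le> \<bar>\<Sum>k<M. signed_rad (m k) (Z k) x\<bar>" by simp
  qed (use p in simp)
  also have "\<dots> \<le> (real M powr (3 / 4 * p) + real M powr (p - 1 / 2)) powr (1 / p)"
  proof (rule powr_mono2)
    show "avg {..<N} (\<lambda>x. \<bar>\<Sum>k<M. signed_rad (m k) (Z k) x\<bar> powr p) \<le> real M powr (3 / 4 * p) + real M powr (p - 1 / 2)"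
    proof (rule avg_powr_sum_signs[OF _ _ mN M])
      show "m k \<noteq> m l" if "k < l" "l < M" for k l using strict_monoD[OF m that(1)] by simp
    qed (use p in simp_all)
  qed (use p in \<open>auto intro: avg_nonneg\<close>)
  finally show ?thesis using C_nonneg by (simp add: mult_left_mono)
qed

text \<open>A gliding hump. Each single trace sum \<open>y m\<close> is small on thin strips, but
  not uniformly in m. Were the limit not small, there would be finer and finer strips on which later
  and later trace sums exceed \<delta>; made disjoint at small cost, they contradict
  \<open>disjoint_pieces_bound\<close>.\<close>

lemma diffuse_partial_trace_second:
  assumes f: "unit_bounded f" and g: "unit_bounded g"
  shows "diffuse (\<lambda>u. partial_trace \<phi> f u g)"
  unfolding diffuse_def
proof (intro conjI allI impI)
  have stf: "step_fun f" and stg: "step_fun g" using f g by (auto intro: loc_step)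
  show "linear_on_steps (\<lambda>u. partial_trace \<phi> f u g)"
    by (rule partial_trace_lin2[OF quad stf stg])
  show "\<exists>K. \<forall>u. unit_bounded u \<longrightarrow> \<bar>partial_trace \<phi> f u g\<bar> \<le> K"
    using partial_trace_bound[OF quad f _ g] by blast
  fix \<delta> :: real assume \<delta>: "\<delta> > 0"
  show "\<forall>\<^sub>F n in sequentially. \<forall>a u. loc n a u \<longrightarrow> \<bar>partial_trace \<phi> f u g\<bar> \<le> \<delta>"
  proof (rule ccontr)
    assume neg: "\<not> ?thesis"
    define y where "y m u = (\<Sum>a\<in>Pow {..<m}. \<phi> (\<lambda>x. f x * hcell m a x) (hcell m a) u g)" for m u
    have lin_y: "linear_on_steps (y m)" for m
      unfolding y_def
      by (intro linear_on_steps_sum_fun quad_lin3[OF quad] step_fun_mult step_fun_hcell stf stg)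
    have large: "\<exists>m\<ge>m0. \<delta> < \<bar>y m u\<bar>" if u: "loc n b u" "\<not> \<bar>partial_trace \<phi> f u g\<bar> \<le> \<delta>" for n b u m0
    proof -
      have "((\<lambda>m. \<bar>y m u\<bar>) \<longlongrightarrow> \<bar>partial_trace \<phi> f u g\<bar>) ufilter"
        unfolding y_def by (intro tendsto_rabs partial_trace_tendsto[OF quad] stf stg loc_step[OF u(1)])
      then have "\<forall>\<^sub>F m in ufilter. \<delta> < \<bar>y m u\<bar>"
        by (rule order_tendstoD) (use u(2) in simp)
      moreover have "\<forall>\<^sub>F m in ufilter. m \<ge> m0"
        by (intro eventually_ufilter eventually_ge_at_top)
      ultimately have "\<forall>\<^sub>F m in ufilter. \<delta> < \<bar>y m u\<bar> \<and> m \<ge> m0" by (rule eventually_conj)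
      from eventually_happens'[OF ufilter_nonbot this] show ?thesis by blast
    qed
    have small_y: "\<forall>\<^sub>F n in sequentially. \<forall>b u. loc n b u \<longrightarrow> \<bar>y m u\<bar> \<le> \<eta>" if \<eta>: "\<eta> > 0" for m \<eta>
    proof -
      have "\<forall>\<^sub>F n in sequentially. \<forall>a\<in>Pow {..<m}. \<forall>b u. loc n b u \<longrightarrow>
          \<bar>\<phi> (\<lambda>x. f x * hcell m a x) (hcell m a) u g\<bar> \<le> \<eta> / 2 ^ m"
        using \<eta> stg
        by (intro eventually_ball_finite ballI small_tensor loc_mult[OF f] loc_imp_unit_bounded[OF loc_hcell] step_fun_hcell) auto
      then show ?thesis
      proof eventually_elim
        case (elim n)
        show ?case
        proof (intro allI impI)
          fix b u assume u: "loc n b u"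
          have "\<bar>y m u\<bar> \<le> (\<Sum>a\<in>Pow {..<m}. \<eta> / 2 ^ m)"
            unfolding y_def using elim u by (intro order_trans[OF sum_abs] sum_mono) blast
          also have "\<dots> = \<eta>" by (simp add: card_Pow)
          finally show "\<bar>y m u\<bar> \<le> \<eta>" .
        qed
      qed
    qed
    \<comment> \<open>Raising the conclusion of \<open>disjoint_pieces_bound\<close> to the power p
      and dividing by M^p leaves M^(-p/4) + M^(-1/2), which is made too small for pieces of size
      \<delta>/2. The 1 added to C keeps the quotient meaningful when C is zero.\<close>
    have "((\<lambda>M. real M powr (- (p / 4)) + real M powr (- (1 / 2))) \<longlongrightarrow> 0 + 0) sequentially"
      using p by (intro tendsto_add tendsto_neg_powr filterlim_real_sequentially) auto
    moreover have "0 + 0 < (\<delta> / 2 / (C + 1)) powr p" using \<delta> C_nonneg by simp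
    ultimately have "\<forall>\<^sub>F M in sequentially. real M powr (- (p / 4)) + real M powr (- (1 / 2)) < (\<delta> / 2 / (C + 1)) powr p"
      by (rule order_tendstoD)
    then obtain M where M: "M > 0" and Msmall: "real M powr (- (p / 4)) + real M powr (- (1 / 2)) < (\<delta> / 2 / (C + 1)) powr p"
      using eventually_happens'[OF sequentially_bot eventually_conj[OF eventually_gt_at_top[of 0]]] by blast
    \<comment> \<open>A piece loses at most \<eta> for each later strip cut out of it, so at most
      \<delta>/2 altogether.\<close>
    define \<eta> where "\<eta> = \<delta> / (2 * real M)"
    have \<eta>: "\<eta> > 0" using \<delta> M by (simp add: \<eta>_def)
    \<comment> \<open>Stage k picks a strip so thin that all earlier trace sums are at most \<eta>
      on it, a function u living there, and a later level m at which the trace sum of u exceeds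
      \<delta>.\<close>
    define P where "P = (\<lambda>(h :: nat \<Rightarrow> nat \<times> nat set \<times> (nat set \<Rightarrow> real) \<times> nat) k (n, b, u, m).
      loc n b u \<and> \<delta> < \<bar>y m u\<bar> \<and> (\<forall>j<k. snd (snd (snd (h j))) < m) \<and>
      (\<forall>j<k. \<forall>b u. loc n b u \<longrightarrow> \<bar>y (snd (snd (snd (h j)))) u\<bar> \<le> \<eta>))"
    have "\<exists>h. \<forall>k. P h k (h k)"
    proof (rule dependent_wf_choice[OF wf_less])
      fix h h' :: "nat \<Rightarrow> nat \<times> nat set \<times> (nat set \<Rightarrow> real) \<times> nat" and k r
      assume eq: "\<And>z. (z, k) \<in> {(x, y). x < y} \<Longrightarrow> h z = h' z"
      then have e: "h j = h' j" if "j < k" for j using that by simp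
      show "P h k r = P h' k r" unfolding P_def using e by (cases r) (simp cong: conj_cong)
    next
      fix k and h :: "nat \<Rightarrow> nat \<times> nat set \<times> (nat set \<Rightarrow> real) \<times> nat"
      have "\<forall>\<^sub>F n in sequentially. \<forall>j\<in>{..<k}. \<forall>b u. loc n b u \<longrightarrow> \<bar>y (snd (snd (snd (h j)))) u\<bar> \<le> \<eta>"
        by (intro eventually_ball_finite ballI small_y \<eta>) auto
      moreover have "\<exists>\<^sub>F n in sequentially. \<not> (\<forall>a u. loc n a u \<longrightarrow> \<bar>partial_trace \<phi> f u g\<bar> \<le> \<delta>)"
        unfolding frequently_def not_not by (rule neg)
      ultimately obtain n b u where n: "\<forall>j\<in>{..<k}. \<forall>b u. loc n b u \<longrightarrow> \<bar>y (snd (snd (snd (h j)))) u\<bar> \<le> \<eta>"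
        and u: "loc n b u" "\<not> \<bar>partial_trace \<phi> f u g\<bar> \<le> \<delta>"
        using frequently_ex[OF frequently_eventually_frequently] by blast
      obtain m where m: "m \<ge> Suc (\<Sum>j<k. snd (snd (snd (h j))))" "\<delta> < \<bar>y m u\<bar>"
        using large[OF u] by blast
      have "snd (snd (snd (h j))) < m" if "j < k" for j
        using m(1) member_le_sum[of j "{..<k}" "\<lambda>j. snd (snd (snd (h j)))"] that by simp
      then have "P h k (n, b, u, m)" unfolding P_def using n u(1) m(2) by simp
      then show "\<exists>r. P h k r" by blast
    qed
    then obtain h where h: "\<And>k. P h k (h k)" by blast
    define n b u m where "n k = fst (h k)" and "b k = fst (snd (h k))"
      and "u k = fst (snd (snd (h k)))" and "m k = snd (snd (snd (h k)))" for k
    have hk: "h k = (n k, b k, u k, m k)" for k by (simp add: n_def b_def u_def m_def)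
    have lu: "loc (n k) (b k) (u k)" and yu: "\<delta> < \<bar>y (m k) (u k)\<bar>" and mk: "j < k \<Longrightarrow> m j < m k"
      and sm: "j < k \<Longrightarrow> loc (n k) b' v \<Longrightarrow> \<bar>y (m j) v\<bar> \<le> \<eta>" for j k b' v
      using h[of k] unfolding P_def hk by auto
    define i where "i k z = (if z \<inter> {..<n k} = b k then 1 else 0 :: real)" for k z
    have sti: "step_fun (i k)" for k
    proof -
      have "dep (n k) (i k)" by (auto simp: dep_def i_def)
      then show ?thesis by (auto simp: step_fun_def)
    qed
    \<comment> \<open>The piece \<open>u k\<close> with the later strips removed; for fixed J and k
      < J these functions have disjoint supports.\<close>
    define v where "v k J z = u k z * (\<Prod>j\<in>{k<..<J}. 1 - i j z)" for k J z
    have stv: "step_fun (v k J)" for k J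
      unfolding v_def by (intro step_fun_mult step_fun_prod step_fun_diff step_fun_const sti loc_step[OF lu])
    have bv: "\<bar>v k J z\<bar> \<le> i k z * (\<Prod>j\<in>{k<..<J}. 1 - i j z)" for k J z
    proof -
      have "0 \<le> (\<Prod>j\<in>{k<..<J}. 1 - i j z)" by (intro prod_nonneg) (auto simp: i_def)
      moreover have "\<bar>u k z\<bar> \<le> i k z" using loc_bound[OF lu] by (simp add: i_def)
      ultimately show ?thesis by (simp add: v_def abs_mult mult_right_mono)
    qed
    have bv1: "\<bar>v k J z\<bar> \<le> 1" for k J z
    proof -
      have "(\<Prod>j\<in>{k<..<J}. 1 - i j z) \<le> 1" by (intro prod_le_1) (auto simp: i_def)
      moreover have "0 \<le> (\<Prod>j\<in>{k<..<J}. 1 - i j z)" by (intro prod_nonneg) (auto simp: i_def)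
      ultimately have "i k z * (\<Prod>j\<in>{k<..<J}. 1 - i j z) \<le> 1 * 1"
        by (intro mult_mono) (auto simp: i_def)
      then show ?thesis using bv[of k J z] by simp
    qed
    have yv: "\<delta> - real J * \<eta> \<le> \<bar>y (m k) (v k J)\<bar>" for k J
    proof (induction J)
      case 0
      have "v k 0 = u k" by (simp add: v_def fun_eq_iff)
      then show ?case using yu[of k] by simp
    next
      case (Suc J)
      show ?case
      proof (cases "k < J")
        case False
        then have "{k<..<Suc J} = {k<..<J}" by auto
        then have "v k (Suc J) = v k J" by (simp add: v_def fun_eq_iff)
        then show ?thesis using Suc \<eta> by (simp add: algebra_simps)
      next
        case True
        then have "{k<..<Suc J} = insert J {k<..<J}" by auto
        then have "v k J z = v k (Suc J) z + v k J z * i J z" for z by (simp add: v_def algebra_simps)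
        then have "v k J = (\<lambda>z. v k (Suc J) z + v k J z * i J z)" by blast
        then have "y (m k) (v k J) = y (m k) (\<lambda>z. v k (Suc J) z + v k J z * i J z)" by (rule arg_cong)
        also have "\<dots> = y (m k) (v k (Suc J)) + y (m k) (\<lambda>z. v k J z * i J z)"
          by (rule linear_on_steps_add[OF lin_y stv step_fun_mult[OF stv sti]])
        finally have "y (m k) (v k J) = y (m k) (v k (Suc J)) + y (m k) (\<lambda>z. v k J z * i J z)" .
        moreover have "\<bar>y (m k) (\<lambda>z. v k J z * i J z)\<bar> \<le> \<eta>"
        proof (rule sm[OF True])
          show "loc (n J) (b J) (\<lambda>z. v k J z * i J z)"
            using bv1 by (intro locI step_fun_mult stv sti) (simp add: i_def)
        qed
        ultimately have "\<bar>y (m k) (v k J)\<bar> - \<eta> \<le> \<bar>y (m k) (v k (Suc J))\<bar>" by linarith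
        then show ?thesis using Suc by (simp add: algebra_simps)
      qed
    qed
    have disj: "(\<Sum>k<J. i k z * (\<Prod>j\<in>{k<..<J}. 1 - i j z)) \<le> 1" for J z
    proof (induction J)
      case (Suc J)
      have "(\<Sum>k<J. i k z * (\<Prod>j\<in>{k<..<Suc J}. 1 - i j z)) = (\<Sum>k<J. i k z * (\<Prod>j\<in>{k<..<J}. 1 - i j z)) * (1 - i J z)"
        unfolding sum_distrib_right
      proof (intro sum.cong refl)
        fix k assume "k \<in> {..<J}"
        then have "{k<..<Suc J} = insert J {k<..<J}" by auto
        then show "i k z * (\<Prod>j\<in>{k<..<Suc J}. 1 - i j z) = i k z * (\<Prod>j\<in>{k<..<J}. 1 - i j z) * (1 - i J z)"
          by (simp add: mult_ac)
      qed
      also have "\<dots> \<le> 1 * (1 - i J z)" by (intro mult_right_mono Suc) (auto simp: i_def)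
      finally have "(\<Sum>k<J. i k z * (\<Prod>j\<in>{k<..<Suc J}. 1 - i j z)) \<le> 1 - i J z" by simp
      moreover have "{J<..<Suc J} = {}" by auto
      ultimately show ?case by simp
    qed simp
    have "real M * (\<delta> / 2) \<le> C * (real M powr (3 / 4 * p) + real M powr (p - 1 / 2)) powr (1 / p)"
    proof (rule disjoint_pieces_bound[OF f g, of "\<lambda>k. v k M" M m])
      show "step_fun (v k M)" for k by (rule stv)
      show "(\<Sum>k<M. \<bar>v k M z\<bar>) \<le> 1" for z
        using order_trans[OF sum_mono[OF bv] disj] .
      show "strict_mono m" using mk by (simp add: strict_mono_def)
      have half: "\<delta> - real M * \<eta> = \<delta> / 2" using M by (simp add: \<eta>_def)
      show "\<delta> / 2 \<le> \<bar>\<Sum>a\<in>Pow {..<m k}. \<phi> (\<lambda>x. f x * hcell (m k) a x) (hcell (m k) a) (v k M) g\<bar>" for k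
        using yv[of M k] unfolding half y_def .
    qed fact
    also have "\<dots> \<le> (C + 1) * (real M powr (3 / 4 * p) + real M powr (p - 1 / 2)) powr (1 / p)"
      by (intro mult_right_mono) auto
    finally have "real M * (\<delta> / 2 / (C + 1)) \<le> (real M powr (3 / 4 * p) + real M powr (p - 1 / 2)) powr (1 / p)"
      using C_nonneg by (simp add: field_simps)
    then have "(real M * (\<delta> / 2 / (C + 1))) powr p \<le> ((real M powr (3 / 4 * p) + real M powr (p - 1 / 2)) powr (1 / p)) powr p"
      using p \<delta> C_nonneg by (intro powr_mono2) auto
    also have "\<dots> = real M powr (3 / 4 * p) + real M powr (p - 1 / 2)"
      using p by (simp add: powr_powr)
    also have "\<dots> = real M powr p * (real M powr (- (p / 4)) + real M powr (- (1 / 2)))"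
      by (simp add: distrib_left powr_add[symmetric] field_simps)
    also have "(real M * (\<delta> / 2 / (C + 1))) powr p = real M powr p * (\<delta> / 2 / (C + 1)) powr p"
      by (rule powr_mult)
    finally have "(\<delta> / 2 / (C + 1)) powr p \<le> real M powr (- (p / 4)) + real M powr (- (1 / 2))"
      using M by simp
    then show False using Msmall by simp
  qed
qed

text \<open>In the variable s all requirements follow from the exponents. In t the functional slot
  has exponent 0, and \<open>small_tensor\<close> and the gliding hump argument take over.\<close>

lemma nice: "nice_form \<phi>" and nice_swap: "nice_form (swap4 \<phi>)"
proof -
  have q': "quad_form 0 (1 - 1 / p) C (swap4 \<phi>)" by (rule quad_form_swap4[OF quad])
  have \<kappa>: "1 - 1 / p < 1" "0 < 1 - 1 / p" using p by auto
  show "nice_form \<phi>"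
    unfolding nice_form_def
  proof (intro conjI allI impI)
    show "\<exists>\<kappa>\<^sub>1 \<kappa>\<^sub>2 K. \<kappa>\<^sub>1 < 1 \<and> quad_form \<kappa>\<^sub>1 \<kappa>\<^sub>2 K \<phi>" using quad \<kappa> by blast
    show "diffuse (\<lambda>f'. \<phi> f' f g' g)" if "unit_bounded f" "unit_bounded g'" "unit_bounded g" for f g' g
      by (rule diffuse_biform1[OF quad_biform_loc[OF quad that(2,3)] \<kappa>(2) that(1)])
    show "diffuse (\<lambda>f'. partial_trace (swap4 \<phi>) g f' f)" if "unit_bounded g" "unit_bounded f" for g f
      by (rule diffuse_biform1[OF partial_trace_biform_loc[OF q' that(1)] \<kappa>(2) that(2)])
  qed
  show "nice_form (swap4 \<phi>)"
    unfolding nice_form_def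
  proof (intro conjI allI impI)
    show "\<exists>\<kappa>\<^sub>1 \<kappa>\<^sub>2 K. \<kappa>\<^sub>1 < 1 \<and> quad_form \<kappa>\<^sub>1 \<kappa>\<^sub>2 K (swap4 \<phi>)" using q' zero_less_one by blast
    show "diffuse (\<lambda>f'. partial_trace (swap4 (swap4 \<phi>)) g f' f)" if "unit_bounded g" "unit_bounded f" for g f
      using diffuse_partial_trace_second[OF that] by simp
    fix g f' f assume b: "unit_bounded g" "unit_bounded f'" "unit_bounded f"
    show "diffuse (\<lambda>g'. swap4 \<phi> g' g f' f)"
      unfolding diffuse_def swap4_def
    proof (intro conjI allI impI)
      show "linear_on_steps (\<lambda>g'. \<phi> f' f g' g)"
        by (intro quad_lin3[OF quad] loc_step[OF b(1)] loc_step[OF b(2)] loc_step[OF b(3)])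
      show "\<exists>K. \<forall>g'. unit_bounded g' \<longrightarrow> \<bar>\<phi> f' f g' g\<bar> \<le> K"
        using quad_bound[OF quad b(2,3) _ b(1)] by blast
      show "\<forall>\<^sub>F n in sequentially. \<forall>a u. loc n a u \<longrightarrow> \<bar>\<phi> f' f u g\<bar> \<le> \<delta>" if "\<delta> > 0" for \<delta>
        by (rule small_tensor[OF b(2) loc_step[OF b(3)] loc_step[OF b(1)] that])
    qed
  qed
qed

end


text \<open>Multiplying by the new sign inserts r into an index set, and a product of two sign
  products carries their symmetric difference; W and the first iterated limit come from the swapped
  form.\<close>

lemma entry_arrays_good_sign:
  assumes sys: "sign_system \<rho>" "sign_system \<sigma>" and \<delta>: "\<And>r. 0 \<le> \<delta> r"
    and gs: "\<And>r. good_sign \<phi> (sign_prod \<rho> ` Pow {..<r}) (sign_prod \<sigma> ` Pow {..<r}) (\<delta> r) (\<rho> r)"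
    and gt: "\<And>r. good_sign (swap4 \<phi>) (sign_prod \<sigma> ` Pow {..<r}) (sign_prod \<rho> ` Pow {..<Suc r}) (\<delta> r) (\<sigma> r)"
  shows "entry_arrays
    (\<lambda>A' A B' B. \<phi> (sign_prod \<rho> A') (sign_prod \<rho> A) (sign_prod \<sigma> B') (sign_prod \<sigma> B))
    (\<lambda>C B' B. partial_trace \<phi> (sign_prod \<rho> C) (sign_prod \<sigma> B') (sign_prod \<sigma> B))
    (\<lambda>D A' A. partial_trace (swap4 \<phi>) (sign_prod \<sigma> D) (sign_prod \<rho> A') (sign_prod \<rho> A))
    (\<lambda>C D. full_trace (swap4 \<phi>) (sign_prod \<sigma> D) (sign_prod \<rho> C))
    (\<lambda>C D. full_trace \<phi> (sign_prod \<rho> C) (sign_prod \<sigma> D)) \<delta>"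
proof -
  have ins: "(\<lambda>x. \<tau> r x * sign_prod \<tau> A x) = sign_prod \<tau> (insert r A)" if "A \<subseteq> {..<r}" for \<tau> r A
  proof -
    have "finite A" "r \<notin> A" using that by (auto intro: finite_subset)
    then show ?thesis by (simp add: sign_prod_insert fun_eq_iff)
  qed
  have mul: "(\<lambda>x. sign_prod \<tau> A x * sign_prod \<tau> B x) = sign_prod \<tau> (sdiff A B)"
    if "sign_system \<tau>" "A \<subseteq> {..<r}" "B \<subseteq> {..<r}" for \<tau> r A B
    using that by (intro ext sign_prod_mult) (auto intro: finite_subset)
  note s = gs[unfolded good_sign_def, rule_format, OF imageI imageI imageI imageI, unfolded Pow_iff]
  note t = gt[unfolded good_sign_def lessThan_Suc_atMost, rule_format, OF imageI imageI imageI imageI, unfolded Pow_iff]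
  show ?thesis
  proof
    show "0 \<le> \<delta> r" for r by (rule \<delta>)
    fix A' A B' B :: "nat set" and r
    {
      assume A: "A' \<subseteq> {..<r}" "A \<subseteq> {..<r}" and B: "B' \<subseteq> {..<r}" "B \<subseteq> {..<r}"
      show "\<bar>\<phi> (sign_prod \<rho> (insert r A')) (sign_prod \<rho> A) (sign_prod \<sigma> B') (sign_prod \<sigma> B)\<bar> \<le> \<delta> r \<and>
        \<bar>\<phi> (sign_prod \<rho> A') (sign_prod \<rho> (insert r A)) (sign_prod \<sigma> B') (sign_prod \<sigma> B)\<bar> \<le> \<delta> r \<and>
        \<bar>\<phi> (sign_prod \<rho> (insert r A')) (sign_prod \<rho> (insert r A)) (sign_prod \<sigma> B') (sign_prod \<sigma> B)
          - partial_trace \<phi> (sign_prod \<rho> (sdiff A' A)) (sign_prod \<sigma> B') (sign_prod \<sigma> B)\<bar> \<le> \<delta> r"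
        using s[OF A B] unfolding ins[OF A(1)] ins[OF A(2)] mul[OF sys(1) A] by (elim conjE) (intro conjI)
    next
      assume A: "A \<subseteq> {..<r}" and B: "B' \<subseteq> {..<r}" "B \<subseteq> {..<r}"
      show "\<bar>partial_trace \<phi> (sign_prod \<rho> (insert r A)) (sign_prod \<sigma> B') (sign_prod \<sigma> B)\<bar> \<le> \<delta> r"
        using s[OF A A B] unfolding ins[OF A] by (elim conjE)
    next
      assume A: "A' \<subseteq> {..<r}" "A \<subseteq> {..<r}" and B: "B \<subseteq> {..<r}"
      show "\<bar>partial_trace (swap4 \<phi>) (sign_prod \<sigma> B) (sign_prod \<rho> (insert r A')) (sign_prod \<rho> A)\<bar> \<le> \<delta> r \<and>
        \<bar>partial_trace (swap4 \<phi>) (sign_prod \<sigma> B) (sign_prod \<rho> A') (sign_prod \<rho> (insert r A))\<bar> \<le> \<delta> r \<and>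
        \<bar>partial_trace (swap4 \<phi>) (sign_prod \<sigma> B) (sign_prod \<rho> (insert r A')) (sign_prod \<rho> (insert r A))
          - full_trace (swap4 \<phi>) (sign_prod \<sigma> B) (sign_prod \<rho> (sdiff A' A))\<bar> \<le> \<delta> r"
        using s[OF A B B] unfolding ins[OF A(1)] ins[OF A(2)] mul[OF sys(1) A] by (elim conjE) (intro conjI)
    next
      assume A: "A \<subseteq> {..<r}" and B: "B \<subseteq> {..<r}"
      show "\<bar>full_trace (swap4 \<phi>) (sign_prod \<sigma> B) (sign_prod \<rho> (insert r A))\<bar> \<le> \<delta> r \<and>
        \<bar>full_trace \<phi> (sign_prod \<rho> (insert r A)) (sign_prod \<sigma> B)\<bar> \<le> \<delta> r"
        using s[OF A A B B] unfolding ins[OF A] by (elim conjE) (intro conjI)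
    next
      assume A: "A' \<subseteq> {..r}" "A \<subseteq> {..r}" and B: "B' \<subseteq> {..<r}" "B \<subseteq> {..<r}"
      show "\<bar>\<phi> (sign_prod \<rho> A') (sign_prod \<rho> A) (sign_prod \<sigma> (insert r B')) (sign_prod \<sigma> B)\<bar> \<le> \<delta> r \<and>
        \<bar>\<phi> (sign_prod \<rho> A') (sign_prod \<rho> A) (sign_prod \<sigma> B') (sign_prod \<sigma> (insert r B))\<bar> \<le> \<delta> r \<and>
        \<bar>\<phi> (sign_prod \<rho> A') (sign_prod \<rho> A) (sign_prod \<sigma> (insert r B')) (sign_prod \<sigma> (insert r B))
          - partial_trace (swap4 \<phi>) (sign_prod \<sigma> (sdiff B' B)) (sign_prod \<rho> A') (sign_prod \<rho> A)\<bar> \<le> \<delta> r"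
        using t[OF B A] unfolding ins[OF B(1)] ins[OF B(2)] mul[OF sys(2) B]
        by (elim conjE) (intro conjI; simp only: swap4_def)
    next
      assume A: "A' \<subseteq> {..r}" "A \<subseteq> {..r}" and B: "B \<subseteq> {..<r}"
      show "\<bar>partial_trace (swap4 \<phi>) (sign_prod \<sigma> (insert r B)) (sign_prod \<rho> A') (sign_prod \<rho> A)\<bar> \<le> \<delta> r"
        using t[OF B B A] unfolding ins[OF B] by (elim conjE)
    next
      assume A: "A \<subseteq> {..r}" and B: "B' \<subseteq> {..<r}" "B \<subseteq> {..<r}"
      show "\<bar>partial_trace \<phi> (sign_prod \<rho> A) (sign_prod \<sigma> (insert r B')) (sign_prod \<sigma> B)\<bar> \<le> \<delta> r \<and>
        \<bar>partial_trace \<phi> (sign_prod \<rho> A) (sign_prod \<sigma> B') (sign_prod \<sigma> (insert r B))\<bar> \<le> \<delta> r \<and>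
        \<bar>partial_trace \<phi> (sign_prod \<rho> A) (sign_prod \<sigma> (insert r B')) (sign_prod \<sigma> (insert r B))
          - full_trace \<phi> (sign_prod \<rho> A) (sign_prod \<sigma> (sdiff B' B))\<bar> \<le> \<delta> r"
        using t[OF B A A] unfolding ins[OF B(1)] ins[OF B(2)] mul[OF sys(2) B] swap4_swap4
        by (elim conjE) (intro conjI)
    next
      assume A: "A \<subseteq> {..r}" and B: "B \<subseteq> {..<r}"
      show "\<bar>full_trace (swap4 \<phi>) (sign_prod \<sigma> (insert r B)) (sign_prod \<rho> A)\<bar> \<le> \<delta> r \<and>
        \<bar>full_trace \<phi> (sign_prod \<rho> A) (sign_prod \<sigma> (insert r B))\<bar> \<le> \<delta> r"
        using t[OF B B A A] unfolding ins[OF B] swap4_swap4 by (elim conjE) (intro conjI)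
    }
  qed
qed


section \<open>Equality of the two iterated limits\<close>

text \<open>Exactly 2^i subsets have largest element i.\<close>

lemma sum_Max_Pow:
  fixes t :: "nat \<Rightarrow> real"
  shows "(\<Sum>P\<in>Pow {..<k}. if P = {} then 0 else t (Max P)) = (\<Sum>i<k. 2 ^ i * t i)"
proof (induction k)
  case (Suc k)
  have "(\<Sum>P\<in>Pow {..<k}. if insert k P = {} then 0 else t (Max (insert k P))) = (\<Sum>P\<in>Pow {..<k}. t k)"
  proof (intro sum.cong refl)
    fix P assume "P \<in> Pow {..<k}"
    then have "Max (insert k P) = k"
      by (intro Max_eqI) (auto intro: finite_subset less_imp_le)
    then show "(if insert k P = {} then 0 else t (Max (insert k P))) = t k" by simp
  qed
  then show ?case
    by (simp add: lessThan_Suc sum_Pow_insert Suc card_Pow)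
qed simp

text \<open>Writing X k for the quantity between the bars, t (k+1) - t k = X k - 2 X (k+1). If the
  absolute sums of X stay bounded, the jumps of t cannot all have the same nonzero size.\<close>

lemma alternating_eq:
  fixes \<nu> \<mu> K :: real and t :: "nat \<Rightarrow> real"
  assumes t: "\<And>k. t k = (if even k then \<nu> else \<mu>)"
    and K: "\<And>n. (\<Sum>k<n. \<bar>(\<Sum>i<k. 2 ^ i * t i) / 2 ^ (k + 1) - t k / 2\<bar>) \<le> K"
  shows "\<nu> = \<mu>"
proof (rule ccontr)
  assume ne: "\<nu> \<noteq> \<mu>"
  define X where "X k = (\<Sum>i<k. 2 ^ i * t i) / 2 ^ (k + 1) - t k / 2" for k
  have step: "\<bar>\<nu> - \<mu>\<bar> \<le> \<bar>X k\<bar> + 2 * \<bar>X (Suc k)\<bar>" for k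
  proof -
    have "X (Suc k) = (X k + t k / 2) / 2 + t k / 4 - t (Suc k) / 2"
      by (simp add: X_def field_simps)
    then have "t (Suc k) - t k = X k - 2 * X (Suc k)" by (simp add: field_simps)
    moreover have "\<bar>t (Suc k) - t k\<bar> = \<bar>\<nu> - \<mu>\<bar>" by (simp add: t abs_minus_commute)
    ultimately show ?thesis by linarith
  qed
  have "real n * \<bar>\<nu> - \<mu>\<bar> \<le> 3 * K" for n
  proof -
    have "real n * \<bar>\<nu> - \<mu>\<bar> = (\<Sum>k<n. \<bar>\<nu> - \<mu>\<bar>)" by simp
    also have "\<dots> \<le> (\<Sum>k<n. \<bar>X k\<bar> + 2 * \<bar>X (Suc k)\<bar>)" by (intro sum_mono step)
    also have "\<dots> = (\<Sum>k<n. \<bar>X k\<bar>) + 2 * (\<Sum>k<n. \<bar>X (Suc k)\<bar>)"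
      by (simp add: sum.distrib sum_distrib_left)
    also have "(\<Sum>k<n. \<bar>X (Suc k)\<bar>) \<le> (\<Sum>k<Suc n. \<bar>X k\<bar>)"
      by (subst sum.lessThan_Suc_shift) simp
    finally show ?thesis using K[of n] K[of "Suc n"] unfolding X_def by linarith
  qed
  moreover obtain n where "3 * K < real n * \<bar>\<nu> - \<mu>\<bar>"
    using ne reals_Archimedean3[of "\<bar>\<nu> - \<mu>\<bar>"] by auto
  ultimately show False using not_less by blast
qed

text \<open>For w with values 0 and 1 the k-th summand indicates that the first zero of w occurs at
  k.\<close>

lemma sum_prod_first_minus:
  fixes w :: "nat \<Rightarrow> real"
  shows "(\<Sum>k<n. (\<Prod>j<k. w j) * (1 - w k)) = 1 - (\<Prod>j<n. w j)"
  by (induction n) (simp_all add: algebra_simps)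

context bounded_form
begin

lemma diff1: "step2 G \<Longrightarrow> step2 G' \<Longrightarrow> step2 F \<Longrightarrow> \<Phi> (\<lambda>x y. G x y - G' x y) F = \<Phi> G F - \<Phi> G' F"
  using add1[of G "\<lambda>x y. -1 * G' x y" F] cmult1[of G' F "-1"] step2_cmult[of G' "-1"] by simp

text \<open>The Riesz product over \<open>\<rho>\<^sub>i\<^sub>k \<otimes> \<sigma>\<^sub>j\<^sub>k\<close> has norm at most two, while the order in which
  \<open>\<rho>\<^sub>i\<^sub>k\<close> and \<open>\<sigma>\<^sub>j\<^sub>k\<close> were chosen alternates with \<open>k\<close>; as the martingale transforms of Riesz products are
  not bounded in \<open>L\<^sub>1\<close>, the two limits cannot differ.\<close>

lemma full_trace_swap_one: "full_trace \<phi> (\<lambda>_. 1) (\<lambda>_. 1) = full_trace (swap4 \<phi>) (\<lambda>_. 1) (\<lambda>_. 1)"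
proof -
  define \<mu> where "\<mu> = full_trace \<phi> (\<lambda>_. 1) (\<lambda>_. 1)"
  define \<nu> where "\<nu> = full_trace (swap4 \<phi>) (\<lambda>_. 1) (\<lambda>_. 1)"
  define t :: "nat \<Rightarrow> real" where "t k = (if even k then \<nu> else \<mu>)" for k
  \<comment> \<open>The multiplier of the martingale transform: the product over P is multiplied by
    the trace that the parity of its largest index selects.\<close>
  define T where "T P = (if P = {} then 0 else t (Max P))" for P :: "nat set"
  \<comment> \<open>The integral of the transformed Riesz product over the set where the factors
    with index below k equal 1 and the one with index k equals -1. The Riesz product without its
    constant term has norm at most 2, so these integrals are absolutely summable up to a small
    error.\<close>
  define X where "X k = (\<Sum>i<k. 2 ^ i * t i) / 2 ^ (k + 1) - t k / 2" for k
  have "(\<Sum>k<n. \<bar>X k\<bar>) \<le> 2 * C + 1" for n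
  proof -
    \<comment> \<open>The total error consists of n contributions of 2^n * 5 d each; this d keeps it
      at most one, also for n = 0.\<close>
    define d :: real where "d = 1 / (real n * 2 ^ n * 5 + 1)"
    have d: "d > 0" unfolding d_def by (intro divide_pos_pos add_nonneg_pos) auto
    obtain \<rho> \<sigma> where sys: "sign_system \<rho>" "sign_system \<sigma>"
      and gs: "\<And>r. good_sign \<phi> (sign_prod \<rho> ` Pow {..<r}) (sign_prod \<sigma> ` Pow {..<r}) d (\<rho> r)"
      and gt: "\<And>r. good_sign (swap4 \<phi>) (sign_prod \<sigma> ` Pow {..<r}) (sign_prod \<rho> ` Pow {..<Suc r}) d (\<sigma> r)"
      using sign_systems_exist[OF nice nice_swap, of "\<lambda>_. d"] d by blast
    interpret E: entry_arrays
      "\<lambda>A' A B' B. \<phi> (sign_prod \<rho> A') (sign_prod \<rho> A) (sign_prod \<sigma> B') (sign_prod \<sigma> B)"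
      "\<lambda>C B' B. partial_trace \<phi> (sign_prod \<rho> C) (sign_prod \<sigma> B') (sign_prod \<sigma> B)"
      "\<lambda>D A' A. partial_trace (swap4 \<phi>) (sign_prod \<sigma> D) (sign_prod \<rho> A') (sign_prod \<rho> A)"
      "\<lambda>C D. full_trace (swap4 \<phi>) (sign_prod \<sigma> D) (sign_prod \<rho> C)"
      "\<lambda>C D. full_trace \<phi> (sign_prod \<rho> C) (sign_prod \<sigma> D)" "\<lambda>_. d"
      using d by (intro entry_arrays_good_sign sys gs gt) simp
    \<comment> \<open>For even k the indices agree and \<sigma> was chosen last; for odd k the index
      i is larger and \<rho> was chosen last. Both sequences increase strictly, so the order of
      choice for a product over P depends on its largest element only.\<close>
    define i j :: "nat \<Rightarrow> nat" where "i k = 2 * k + k mod 2" and "j k = 2 * k" for k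
    have i_less: "i k < i l" if "k < l" for k l
    proof -
      have "k mod 2 < 2" by simp
      then show ?thesis using that unfolding i_def by linarith
    qed
    have ij: "strict_mono i" "strict_mono j"
      using i_less by (auto simp: strict_mono_def j_def)
    note inj = strict_mono_imp_inj_on[OF ij(1)] strict_mono_imp_inj_on[OF ij(2)]
    define x where "x k u v = \<rho> (i k) u * \<sigma> (j k) v" for k u v
    define xP where "xP P u v = sign_prod \<rho> (i ` P) u * sign_prod \<sigma> (j ` P) v" for P u v
    have xP: "xP P u v = (\<Prod>k\<in>P. x k u v)" for P u v
    proof -
      have "inj_on i P" "inj_on j P" using inj by (auto intro: inj_on_subset)
      then show ?thesis by (simp add: xP_def x_def sign_prod_def prod.reindex prod.distrib)
    qed
    have x1: "x k u v = 1 \<or> x k u v = -1" for k u v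
      using sign_system_abs[OF sys(1), of "i k" u] sign_system_abs[OF sys(2), of "j k" v] by (auto simp: x_def)
    have st: "step2 (xP P)" for P
      unfolding xP_def using sys by (intro step2_tensor loc_step[OF unit_bounded_sign_prod'])
    define e where "e P' P = \<Phi> (xP P') (xP P)" for P' P
    have e: "\<bar>e P' P - (if P' = P then T P else 0)\<bar> \<le> 5 * d" if fin: "finite P'" "finite P" and ne: "P \<noteq> {}" for P' P
    proof -
      let ?Q = "P' \<union> P"
      have mi: "Max (i ` P' \<union> i ` P) = i (Max ?Q)" "Max (j ` P' \<union> j ` P) = j (Max ?Q)"
        unfolding image_Un[symmetric] using fin ne ij
        by (simp_all add: mono_Max_commute strict_mono_mono)
      have cond: "Max (i ` P' \<union> i ` P) > Max (j ` P' \<union> j ` P) \<longleftrightarrow> odd (Max ?Q)"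
        unfolding mi by (simp add: i_def j_def odd_iff_mod_2_eq_one)
      define g where "g = (if odd (Max ?Q) then full_trace \<phi> (sign_prod \<rho> (sdiff (i ` P') (i ` P))) (sign_prod \<sigma> (sdiff (j ` P') (j ` P)))
         else full_trace (swap4 \<phi>) (sign_prod \<sigma> (sdiff (j ` P') (j ` P))) (sign_prod \<rho> (sdiff (i ` P') (i ` P))))"
      have "\<bar>e P' P - g\<bar> \<le> 4 * d"
        using E.M_order[of "i ` P'" "i ` P" "j ` P'" "j ` P" d] fin ne cond
        unfolding e_def xP_def \<phi>_def g_def by (simp split: if_splits)
      moreover have "\<bar>g - (if P' = P then T P else 0)\<bar> \<le> d"
      proof (cases "P' = P")
        case True
        then have "g = T P"
          using ne by (simp add: g_def T_def t_def \<nu>_def \<mu>_def)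
        then show ?thesis using True d by simp
      next
        case False
        then have "i ` P' \<noteq> i ` P" using inj(1) by (simp add: inj_image_eq_iff)
        then have "sdiff (i ` P') (i ` P) \<union> sdiff (j ` P') (j ` P) \<noteq> {}"
          by (simp add: sdiff_eq_empty)
        then have "\<bar>g\<bar> \<le> d"
          unfolding g_def using fin by (simp add: E.g_Max finite_sdiff)
        then show ?thesis using False by simp
      qed
      ultimately show ?thesis by linarith
    qed
    \<comment> \<open>The Riesz product without its constant term, because the estimate for
      \<open>e\<close> excludes P = {}.\<close>
    define F where "F = (\<lambda>u v. \<Sum>P\<in>Pow {..<n}. (if P = {} then 0 else 1) * xP P u v)"
    have stF: "step2 F" unfolding F_def by (intro step2_sum step2_cmult st)
    define c where "c k = sgn (X k)" for k
    \<comment> \<open>2^(k+1) times the indicator of the set where the first factor -1 occurs at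
      index k. Disjointness of these sets bounds G by one.\<close>
    define H where "H k = (\<lambda>u v. \<Sum>P\<in>Pow {..<k}. 1 * (xP P u v - xP (insert k P) u v))" for k
    have stH: "step2 (H k)" for k unfolding H_def by (intro step2_sum step2_cmult step2_diff st)
    define G where "G = (\<lambda>u v. \<Sum>k<n. (c k / 2 ^ (k + 1)) * H k u v)"
    have stG: "step2 G" unfolding G_def by (intro step2_sum step2_cmult stH)
    define L where "L k = (\<Sum>P'\<in>Pow {..<k}. \<Sum>P\<in>Pow {..<n}. (if P = {} then 0 else 1) * (e P' P - e (insert k P') P))" for k
    have "\<Phi> G F = (\<Sum>k<n. c k / 2 ^ (k + 1) * \<Phi> (H k) F)"
      unfolding G_def by (rule sum1) (auto intro: stH stF)
    also have "\<dots> = (\<Sum>k<n. c k / 2 ^ (k + 1) * L k)"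
    proof (intro sum.cong refl arg_cong2[where f = "(*)"])
      fix k
      have "\<Phi> (H k) F = (\<Sum>P'\<in>Pow {..<k}. 1 * \<Phi> (\<lambda>u v. xP P' u v - xP (insert k P') u v) F)"
        unfolding H_def by (rule sum1) (auto intro: step2_diff st stF)
      also have "\<dots> = L k"
        unfolding L_def
      proof (intro sum.cong refl)
        fix P'
        have ex: "\<Phi> (xP R) F = (\<Sum>P\<in>Pow {..<n}. (if P = {} then 0 else 1) * e R P)" for R
          unfolding F_def e_def by (rule sum2) (auto intro: st)
        show "1 * \<Phi> (\<lambda>u v. xP P' u v - xP (insert k P') u v) F
          = (\<Sum>P\<in>Pow {..<n}. (if P = {} then 0 else 1) * (e P' P - e (insert k P') P))"
          by (simp only: diff1[OF st st stF] ex mult_1 sum_subtractf right_diff_distrib)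
      qed
      finally show "\<Phi> (H k) F = L k" .
    qed
    finally have \<Phi>GF: "\<Phi> G F = (\<Sum>k<n. c k / 2 ^ (k + 1) * L k)" .
    have L: "\<bar>L k / 2 ^ (k + 1) - X k\<bar> \<le> 2 ^ n * (5 * d)" if k: "k < n" for k
    proof -
      have fin: "finite P" if "P \<subseteq> {..<m}" for P and m :: nat using that by (rule finite_subset) simp
      define D where "D P' = (\<Sum>P\<in>Pow {..<n}. (if P = {} then 0 else 1) * (e P' P - e (insert k P') P))" for P'
      have D: "\<bar>D P' - (T P' - t k)\<bar> \<le> 2 ^ n * (10 * d)" if P': "P' \<in> Pow {..<k}" for P'
      proof -
        have sub: "P' \<in> Pow {..<n}" "insert k P' \<in> Pow {..<n}" using P' k by auto
        have Tk: "T (insert k P') = t k"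
        proof -
          have "Max (insert k P') = k" using P' fin[of P' k] by (intro Max_eqI) (auto intro: less_imp_le)
          then show ?thesis by (simp add: T_def)
        qed
        have del: "(\<Sum>P\<in>Pow {..<n}. if R = P then T P else 0) = T R" if "R \<in> Pow {..<n}" for R
          using that by (subst sum.delta') auto
        have "(\<Sum>P\<in>Pow {..<n}. (if P = {} then 0 else 1) * ((if P' = P then T P else 0) - (if insert k P' = P then T P else 0)))
          = (\<Sum>P\<in>Pow {..<n}. (if P' = P then T P else 0) - (if insert k P' = P then T P else 0))"
          by (intro sum.cong refl) (auto simp: T_def)
        also have "\<dots> = T P' - t k"
          unfolding sum_subtractf del[OF sub(1)] del[OF sub(2)] Tk ..
        finally have "D P' - (T P' - t k) = (\<Sum>P\<in>Pow {..<n}. (if P = {} then 0 else 1) *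
            ((e P' P - e (insert k P') P) - ((if P' = P then T P else 0) - (if insert k P' = P then T P else 0))))"
          unfolding D_def by (simp only: right_diff_distrib sum_subtractf)
        also have "\<bar>\<dots>\<bar> \<le> (\<Sum>P\<in>Pow {..<n}. 10 * d)"
        proof (intro order_trans[OF sum_abs] sum_mono)
          fix P assume P: "P \<in> Pow {..<n}"
          show "\<bar>(if P = {} then 0 else 1) *
            ((e P' P - e (insert k P') P) - ((if P' = P then T P else 0) - (if insert k P' = P then T P else 0)))\<bar> \<le> 10 * d"
          proof (cases "P = {}")
            case False
            have "\<bar>e P' P - (if P' = P then T P else 0)\<bar> \<le> 5 * d"
              "\<bar>e (insert k P') P - (if insert k P' = P then T P else 0)\<bar> \<le> 5 * d"
              using P sub False by (intro e fin[of _ n]; simp)+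
            then show ?thesis using False by simp
          qed (use d in simp)
        qed
        finally show ?thesis by (simp add: card_Pow)
      qed
      have "L k - 2 ^ (k + 1) * X k = (\<Sum>P'\<in>Pow {..<k}. D P' - (T P' - t k))"
      proof -
        have "(\<Sum>P'\<in>Pow {..<k}. T P') = (\<Sum>i<k. 2 ^ i * t i)"
          unfolding T_def by (rule sum_Max_Pow)
        then have "2 ^ (k + 1) * X k = (\<Sum>P'\<in>Pow {..<k}. T P') - 2 ^ k * t k"
          unfolding X_def by (simp add: field_simps)
        moreover have "L k = (\<Sum>P'\<in>Pow {..<k}. D P')" by (simp only: L_def D_def)
        ultimately show ?thesis
          by (simp only: sum_subtractf sum_constant) (simp add: card_Pow)
      qed
      also have "\<bar>\<dots>\<bar> \<le> (\<Sum>P'\<in>Pow {..<k}. 2 ^ n * (10 * d))"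
        by (intro order_trans[OF sum_abs] sum_mono D)
      also have "\<dots> = 2 ^ (k + 1) * (2 ^ n * (5 * d))" by (simp add: card_Pow)
      finally have "\<bar>(L k - 2 ^ (k + 1) * X k) / 2 ^ (k + 1)\<bar> \<le> 2 ^ n * (5 * d)"
        by (simp add: abs_divide field_simps)
      then show ?thesis by (simp add: diff_divide_distrib)
    qed
    have "\<bar>G u v\<bar> \<le> 1" for u v
    proof -
      define w where "w k = (1 + x k u v) / 2" for k
      have w: "0 \<le> w k" "w k \<le> 1" for k using x1[of k u v] by (auto simp: w_def)
      have Hw: "H k u v / 2 ^ (k + 1) = (\<Prod>j<k. w j) * (1 - w k)" for k
      proof -
        have ins: "xP (insert k P) u v = x k u v * xP P u v" if "P \<in> Pow {..<k}" for P
        proof -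
          have "finite P" "k \<notin> P" using that by (auto intro: finite_subset)
          then show ?thesis by (simp add: xP)
        qed
        have "H k u v = (\<Sum>P\<in>Pow {..<k}. xP P u v * (1 - x k u v))"
          unfolding H_def by (intro sum.cong refl) (simp add: ins algebra_simps)
        also have "\<dots> = (\<Sum>P\<in>Pow {..<k}. prod (\<lambda>k. x k u v) P * prod (\<lambda>_. 1) ({..<k} - P)) * (1 - x k u v)"
          by (simp add: sum_distrib_right xP)
        also have "\<dots> = (\<Prod>j<k. x j u v + 1) * (1 - x k u v)"
          by (subst prod_add) auto
        also have "(\<Prod>j<k. x j u v + 1) = (\<Prod>j<k. 2 * w j)"
          by (intro prod.cong refl) (simp add: w_def field_simps)
        also have "\<dots> = 2 ^ k * (\<Prod>j<k. w j)" by (simp add: prod.distrib)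
        finally show ?thesis by (simp add: w_def field_simps)
      qed
      have "\<bar>G u v\<bar> \<le> (\<Sum>k<n. \<bar>c k * (H k u v / 2 ^ (k + 1))\<bar>)"
        unfolding G_def by (rule order_trans[OF sum_abs]) simp
      also have "\<dots> \<le> (\<Sum>k<n. (\<Prod>j<k. w j) * (1 - w k))"
      proof (rule sum_mono)
        fix k
        have nn: "0 \<le> (\<Prod>j<k. w j) * (1 - w k)" using w by (intro mult_nonneg_nonneg prod_nonneg) auto
        have "\<bar>c k\<bar> * ((\<Prod>j<k. w j) * (1 - w k)) \<le> 1 * ((\<Prod>j<k. w j) * (1 - w k))"
          using nn by (intro mult_right_mono) (auto simp: c_def abs_sgn_eq)
        then show "\<bar>c k * (H k u v / 2 ^ (k + 1))\<bar> \<le> (\<Prod>j<k. w j) * (1 - w k)"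
          unfolding Hw abs_mult[of "c k"] using nn by simp
      qed
      also have "\<dots> = 1 - (\<Prod>j<n. w j)" by (rule sum_prod_first_minus)
      also have "\<dots> \<le> 1" using w by (simp add: prod_nonneg)
      finally show ?thesis .
    qed
    then have G1: "\<bar>G u v\<bar> \<le> (if u \<inter> {..<0} = {} then 1 else 0)" for u v by simp
    obtain N0 where N0: "dep2 N0 F" using stF by (auto simp: step2_def)
    obtain m Y where m: "strict_mono m" "\<And>r. \<sigma> r = signed_rad (m r) (Y r)"
      using sign_system_levels[OF sys(2)] by metis
    define N where "N = N0 + Suc (m (j n))"
    \<comment> \<open>For fixed u every nonempty product of factors has mean zero in v. The
      nonnegative Riesz product thus has mean one, and removing its constant term adds at most
      one.\<close>
    have norm: "mixed_norm p N F \<le> 2"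
    proof (rule mixed_norm_le_const)
      fix u
      have Psum: "(\<Sum>P\<in>Pow {..<n}. xP P u v) = (\<Prod>k<n. x k u v + 1)" for v
      proof -
        have "(\<Prod>k<n. x k u v + 1) = (\<Sum>P\<in>Pow {..<n}. prod (\<lambda>k. x k u v) P * prod (\<lambda>_. 1) ({..<n} - P))"
          by (rule prod_add) simp
        then show ?thesis by (simp add: xP)
      qed
      have le: "\<bar>F u v\<bar> \<le> (\<Sum>P\<in>Pow {..<n}. xP P u v) + 1" for v
      proof -
        have "F u v = (\<Sum>P\<in>Pow {..<n}. xP P u v - (if P = {} then 1 else 0))"
          unfolding F_def by (intro sum.cong refl) (simp add: xP)
        also have "\<dots> = (\<Sum>P\<in>Pow {..<n}. xP P u v) - 1"
          unfolding sum_subtractf by (subst sum.delta) auto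
        finally have F: "F u v = (\<Sum>P\<in>Pow {..<n}. xP P u v) - 1" .
        have "0 \<le> (\<Sum>P\<in>Pow {..<n}. xP P u v)"
          unfolding Psum
        proof (rule prod_nonneg)
          fix k show "0 \<le> x k u v + 1" using x1[of k u v] by auto
        qed
        then show ?thesis using F by linarith
      qed
      have z: "avg {..<N} (\<lambda>v. xP P u v) = (if P = {} then 1 else 0)" if P: "P \<in> Pow {..<n}" for P
      proof (cases "P = {}")
        case False
        have fin: "finite (j ` P)" using P by (auto intro: finite_subset)
        have "Max (j ` P) < j n" using fin False P by (auto simp: j_def)
        then have "m (Max (j ` P)) < N" using strict_monoD[OF m(1)] by (auto simp: N_def intro: less_SucI trans_less_add2)
        then have "avg {..<N} (\<lambda>v. 1 * sign_prod \<sigma> (j ` P) v) = 0"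
          using False fin by (intro avg_sign_prod[OF m(2,1), of _ 0]) auto
        then show ?thesis using False unfolding xP_def avg_cmult by simp
      qed (simp add: xP)
      have "avg {..<N} (\<lambda>v. \<bar>F u v\<bar>) \<le> avg {..<N} (\<lambda>v. (\<Sum>P\<in>Pow {..<n}. xP P u v) + 1)"
        by (intro avg_mono le)
      also have "\<dots> = (\<Sum>P\<in>Pow {..<n}. if P = {} then 1 else 0) + 1"
        unfolding avg_add avg_sum by (simp add: z)
      also have "\<dots> = 2" by (subst sum.delta) auto
      finally show "avg {..<N} (\<lambda>v. \<bar>F u v\<bar>) \<le> 2" .
    qed (use p in auto)
    have "\<Phi> G F \<le> C * 2 powr (- (1 - 1 / p) * real 0) * mixed_norm p N F"
      by (rule order_trans[OF abs_ge_self bound[OF stG G1]]) (rule dep2_mono[OF N0], simp add: N_def)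
    also have "\<dots> \<le> C * 2" using norm C_nonneg by (simp add: mult_left_mono)
    finally have ub: "\<Phi> G F \<le> 2 * C" by simp
    have "(\<Sum>k<n. \<bar>X k\<bar>) = (\<Sum>k<n. c k * X k)"
      by (intro sum.cong refl) (simp add: c_def abs_sgn mult.commute)
    also have "\<dots> \<le> (\<Sum>k<n. c k / 2 ^ (k + 1) * L k + 2 ^ n * (5 * d))"
    proof (rule sum_mono)
      fix k assume "k \<in> {..<n}"
      then have Lk: "\<bar>L k / 2 ^ (k + 1) - X k\<bar> \<le> 2 ^ n * (5 * d)" using L by simp
      have "\<bar>c k * (L k / 2 ^ (k + 1) - X k)\<bar> \<le> 1 * \<bar>L k / 2 ^ (k + 1) - X k\<bar>"
        unfolding abs_mult by (intro mult_right_mono) (auto simp: c_def abs_sgn_eq)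
      also have "\<dots> \<le> 2 ^ n * (5 * d)" using Lk by simp
      finally have le: "\<bar>c k * (L k / 2 ^ (k + 1)) - c k * X k\<bar> \<le> 2 ^ n * (5 * d)"
        by (simp only: right_diff_distrib)
      have "z \<le> u + B" if "\<bar>u - z\<bar> \<le> B" for u z B :: real using that by linarith
      from this[OF le] show "c k * X k \<le> c k / 2 ^ (k + 1) * L k + 2 ^ n * (5 * d)" by simp
    qed
    also have "\<dots> = \<Phi> G F + real n * (2 ^ n * (5 * d))"
      unfolding \<Phi>GF by (simp add: sum.distrib)
    also have "\<dots> \<le> 2 * C + 1"
    proof -
      have "real n * (2 ^ n * (5 * d)) = (real n * 2 ^ n * 5) / (real n * 2 ^ n * 5 + 1)"
        by (simp add: d_def)
      also have "\<dots> \<le> 1" by (simp add: divide_le_eq_1 add_nonneg_pos)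
      finally show ?thesis using ub by linarith
    qed
    finally show ?thesis .
  qed
  then have "\<nu> = \<mu>"
    unfolding X_def by (intro alternating_eq[of t \<nu> \<mu> "2 * C + 1"]) (simp_all add: t_def)
  then show ?thesis by (simp add: \<nu>_def \<mu>_def)
qed

end

text \<open>Multiplication by f \<otimes> g does not increase the test function pointwise, so all
  bounds persist. This reduces the equality of traces with weights f and g to that with constant
  weights.\<close>

lemma (in bounded_form) bounded_form_mult:
  assumes f: "unit_bounded f" and g: "unit_bounded g"
  shows "bounded_form p C (\<lambda>G. \<Phi> (\<lambda>x y. f x * g y * G x y))"
proof -
  have st: "step2 (\<lambda>x y. f x * g y)" by (intro step2_tensor loc_step[OF f] loc_step[OF g])
  have le: "\<bar>f x * g y * G x y\<bar> \<le> \<bar>G x y\<bar>" for G :: "nat set \<Rightarrow> nat set \<Rightarrow> real" and x y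
  proof -
    have "\<bar>f x\<bar> * \<bar>g y\<bar> \<le> 1 * 1"
      using unit_bounded_bound[OF f] unit_bounded_bound[OF g] by (intro mult_mono) auto
    then have "\<bar>f x\<bar> * \<bar>g y\<bar> * \<bar>G x y\<bar> \<le> 1 * \<bar>G x y\<bar>" by (intro mult_right_mono) auto
    then show ?thesis by (simp add: abs_mult)
  qed
  show ?thesis
  proof
    show "1 < p" by (rule p)
    fix G G' F :: "nat set \<Rightarrow> nat set \<Rightarrow> real" and c
    {
      assume "step2 G" "step2 G'" "step2 F"
      then show "\<Phi> (\<lambda>x y. f x * g y * (G x y + G' x y)) F = \<Phi> (\<lambda>x y. f x * g y * G x y) F + \<Phi> (\<lambda>x y. f x * g y * G' x y) F"
        by (simp add: add1[symmetric] step2_mult[OF st] distrib_left)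
    next
      assume G: "step2 G" and F: "step2 F"
      have "(\<lambda>x y. f x * g y * (c * G x y)) = (\<lambda>x y. c * (f x * g y * G x y))"
        by (simp add: mult_ac)
      then show "\<Phi> (\<lambda>x y. f x * g y * (c * G x y)) F = c * \<Phi> (\<lambda>x y. f x * g y * G x y) F"
        by (simp only: cmult1[OF step2_mult[OF st G] F])
    next
      assume "step2 G" "step2 F" "step2 G'"
      then show "\<Phi> (\<lambda>x y. f x * g y * G x y) (\<lambda>x y. F x y + G' x y) = \<Phi> (\<lambda>x y. f x * g y * G x y) F + \<Phi> (\<lambda>x y. f x * g y * G x y) G'"
        by (intro add2 step2_mult[OF st])
    next
      assume "step2 G" "step2 F"
      then show "\<Phi> (\<lambda>x y. f x * g y * G x y) (\<lambda>x y. c * F x y) = c * \<Phi> (\<lambda>x y. f x * g y * G x y) F"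
        by (intro cmult2 step2_mult[OF st])
    next
      fix n a N assume "step2 G" "\<And>x y. \<bar>G x y\<bar> \<le> (if x \<inter> {..<n} = a then 1 else 0)" "dep2 N F"
      then show "\<bar>\<Phi> (\<lambda>x y. f x * g y * G x y) F\<bar> \<le> C * 2 powr (- (1 - 1 / p) * real n) * mixed_norm p N F"
        by (intro bound[of _ n a] step2_mult[OF st] order_trans[OF le])
    next
      fix \<epsilon> :: real assume "step2 F" "\<epsilon> > 0"
      from small[OF this]
      show "\<forall>\<^sub>F n in sequentially. \<forall>b G. step2 G \<longrightarrow>
        (\<forall>x y. \<bar>G x y\<bar> \<le> (if y \<inter> {..<n} = b then 1 else 0)) \<longrightarrow> \<bar>\<Phi> (\<lambda>x y. f x * g y * G x y) F\<bar> \<le> \<epsilon>"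
      proof eventually_elim
        case (elim n)
        show ?case
        proof (intro allI impI)
          fix b G assume G: "step2 G" and b: "\<forall>x y. \<bar>G x y\<bar> \<le> (if y \<inter> {..<n} = b then 1 else 0)"
          show "\<bar>\<Phi> (\<lambda>x y. f x * g y * G x y) F\<bar> \<le> \<epsilon>"
            by (rule elim[rule_format, OF step2_mult[OF st G]]) (rule order_trans[OF le b[rule_format]])
        qed
      qed
    }
  qed
qed

lemma (in bounded_form) full_trace_swap:
  assumes f: "unit_bounded f" and g: "unit_bounded g"
  shows "full_trace \<phi> f g = full_trace (swap4 \<phi>) g f"
proof -
  interpret M: bounded_form p C "\<lambda>G. \<Phi> (\<lambda>x y. f x * g y * G x y)"
    by (rule bounded_form_mult[OF f g])
  have M\<phi>: "M.\<phi> f' h g' k = \<phi> (\<lambda>x. f x * f' x) h (\<lambda>y. g y * g' y) k" for f' h g' k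
    unfolding M.\<phi>_def \<phi>_def by (simp only: mult_ac)
  have "partial_trace M.\<phi> (\<lambda>_. 1) (\<lambda>y. 1 * hcell n b y) k = partial_trace \<phi> f (\<lambda>y. g y * hcell n b y) k" for n b k
    unfolding partial_trace_def trace_form_def M\<phi> by simp
  then have 1: "full_trace M.\<phi> (\<lambda>_. 1) (\<lambda>_. 1) = full_trace \<phi> f g"
    unfolding full_trace_def trace_form_def by simp
  have "partial_trace (swap4 M.\<phi>) (\<lambda>_. 1) (\<lambda>y. 1 * hcell n b y) k = partial_trace (swap4 \<phi>) g (\<lambda>y. f y * hcell n b y) k" for n b k
    unfolding partial_trace_def trace_form_def swap4_def M\<phi> by simp
  then have 2: "full_trace (swap4 M.\<phi>) (\<lambda>_. 1) (\<lambda>_. 1) = full_trace (swap4 \<phi>) g f"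
    unfolding full_trace_def trace_form_def by simp
  show ?thesis using M.full_trace_swap_one unfolding 1 2 .
qed


section \<open>Holder's inequality for averages\<close>

lemma avg_holder:
  fixes f g :: "'a set \<Rightarrow> real"
  assumes fin: "finite X" and pq: "p > 1" "q > 1" "1 / p + 1 / q = 1"
    and nn: "\<And>Z. 0 \<le> f Z" "\<And>Z. 0 \<le> g Z"
  shows "avg X (\<lambda>Z. f Z * g Z) \<le> avg X (\<lambda>Z. f Z powr p) powr (1 / p) * avg X (\<lambda>Z. g Z powr q) powr (1 / q)"
proof -
  have zero: "u Z = 0" if "avg X (\<lambda>Z. u Z powr r) = 0" "Z \<subseteq> X" for u :: "'a set \<Rightarrow> real" and r Z
  proof -
    have "(\<Sum>Z\<in>Pow X. u Z powr r) = 0" using that(1) by (simp add: avg_def)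
    then have "\<forall>Z\<in>Pow X. u Z powr r = 0"
      using fin by (subst (asm) sum_nonneg_eq_0_iff) auto
    then show ?thesis using that(2) by simp
  qed
  have nnp: "0 \<le> avg X (\<lambda>Z. u Z powr r)" for u :: "'a set \<Rightarrow> real" and r
    by (intro avg_nonneg) simp
  define a where "a = avg X (\<lambda>Z. f Z powr p) powr (1 / p)"
  define b where "b = avg X (\<lambda>Z. g Z powr q) powr (1 / q)"
  show ?thesis
  proof (cases "avg X (\<lambda>Z. f Z powr p) = 0 \<or> avg X (\<lambda>Z. g Z powr q) = 0")
    case True
    then have "f Z * g Z = 0" if "Z \<subseteq> X" for Z using zero that by (metis mult_eq_0_iff)
    then have "avg X (\<lambda>Z. f Z * g Z) = avg X (\<lambda>_. 0)" by (rule avg_cong)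
    then show ?thesis using fin by simp
  next
    case False
    then have pos: "0 < avg X (\<lambda>Z. f Z powr p)" "0 < avg X (\<lambda>Z. g Z powr q)"
      using nnp[of f p] nnp[of g q] by auto
    then have ab: "a > 0" "b > 0" by (simp_all add: a_def b_def)
    have ap: "a powr p = avg X (\<lambda>Z. f Z powr p)" and bq: "b powr q = avg X (\<lambda>Z. g Z powr q)"
      using pos pq by (simp_all add: a_def b_def powr_powr)
    have "f Z * g Z \<le> (a * b / (p * a powr p)) * f Z powr p + (a * b / (q * b powr q)) * g Z powr q" for Z
    proof -
      have "(f Z / a) * (g Z / b) \<le> (f Z / a) powr p / p + (g Z / b) powr q / q"
        using ab nn by (intro Youngs_inequality pq) auto
      then have "a * b * ((f Z / a) * (g Z / b)) \<le> a * b * ((f Z / a) powr p / p + (g Z / b) powr q / q)"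
        using ab by (intro mult_left_mono) auto
      then show ?thesis using ab nn pq by (simp add: powr_divide field_simps)
    qed
    then have "avg X (\<lambda>Z. f Z * g Z) \<le> avg X (\<lambda>Z. (a * b / (p * a powr p)) * f Z powr p + (a * b / (q * b powr q)) * g Z powr q)"
      by (rule avg_mono)
    also have "\<dots> = a * b / (p * a powr p) * a powr p + a * b / (q * b powr q) * b powr q"
      unfolding avg_add avg_cmult ap bq ..
    also have "\<dots> = a * b * (1 / p + 1 / q)"
      using ab pq by (simp add: field_simps)
    finally show ?thesis using pq by (simp add: a_def b_def)
  qed
qed

lemma avg_powr_mean:
  fixes f :: "'a set \<Rightarrow> real"
  assumes "finite X" "p > 1" "\<And>Z. 0 \<le> f Z"
  shows "avg X f \<le> avg X (\<lambda>Z. f Z powr p) powr (1 / p)"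
proof -
  have "1 / p + 1 / (p / (p - 1)) = 1" using assms(2) by (simp add: field_simps)
  from avg_holder[OF assms(1,2) _ this assms(3), of "\<lambda>_. 1"] assms show ?thesis
    by (simp add: divide_less_eq less_divide_eq)
qed

lemma avg2_abs_le_mixed_norm:
  assumes "p > 1" shows "avg2 N (\<lambda>x y. \<bar>F x y\<bar>) \<le> mixed_norm p N F"
  unfolding avg2_def mixed_norm_def
  by (rule avg_powr_mean[OF _ assms]) (auto intro: avg_nonneg)


section \<open>Compression of a bounded form to a multiple of the identity\<close>

lemma sum_sdiff_reindex:
  assumes "A \<in> Pow {..<N}"
  shows "(\<Sum>A'\<in>Pow {..<N}. h A' (sdiff A' A)) = (\<Sum>C\<in>Pow {..<N}. h (sdiff A C) C)"
proof (rule sum.reindex_bij_witness[where i = "\<lambda>C. sdiff A C" and j = "\<lambda>A'. sdiff A' A"])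
  fix A' assume "A' \<in> Pow {..<N}"
  then show "sdiff A' A \<in> Pow {..<N}" using assms sdiff_sub[of A' "{..<N}" A] by auto
  show "sdiff A (sdiff A' A) = A'" by (auto simp: sdiff_def)
  then show "h (sdiff A (sdiff A' A)) (sdiff A' A) = h A' (sdiff A' A)" by simp
next
  fix C assume "C \<in> Pow {..<N}"
  then show "sdiff A C \<in> Pow {..<N}" using assms sdiff_sub[of A "{..<N}" C] by auto
  show "sdiff (sdiff A C) A = C" by (rule sdiff_sdiff)
qed

text \<open>The sum runs over the index of the first variable only and keeps B' and B fixed. What
  results is a pairing with a Walsh multiple of a partial coefficient of F, whose norm
  \<open>mixed_norm_partial_first\<close> compares with that of F.\<close>

lemma parseval_first:
  assumes F: "dep2 N F" and C: "C \<subseteq> {..<N}" and B: "B \<subseteq> {..<N}" "B' \<subseteq> {..<N}"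
  shows "(\<Sum>A\<in>Pow {..<N}. coef N G (sdiff A C) B' * coef N F A B)
    = avg2 N (\<lambda>x y. G x y * (walsh C x * walsh B' y * avg {..<N} (\<lambda>y. F x y * walsh B y)))"
proof -
  define h where "h x = avg {..<N} (\<lambda>y. F x y * walsh B y)" for x
  have d: "dep N h"
    unfolding dep_def h_def using dep2_section'[OF F] by (simp add: dep_def)
  have hc: "avg {..<N} (\<lambda>x. h x * walsh A x) = coef N F A B" for A
    unfolding h_def coef_def avg2_def avg_mult_const[symmetric] by (simp add: mult_ac)
  have "G x y * (walsh C x * walsh B' y * h x)
      = (\<Sum>A\<in>Pow {..<N}. G x y * (walsh (sdiff A C) x * walsh B' y) * coef N F A B)" for x y
  proof -
    have "G x y * (walsh C x * walsh B' y * h x)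
        = (\<Sum>A\<in>Pow {..<N}. G x y * (walsh C x * walsh B' y * (coef N F A B * walsh A x)))"
      by (subst walsh_expand[OF d, symmetric]) (simp only: sum_distrib_left hc)
    also have "\<dots> = (\<Sum>A\<in>Pow {..<N}. G x y * (walsh (sdiff A C) x * walsh B' y) * coef N F A B)"
    proof (intro sum.cong refl)
      fix A assume "A \<in> Pow {..<N}"
      then have "finite A" "finite C" using C by (auto intro: finite_subset)
      then have "walsh (sdiff A C) x = walsh A x * walsh C x" using walsh_mult by simp
      then show "G x y * (walsh C x * walsh B' y * (coef N F A B * walsh A x))
          = G x y * (walsh (sdiff A C) x * walsh B' y) * coef N F A B" by (simp only: mult_ac)
    qed
    finally show ?thesis .
  qed
  then show ?thesis
    unfolding h_def[symmetric] by (simp only: avg2_sum avg2_mult_const coef_def)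
qed

lemma parseval_second:
  assumes F: "dep2 N F" and D: "D \<subseteq> {..<N}" and A: "A \<subseteq> {..<N}" "A' \<subseteq> {..<N}"
  shows "(\<Sum>B\<in>Pow {..<N}. coef N G A' (sdiff B D) * coef N F A B)
    = avg2 N (\<lambda>x y. G x y * (walsh A' x * walsh D y * avg {..<N} (\<lambda>x. F x y * walsh A x)))"
proof -
  define h where "h y = avg {..<N} (\<lambda>x. F x y * walsh A x)" for y
  have d: "dep N h"
    unfolding dep_def h_def using dep2_section[OF F] by (simp add: dep_def)
  have hc: "avg {..<N} (\<lambda>y. h y * walsh B y) = coef N F A B" for B
    unfolding h_def coef_def avg2_swap avg_mult_const[symmetric] by (simp add: mult_ac)
  have "G x y * (walsh A' x * walsh D y * h y)
      = (\<Sum>B\<in>Pow {..<N}. G x y * (walsh A' x * walsh (sdiff B D) y) * coef N F A B)" for x y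
  proof -
    have "G x y * (walsh A' x * walsh D y * h y)
        = (\<Sum>B\<in>Pow {..<N}. G x y * (walsh A' x * walsh D y * (coef N F A B * walsh B y)))"
      by (subst walsh_expand[OF d, symmetric]) (simp only: sum_distrib_left hc)
    also have "\<dots> = (\<Sum>B\<in>Pow {..<N}. G x y * (walsh A' x * walsh (sdiff B D) y) * coef N F A B)"
    proof (intro sum.cong refl)
      fix B assume "B \<in> Pow {..<N}"
      then have "finite B" "finite D" using D by (auto intro: finite_subset)
      then have "walsh (sdiff B D) y = walsh B y * walsh D y" using walsh_mult by simp
      then show "G x y * (walsh A' x * walsh D y * (coef N F A B * walsh B y))
          = G x y * (walsh A' x * walsh (sdiff B D) y) * coef N F A B" by (simp only: mult_ac)
    qed
    finally show ?thesis .
  qed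
  then show ?thesis
    unfolding h_def[symmetric] by (simp only: avg2_sum avg2_mult_const coef_def)
qed

lemma mixed_norm_partial_first:
  assumes "p > 0"
  shows "mixed_norm p N (\<lambda>x y. walsh C x * walsh B' y * avg {..<N} (\<lambda>y. F x y * walsh B y)) \<le> mixed_norm p N F"
  unfolding mixed_norm_def[of p N F]
proof (rule mixed_norm_le[OF assms])
  fix x
  have "\<bar>avg {..<N} (\<lambda>y. F x y * walsh B y)\<bar> \<le> avg {..<N} (\<lambda>y. \<bar>F x y\<bar>)"
    by (rule order_trans[OF abs_avg_le]) (simp add: abs_mult)
  then show "avg {..<N} (\<lambda>y. \<bar>walsh C x * walsh B' y * avg {..<N} (\<lambda>y. F x y * walsh B y)\<bar>) \<le> avg {..<N} (\<lambda>y. \<bar>F x y\<bar>)"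
    by (simp add: abs_mult)
qed

text \<open>After integrating in s, the function depends on t alone up to sign, so its mixed norm is
  an L_1 norm. This is at most the L_1 norm of F on the square, hence at most its mixed
  norm.\<close>

lemma mixed_norm_partial_second:
  assumes "p > 1"
  shows "mixed_norm p N (\<lambda>x y. walsh A' x * walsh D y * avg {..<N} (\<lambda>x. F x y * walsh A x)) \<le> mixed_norm p N F"
proof (rule mixed_norm_le_const)
  fix x
  have "avg {..<N} (\<lambda>y. \<bar>walsh A' x * walsh D y * avg {..<N} (\<lambda>x. F x y * walsh A x)\<bar>)
      \<le> avg {..<N} (\<lambda>y. avg {..<N} (\<lambda>x. \<bar>F x y\<bar>))"
  proof (rule avg_mono)
    fix y
    have "\<bar>avg {..<N} (\<lambda>x. F x y * walsh A x)\<bar> \<le> avg {..<N} (\<lambda>x. \<bar>F x y\<bar>)"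
      by (rule order_trans[OF abs_avg_le]) (simp add: abs_mult)
    then show "\<bar>walsh A' x * walsh D y * avg {..<N} (\<lambda>x. F x y * walsh A x)\<bar> \<le> avg {..<N} (\<lambda>x. \<bar>F x y\<bar>)"
      by (simp add: abs_mult)
  qed
  also have "\<dots> \<le> mixed_norm p N F"
    unfolding avg2_swap[symmetric] by (rule avg2_abs_le_mixed_norm[OF assms])
  finally show "avg {..<N} (\<lambda>y. \<bar>walsh A' x * walsh D y * avg {..<N} (\<lambda>x. F x y * walsh A x)\<bar>) \<le> mixed_norm p N F" .
qed (use assms in auto)

lemma mixed_norm_walsh_mult: "mixed_norm p N (\<lambda>x y. walsh C x * walsh D y * F x y) = mixed_norm p N F"
  by (simp add: mixed_norm_def abs_mult)

definition compose_signs ::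
  "(nat \<Rightarrow> nat set \<Rightarrow> real) \<Rightarrow> (nat \<Rightarrow> nat set \<Rightarrow> real) \<Rightarrow> (nat set \<Rightarrow> nat set \<Rightarrow> real) \<Rightarrow> nat set \<Rightarrow> nat set \<Rightarrow> real" where
  "compose_signs \<rho> \<sigma> F x y = F (sign_map \<rho> x) (sign_map \<sigma> y)"

lemma compose_signs_expand:
  assumes "sign_system \<rho>" "sign_system \<sigma>" "dep2 N F"
  shows "compose_signs \<rho> \<sigma> F = (\<lambda>x y. \<Sum>z\<in>Pow {..<N} \<times> Pow {..<N}.
    coef N F (fst z) (snd z) * (sign_prod \<rho> (fst z) x * sign_prod \<sigma> (snd z) y))"
proof (intro ext)
  fix x y
  show "compose_signs \<rho> \<sigma> F x y = (\<Sum>z\<in>Pow {..<N} \<times> Pow {..<N}.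
    coef N F (fst z) (snd z) * (sign_prod \<rho> (fst z) x * sign_prod \<sigma> (snd z) y))"
    unfolding compose_signs_def walsh_expand2[OF assms(3), of "sign_map \<rho> x"] sign_prod_walsh[OF assms(1)] sign_prod_walsh[OF assms(2)]
    by (simp add: sum.cartesian_product case_prod_unfold)
qed

text \<open>These are the step functions in the span of the tensors of Haar functions.\<close>

definition mean_zero :: "nat \<Rightarrow> (nat set \<Rightarrow> nat set \<Rightarrow> real) \<Rightarrow> bool" where
  "mean_zero N F \<longleftrightarrow> dep2 N F \<and> (\<forall>A. coef N F A {} = 0 \<and> coef N F {} A = 0)"

text \<open>Items with empty index set are set apart, as they have no largest index.\<close>

lemma sum_delta_Max_le:
  fixes U :: "'a \<Rightarrow> nat set" and \<epsilon> :: real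
  assumes fin: "finite I" and U: "\<And>X. X \<in> I \<Longrightarrow> U X \<subseteq> {..<N}" and \<epsilon>: "\<epsilon> \<ge> 0"
    and c: "\<And>r. card {X \<in> I. U X \<subseteq> {..r}} \<le> 16 ^ Suc r"
  shows "(\<Sum>X\<in>I. if U X = {} then 0 else \<epsilon> / 32 ^ Suc (Max (U X))) \<le> \<epsilon>"
proof -
  let ?J = "{X \<in> I. U X \<noteq> {}}"
  have "(\<Sum>X\<in>I. if U X = {} then 0 else \<epsilon> / 32 ^ Suc (Max (U X))) = (\<Sum>X\<in>?J. \<epsilon> / 32 ^ Suc (Max (U X)))"
    using fin by (intro sum.mono_neutral_cong_right) auto
  also have "\<dots> \<le> (\<Sum>r<N. real (card {X \<in> ?J. U X \<subseteq> {..r}}) * (\<epsilon> / 32 ^ Suc r))"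
    using fin U \<epsilon> by (intro sum_Max_le) auto
  also have "\<dots> \<le> \<epsilon>"
  proof (rule sum_weights_le[OF \<epsilon>])
    fix r
    have "card {X \<in> ?J. U X \<subseteq> {..r}} \<le> card {X \<in> I. U X \<subseteq> {..r}}"
      using fin by (intro card_mono) auto
    also note c[of r]
    finally show "real (card {X \<in> ?J. U X \<subseteq> {..r}}) \<le> 16 ^ Suc r"
      by (simp only: of_nat_le_iff[of _ "16 ^ Suc r", where 'a = real, symmetric] of_nat_power of_nat_numeral)
  qed
  finally show ?thesis .
qed

theorem (in bounded_form) form_compression:
  assumes \<epsilon>: "\<epsilon> > 0"
  shows "\<exists>\<rho> \<sigma>. sign_system \<rho> \<and> sign_system \<sigma> \<and>
    (\<forall>N k G F. mean_zero N G \<longrightarrow> mean_zero N F \<longrightarrow> 0 \<le> k \<longrightarrow>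
      (\<forall>F'. dep2 N F' \<longrightarrow> \<bar>avg2 N (\<lambda>x y. G x y * F' x y)\<bar> \<le> k * mixed_norm p N F') \<longrightarrow>
      \<bar>\<Phi> (compose_signs \<rho> \<sigma> G) (compose_signs \<rho> \<sigma> F)
        - full_trace \<phi> (\<lambda>_. 1) (\<lambda>_. 1) * avg2 N (\<lambda>x y. G x y * F x y)\<bar> \<le> \<epsilon> * (k * mixed_norm p N F))"
proof -
  \<comment> \<open>The estimates E1 to E4 below contribute 4, 1, 2 and 2 multiples of
    \<epsilon>'.\<close>
  define \<epsilon>' where "\<epsilon>' = \<epsilon> / 9"
  have \<epsilon>': "\<epsilon>' > 0" using \<epsilon> by (simp add: \<epsilon>'_def)
  define \<delta> where "\<delta> r = \<epsilon>' / 32 ^ Suc r" for r :: nat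
  have \<delta>: "\<delta> r > 0" for r using \<epsilon>' by (simp add: \<delta>_def)
  obtain \<rho> \<sigma> where sys: "sign_system \<rho>" "sign_system \<sigma>"
    and gs: "\<And>r. good_sign \<phi> (sign_prod \<rho> ` Pow {..<r}) (sign_prod \<sigma> ` Pow {..<r}) (\<delta> r) (\<rho> r)"
    and gt: "\<And>r. good_sign (swap4 \<phi>) (sign_prod \<sigma> ` Pow {..<r}) (sign_prod \<rho> ` Pow {..<Suc r}) (\<delta> r) (\<sigma> r)"
    using sign_systems_exist[OF nice nice_swap, of \<delta>] \<delta> by blast
  define M where "M A' A B' B = \<phi> (sign_prod \<rho> A') (sign_prod \<rho> A) (sign_prod \<sigma> B') (sign_prod \<sigma> B)" for A' A B' B
  define V where "V C B' B = partial_trace \<phi> (sign_prod \<rho> C) (sign_prod \<sigma> B') (sign_prod \<sigma> B)" for C B' B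
  define W where "W D A' A = partial_trace (swap4 \<phi>) (sign_prod \<sigma> D) (sign_prod \<rho> A') (sign_prod \<rho> A)" for D A' A
  define g where "g C D = full_trace \<phi> (sign_prod \<rho> C) (sign_prod \<sigma> D)" for C D
  have g1: "full_trace (swap4 \<phi>) (sign_prod \<sigma> D) (sign_prod \<rho> C) = g C D" for C D
    unfolding g_def using sys by (intro full_trace_swap[symmetric] unit_bounded_sign_prod')
  have "entry_arrays M V W (\<lambda>C D. full_trace (swap4 \<phi>) (sign_prod \<sigma> D) (sign_prod \<rho> C)) g \<delta>"
    unfolding M_def V_def W_def g_def
    using \<delta> by (intro entry_arrays_good_sign sys gs gt) (simp add: less_imp_le)
  then interpret E: entry_arrays M V W g g \<delta> unfolding g1 .
  define v where "v C B' B = V C B' B - g C (sdiff B' B)" for C B' B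
  define w where "w D A' A = W D A' A - g (sdiff A' A) D" for D A' A
  have main: "\<bar>\<Phi> (compose_signs \<rho> \<sigma> G) (compose_signs \<rho> \<sigma> F)
        - full_trace \<phi> (\<lambda>_. 1) (\<lambda>_. 1) * avg2 N (\<lambda>x y. G x y * F x y)\<bar> \<le> \<epsilon> * (k * mixed_norm p N F)"
    if G: "mean_zero N G" and F: "mean_zero N F" and k: "0 \<le> k"
      and dual: "\<And>F'. dep2 N F' \<Longrightarrow> \<bar>avg2 N (\<lambda>x y. G x y * F' x y)\<bar> \<le> k * mixed_norm p N F'" for N k G F
  proof -
    define I where "I = Pow {..<N}"
    have finI: "finite I" by (simp add: I_def)
    have fin: "finite A" if "A \<in> I" for A using that unfolding I_def by (auto intro: finite_subset)
    have sub: "A \<subseteq> {..<N}" if "A \<in> I" for A using that by (simp add: I_def)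
    define a where "a = coef N G"
    define f where "f = coef N F"
    define Q where "Q = k * mixed_norm p N F"
    have Q0: "0 \<le> Q" using k by (simp add: Q_def)
    have dF: "dep2 N F" and dG: "dep2 N G" using F G by (auto simp: mean_zero_def)
    \<comment> \<open>In E1, E3 and E4 these coefficients remove the terms whose index sets are all
      empty, for which there is no largest index to estimate by.\<close>
    have a0: "a A {} = 0" "a {} A = 0" and f0: "f A {} = 0" "f {} A = 0" for A
      using F G by (auto simp: mean_zero_def a_def f_def)
    have dW: "dep2 N (\<lambda>x y. walsh A x * walsh B y)" if "A \<in> I" "B \<in> I" for A B
      using sub that by (intro dep2_tensor dep_walsh)
    have abs_a: "\<bar>a A B\<bar> \<le> k" if "A \<in> I" "B \<in> I" for A B
    proof -
      have "mixed_norm p N (\<lambda>x y. walsh A x * walsh B y) = 1" by (simp add: mixed_norm_def abs_mult)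
      then show ?thesis using dual[OF dW[OF that]] unfolding a_def coef_def by simp
    qed
    have abs_f: "\<bar>f A B\<bar> \<le> mixed_norm p N F" for A B
    proof -
      have "\<bar>f A B\<bar> \<le> avg2 N (\<lambda>x y. \<bar>F x y * (walsh A x * walsh B y)\<bar>)"
        unfolding f_def coef_def by (rule abs_avg2_le)
      also have "\<dots> = avg2 N (\<lambda>x y. \<bar>F x y\<bar>)" by (simp add: abs_mult)
      also have "\<dots> \<le> mixed_norm p N F" by (rule avg2_abs_le_mixed_norm[OF p])
      finally show ?thesis .
    qed
    have af: "\<bar>a A' B' * f A B\<bar> \<le> Q" if "A' \<in> I" "B' \<in> I" for A' B' A B
      unfolding Q_def abs_mult using abs_a[OF that] abs_f k by (intro mult_mono) auto
    define S where "S h = (\<Sum>A'\<in>I. \<Sum>A\<in>I. \<Sum>B'\<in>I. \<Sum>B\<in>I. a A' B' * f A B * h A' A B' B)" for h :: "nat set \<Rightarrow> nat set \<Rightarrow> nat set \<Rightarrow> nat set \<Rightarrow> real"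
    have S_add: "S (\<lambda>A' A B' B. h A' A B' B + h' A' A B' B) = S h + S h'" for h h'
      unfolding S_def by (simp only: distrib_left sum.distrib)
    have \<Phi>S: "\<Phi> (compose_signs \<rho> \<sigma> G) (compose_signs \<rho> \<sigma> F) = S M"
    proof -
      define J where "J = I \<times> I"
      have finJ: "finite J" using finI by (simp add: J_def)
      define U where "U z = (\<lambda>x y. sign_prod \<rho> (fst z) x * sign_prod \<sigma> (snd z) y)" for z
      have stU: "step2 (U z)" for z
        unfolding U_def using sys by (intro step2_tensor loc_step[OF unit_bounded_sign_prod'])
      have eG: "compose_signs \<rho> \<sigma> G = (\<lambda>x y. \<Sum>z\<in>J. a (fst z) (snd z) * U z x y)"
        unfolding compose_signs_expand[OF sys dG] J_def I_def a_def U_def ..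
      have eF: "compose_signs \<rho> \<sigma> F = (\<lambda>x y. \<Sum>z\<in>J. f (fst z) (snd z) * U z x y)"
        unfolding compose_signs_expand[OF sys dF] J_def I_def f_def U_def ..
      have stF: "step2 (compose_signs \<rho> \<sigma> F)"
        unfolding eF by (intro step2_sum step2_cmult stU)
      have "\<Phi> (compose_signs \<rho> \<sigma> G) (compose_signs \<rho> \<sigma> F) = (\<Sum>z'\<in>J. a (fst z') (snd z') * \<Phi> (U z') (compose_signs \<rho> \<sigma> F))"
        unfolding eG by (rule sum1[OF finJ stU stF])
      also have "\<dots> = (\<Sum>z'\<in>J. a (fst z') (snd z') * (\<Sum>z\<in>J. f (fst z) (snd z) * \<Phi> (U z') (U z)))"
        unfolding eF by (simp only: sum2[OF finJ stU stU])
      also have "\<dots> = (\<Sum>z'\<in>J. \<Sum>z\<in>J. a (fst z') (snd z') * f (fst z) (snd z) * M (fst z') (fst z) (snd z') (snd z))"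
        unfolding M_def \<phi>_def U_def by (simp only: sum_distrib_left mult.assoc)
      also have "\<dots> = (\<Sum>A'\<in>I. \<Sum>B'\<in>I. \<Sum>A\<in>I. \<Sum>B\<in>I. a A' B' * f A B * M A' A B' B)"
        unfolding J_def by (simp add: sum.cartesian_product' )
      also have "\<dots> = S M"
        unfolding S_def by (rule sum.cong[OF refl], rule sum.swap)
      finally show ?thesis .
    qed
    define err where "err A' A B' B = M A' A B' B - (g (sdiff A' A) (sdiff B' B) + (v (sdiff A' A) B' B + w (sdiff B' B) A' A))" for A' A B' B
    have "S M = S (\<lambda>A' A B' B. err A' A B' B + (g (sdiff A' A) (sdiff B' B) + (v (sdiff A' A) B' B + w (sdiff B' B) A' A)))"
      by (simp add: err_def)
    also have "\<dots> = S err + (S (\<lambda>A' A B' B. g (sdiff A' A) (sdiff B' B)) + (S (\<lambda>A' A B' B. v (sdiff A' A) B' B)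
        + S (\<lambda>A' A B' B. w (sdiff B' B) A' A)))"
      by (simp only: S_add)
    finally have SM: "S M = \<dots>" .
    have card4: "card {X \<in> I \<times> I \<times> I \<times> I. U X \<subseteq> {..r}} \<le> 16 ^ Suc r"
      if "\<And>A B C D. U (A, B, C, D) = A \<union> B \<union> C \<union> D" for U r
    proof -
      have "{X \<in> I \<times> I \<times> I \<times> I. U X \<subseteq> {..r}} \<subseteq> Pow {..r} \<times> Pow {..r} \<times> Pow {..r} \<times> Pow {..r}"
        using that by auto
      from card_mono[OF _ this] show ?thesis unfolding card_Pow_tuples by simp
    qed
    have card3: "card {X \<in> I \<times> I \<times> I. U X \<subseteq> {..r}} \<le> 16 ^ Suc r"
      if "\<And>A B C. U (A, B, C) = A \<union> B \<union> C" for U r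
    proof -
      have "{X \<in> I \<times> I \<times> I. U X \<subseteq> {..r}} \<subseteq> Pow {..r} \<times> Pow {..r} \<times> Pow {..r}"
        using that by auto
      from card_mono[OF _ this] have "card {X \<in> I \<times> I \<times> I. U X \<subseteq> {..r}} \<le> 8 ^ Suc r"
        unfolding card_Pow_tuples by simp
      also have "\<dots> \<le> (16 :: nat) ^ Suc r" by (intro power_mono) auto
      finally show ?thesis .
    qed
    have card2: "card {X \<in> I \<times> I. U X \<subseteq> {..r}} \<le> 16 ^ Suc r"
      if "\<And>A B. U (A, B) = A \<union> B" for U r
    proof -
      have "{X \<in> I \<times> I. U X \<subseteq> {..r}} \<subseteq> Pow {..r} \<times> Pow {..r}"
        using that by auto
      from card_mono[OF _ this] have "card {X \<in> I \<times> I. U X \<subseteq> {..r}} \<le> 4 ^ Suc r"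
        unfolding card_Pow_tuples by simp
      also have "\<dots> \<le> (16 :: nat) ^ Suc r" by (intro power_mono) auto
      finally show ?thesis .
    qed
    \<comment> \<open>The remainder is small in terms of all four index sets, so absolute values
      suffice: the products of coefficients are bounded by Q and the weights pay for the number of
      quadruples.\<close>
    have E1: "\<bar>S err\<bar> \<le> 4 * Q * \<epsilon>'"
    proof -
      define U where "U = (\<lambda>(A', A, B', B). A' \<union> A \<union> B' \<union> (B :: nat set))"
      have "\<bar>S err\<bar> \<le> (\<Sum>A'\<in>I. \<Sum>A\<in>I. \<Sum>B'\<in>I. \<Sum>B\<in>I. \<bar>a A' B' * f A B * err A' A B' B\<bar>)"
        unfolding S_def by (intro order_trans[OF sum_abs] sum_mono order_refl)
      also have "\<dots> \<le> (\<Sum>A'\<in>I. \<Sum>A\<in>I. \<Sum>B'\<in>I. \<Sum>B\<in>I. 4 * Q * (if U (A', A, B', B) = {} then 0 else \<delta> (Max (U (A', A, B', B)))))"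
      proof (intro sum_mono)
        fix A' A B' B assume A: "A' \<in> I" "A \<in> I" "B' \<in> I" "B \<in> I"
        show "\<bar>a A' B' * f A B * err A' A B' B\<bar> \<le> 4 * Q * (if U (A', A, B', B) = {} then 0 else \<delta> (Max (U (A', A, B', B))))"
        proof (cases "U (A', A, B', B) = {}")
          case True
          then show ?thesis by (simp add: U_def a0)
        next
          case False
          have "\<bar>err A' A B' B\<bar> \<le> 4 * \<delta> (Max (U (A', A, B', B)))"
            unfolding err_def v_def w_def U_def split add.assoc[symmetric]
            using False A by (intro E.M_Max fin refl) (simp_all add: U_def)
          then have "\<bar>a A' B' * f A B\<bar> * \<bar>err A' A B' B\<bar> \<le> Q * (4 * \<delta> (Max (U (A', A, B', B))))"
            using af[OF A(1,3)] Q0 by (intro mult_mono) auto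
          then show ?thesis using False by (simp add: abs_mult)
        qed
      qed
      also have "\<dots> = 4 * Q * (\<Sum>X\<in>I \<times> I \<times> I \<times> I. if U X = {} then 0 else \<delta> (Max (U X)))"
        by (simp only: sum_distrib_left sum.cartesian_product')
      also have "\<dots> \<le> 4 * Q * \<epsilon>'"
        unfolding \<delta>_def using finI sub \<epsilon>' Q0
        by (intro mult_left_mono sum_delta_Max_le[where N = N] card4) (auto simp: U_def dest!: sub)
      finally show ?thesis .
    qed
    have sum4_C: "(\<Sum>A'\<in>I. \<Sum>A\<in>I. h A' A (sdiff A' A)) = (\<Sum>C\<in>I. \<Sum>A\<in>I. h (sdiff A C) A C)" for h :: "nat set \<Rightarrow> nat set \<Rightarrow> nat set \<Rightarrow> real"
    proof -
      have "(\<Sum>A'\<in>I. \<Sum>A\<in>I. h A' A (sdiff A' A)) = (\<Sum>A\<in>I. \<Sum>A'\<in>I. h A' A (sdiff A' A))"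
        by (rule sum.swap)
      also have "\<dots> = (\<Sum>A\<in>I. \<Sum>C\<in>I. h (sdiff A C) A C)"
        unfolding I_def by (intro sum.cong refl sum_sdiff_reindex[where h = "\<lambda>A' C. h A' _ C"])
      also have "\<dots> = (\<Sum>C\<in>I. \<Sum>A\<in>I. h (sdiff A C) A C)" by (rule sum.swap)
      finally show ?thesis .
    qed
    \<comment> \<open>The inner sums over indices with given symmetric differences are pairings of G
      with Walsh multiples of F, which have the norm of F. The pair of empty differences yields the
      multiple of the identity.\<close>
    have E2: "\<bar>S (\<lambda>A' A B' B. g (sdiff A' A) (sdiff B' B)) - g {} {} * avg2 N (\<lambda>x y. G x y * F x y)\<bar> \<le> Q * \<epsilon>'"
    proof -
      define U where "U = (\<lambda>(C, D). C \<union> (D :: nat set))"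
      define H where "H C D = avg2 N (\<lambda>x y. G x y * (walsh C x * walsh D y * F x y))" for C D
      have "S (\<lambda>A' A B' B. g (sdiff A' A) (sdiff B' B))
          = (\<Sum>C\<in>I. \<Sum>A\<in>I. \<Sum>B'\<in>I. \<Sum>B\<in>I. a (sdiff A C) B' * f A B * g C (sdiff B' B))"
        unfolding S_def by (rule sum4_C[where h = "\<lambda>A' A C. \<Sum>B'\<in>I. \<Sum>B\<in>I. a A' B' * f A B * g C (sdiff B' B)"])
      also have "\<dots> = (\<Sum>C\<in>I. \<Sum>A\<in>I. \<Sum>D\<in>I. \<Sum>B\<in>I. a (sdiff A C) (sdiff B D) * f A B * g C D)"
        by (rule sum.cong[OF refl], rule sum.cong[OF refl], rule sum4_C[where h = "\<lambda>B' B D. a _ B' * f _ B * g _ D"])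
      also have "\<dots> = (\<Sum>C\<in>I. \<Sum>D\<in>I. \<Sum>A\<in>I. \<Sum>B\<in>I. a (sdiff A C) (sdiff B D) * f A B * g C D)"
        by (rule sum.cong[OF refl], rule sum.swap)
      also have "\<dots> = (\<Sum>C\<in>I. \<Sum>D\<in>I. H C D * g C D)"
      proof (intro sum.cong refl)
        fix C D assume "C \<in> I" "D \<in> I"
        from parseval_mult[OF dF sub[OF this(1)] sub[OF this(2)], of G]
        show "(\<Sum>A\<in>I. \<Sum>B\<in>I. a (sdiff A C) (sdiff B D) * f A B * g C D) = H C D * g C D"
          unfolding H_def a_def f_def I_def by (simp only: sum_distrib_right)
      qed
      also have "\<dots> = (\<Sum>X\<in>I \<times> I. H (fst X) (snd X) * g (fst X) (snd X))"
        by (simp add: sum.cartesian_product case_prod_unfold)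
      finally have eq: "S (\<lambda>A' A B' B. g (sdiff A' A) (sdiff B' B)) = (\<Sum>X\<in>I \<times> I. H (fst X) (snd X) * g (fst X) (snd X))" .
      have e0: "g {} {} * avg2 N (\<lambda>x y. G x y * F x y) = (\<Sum>X\<in>I \<times> I. if X = ({}, {}) then H {} {} * g {} {} else 0)"
        using finI by (subst sum.delta) (auto simp: H_def I_def mult.commute)
      have "\<bar>S (\<lambda>A' A B' B. g (sdiff A' A) (sdiff B' B)) - g {} {} * avg2 N (\<lambda>x y. G x y * F x y)\<bar>
          \<le> (\<Sum>X\<in>I \<times> I. \<bar>H (fst X) (snd X) * g (fst X) (snd X) - (if X = ({}, {}) then H {} {} * g {} {} else 0)\<bar>)"
        unfolding eq e0 sum_subtractf[symmetric] by (rule sum_abs)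
      also have "\<dots> \<le> (\<Sum>X\<in>I \<times> I. Q * (if U X = {} then 0 else \<delta> (Max (U X))))"
      proof (rule sum_mono)
        fix X assume "X \<in> I \<times> I"
        then obtain C D where X: "X = (C, D)" and CD: "C \<in> I" "D \<in> I" by auto
        show "\<bar>H (fst X) (snd X) * g (fst X) (snd X) - (if X = ({}, {}) then H {} {} * g {} {} else 0)\<bar>
          \<le> Q * (if U X = {} then 0 else \<delta> (Max (U X)))"
        proof (cases "C = {} \<and> D = {}")
          case True
          then show ?thesis by (simp add: X U_def)
        next
          case False
          have "dep2 N (\<lambda>x y. walsh C x * walsh D y * F x y)"
            by (intro dep2_mult dW CD dF)
          from dual[OF this] have "\<bar>H C D\<bar> \<le> Q"
            unfolding H_def mixed_norm_walsh_mult Q_def .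
          moreover have "\<bar>g C D\<bar> \<le> \<delta> (Max (C \<union> D))"
            using False by (intro E.g_Max fin CD) auto
          ultimately have "\<bar>H C D\<bar> * \<bar>g C D\<bar> \<le> Q * \<delta> (Max (C \<union> D))"
            using Q0 by (intro mult_mono) auto
          then show ?thesis using False by (auto simp: X U_def abs_mult)
        qed
      qed
      also have "\<dots> = Q * (\<Sum>X\<in>I \<times> I. if U X = {} then 0 else \<delta> (Max (U X)))"
        by (simp only: sum_distrib_left)
      also have "\<dots> \<le> Q * \<epsilon>'"
        unfolding \<delta>_def using finI \<epsilon>' Q0
        by (intro mult_left_mono sum_delta_Max_le[where N = N] card2) (auto simp: U_def dest!: sub)
      finally show ?thesis .
    qed
    \<comment> \<open>Here smallness is available only in terms of C, B' and B. The sum over A is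
      therefore carried out, as a pairing, before absolute values are taken.\<close>
    have E3: "\<bar>S (\<lambda>A' A B' B. v (sdiff A' A) B' B)\<bar> \<le> 2 * Q * \<epsilon>'"
    proof -
      define U where "U = (\<lambda>(C, B', B). C \<union> B' \<union> (B :: nat set))"
      define H where "H C B' B = (\<Sum>A\<in>I. a (sdiff A C) B' * f A B)" for C B' B
      have "S (\<lambda>A' A B' B. v (sdiff A' A) B' B)
          = (\<Sum>C\<in>I. \<Sum>A\<in>I. \<Sum>B'\<in>I. \<Sum>B\<in>I. a (sdiff A C) B' * f A B * v C B' B)"
        unfolding S_def by (rule sum4_C[where h = "\<lambda>A' A C. \<Sum>B'\<in>I. \<Sum>B\<in>I. a A' B' * f A B * v C B' B"])
      also have "\<dots> = (\<Sum>C\<in>I. \<Sum>B'\<in>I. \<Sum>A\<in>I. \<Sum>B\<in>I. a (sdiff A C) B' * f A B * v C B' B)"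
        by (rule sum.cong[OF refl], rule sum.swap)
      also have "\<dots> = (\<Sum>C\<in>I. \<Sum>B'\<in>I. \<Sum>B\<in>I. \<Sum>A\<in>I. a (sdiff A C) B' * f A B * v C B' B)"
        by (rule sum.cong[OF refl], rule sum.cong[OF refl], rule sum.swap)
      also have "\<dots> = (\<Sum>C\<in>I. \<Sum>B'\<in>I. \<Sum>B\<in>I. H C B' B * v C B' B)"
        unfolding H_def by (simp only: sum_distrib_right)
      finally have "\<bar>S (\<lambda>A' A B' B. v (sdiff A' A) B' B)\<bar> \<le> (\<Sum>C\<in>I. \<Sum>B'\<in>I. \<Sum>B\<in>I. \<bar>H C B' B * v C B' B\<bar>)"
        by (simp only:) (intro order_trans[OF sum_abs] sum_mono order_refl)
      also have "\<dots> \<le> (\<Sum>C\<in>I. \<Sum>B'\<in>I. \<Sum>B\<in>I. 2 * Q * (if U (C, B', B) = {} then 0 else \<delta> (Max (U (C, B', B)))))"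
      proof (intro sum_mono)
        fix C B' B assume I: "C \<in> I" "B' \<in> I" "B \<in> I"
        show "\<bar>H C B' B * v C B' B\<bar> \<le> 2 * Q * (if U (C, B', B) = {} then 0 else \<delta> (Max (U (C, B', B))))"
        proof (cases "U (C, B', B) = {}")
          case True
          then show ?thesis by (simp add: U_def H_def a0)
        next
          case False
          have "H C B' B = avg2 N (\<lambda>x y. G x y * (walsh C x * walsh B' y * avg {..<N} (\<lambda>y. F x y * walsh B y)))"
            unfolding H_def a_def f_def I_def by (rule parseval_first[OF dF sub[OF I(1)] sub[OF I(3)] sub[OF I(2)]])
          also have "\<bar>\<dots>\<bar> \<le> k * mixed_norm p N (\<lambda>x y. walsh C x * walsh B' y * avg {..<N} (\<lambda>y. F x y * walsh B y))"
          proof (rule dual)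
            have "dep N (\<lambda>x. avg {..<N} (\<lambda>y. F x y * walsh B y))"
              using dep2_section'[OF dF] by (simp add: dep_def)
            then have "dep2 N (\<lambda>x y. avg {..<N} (\<lambda>y. F x y * walsh B y) * 1)"
              by (intro dep2_tensor) simp_all
            then show "dep2 N (\<lambda>x y. walsh C x * walsh B' y * avg {..<N} (\<lambda>y. F x y * walsh B y))"
              by (intro dep2_mult dW I) simp
          qed
          also have "\<dots> \<le> Q" unfolding Q_def using p k by (intro mult_left_mono mixed_norm_partial_first) auto
          finally have "\<bar>H C B' B\<bar> \<le> Q" .
          moreover have "\<bar>v C B' B\<bar> \<le> 2 * \<delta> (Max (C \<union> B' \<union> B))"
            unfolding v_def using False I by (intro E.V_Max fin) (auto simp: U_def)
          ultimately have "\<bar>H C B' B\<bar> * \<bar>v C B' B\<bar> \<le> Q * (2 * \<delta> (Max (C \<union> B' \<union> B)))"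
            using Q0 by (intro mult_mono) auto
          then show ?thesis unfolding if_not_P[OF False] abs_mult by (simp add: U_def)
        qed
      qed
      also have "\<dots> = 2 * Q * (\<Sum>X\<in>I \<times> I \<times> I. if U X = {} then 0 else \<delta> (Max (U X)))"
        by (simp only: sum_distrib_left sum.cartesian_product')
      also have "\<dots> \<le> 2 * Q * \<epsilon>'"
        unfolding \<delta>_def using finI \<epsilon>' Q0
        by (intro mult_left_mono sum_delta_Max_le[where N = N] card3) (auto simp: U_def dest!: sub)
      finally show ?thesis .
    qed
    \<comment> \<open>The mirror image: w is small in terms of A', A and D, and the sum over B is
      carried out first.\<close>
    have E4: "\<bar>S (\<lambda>A' A B' B. w (sdiff B' B) A' A)\<bar> \<le> 2 * Q * \<epsilon>'"
    proof -
      define U where "U = (\<lambda>(A', A, D). A' \<union> A \<union> (D :: nat set))"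
      define H where "H A' A D = (\<Sum>B\<in>I. a A' (sdiff B D) * f A B)" for A' A D
      have "S (\<lambda>A' A B' B. w (sdiff B' B) A' A)
          = (\<Sum>A'\<in>I. \<Sum>A\<in>I. \<Sum>D\<in>I. \<Sum>B\<in>I. a A' (sdiff B D) * f A B * w D A' A)"
        unfolding S_def by (rule sum.cong[OF refl], rule sum.cong[OF refl], rule sum4_C[where h = "\<lambda>B' B D. a _ B' * f _ B * w D _ _"])
      also have "\<dots> = (\<Sum>A'\<in>I. \<Sum>A\<in>I. \<Sum>D\<in>I. H A' A D * w D A' A)"
        unfolding H_def by (simp only: sum_distrib_right)
      finally have "\<bar>S (\<lambda>A' A B' B. w (sdiff B' B) A' A)\<bar> \<le> (\<Sum>A'\<in>I. \<Sum>A\<in>I. \<Sum>D\<in>I. \<bar>H A' A D * w D A' A\<bar>)"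
        by (simp only:) (intro order_trans[OF sum_abs] sum_mono order_refl)
      also have "\<dots> \<le> (\<Sum>A'\<in>I. \<Sum>A\<in>I. \<Sum>D\<in>I. 2 * Q * (if U (A', A, D) = {} then 0 else \<delta> (Max (U (A', A, D)))))"
      proof (intro sum_mono)
        fix A' A D assume I: "A' \<in> I" "A \<in> I" "D \<in> I"
        show "\<bar>H A' A D * w D A' A\<bar> \<le> 2 * Q * (if U (A', A, D) = {} then 0 else \<delta> (Max (U (A', A, D))))"
        proof (cases "U (A', A, D) = {}")
          case True
          then show ?thesis by (simp add: U_def H_def a0)
        next
          case False
          have "H A' A D = avg2 N (\<lambda>x y. G x y * (walsh A' x * walsh D y * avg {..<N} (\<lambda>x. F x y * walsh A x)))"
            unfolding H_def a_def f_def I_def by (rule parseval_second[OF dF sub[OF I(3)] sub[OF I(2)] sub[OF I(1)]])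
          also have "\<bar>\<dots>\<bar> \<le> k * mixed_norm p N (\<lambda>x y. walsh A' x * walsh D y * avg {..<N} (\<lambda>x. F x y * walsh A x))"
          proof (rule dual)
            have "dep N (\<lambda>y. avg {..<N} (\<lambda>x. F x y * walsh A x))"
              using dep2_section[OF dF] by (simp add: dep_def)
            then have "dep2 N (\<lambda>x y. 1 * avg {..<N} (\<lambda>x. F x y * walsh A x))"
              by (intro dep2_tensor) simp_all
            then show "dep2 N (\<lambda>x y. walsh A' x * walsh D y * avg {..<N} (\<lambda>x. F x y * walsh A x))"
              by (intro dep2_mult dW I) simp
          qed
          also have "\<dots> \<le> Q" unfolding Q_def using p k by (intro mult_left_mono mixed_norm_partial_second) auto
          finally have "\<bar>H A' A D\<bar> \<le> Q" .
          moreover have "\<bar>w D A' A\<bar> \<le> 2 * \<delta> (Max (A' \<union> A \<union> D))"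
            unfolding w_def using False I by (intro E.W_Max fin) (auto simp: U_def)
          ultimately have "\<bar>H A' A D\<bar> * \<bar>w D A' A\<bar> \<le> Q * (2 * \<delta> (Max (A' \<union> A \<union> D)))"
            using Q0 by (intro mult_mono) auto
          then show ?thesis unfolding if_not_P[OF False] abs_mult by (simp add: U_def)
        qed
      qed
      also have "\<dots> = 2 * Q * (\<Sum>X\<in>I \<times> I \<times> I. if U X = {} then 0 else \<delta> (Max (U X)))"
        by (simp only: sum_distrib_left sum.cartesian_product')
      also have "\<dots> \<le> 2 * Q * \<epsilon>'"
        unfolding \<delta>_def using finI \<epsilon>' Q0
        by (intro mult_left_mono sum_delta_Max_le[where N = N] card3) (auto simp: U_def dest!: sub)
      finally show ?thesis .
    qed
    have c: "g {} {} = full_trace \<phi> (\<lambda>_. 1) (\<lambda>_. 1)" by (simp add: g_def)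
    have "4 * Q * \<epsilon>' + Q * \<epsilon>' + 2 * Q * \<epsilon>' + 2 * Q * \<epsilon>' = \<epsilon> * Q" by (simp add: \<epsilon>'_def)
    then show ?thesis
      using E1 E2 E3 E4 unfolding \<Phi>S SM c Q_def[symmetric] by linarith
  qed
  show ?thesis
    using sys main by blast
qed


section \<open>Binary digits and dyadic intervals\<close>

text \<open>For s in [0,1) these are the positions of the ones in the binary expansion that does not
  end in ones. At s = 1 no bit is set.\<close>

definition bits :: "real \<Rightarrow> nat set" where
  "bits s = {n. odd \<lfloor>2 ^ Suc n * s\<rfloor>}"

text \<open>The digits are read with the most significant one first, so that
  \<open>dyadic n (cell_index n a)\<close> consists of the points whose first n digits are those of
  a.\<close>

fun cell_index :: "nat \<Rightarrow> nat set \<Rightarrow> nat" where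
  "cell_index 0 a = 0"
| "cell_index (Suc n) a = 2 * cell_index n a + (if n \<in> a then 1 else 0)"

lemma cell_index_Int: "cell_index n (a \<inter> {..<m}) = cell_index n a" if "n \<le> m"
  using that by (induction n) auto

lemma cell_index_cong: "a \<inter> {..<n} = b \<inter> {..<n} \<Longrightarrow> cell_index n a = cell_index n b"
  by (metis cell_index_Int order_refl)

lemma cell_index_less: "cell_index n a < 2 ^ n"
  by (induction n) auto

lemma cell_index_inj: "cell_index n a = cell_index n b \<Longrightarrow> a \<inter> {..<n} = b \<inter> {..<n}"
proof (induction n)
  case (Suc n)
  have o: "odd (cell_index (Suc n) c) \<longleftrightarrow> n \<in> c" for c by simp
  have n: "n \<in> a \<longleftrightarrow> n \<in> b" using o[of a] o[of b] unfolding Suc.prems by blast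
  then have "cell_index n a = cell_index n b" using Suc.prems by (simp split: if_splits)
  then have "a \<inter> {..<n} = b \<inter> {..<n}" by (rule Suc.IH)
  then show ?case using n by (auto simp: lessThan_Suc)
qed simp

lemma cell_index_bij: "bij_betw (cell_index n) (Pow {..<n}) {..<2 ^ n}"
proof -
  have inj: "inj_on (cell_index n) (Pow {..<n})"
  proof (rule inj_onI)
    fix a b assume "a \<in> Pow {..<n}" "b \<in> Pow {..<n}" "cell_index n a = cell_index n b"
    then show "a = b" using cell_index_inj[of n a b] by (simp add: Int_absorb2)
  qed
  have "card (cell_index n ` Pow {..<n}) = card {..<(2::nat) ^ n}"
    by (simp add: card_image[OF inj] card_Pow)
  moreover have "cell_index n ` Pow {..<n} \<subseteq> {..<2 ^ n}" using cell_index_less by auto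
  ultimately have "cell_index n ` Pow {..<n} = {..<2 ^ n}" by (intro card_subset_eq) auto
  then show ?thesis using inj by (simp add: bij_betw_def)
qed

lemma floor_bits:
  assumes "0 \<le> s" "s < 1"
  shows "\<lfloor>2 ^ n * s\<rfloor> = int (cell_index n (bits s))"
proof (induction n)
  case 0
  then show ?case using assms by (simp add: floor_eq_iff)
next
  case (Suc n)
  let ?k = "\<lfloor>2 ^ n * s\<rfloor>" and ?l = "\<lfloor>2 ^ Suc n * s\<rfloor>"
  have "\<lfloor>2 * u\<rfloor> = 2 * \<lfloor>u\<rfloor> \<or> \<lfloor>2 * u\<rfloor> = 2 * \<lfloor>u\<rfloor> + 1" for u :: real by linarith
  from this[of "2 ^ n * s"] have "?l = 2 * ?k \<or> ?l = 2 * ?k + 1" by (simp add: mult.assoc)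
  then have "?l = 2 * ?k + (if odd ?l then 1 else 0)" by auto
  also have "odd ?l \<longleftrightarrow> n \<in> bits s" by (simp add: bits_def)
  finally show ?case using Suc by simp
qed

lemma dyadic_iff_bits:
  assumes s: "0 \<le> s" "s < 1"
  shows "s \<in> dyadic n (cell_index n a) \<longleftrightarrow> bits s \<inter> {..<n} = a \<inter> {..<n}"
proof -
  have "s \<in> dyadic n (cell_index n a) \<longleftrightarrow> \<lfloor>2 ^ n * s\<rfloor> = int (cell_index n a)"
    by (auto simp: dyadic_def floor_eq_iff field_simps)
  also have "\<dots> \<longleftrightarrow> cell_index n (bits s) = cell_index n a"
    by (simp add: floor_bits[OF s])
  also have "\<dots> \<longleftrightarrow> bits s \<inter> {..<n} = a \<inter> {..<n}"
    by (rule iffI[OF cell_index_inj cell_index_cong])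
  finally show ?thesis .
qed

text \<open>The left, positive child of a cell of level n is the part where the digit at position n
  is 0, in agreement with \<open>sg\<close>.\<close>

lemma haar_bits:
  assumes s: "0 \<le> s" "s < 1" and a: "a \<subseteq> {..<n}"
  shows "haar n (cell_index n a) s = hcell n a (bits s)"
proof -
  have na: "n \<notin> a" using a by auto
  have 1: "s \<in> dyadic (n + 1) (2 * cell_index n a) \<longleftrightarrow> bits s \<inter> {..<Suc n} = a \<inter> {..<Suc n}"
    using dyadic_iff_bits[OF s, of "Suc n" a] na by simp
  have "cell_index n (insert n a) = cell_index n a"
    by (rule cell_index_cong) auto
  then have 2: "s \<in> dyadic (n + 1) (2 * cell_index n a + 1) \<longleftrightarrow> bits s \<inter> {..<Suc n} = insert n a \<inter> {..<Suc n}"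
    using dyadic_iff_bits[OF s, of "Suc n" "insert n a"] by simp
  have "bits s \<inter> {..<Suc n} = a \<inter> {..<Suc n} \<longleftrightarrow> bits s \<inter> {..<n} = a \<and> n \<notin> bits s"
    "bits s \<inter> {..<Suc n} = insert n a \<inter> {..<Suc n} \<longleftrightarrow> bits s \<inter> {..<n} = a \<and> n \<in> bits s"
    using a na by (auto simp: lessThan_Suc)
  then show ?thesis
    unfolding haar_def indicator_def using 1 2 by (auto simp: hcell_def sg_def)
qed

lemma sets_bits: "{s \<in> space unit_leb. n \<in> bits s} \<in> sets unit_leb"
proof -
  have "(\<lambda>s::real. 2 ^ Suc n * s) \<in> borel_measurable unit_leb"
    by (intro measurable_restrict_space1 measurable_completion) measurable
  then have "(\<lambda>s::real. \<lfloor>2 ^ Suc n * s\<rfloor>) \<in> measurable unit_leb (count_space UNIV)"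
    by (rule measurable_compose[OF _ measurable_real_floor])
  from measurable_sets[OF this, of "{k. odd k}"] show ?thesis
    by (simp add: bits_def vimage_def Int_def conj_commute)
qed

lemma simple_function_bits: "simple_function unit_leb (\<lambda>s. h (bits s \<inter> {..<N}))"
proof -
  have "simple_function unit_leb (\<lambda>s. bits s \<inter> {..<N})"
    unfolding simple_function_def
  proof (intro conjI ballI)
    have "(\<lambda>s. bits s \<inter> {..<N}) ` space unit_leb \<subseteq> Pow {..<N}" by auto
    then show "finite ((\<lambda>s. bits s \<inter> {..<N}) ` space unit_leb)"
      by (rule finite_subset) simp
    fix a assume "a \<in> (\<lambda>s. bits s \<inter> {..<N}) ` space unit_leb"
    then have a: "a \<subseteq> {..<N}" by auto
    have "{s \<in> space unit_leb. (n \<in> bits s) = (n \<in> a)} \<in> sets unit_leb" for n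
    proof (cases "n \<in> a")
      case False
      have "{s \<in> space unit_leb. n \<notin> bits s} = space unit_leb - {s \<in> space unit_leb. n \<in> bits s}" by auto
      also have "\<dots> \<in> sets unit_leb" by (intro sets.compl_sets sets_bits)
      finally show ?thesis using False by simp
    next
      case True
      then show ?thesis using sets_bits[of n] by simp
    qed
    then have "{s \<in> space unit_leb. \<forall>n\<in>{..<N}. (n \<in> bits s) = (n \<in> a)} \<in> sets unit_leb"
      by (intro sets.sets_Collect_finite_All) auto
    also have "{s \<in> space unit_leb. \<forall>n\<in>{..<N}. (n \<in> bits s) = (n \<in> a)}
        = (\<lambda>s. bits s \<inter> {..<N}) -` {a} \<inter> space unit_leb"
      using a by auto
    finally show "(\<lambda>s. bits s \<inter> {..<N}) -` {a} \<inter> space unit_leb \<in> sets unit_leb" .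
  qed
  from simple_function_compose1[OF this, of h] show ?thesis .
qed

lemma simple_function_dep_bits:
  assumes "dep N f" shows "simple_function unit_leb (\<lambda>s. f (bits s))"
proof -
  have "(\<lambda>s. f (bits s)) = (\<lambda>s. f (bits s \<inter> {..<N}))"
    using assms by (simp add: dep_def)
  then show ?thesis using simple_function_bits[of f N] by simp
qed

lemma AE_unit_leb_less_1: "AE s in unit_leb. 0 \<le> s \<and> s < 1"
proof -
  have "AE s in lebesgue. s \<noteq> (1::real)"
    by (rule AE_completion[OF AE_lborel_singleton])
  then have "AE s in unit_leb. s \<noteq> 1"
    by (subst AE_restrict_space_iff) (auto elim: eventually_mono)
  moreover have "AE s in unit_leb. s \<in> {0..1}"
    by (rule AE_I2) simp
  ultimately show ?thesis by eventually_elim auto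
qed

text \<open>Binary expansion carries Lebesgue measure to the uniform measure on digits: every cell
  of level N has measure 2^(-N).\<close>

lemma nn_integral_bits:
  assumes f: "dep N f" and nn: "\<And>x. 0 \<le> f x"
  shows "(\<integral>\<^sup>+ s. ennreal (f (bits s)) \<partial>unit_leb) = ennreal (avg {..<N} f)"
proof -
  let ?D = "\<lambda>a. dyadic N (cell_index N a)"
  have D: "?D a \<subseteq> {0..1}" for a
  proof
    fix s assume s: "s \<in> ?D a"
    have "real (cell_index N a) + 1 \<le> 2 ^ N"
      using cell_index_less[of N a] by (simp add: nat_less_real_le)
    then have "(real (cell_index N a) + 1) / 2 ^ N \<le> 1" by simp
    moreover have "0 \<le> real (cell_index N a) / 2 ^ N" by simp
    moreover have "real (cell_index N a) / 2 ^ N \<le> s" "s < (real (cell_index N a) + 1) / 2 ^ N"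
      using s by (simp_all add: dyadic_def)
    ultimately show "s \<in> {0..1}" unfolding atLeastAtMost_iff by linarith
  qed
  have Dm: "?D a \<in> sets unit_leb" for a
    using D[of a] by (auto simp: dyadic_def sets_restrict_space)
  have eD: "emeasure unit_leb (?D a) = ennreal (1 / 2 ^ N)" for a
  proof -
    have "emeasure unit_leb (?D a) = emeasure lebesgue (?D a)"
      using D by (intro emeasure_restrict_space) auto
    also have "\<dots> = ennreal (1 / 2 ^ N)"
      by (simp add: dyadic_def divide_right_mono diff_divide_distrib[symmetric])
    finally show ?thesis .
  qed
  have "(\<integral>\<^sup>+ s. ennreal (f (bits s)) \<partial>unit_leb)
      = (\<integral>\<^sup>+ s. (\<Sum>a\<in>Pow {..<N}. ennreal (f a) * indicator (?D a) s) \<partial>unit_leb)"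
  proof (rule nn_integral_cong_AE)
    show "AE s in unit_leb. ennreal (f (bits s)) = (\<Sum>a\<in>Pow {..<N}. ennreal (f a) * indicator (?D a) s)"
      using AE_unit_leb_less_1
    proof eventually_elim
      case (elim s)
      have "(\<Sum>a\<in>Pow {..<N}. ennreal (f a) * indicator (?D a) s)
          = (\<Sum>a\<in>Pow {..<N}. if a = bits s \<inter> {..<N} then ennreal (f a) else 0)"
        using elim by (intro sum.cong refl) (auto simp: indicator_def dyadic_iff_bits Int_absorb2)
      also have "\<dots> = ennreal (f (bits s \<inter> {..<N}))" by (subst sum.delta) auto
      finally show ?case using f by (simp add: dep_def)
    qed
  qed
  also have "\<dots> = (\<Sum>a\<in>Pow {..<N}. ennreal (f a) * emeasure unit_leb (?D a))"
    using Dm by (subst nn_integral_sum) (auto simp: nn_integral_cmult_indicator)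
  also have "\<dots> = (\<Sum>a\<in>Pow {..<N}. ennreal (f a * (1 / 2 ^ N)))"
    unfolding eD by (intro sum.cong refl ennreal_mult[symmetric] nn) simp
  also have "\<dots> = ennreal (\<Sum>a\<in>Pow {..<N}. f a * (1 / 2 ^ N))"
    using nn by (intro sum_ennreal) auto
  also have "(\<Sum>a\<in>Pow {..<N}. f a * (1 / 2 ^ N)) = avg {..<N} f"
    by (simp add: avg_def sum_divide_distrib)
  finally show ?thesis .
qed


section \<open>Step functions as elements of the Bochner space\<close>

definition embed1 :: "(nat set \<Rightarrow> real) \<Rightarrow> L1" where
  "embed1 g = Abs_L1 (abs_L0 (\<lambda>t. g (bits t)))"

definition embed :: "(nat set \<Rightarrow> nat set \<Rightarrow> real) \<Rightarrow> L1 L0" where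
  "embed F = abs_L0 (\<lambda>s. embed1 (F (bits s)))"

lemma strongly_measurable_bits: "dep N f \<Longrightarrow> strongly_measurable (\<lambda>s. f (bits s))"
  by (intro strongly_measurable_simple simple_function_dep_bits)

lemma Lp_integral_abs:
  "strongly_measurable f \<Longrightarrow> Lp_integral p (abs_L0 f) = (\<integral>\<^sup>+ s. ennreal (norm (f s) powr p) \<partial>unit_leb)"
  by (rule Lp_integral.abs_eq) simp

lemma embed1_Lp:
  assumes "dep N g"
  shows "Lp_integral 1 (abs_L0 (\<lambda>t. g (bits t))) = ennreal (avg {..<N} (\<lambda>y. \<bar>g y\<bar>))"
proof -
  have "Lp_integral 1 (abs_L0 (\<lambda>t. g (bits t))) = (\<integral>\<^sup>+ t. ennreal \<bar>g (bits t)\<bar> \<partial>unit_leb)"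
    by (subst Lp_integral_abs[OF strongly_measurable_bits[OF assms]]) simp
  also have "\<dots> = ennreal (avg {..<N} (\<lambda>y. \<bar>g y\<bar>))"
    using dep_compose[OF assms, of abs] by (intro nn_integral_bits) auto
  finally show ?thesis .
qed

lemma Rep_embed1:
  assumes "dep N g" shows "Rep_L1 (embed1 g) = abs_L0 (\<lambda>t. g (bits t))"
  unfolding embed1_def
  by (rule Abs_L1_inverse) (simp add: Lp_space_def embed1_Lp[OF assms])

lemma norm_embed1:
  assumes "dep N g" shows "norm (embed1 g) = avg {..<N} (\<lambda>y. \<bar>g y\<bar>)"
proof -
  have "0 \<le> avg {..<N} (\<lambda>y. \<bar>g y\<bar>)" by (rule avg_nonneg) simp
  then show ?thesis
    by (simp add: norm_L1.rep_eq Lp_norm_def Rep_embed1[OF assms] embed1_Lp[OF assms])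
qed

lemma embed1_add:
  assumes "dep N f" "dep N g"
  shows "embed1 (\<lambda>y. f y + g y) = embed1 f + embed1 g"
proof -
  have "Rep_L1 (embed1 (\<lambda>y. f y + g y)) = Rep_L1 (embed1 f + embed1 g)"
    unfolding plus_L1.rep_eq Rep_embed1[OF assms(1)] Rep_embed1[OF assms(2)] Rep_embed1[OF dep_add[OF assms]]
    by (subst plus_L0.abs_eq) (auto intro: strongly_measurable_bits assms)
  then show ?thesis by (simp add: Rep_L1_inject)
qed

lemma embed1_cmult:
  assumes "dep N f"
  shows "embed1 (\<lambda>y. c * f y) = c *\<^sub>R embed1 f"
proof -
  have "Rep_L1 (embed1 (\<lambda>y. c * f y)) = Rep_L1 (c *\<^sub>R embed1 f)"
    unfolding scaleR_L1.rep_eq Rep_embed1[OF assms] Rep_embed1[OF dep_compose[OF assms, of "\<lambda>u. c * u"]]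
    by (subst scaleR_L0.abs_eq) (auto intro: strongly_measurable_bits assms)
  then show ?thesis by (simp add: Rep_L1_inject)
qed

lemma dep_embed1:
  assumes "dep2 N F" shows "dep N (\<lambda>x. embed1 (F x))"
  using dep2_row[OF assms] by (simp add: dep_def)

lemma strongly_measurable_embed: "dep2 N F \<Longrightarrow> strongly_measurable (\<lambda>s. embed1 (F (bits s)))"
  by (rule strongly_measurable_bits[OF dep_embed1])

lemma Lp_integral_embed:
  assumes "dep2 N F"
  shows "Lp_integral p (embed F) = ennreal (avg {..<N} (\<lambda>x. avg {..<N} (\<lambda>y. \<bar>F x y\<bar>) powr p))"
proof -
  have d: "dep N (\<lambda>x. avg {..<N} (\<lambda>y. \<bar>F x y\<bar>) powr p)"
    using dep2_section'[OF assms] by (simp add: dep_def)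
  have "Lp_integral p (embed F) = (\<integral>\<^sup>+ s. ennreal (norm (embed1 (F (bits s))) powr p) \<partial>unit_leb)"
    unfolding embed_def by (rule Lp_integral_abs[OF strongly_measurable_embed[OF assms]])
  also have "\<dots> = (\<integral>\<^sup>+ s. ennreal (avg {..<N} (\<lambda>y. \<bar>F (bits s) y\<bar>) powr p) \<partial>unit_leb)"
    by (simp add: norm_embed1[OF dep2_section[OF assms]])
  also have "\<dots> = ennreal (avg {..<N} (\<lambda>x. avg {..<N} (\<lambda>y. \<bar>F x y\<bar>) powr p))"
    by (rule nn_integral_bits[OF d]) simp
  finally show ?thesis .
qed

lemma embed_Lp_space: "step2 F \<Longrightarrow> embed F \<in> Lp_space p"
  unfolding Lp_space_def step2_def using Lp_integral_embed by fastforce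

lemma Lp_norm_embed:
  assumes "dep2 N F" shows "Lp_norm p (embed F) = mixed_norm p N F"
proof -
  have "0 \<le> avg {..<N} (\<lambda>x. avg {..<N} (\<lambda>y. \<bar>F x y\<bar>) powr p)" by (rule avg_nonneg) simp
  then show ?thesis unfolding Lp_norm_def Lp_integral_embed[OF assms] mixed_norm_def by simp
qed

lemma embed_add:
  assumes "step2 F" "step2 G"
  shows "embed (\<lambda>x y. F x y + G x y) = embed F + embed G"
proof -
  obtain N where N: "dep2 N F" "dep2 N G" using step2_common[OF assms] by blast
  have "embed1 (\<lambda>y. F (bits s) y + G (bits s) y) = embed1 (F (bits s)) + embed1 (G (bits s))" for s
    by (rule embed1_add[OF dep2_section[OF N(1)] dep2_section[OF N(2)]])
  then show ?thesis
    unfolding embed_def by (subst plus_L0.abs_eq) (auto intro: strongly_measurable_embed N)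
qed

lemma embed_cmult:
  assumes "step2 F"
  shows "embed (\<lambda>x y. c * F x y) = c *\<^sub>R embed F"
proof -
  obtain N where N: "dep2 N F" using assms by (auto simp: step2_def)
  have "embed1 (\<lambda>y. c * F (bits s) y) = c *\<^sub>R embed1 (F (bits s))" for s
    by (rule embed1_cmult[OF dep2_section[OF N]])
  then show ?thesis
    unfolding embed_def by (subst scaleR_L0.abs_eq) (auto intro: strongly_measurable_embed N)
qed

lemma embed_diff:
  assumes "step2 F" "step2 G"
  shows "embed (\<lambda>x y. F x y - G x y) = embed F - embed G"
  using embed_add[OF assms(1) step2_cmult[OF assms(2)], of "-1"] embed_cmult[OF assms(2), of "-1"] by simp

lemma embed_zero: "embed (\<lambda>_ _. 0) = 0"
  using embed_cmult[OF step2_const[of 0], of 0] by simp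

lemma embed_sum:
  assumes "finite I" "\<And>i. i \<in> I \<Longrightarrow> step2 (H i)"
  shows "embed (\<lambda>x y. \<Sum>i\<in>I. c i * H i x y) = (\<Sum>i\<in>I. c i *\<^sub>R embed (H i))"
  using assms
proof (induction I rule: finite_induct)
  case (insert i I)
  have "step2 (\<lambda>x y. \<Sum>i\<in>I. c i * H i x y)"
    using insert by (intro step2_sum step2_cmult) auto
  then have "embed (\<lambda>x y. c i * H i x y + (\<Sum>i\<in>I. c i * H i x y)) = c i *\<^sub>R embed (H i) + embed (\<lambda>x y. \<Sum>i\<in>I. c i * H i x y)"
    using insert.prems by (simp add: embed_add embed_cmult step2_cmult)
  then show ?case using insert by simp
qed (simp add: embed_zero)

lemma abs_L0_eqI:
  "strongly_measurable f \<Longrightarrow> strongly_measurable g \<Longrightarrow> AE s in unit_leb. f s = g s \<Longrightarrow> abs_L0 f = abs_L0 g"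
  by (rule Quotient_rel_abs[OF Quotient_L0]) simp

text \<open>The point \<open>s = 1\<close>, where every Haar function vanishes but \<^term>\<open>hcell\<close> does not, is a null set.\<close>

lemma vector_valued_haar:
  assumes a: "a \<subseteq> {..<m}" and b: "b \<subseteq> {..<n}"
  shows "vector_valued (tensor (haar m (cell_index m a)) (haar n (cell_index n b)))
    = embed (\<lambda>x y. hcell m a x * hcell n b y)"
proof -
  let ?h = "haar m (cell_index m a)" and ?k = "haar n (cell_index n b)"
  have st: "step2 (\<lambda>x y. hcell m a x * hcell n b y)" by (intro step2_tensor step_fun_hcell)
  then obtain N where N: "dep2 N (\<lambda>x y. hcell m a x * hcell n b y)" by (auto simp: step2_def)
  have inner: "abs_L0 (\<lambda>t. ?h s * ?k t) = abs_L0 (\<lambda>t. hcell m a (bits s) * hcell n b (bits t))"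
    if s: "0 \<le> s" "s < 1" for s
  proof (rule abs_L0_eqI)
    show "AE t in unit_leb. ?h s * ?k t = hcell m a (bits s) * hcell n b (bits t)"
      using AE_unit_leb_less_1 by eventually_elim (simp add: haar_bits s a b)
    show "strongly_measurable (\<lambda>t. hcell m a (bits s) * hcell n b (bits t))"
      by (rule strongly_measurable_bits[OF dep2_section[OF N]])
    show "strongly_measurable (\<lambda>t. ?h s * ?k t)"
      by (intro strongly_measurable_simple simple_function_mult simple_function_const simple_function_haar)
  qed
  have "AE s in unit_leb. Abs_L1 (abs_L0 (\<lambda>t. tensor ?h ?k (s, t))) = embed1 (\<lambda>y. hcell m a (bits s) * hcell n b y)"
    using AE_unit_leb_less_1 by eventually_elim (simp add: tensor_def embed1_def inner)
  then show ?thesis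
    unfolding vector_valued_def embed_def
    by (intro abs_L0_eqI haar_tensor_measurable strongly_measurable_embed[OF N])
qed


section \<open>Centered step functions and the Haar span\<close>

lemma mean_zeroI:
  assumes F: "dep2 N F" and x: "\<And>y. avg {..<N} (\<lambda>x. F x y) = 0" and y: "\<And>x. avg {..<N} (F x) = 0"
  shows "mean_zero N F"
proof -
  have "coef N F A {} = 0" "coef N F {} A = 0" for A
  proof -
    have "coef N F A {} = avg {..<N} (\<lambda>x. walsh A x * avg {..<N} (F x))"
      unfolding coef_def avg2_def by (simp add: avg_cmult[symmetric] mult.commute)
    then show "coef N F A {} = 0" by (simp add: y)
    have "coef N F {} A = avg {..<N} (\<lambda>y. walsh A y * avg {..<N} (\<lambda>x. F x y))"
      unfolding coef_def avg2_swap by (simp add: avg_cmult[symmetric] mult.commute)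
    then show "coef N F {} A = 0" by (simp add: x)
  qed
  then show ?thesis using F by (simp add: mean_zero_def)
qed

lemma mean_zeroD:
  assumes "mean_zero N F"
  shows "dep2 N F" "avg {..<N} (\<lambda>x. F x y) = 0" "avg {..<N} (F x) = 0"
proof -
  show F: "dep2 N F" using assms by (simp add: mean_zero_def)
  have d: "dep N (\<lambda>y. avg {..<N} (\<lambda>x. F x y))"
    using dep2_section[OF F] by (simp add: dep_def)
  have "avg {..<N} (\<lambda>y. avg {..<N} (\<lambda>x. F x y) * walsh B y) = coef N F {} B" for B
    unfolding coef_def avg2_swap by (simp add: avg_mult_const[symmetric])
  then have "avg {..<N} (\<lambda>y. avg {..<N} (\<lambda>x. F x y) * walsh B y) = 0" for B
    using assms by (simp add: mean_zero_def)
  then show "avg {..<N} (\<lambda>x. F x y) = 0"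
    using walsh_expand[OF d, of y] by simp
  have d: "dep N (\<lambda>x. avg {..<N} (F x))"
    using dep2_row[OF F] by (simp add: dep_def)
  have "avg {..<N} (\<lambda>x. avg {..<N} (F x) * walsh A x) = coef N F A {}" for A
    unfolding coef_def avg2_def by (simp add: avg_mult_const[symmetric])
  then have "avg {..<N} (\<lambda>x. avg {..<N} (F x) * walsh A x) = 0" for A
    using assms by (simp add: mean_zero_def)
  then show "avg {..<N} (F x) = 0"
    using walsh_expand[OF d, of x] by simp
qed

lemma mean_zero_mono:
  assumes "mean_zero N F" "N \<le> M" shows "mean_zero M F"
proof (rule mean_zeroI)
  note F = mean_zeroD(1)[OF assms(1)]
  show "dep2 M F" by (rule dep2_mono[OF F assms(2)])
  show "avg {..<M} (\<lambda>x. F x y) = 0" for y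
    using avg_level[OF dep2_section'[OF F] assms(2)] mean_zeroD(2)[OF assms(1)] by simp
  show "avg {..<M} (F x) = 0" for x
    using avg_level[OF dep2_section[OF F] assms(2)] mean_zeroD(3)[OF assms(1)] by simp
qed

definition centered :: "(nat set \<Rightarrow> nat set \<Rightarrow> real) \<Rightarrow> bool" where
  "centered F \<longleftrightarrow> (\<exists>N. mean_zero N F)"

lemma centered_step2: "centered F \<Longrightarrow> step2 F"
  unfolding centered_def mean_zero_def step2_def by blast

lemma centered_mean_zero:
  assumes "centered F" "dep2 N F" shows "mean_zero N F"
proof -
  obtain M where M: "mean_zero M F" using assms(1) by (auto simp: centered_def)
  then have M': "mean_zero (max N M) F" by (rule mean_zero_mono) simp
  have le: "N \<le> max N M" by simp
  show ?thesis
  proof (rule mean_zeroI[OF assms(2)])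
    show "avg {..<N} (\<lambda>x. F x y) = 0" for y
      using avg_level[OF dep2_section'[OF assms(2)] le] mean_zeroD(2)[OF M'] by simp
    show "avg {..<N} (F x) = 0" for x
      using avg_level[OF dep2_section[OF assms(2)] le] mean_zeroD(3)[OF M'] by simp
  qed
qed

lemma centered_add:
  assumes "centered F" "centered G" shows "centered (\<lambda>x y. F x y + G x y)"
proof -
  obtain N where N: "dep2 N F" "dep2 N G" using step2_common centered_step2 assms by blast
  note F = centered_mean_zero[OF assms(1) N(1)] and G = centered_mean_zero[OF assms(2) N(2)]
  have "mean_zero N (\<lambda>x y. F x y + G x y)"
    by (intro mean_zeroI dep2_add N) (simp_all add: avg_add mean_zeroD[OF F] mean_zeroD[OF G])
  then show ?thesis by (auto simp: centered_def)
qed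

lemma centered_cmult:
  assumes "centered F" shows "centered (\<lambda>x y. c * F x y)"
proof -
  obtain N where F: "mean_zero N F" using assms by (auto simp: centered_def)
  have "mean_zero N (\<lambda>x y. c * F x y)"
    by (intro mean_zeroI dep2_cmult mean_zeroD[OF F]) (simp_all add: avg_cmult mean_zeroD[OF F])
  then show ?thesis by (auto simp: centered_def)
qed

lemma centered_diff: "centered F \<Longrightarrow> centered G \<Longrightarrow> centered (\<lambda>x y. F x y - G x y)"
  using centered_add[of F "\<lambda>x y. -1 * G x y"] centered_cmult[of G "-1"] by simp

lemma centered_zero: "centered (\<lambda>_ _. 0)"
  unfolding centered_def by (intro exI[of _ 0] mean_zeroI) simp_all

lemma centered_tensor:
  assumes N: "dep N f" "dep N g" "avg {..<N} f = 0" "avg {..<N} g = 0"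
  shows "centered (\<lambda>x y. f x * g y)"
proof -
  have "mean_zero N (\<lambda>x y. f x * g y)"
    by (intro mean_zeroI dep2_tensor N) (simp_all add: avg_mult_const avg_cmult N)
  then show ?thesis by (auto simp: centered_def)
qed

lemma avg_hcell: "n < N \<Longrightarrow> avg {..<N} (hcell n a) = 0"
proof -
  assume "n < N"
  have "hcell n a = (\<lambda>x. (if x \<inter> {..<n} = a then 1 else 0) * sg x n)"
    by (auto simp: hcell_def)
  moreover have "dep n (\<lambda>x. if x \<inter> {..<n} = a then 1 else 0 :: real)"
    by (simp add: dep_def Int_assoc)
  ultimately show ?thesis using avg_dep_mult_sg[OF _ \<open>n < N\<close>] by simp
qed

lemma haar_tensors_eq:
  "haar_tensors = {embed (\<lambda>x y. hcell m a x * hcell n b y) | m a n b. a \<subseteq> {..<m} \<and> b \<subseteq> {..<n}}"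
proof (intro set_eqI iffI)
  fix F assume "F \<in> haar_tensors"
  then obtain m j n k where F: "F = vector_valued (tensor (haar m j) (haar n k))" and jk: "j < 2 ^ m" "k < 2 ^ n"
    unfolding haar_tensors_def by blast
  obtain a where a: "a \<subseteq> {..<m}" "cell_index m a = j"
    using bij_betw_imp_surj_on[OF cell_index_bij[of m]] jk(1) by (metis PowD image_iff lessThan_iff)
  obtain b where b: "b \<subseteq> {..<n}" "cell_index n b = k"
    using bij_betw_imp_surj_on[OF cell_index_bij[of n]] jk(2) by (metis PowD image_iff lessThan_iff)
  have "F = embed (\<lambda>x y. hcell m a x * hcell n b y)"
    using vector_valued_haar[OF a(1) b(1)] unfolding F a(2) b(2) .
  then show "F \<in> {embed (\<lambda>x y. hcell m a x * hcell n b y) | m a n b. a \<subseteq> {..<m} \<and> b \<subseteq> {..<n}}"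
    using a b by blast
next
  fix F assume "F \<in> {embed (\<lambda>x y. hcell m a x * hcell n b y) | m a n b. a \<subseteq> {..<m} \<and> b \<subseteq> {..<n}}"
  then obtain m a n b where F: "F = embed (\<lambda>x y. hcell m a x * hcell n b y)" and ab: "a \<subseteq> {..<m}" "b \<subseteq> {..<n}"
    by blast
  show "F \<in> haar_tensors"
    unfolding F vector_valued_haar[OF ab, symmetric] haar_tensors_def
    using cell_index_less by blast
qed

text \<open>The factors below the largest index n are constant on cells of level n, so the Walsh
  function is a combination of the Haar functions of that one level.\<close>

lemma walsh_hcell:
  assumes "finite A" "A \<noteq> {}"
  shows "walsh A x = (\<Sum>a\<in>Pow {..<Max A}. walsh (A - {Max A}) a * hcell (Max A) a x)"
proof -
  let ?n = "Max A"
  have n: "?n \<in> A" using assms by simp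
  have "(\<Sum>a\<in>Pow {..<?n}. walsh (A - {?n}) a * hcell ?n a x)
      = (\<Sum>a\<in>Pow {..<?n}. if a = x \<inter> {..<?n} then walsh (A - {?n}) a * sg x ?n else 0)"
    by (intro sum.cong) (auto simp: hcell_def)
  also have "\<dots> = walsh (A - {?n}) (x \<inter> {..<?n}) * sg x ?n"
    by (subst sum.delta) auto
  also have "walsh (A - {?n}) (x \<inter> {..<?n}) = walsh (A - {?n}) x"
  proof -
    have "A - {?n} \<subseteq> {..<?n}" using assms by (auto simp: less_le)
    from dep_walsh[OF this] show ?thesis by (simp add: dep_def)
  qed
  also have "walsh (A - {?n}) x * sg x ?n = walsh A x"
    unfolding walsh_def using prod.remove[OF assms(1) n, of "sg x"] by (simp add: mult.commute)
  finally show ?thesis ..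
qed

text \<open>Haar functions have mean zero in each variable. Conversely, a centered function has no
  Walsh coefficient with an empty index set, and the other Walsh functions are combinations of Haar
  functions.\<close>

lemma span_haar_tensors: "span haar_tensors = embed ` {F. centered F}"
proof
  have "subspace (embed ` {F. centered F})"
    unfolding subspace_def
  proof (intro conjI ballI allI)
    show "0 \<in> embed ` {F. centered F}"
      using centered_zero embed_zero by (metis image_eqI mem_Collect_eq)
    fix X Y assume "X \<in> embed ` {F. centered F}" "Y \<in> embed ` {F. centered F}"
    then obtain F G where FG: "X = embed F" "centered F" "Y = embed G" "centered G" by blast
    then have "X + Y = embed (\<lambda>x y. F x y + G x y)" by (simp add: embed_add centered_step2)
    then show "X + Y \<in> embed ` {F. centered F}" using centered_add FG by blast
  next
    fix c X assume "X \<in> embed ` {F. centered F}"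
    then obtain F where F: "X = embed F" "centered F" by blast
    then have "c *\<^sub>R X = embed (\<lambda>x y. c * F x y)" by (simp add: embed_cmult centered_step2)
    then show "c *\<^sub>R X \<in> embed ` {F. centered F}" using centered_cmult F by blast
  qed
  moreover have "haar_tensors \<subseteq> embed ` {F. centered F}"
  proof
    fix X assume "X \<in> haar_tensors"
    then obtain m a n b where X: "X = embed (\<lambda>x y. hcell m a x * hcell n b y)" unfolding haar_tensors_eq by blast
    have "centered (\<lambda>x y. hcell m a x * hcell n b y)"
      by (intro centered_tensor[of "Suc (m + n)"] avg_hcell dep_mono[OF dep_hcell]) auto
    then show "X \<in> embed ` {F. centered F}" using X by blast
  qed
  ultimately show "span haar_tensors \<subseteq> embed ` {F. centered F}" by (intro span_minimal)
  show "embed ` {F. centered F} \<subseteq> span haar_tensors"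
  proof
    fix X assume "X \<in> embed ` {F. centered F}"
    then obtain F N where X: "X = embed F" and F: "mean_zero N F" by (auto simp: centered_def)
    let ?J = "Pow {..<N} \<times> Pow {..<N}"
    let ?w = "\<lambda>z x y. walsh (fst z) x * walsh (snd z) y"
    have st: "step2 (?w z)" if "z \<in> ?J" for z
      using that by (intro step2I[of N] dep2_tensor dep_walsh) auto
    have eF: "F = (\<lambda>x y. \<Sum>z\<in>?J. coef N F (fst z) (snd z) * ?w z x y)"
      by (intro ext, subst walsh_expand2[OF mean_zeroD(1)[OF F]]) (simp add: sum.cartesian_product case_prod_unfold)
    have "X = embed (\<lambda>x y. \<Sum>z\<in>?J. coef N F (fst z) (snd z) * ?w z x y)"
      unfolding X by (rule arg_cong[OF eF])
    also have "\<dots> = (\<Sum>z\<in>?J. coef N F (fst z) (snd z) *\<^sub>R embed (?w z))"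
      by (rule embed_sum) (auto intro: st)
    also have "\<dots> \<in> span haar_tensors"
    proof (rule span_sum)
      fix z assume z: "z \<in> ?J"
      show "coef N F (fst z) (snd z) *\<^sub>R embed (?w z) \<in> span haar_tensors"
      proof (cases "fst z = {} \<or> snd z = {}")
        case True
        then have "coef N F (fst z) (snd z) = 0" using F by (auto simp: mean_zero_def)
        then show ?thesis by (simp add: span_zero)
      next
        case False
        have fin: "finite (fst z)" "finite (snd z)" using z by (auto intro: finite_subset[of _ "{..<N}"])
        let ?m = "Max (fst z)" and ?n = "Max (snd z)"
        let ?K = "Pow {..<?m} \<times> Pow {..<?n}"
        let ?c = "\<lambda>u. walsh (fst z - {?m}) (fst u) * walsh (snd z - {?n}) (snd u)"
        have "?w z = (\<lambda>x y. \<Sum>u\<in>?K. ?c u * (hcell ?m (fst u) x * hcell ?n (snd u) y))"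
        proof (intro ext)
          fix x y
          have "?w z x y = (\<Sum>a\<in>Pow {..<?m}. walsh (fst z - {?m}) a * hcell ?m a x) * (\<Sum>b\<in>Pow {..<?n}. walsh (snd z - {?n}) b * hcell ?n b y)"
            using walsh_hcell[OF fin(1), of x] walsh_hcell[OF fin(2), of y] False by simp
          also have "\<dots> = (\<Sum>u\<in>?K. (walsh (fst z - {?m}) (fst u) * hcell ?m (fst u) x) * (walsh (snd z - {?n}) (snd u) * hcell ?n (snd u) y))"
            by (simp only: sum_product sum.cartesian_product case_prod_unfold)
          also have "\<dots> = (\<Sum>u\<in>?K. ?c u * (hcell ?m (fst u) x * hcell ?n (snd u) y))"
            by (intro sum.cong refl) (simp only: mult_ac)
          finally show "?w z x y = (\<Sum>u\<in>?K. ?c u * (hcell ?m (fst u) x * hcell ?n (snd u) y))" .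
        qed
        then have "embed (?w z) = embed (\<lambda>x y. \<Sum>u\<in>?K. ?c u * (hcell ?m (fst u) x * hcell ?n (snd u) y))"
          by (rule arg_cong)
        also have "\<dots> = (\<Sum>u\<in>?K. ?c u *\<^sub>R embed (\<lambda>x y. hcell ?m (fst u) x * hcell ?n (snd u) y))"
          by (rule embed_sum) (auto intro!: step2_tensor)
        also have "\<dots> \<in> span haar_tensors"
        proof (intro span_sum span_scale span_base)
          fix u assume "u \<in> ?K"
          then have "fst u \<subseteq> {..<?m}" "snd u \<subseteq> {..<?n}" by auto
          then show "embed (\<lambda>x y. hcell ?m (fst u) x * hcell ?n (snd u) y) \<in> haar_tensors"
            unfolding haar_tensors_eq by blast
        qed
        finally show ?thesis by (rule span_scale)
      qed
    qed
    finally show "X \<in> span haar_tensors" .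
  qed
qed


section \<open>The norm of the Bochner space\<close>

lemma powr_pred_mult:
  fixes u p :: real
  assumes "0 \<le> u" shows "u powr (p - 1) * u = u powr p"
proof (cases "u = 0")
  case False
  then have "u powr (p - 1) * u = u powr (p - 1) * u powr 1" using assms by simp
  then show ?thesis by (simp only: powr_add[symmetric]) simp
qed simp

text \<open>The p-th power lies above its tangent at w; this is Young's inequality for x and
  w^(p-1).\<close>

lemma powr_tangent:
  fixes p x w :: real
  assumes p: "p > 1" and "0 \<le> x" "0 \<le> w"
  shows "p * x * w powr (p - 1) \<le> x powr p + (p - 1) * w powr p"
proof -
  define q where "q = p / (p - 1)"
  have q: "q > 1" "1 / p + 1 / q = 1" "(p - 1) * q = p" using p by (auto simp: q_def field_simps)
  have "x * w powr (p - 1) \<le> x powr p / p + (w powr (p - 1)) powr q / q"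
    using assms by (intro Youngs_inequality q) auto
  also have "(w powr (p - 1)) powr q = w powr p" by (simp add: powr_powr q)
  finally have "p * (x * w powr (p - 1)) \<le> p * (x powr p / p + w powr p / q)"
    using p by (intro mult_left_mono) auto
  also have "\<dots> = x powr p + (p - 1) * w powr p" using p by (simp add: q_def field_simps)
  finally show ?thesis by (simp add: mult.assoc)
qed

text \<open>Convexity of the p-th power with weights a/(a+b) and b/(a+b), from the tangent at the
  common point w. Integrated with bounds a and b for the two norms, it becomes Minkowski's
  inequality.\<close>

lemma powr_sum_le:
  fixes p u v a b :: real
  assumes p: "p > 1" and uv: "0 \<le> u" "0 \<le> v" and ab: "0 < a" "0 < b"
  shows "(u + v) powr p \<le> (a + b) powr (p - 1) * (a * (u / a) powr p + b * (v / b) powr p)"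
proof -
  define w where "w = (u + v) / (a + b)"
  have w: "0 \<le> w" using uv ab by (simp add: w_def)
  have eq: "u + v = (a + b) * w" using ab by (simp add: w_def)
  have A: "a * (p * (u / a) * w powr (p - 1)) \<le> a * ((u / a) powr p + (p - 1) * w powr p)"
    using uv ab w by (intro mult_left_mono powr_tangent p) auto
  have B: "b * (p * (v / b) * w powr (p - 1)) \<le> b * ((v / b) powr p + (p - 1) * w powr p)"
    using uv ab w by (intro mult_left_mono powr_tangent p) auto
  have "a * (p * (u / a) * w powr (p - 1)) + b * (p * (v / b) * w powr (p - 1)) = p * (u + v) * w powr (p - 1)"
    using ab by (simp add: field_simps)
  also have "\<dots> = p * (a + b) * w powr p"
  proof -
    have "w * w powr (p - 1) = w powr p" using powr_pred_mult[OF w] by (simp add: mult.commute)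
    then show ?thesis unfolding eq by (simp add: mult.assoc)
  qed
  finally have "p * (a + b) * w powr p \<le> a * (u / a) powr p + b * (v / b) powr p + (p - 1) * (a + b) * w powr p"
    using A B by (simp add: algebra_simps)
  then have "(a + b) * w powr p \<le> a * (u / a) powr p + b * (v / b) powr p"
    by (simp add: algebra_simps)
  then have "(a + b) powr (p - 1) * ((a + b) * w powr p) \<le> (a + b) powr (p - 1) * (a * (u / a) powr p + b * (v / b) powr p)"
    by (rule mult_left_mono) simp
  moreover have "(a + b) powr (p - 1) * ((a + b) * w powr p) = (u + v) powr p"
  proof -
    have "(a + b) powr (p - 1) * (a + b) = (a + b) powr p" using ab by (intro powr_pred_mult) simp
    then show ?thesis unfolding eq powr_mult by (simp only: mult.assoc[symmetric])
  qed
  ultimately show ?thesis by simp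
qed

lemma Lp_integral_add_le:
  fixes F G :: "'b::real_normed_vector L0"
  assumes p: "p > 1" and ab: "0 < a" "0 < b"
    and F: "Lp_integral p F \<le> ennreal (a powr p)" and G: "Lp_integral p G \<le> ennreal (b powr p)"
  shows "Lp_integral p (F + G) \<le> ennreal ((a + b) powr p)"
  using F G
proof (transfer fixing: p a b, clarsimp)
  fix f g :: "real \<Rightarrow> 'b"
  assume f: "strongly_measurable f" and g: "strongly_measurable g"
    and If: "(\<integral>\<^sup>+ s. ennreal (norm (f s) powr p) \<partial>unit_leb) \<le> ennreal (a powr p)"
    and Ig: "(\<integral>\<^sup>+ s. ennreal (norm (g s) powr p) \<partial>unit_leb) \<le> ennreal (b powr p)"
  obtain f' where f': "f' \<in> borel_measurable unit_leb" "AE s in unit_leb. norm (f s) = f' s"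
    using strongly_measurable_norm_AE[OF f] .
  obtain g' where g': "g' \<in> borel_measurable unit_leb" "AE s in unit_leb. norm (g s) = g' s"
    using strongly_measurable_norm_AE[OF g] .
  define \<alpha> where "\<alpha> = (a + b) powr (p - 1) * a * a powr (- p)"
  define \<beta> where "\<beta> = (a + b) powr (p - 1) * b * b powr (- p)"
  have \<alpha>\<beta>: "0 \<le> \<alpha>" "0 \<le> \<beta>" using ab by (simp_all add: \<alpha>_def \<beta>_def)
  have pt: "norm (f s + g s) powr p \<le> \<alpha> * norm (f s) powr p + \<beta> * norm (g s) powr p" for s
  proof -
    have "norm (f s + g s) powr p \<le> (norm (f s) + norm (g s)) powr p"
      using p by (intro powr_mono2 norm_triangle_ineq) auto
    also have "\<dots> \<le> (a + b) powr (p - 1) * (a * (norm (f s) / a) powr p + b * (norm (g s) / b) powr p)"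
      using ab by (intro powr_sum_le p) auto
    also have "\<dots> = \<alpha> * norm (f s) powr p + \<beta> * norm (g s) powr p"
    proof -
      have "(u / c) powr p = u powr p * c powr (- p)" if "0 \<le> u" "0 < c" for u c :: real
        using that by (simp add: powr_divide powr_minus_divide)
      then show ?thesis using ab unfolding \<alpha>_def \<beta>_def by (simp add: algebra_simps)
    qed
    finally show ?thesis .
  qed
  have If': "(\<integral>\<^sup>+ s. ennreal (norm (f s) powr p) \<partial>unit_leb) = (\<integral>\<^sup>+ s. ennreal (f' s powr p) \<partial>unit_leb)"
    using f'(2) by (intro nn_integral_cong_AE) (auto elim: eventually_mono)
  have Ig': "(\<integral>\<^sup>+ s. ennreal (norm (g s) powr p) \<partial>unit_leb) = (\<integral>\<^sup>+ s. ennreal (g' s powr p) \<partial>unit_leb)"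
    using g'(2) by (intro nn_integral_cong_AE) (auto elim: eventually_mono)
  have "(\<integral>\<^sup>+ s. ennreal (norm (f s + g s) powr p) \<partial>unit_leb)
      \<le> (\<integral>\<^sup>+ s. ennreal \<alpha> * ennreal (f' s powr p) + ennreal \<beta> * ennreal (g' s powr p) \<partial>unit_leb)"
  proof (rule nn_integral_mono_AE)
    show "AE s in unit_leb. ennreal (norm (f s + g s) powr p) \<le> ennreal \<alpha> * ennreal (f' s powr p) + ennreal \<beta> * ennreal (g' s powr p)"
      using f'(2) g'(2)
    proof eventually_elim
      case (elim s)
      have "ennreal (norm (f s + g s) powr p) \<le> ennreal (\<alpha> * f' s powr p + \<beta> * g' s powr p)"
        using pt[of s] elim by (intro ennreal_leI) simp
      also have "\<dots> = ennreal \<alpha> * ennreal (f' s powr p) + ennreal \<beta> * ennreal (g' s powr p)"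
        using \<alpha>\<beta> by (simp add: ennreal_mult)
      finally show ?case .
    qed
  qed
  also have "\<dots> = ennreal \<alpha> * (\<integral>\<^sup>+ s. ennreal (f' s powr p) \<partial>unit_leb) + ennreal \<beta> * (\<integral>\<^sup>+ s. ennreal (g' s powr p) \<partial>unit_leb)"
    using f'(1) g'(1) by (simp add: nn_integral_add nn_integral_cmult)
  also have "\<dots> \<le> ennreal \<alpha> * ennreal (a powr p) + ennreal \<beta> * ennreal (b powr p)"
    using If Ig unfolding If' Ig' by (intro add_mono mult_left_mono) auto
  also have "\<dots> = ennreal (\<alpha> * a powr p + \<beta> * b powr p)"
    using \<alpha>\<beta> by (simp add: ennreal_mult)
  also have "\<alpha> * a powr p + \<beta> * b powr p = (a + b) powr p"
  proof -
    have "a powr (- p) * a powr p = 1" "b powr (- p) * b powr p = 1"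
      using ab by (simp_all add: powr_add[symmetric])
    then have "\<alpha> * a powr p + \<beta> * b powr p = (a + b) powr (p - 1) * (a + b)"
      unfolding \<alpha>_def \<beta>_def by (simp only: mult.assoc mult_1_right distrib_left)
    also have "\<dots> = (a + b) powr p" using ab by (intro powr_pred_mult) simp
    finally show ?thesis .
  qed
  finally show "(\<integral>\<^sup>+ s. ennreal (norm (f s + g s) powr p) \<partial>unit_leb) \<le> ennreal ((a + b) powr p)" .
qed

context
  fixes p :: real
  assumes p: "p > 1"
begin

lemma Lp_integral_norm: "F \<in> Lp_space p \<Longrightarrow> Lp_integral p F = ennreal (Lp_norm p F powr p)"
  unfolding Lp_space_def Lp_norm_def using p by (simp add: powr_powr)

lemma Lp_norm_nonneg [simp]: "0 \<le> Lp_norm p F"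
  by (simp add: Lp_norm_def)

lemma Lp_norm_leI:
  assumes "Lp_integral p F \<le> ennreal (c powr p)" "0 \<le> c"
  shows "F \<in> Lp_space p" "Lp_norm p F \<le> c"
proof -
  have "Lp_integral p F < \<infinity>" using assms(1) by (rule le_less_trans) simp
  then show "F \<in> Lp_space p" by (simp add: Lp_space_def)
  have "enn2real (Lp_integral p F) \<le> c powr p"
    using enn2real_mono[OF assms(1)] by simp
  then have "enn2real (Lp_integral p F) powr (1 / p) \<le> (c powr p) powr (1 / p)"
    using p by (intro powr_mono2) auto
  then show "Lp_norm p F \<le> c" using p assms(2) by (simp add: Lp_norm_def powr_powr)
qed

lemma Lp_norm_add:
  fixes F G :: "'b::real_normed_vector L0"
  assumes "F \<in> Lp_space p" "G \<in> Lp_space p"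
  shows "F + G \<in> Lp_space p" "Lp_norm p (F + G) \<le> Lp_norm p F + Lp_norm p G"
proof -
  \<comment> \<open>The summand e keeps both bounds positive when a norm is zero.\<close>
  have *: "Lp_integral p (F + G) \<le> ennreal ((Lp_norm p F + Lp_norm p G + e) powr p)" if "e > 0" for e
  proof -
    have "Lp_integral p (F + G) \<le> ennreal (((Lp_norm p F + e / 2) + (Lp_norm p G + e / 2)) powr p)"
    proof (rule Lp_integral_add_le[OF p])
      show "0 < Lp_norm p F + e / 2" "0 < Lp_norm p G + e / 2"
        using that by (auto intro: add_nonneg_pos)
      show "Lp_integral p F \<le> ennreal ((Lp_norm p F + e / 2) powr p)"
        unfolding Lp_integral_norm[OF assms(1)] using p that by (intro ennreal_leI powr_mono2) auto
      show "Lp_integral p G \<le> ennreal ((Lp_norm p G + e / 2) powr p)"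
        unfolding Lp_integral_norm[OF assms(2)] using p that by (intro ennreal_leI powr_mono2) auto
    qed
    then show ?thesis by (simp add: algebra_simps)
  qed
  show "F + G \<in> Lp_space p" by (rule Lp_norm_leI(1)[OF *[of 1]]) (simp_all add: add_nonneg_nonneg)
  show "Lp_norm p (F + G) \<le> Lp_norm p F + Lp_norm p G"
  proof (rule field_le_epsilon)
    fix e :: real assume "e > 0"
    then show "Lp_norm p (F + G) \<le> Lp_norm p F + Lp_norm p G + e"
      by (intro Lp_norm_leI(2)[OF *] add_nonneg_nonneg) simp_all
  qed
qed

lemma Lp_integral_scaleR:
  fixes F :: "'b::real_normed_vector L0"
  shows "Lp_integral p (c *\<^sub>R F) = ennreal (\<bar>c\<bar> powr p) * Lp_integral p F"
proof (transfer fixing: p c, clarsimp)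
  fix f :: "real \<Rightarrow> 'b"
  assume f: "strongly_measurable f"
  obtain f' where f': "f' \<in> borel_measurable unit_leb" "AE s in unit_leb. norm (f s) = f' s"
    using strongly_measurable_norm_AE[OF f] .
  have "(\<integral>\<^sup>+ s. ennreal ((\<bar>c\<bar> * norm (f s)) powr p) \<partial>unit_leb) = (\<integral>\<^sup>+ s. ennreal (\<bar>c\<bar> powr p) * ennreal (f' s powr p) \<partial>unit_leb)"
    using f'(2) by (intro nn_integral_cong_AE) (auto simp: ennreal_mult' powr_mult elim!: eventually_mono)
  also have "\<dots> = ennreal (\<bar>c\<bar> powr p) * (\<integral>\<^sup>+ s. ennreal (f' s powr p) \<partial>unit_leb)"
    using f'(1) by (intro nn_integral_cmult) auto
  also have "(\<integral>\<^sup>+ s. ennreal (f' s powr p) \<partial>unit_leb) = (\<integral>\<^sup>+ s. ennreal (norm (f s) powr p) \<partial>unit_leb)"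
    using f'(2) by (intro nn_integral_cong_AE) (auto elim: eventually_mono)
  finally show "(\<integral>\<^sup>+ s. ennreal ((\<bar>c\<bar> * norm (f s)) powr p) \<partial>unit_leb)
    = ennreal (\<bar>c\<bar> powr p) * (\<integral>\<^sup>+ s. ennreal (norm (f s) powr p) \<partial>unit_leb)" .
qed

lemma Lp_norm_scaleR:
  fixes F :: "'b::real_normed_vector L0"
  shows "Lp_norm p (c *\<^sub>R F) = \<bar>c\<bar> * Lp_norm p F"
  using p unfolding Lp_norm_def Lp_integral_scaleR by (simp add: enn2real_mult powr_mult powr_powr)

lemma Lp_space_scaleR: "(F :: 'b::real_normed_vector L0) \<in> Lp_space p \<Longrightarrow> c *\<^sub>R F \<in> Lp_space p"
  unfolding Lp_space_def by (simp add: Lp_integral_scaleR ennreal_mult_less_top)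

lemma Lp_norm_diff:
  fixes F G :: "'b::real_normed_vector L0"
  assumes "F \<in> Lp_space p" "G \<in> Lp_space p"
  shows "F - G \<in> Lp_space p" "Lp_norm p (F - G) \<le> Lp_norm p F + Lp_norm p G"
  using Lp_norm_add[OF assms(1) Lp_space_scaleR[OF assms(2), of "-1"]] Lp_norm_scaleR[of "-1" G] by simp_all

lemma Lp_norm_minus_commute:
  fixes F G :: "'b::real_normed_vector L0"
  shows "Lp_norm p (F - G) = Lp_norm p (G - F)"
  using Lp_norm_scaleR[of "-1" "F - G"] by simp

lemma Lp_norm_triangle:
  fixes F G H :: "'b::real_normed_vector L0"
  assumes "F \<in> Lp_space p" "G \<in> Lp_space p" "H \<in> Lp_space p"
  shows "Lp_norm p (F - H) \<le> Lp_norm p (F - G) + Lp_norm p (G - H)"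
  using Lp_norm_add(2)[OF Lp_norm_diff(1)[OF assms(1,2)] Lp_norm_diff(1)[OF assms(2,3)]] by simp

lemma Lp_norm_eq_0:
  fixes F :: "'b::real_normed_vector L0"
  assumes "F \<in> Lp_space p" "Lp_norm p F = 0"
  shows "F = 0"
proof -
  have "Lp_integral p F = 0"
    using Lp_integral_norm[OF assms(1)] assms(2) by simp
  then show ?thesis
  proof (transfer fixing: p, clarsimp)
    fix f :: "real \<Rightarrow> 'b"
    assume f: "strongly_measurable f" and 0: "(\<integral>\<^sup>+ s. ennreal (norm (f s) powr p) \<partial>unit_leb) = 0"
    obtain f' where f': "f' \<in> borel_measurable unit_leb" "AE s in unit_leb. norm (f s) = f' s"
      using strongly_measurable_norm_AE[OF f] .
    have "(\<integral>\<^sup>+ s. ennreal (f' s powr p) \<partial>unit_leb) = (\<integral>\<^sup>+ s. ennreal (norm (f s) powr p) \<partial>unit_leb)"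
      using f'(2) by (intro nn_integral_cong_AE) (auto elim: eventually_mono)
    with 0 f'(1) have "AE s in unit_leb. ennreal (f' s powr p) = 0"
      by (subst nn_integral_0_iff_AE[symmetric]) auto
    with f'(2) show "AE s in unit_leb. f s = 0"
      by eventually_elim (auto simp: ennreal_eq_0_iff)
  qed
qed

end


section \<open>Limits of sequences of step functions\<close>

lemma norm_geometric_diff_le:
  fixes u :: "nat \<Rightarrow> 'b::real_normed_vector" and w :: real
  assumes d: "\<And>n. norm (u (Suc n) - u n) \<le> C * w ^ n" and w: "0 < w" "w < 1"
  shows "norm (u (n + k) - u n) \<le> C * w ^ n / (1 - w)"
proof -
  have C: "0 \<le> C" using order_trans[OF norm_ge_zero d[of 0]] by simp
  have "norm (u (n + k) - u n) \<le> C * w ^ n * (1 - w ^ k) / (1 - w)"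
  proof (induction k)
    case (Suc k)
    have "norm (u (n + Suc k) - u n) \<le> norm (u (Suc (n + k)) - u (n + k)) + norm (u (n + k) - u n)"
      using norm_triangle_ineq[of "u (Suc (n + k)) - u (n + k)" "u (n + k) - u n"] by simp
    also have "\<dots> \<le> C * w ^ (n + k) + C * w ^ n * (1 - w ^ k) / (1 - w)"
      by (intro add_mono d Suc.IH)
    also have "\<dots> = C * w ^ n * (1 - w ^ Suc k) / (1 - w)"
      using w by (simp add: field_simps power_add)
    finally show ?case .
  qed simp
  also have "\<dots> \<le> C * w ^ n / (1 - w)"
    using C w by (intro divide_right_mono) (auto intro!: mult_left_le)
  finally show ?thesis .
qed

lemma norm_geometric_limit_le:
  fixes u :: "nat \<Rightarrow> 'b::real_normed_vector" and w :: real
  assumes d: "\<And>n. norm (u (Suc n) - u n) \<le> C * w ^ n" and w: "0 < w" "w < 1" and l: "u \<longlonglongrightarrow> l"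
  shows "norm (l - u n) \<le> C * w ^ n / (1 - w)"
proof (rule tendsto_upperbound)
  show "(\<lambda>k. norm (u (k + n) - u n)) \<longlonglongrightarrow> norm (l - u n)"
    by (intro tendsto_norm tendsto_diff tendsto_const LIMSEQ_ignore_initial_segment l)
  show "eventually (\<lambda>k. norm (u (k + n) - u n) \<le> C * w ^ n / (1 - w)) sequentially"
    using norm_geometric_diff_le[OF d w, of n] by (intro always_eventually allI) (simp add: add.commute)
qed simp

text \<open>The Riesz-Fischer argument. Half of the geometric decay, w = sqrt r, is spent on
  pointwise control: the sum of the p-th powers of the increments divided by w^(np) is integrable,
  so almost everywhere the increments are at most C w^n with C depending on the point. Completeness
  of the value space enters only through \<open>conv\<close>, so the lemma serves real values and
  \<open>L1\<close> values alike.\<close>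

lemma step_sequence_limit:
  fixes u :: "nat \<Rightarrow> real \<Rightarrow> 'b::real_normed_vector" and p r K :: real
  assumes p: "p > 0" and r: "0 < r" "r < 1" and K: "0 \<le> K"
    and simple: "\<And>n. simple_function unit_leb (u n)"
    and I: "\<And>n. (\<integral>\<^sup>+ s. ennreal (norm (u (Suc n) s - u n s) powr p) \<partial>unit_leb) \<le> ennreal ((K * r ^ n) powr p)"
    and conv: "\<And>s C. (\<And>n. norm (u (Suc n) s - u n s) \<le> C * sqrt r ^ n) \<Longrightarrow> convergent (\<lambda>n. u n s)"
  shows "\<exists>z e. strongly_measurable z \<and> e \<longlonglongrightarrow> 0 \<and> (\<forall>n. 0 \<le> e n \<and>
    (\<integral>\<^sup>+ s. ennreal (norm (z s - u n s) powr p) \<partial>unit_leb) \<le> ennreal (e n powr p))"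
proof -
  define w where "w = sqrt r"
  have w: "0 < w" "w < 1" "r = w * w" using r by (simp_all add: w_def)
  define f where "f n s = norm (u (Suc n) s - u n s) powr p / (w ^ n) powr p" for n s
  define h where "h s = (\<Sum>n. ennreal (f n s))" for s
  have sf: "simple_function unit_leb (\<lambda>s. u (Suc n) s - u n s)" for n
    by (intro simple_function_diff simple)
  have meas [measurable]: "f n \<in> borel_measurable unit_leb" for n
  proof -
    have "simple_function unit_leb (\<lambda>s. norm (u (Suc n) s - u n s) powr p / (w ^ n) powr p)"
      by (rule simple_function_compose1[OF sf, of "\<lambda>v. norm v powr p / (w ^ n) powr p"])
    then show ?thesis unfolding f_def by (rule borel_measurable_simple_function)
  qed
  have f: "0 \<le> f n s" for n s by (simp add: f_def)
  have If: "(\<integral>\<^sup>+ s. ennreal (f n s) \<partial>unit_leb) \<le> ennreal (K powr p * (w powr p) ^ n)" for n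
  proof -
    have m: "(\<lambda>s. norm (u (Suc n) s - u n s) powr p) \<in> borel_measurable unit_leb"
      by (intro borel_measurable_simple_function simple_function_compose1[OF sf, of "\<lambda>v. norm v powr p"])
    have "(\<integral>\<^sup>+ s. ennreal (f n s) \<partial>unit_leb)
        = (\<integral>\<^sup>+ s. ennreal (1 / (w ^ n) powr p) * ennreal (norm (u (Suc n) s - u n s) powr p) \<partial>unit_leb)"
      unfolding f_def by (intro nn_integral_cong) (simp add: ennreal_mult[symmetric])
    also have "\<dots> = ennreal (1 / (w ^ n) powr p) * (\<integral>\<^sup>+ s. ennreal (norm (u (Suc n) s - u n s) powr p) \<partial>unit_leb)"
      using m by (intro nn_integral_cmult) auto
    also have "\<dots> \<le> ennreal (1 / (w ^ n) powr p) * ennreal ((K * r ^ n) powr p)"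
      by (intro mult_left_mono I) simp
    also have "\<dots> = ennreal (1 / (w ^ n) powr p * (K * r ^ n) powr p)" by (rule ennreal_mult[symmetric]) simp_all
    also have "1 / (w ^ n) powr p * (K * r ^ n) powr p = K powr p * (w powr p) ^ n"
    proof -
      have "(K * r ^ n) powr p = K powr p * ((w ^ n) powr p * (w ^ n) powr p)"
        using K w by (simp add: power_mult_distrib powr_mult)
      moreover have "(w ^ n) powr p = (w powr p) ^ n"
        using w by (simp add: powr_realpow[symmetric] powr_powr mult.commute)
      ultimately show ?thesis using w by simp
    qed
    finally show ?thesis .
  qed
  have wp: "0 < w powr p" "w powr p < 1" using w p powr_less_mono2[of p w 1] by auto
  define M where "M = K powr p / (1 - w powr p)"
  have "(\<integral>\<^sup>+ s. h s \<partial>unit_leb) = (\<Sum>n. \<integral>\<^sup>+ s. ennreal (f n s) \<partial>unit_leb)"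
    unfolding h_def by (intro nn_integral_suminf) measurable
  also have "\<dots> \<le> (\<Sum>n. ennreal (K powr p * (w powr p) ^ n))"
    by (intro suminf_le If) auto
  also have "\<dots> = ennreal M"
  proof (rule suminf_ennreal_eq)
    show "(\<lambda>n. K powr p * (w powr p) ^ n) sums M"
      using sums_mult[OF geometric_sums[of "w powr p"], of "K powr p"] wp by (simp add: M_def)
  qed simp
  finally have Ih: "(\<integral>\<^sup>+ s. h s \<partial>unit_leb) \<le> ennreal M" .
  have hm [measurable]: "h \<in> borel_measurable unit_leb" unfolding h_def by measurable
  have "AE s in unit_leb. h s \<noteq> \<infinity>"
    using Ih by (intro nn_integral_noteq_infinite hm) (auto simp: top_unique)
  then have ae: "AE s in unit_leb. \<exists>C\<ge>0. h s = ennreal (C powr p) \<and> (\<forall>n. norm (u (Suc n) s - u n s) \<le> C * w ^ n)"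
  proof eventually_elim
    case (elim s)
    then obtain m where m: "0 \<le> m" "h s = ennreal m" by (cases "h s") auto
    have "norm (u (Suc n) s - u n s) \<le> m powr (1 / p) * w ^ n" for n
    proof -
      have "ennreal (f n s) \<le> h s"
        unfolding h_def using sum_le_suminf[of "\<lambda>n. ennreal (f n s)" "{n}"] by simp
      then have "f n s \<le> m" using m by simp
      then have "norm (u (Suc n) s - u n s) powr p \<le> m * (w ^ n) powr p"
        using w by (simp add: f_def field_simps)
      then have "(norm (u (Suc n) s - u n s) powr p) powr (1 / p) \<le> (m * (w ^ n) powr p) powr (1 / p)"
        using p by (intro powr_mono2) auto
      then show ?thesis using p w m by (simp add: powr_powr powr_mult)
    qed
    moreover have "h s = ennreal ((m powr (1 / p)) powr p)" using m p by (simp add: powr_powr)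
    ultimately show ?case by (intro exI[of _ "m powr (1 / p)"]) simp
  qed
  define z where "z s = lim (\<lambda>n. u n s)" for s
  have zlim: "(\<lambda>n. u n s) \<longlonglongrightarrow> z s" if "\<And>n. norm (u (Suc n) s - u n s) \<le> C * w ^ n" for s C
    using conv[of s C] that unfolding z_def w_def by (simp add: convergent_LIMSEQ_iff)
  have "AE s in unit_leb. (\<lambda>n. u n s) \<longlonglongrightarrow> z s"
    using ae by eventually_elim (auto intro: zlim)
  then have z: "strongly_measurable z"
    unfolding strongly_measurable_def using simple by blast
  have M: "0 \<le> M" using wp by (simp add: M_def)
  define e where "e n = M powr (1 / p) * (w ^ n / (1 - w))" for n
  have "e \<longlonglongrightarrow> M powr (1 / p) * (0 / (1 - w))"
    unfolding e_def using w by (intro tendsto_mult tendsto_divide tendsto_const LIMSEQ_power_zero) auto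
  then have e0: "e \<longlonglongrightarrow> 0" by simp
  have e: "0 \<le> e n" for n using w by (simp add: e_def)
  have "(\<integral>\<^sup>+ s. ennreal (norm (z s - u n s) powr p) \<partial>unit_leb) \<le> ennreal (e n powr p)" for n
  proof -
    have "(\<integral>\<^sup>+ s. ennreal (norm (z s - u n s) powr p) \<partial>unit_leb)
        \<le> (\<integral>\<^sup>+ s. ennreal ((w ^ n / (1 - w)) powr p) * h s \<partial>unit_leb)"
    proof (rule nn_integral_mono_AE)
      show "AE s in unit_leb. ennreal (norm (z s - u n s) powr p) \<le> ennreal ((w ^ n / (1 - w)) powr p) * h s"
        using ae
      proof eventually_elim
        case (elim s)
        then obtain C where C: "0 \<le> C" "h s = ennreal (C powr p)" "\<And>n. norm (u (Suc n) s - u n s) \<le> C * w ^ n"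
          by blast
        have "norm (z s - u n s) \<le> C * w ^ n / (1 - w)"
          by (rule norm_geometric_limit_le[OF C(3) w(1,2) zlim[OF C(3)]])
        then have "norm (z s - u n s) powr p \<le> (C * w ^ n / (1 - w)) powr p"
          using p by (intro powr_mono2) auto
        also have "\<dots> = (w ^ n / (1 - w)) powr p * C powr p"
          using C(1) w by (simp add: powr_mult powr_divide)
        finally have "ennreal (norm (z s - u n s) powr p) \<le> ennreal ((w ^ n / (1 - w)) powr p * C powr p)"
          by (rule ennreal_leI)
        then show ?case by (simp add: C(2) ennreal_mult)
      qed
    qed
    also have "\<dots> = ennreal ((w ^ n / (1 - w)) powr p) * (\<integral>\<^sup>+ s. h s \<partial>unit_leb)"
      by (intro nn_integral_cmult hm)
    also have "\<dots> \<le> ennreal ((w ^ n / (1 - w)) powr p) * ennreal M"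
      by (intro mult_left_mono Ih) simp
    also have "\<dots> = ennreal ((w ^ n / (1 - w)) powr p * M)"
      using M by (simp add: ennreal_mult)
    also have "(w ^ n / (1 - w)) powr p * M = e n powr p"
    proof -
      have "e n powr p = (M powr (1 / p)) powr p * (w ^ n / (1 - w)) powr p"
        unfolding e_def by (rule powr_mult)
      then show ?thesis using M p by (simp add: powr_powr)
    qed
    finally show ?thesis .
  qed
  then show ?thesis using z e0 e by blast
qed

lemma convergent_geometric_real:
  fixes u :: "nat \<Rightarrow> real"
  assumes "\<And>n. norm (u (Suc n) - u n) \<le> C * w ^ n" "0 < w" "w < 1"
  shows "convergent u"
proof -
  have "summable (\<lambda>n. C * w ^ n)"
    using assms(2,3) by (intro summable_mult summable_geometric) simp
  then have "summable (\<lambda>n. u (Suc n) - u n)"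
    by (rule summable_comparison_test') (rule assms(1))
  from summable_LIMSEQ[OF this] have "(\<lambda>n. u n - u 0) \<longlonglongrightarrow> (\<Sum>n. u (Suc n) - u n)"
    unfolding sum_lessThan_telescope .
  from tendsto_add[OF this tendsto_const[of "u 0"]] have "u \<longlonglongrightarrow> (\<Sum>n. u (Suc n) - u n) + u 0"
    by simp
  then show ?thesis by (rule convergentI)
qed

lemma abs_L0_diff:
  "strongly_measurable f \<Longrightarrow> strongly_measurable g \<Longrightarrow> abs_L0 f - abs_L0 g = abs_L0 (\<lambda>s. f s - g s)"
  by (subst minus_L0.abs_eq) auto

lemma Rep_L1_diff_step:
  assumes "dep N f" "dep N g"
  shows "Rep_L1 (embed1 f - embed1 g) = abs_L0 (\<lambda>t. f (bits t) - g (bits t))"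
  unfolding minus_L1.rep_eq Rep_embed1[OF assms(1)] Rep_embed1[OF assms(2)]
  by (rule abs_L0_diff) (rule strongly_measurable_bits[OF assms(1)] strongly_measurable_bits[OF assms(2)])+

lemma norm_L1_integral:
  assumes "Rep_L1 z = abs_L0 f" "strongly_measurable f"
  shows "(\<integral>\<^sup>+ t. ennreal (norm (f t) powr 1) \<partial>unit_leb) = ennreal (norm z)"
proof -
  have "Lp_integral 1 (Rep_L1 z) < \<infinity>" using Rep_L1[of z] by (simp add: Lp_space_def)
  then show ?thesis
    unfolding norm_L1.rep_eq Lp_norm_def Lp_integral_abs[OF assms(2), symmetric] assms(1)[symmetric]
    by simp
qed

text \<open>Completeness of \<open>L1\<close> in the form required here, for step functions with
  geometric increments. It provides the assumption \<open>conv\<close> for the outer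
  variable.\<close>

lemma embed1_convergent:
  assumes g: "\<And>n. step_fun (g n)"
    and d: "\<And>n. norm (embed1 (g (Suc n)) - embed1 (g n)) \<le> C * (1 / 2) ^ n"
  shows "convergent (\<lambda>n. embed1 (g n))"
proof -
  have C: "0 \<le> C" using order_trans[OF norm_ge_zero d[of 0]] by simp
  have sm: "strongly_measurable (\<lambda>t. g n (bits t))" for n
    using g[of n] strongly_measurable_bits by (auto simp: step_fun_def)
  have "\<exists>z e. strongly_measurable z \<and> e \<longlonglongrightarrow> 0 \<and> (\<forall>n. 0 \<le> e n \<and>
    (\<integral>\<^sup>+ t. ennreal (norm (z t - g n (bits t)) powr 1) \<partial>unit_leb) \<le> ennreal (e n powr 1))"
  proof (rule step_sequence_limit[where r = "1 / 2" and K = C])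
    show "simple_function unit_leb (\<lambda>t. g n (bits t))" for n
      using g[of n] simple_function_dep_bits by (auto simp: step_fun_def)
    show "(\<integral>\<^sup>+ t. ennreal (norm (g (Suc n) (bits t) - g n (bits t)) powr 1) \<partial>unit_leb) \<le> ennreal ((C * (1 / 2) ^ n) powr 1)" for n
    proof -
      obtain N where N: "dep N (g (Suc n))" "dep N (g n)" using step_fun_common[OF g g] by blast
      have "(\<integral>\<^sup>+ t. ennreal (norm (g (Suc n) (bits t) - g n (bits t)) powr 1) \<partial>unit_leb)
          = ennreal (norm (embed1 (g (Suc n)) - embed1 (g n)))"
        by (rule norm_L1_integral[OF Rep_L1_diff_step[OF N]]) (intro strongly_measurable_diff sm)
      also have "\<dots> \<le> ennreal (C * (1 / 2) ^ n)" by (rule ennreal_leI[OF d])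
      finally show ?thesis using C by simp
    qed
    show "convergent (\<lambda>n. g n (bits t))"
      if "\<And>n. norm (g (Suc n) (bits t) - g n (bits t)) \<le> D * sqrt (1 / 2) ^ n" for t D
      by (rule convergent_geometric_real[OF that]) auto
  qed (use C in auto)
  then obtain z e where z: "strongly_measurable z" and e0: "e \<longlonglongrightarrow> 0" and e: "\<And>n. 0 \<le> e n"
    and I: "\<And>n. (\<integral>\<^sup>+ t. ennreal (norm (z t - g n (bits t)) powr 1) \<partial>unit_leb) \<le> ennreal (e n powr 1)"
    by blast
  have zd: "abs_L0 (\<lambda>t. z t - g n (bits t)) = abs_L0 z - abs_L0 (\<lambda>t. g n (bits t))" for n
    by (rule abs_L0_diff[OF z sm, symmetric])
  have Lp: "Lp_integral 1 (abs_L0 z - abs_L0 (\<lambda>t. g n (bits t))) \<le> ennreal (e n)" for n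
    unfolding zd[symmetric] Lp_integral_abs[OF strongly_measurable_diff[OF z sm]] using I[of n] e[of n] by simp
  have R: "Rep_L1 (embed1 (g n)) = abs_L0 (\<lambda>t. g n (bits t))" for n
    using g[of n] Rep_embed1 by (auto simp: step_fun_def)
  have W: "abs_L0 z - abs_L0 (\<lambda>t. g 0 (bits t)) \<in> Lp_space 1"
    using Lp[of 0] by (auto simp: Lp_space_def intro: le_less_trans)
  define L where "L = embed1 (g 0) + Abs_L1 (abs_L0 z - abs_L0 (\<lambda>t. g 0 (bits t)))"
  have RL: "Rep_L1 L = abs_L0 z"
    unfolding L_def plus_L1.rep_eq R Abs_L1_inverse[OF W] by simp
  have "norm (L - embed1 (g n)) \<le> e n" for n
    unfolding norm_L1.rep_eq minus_L1.rep_eq RL R Lp_norm_def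
    using enn2real_mono[OF Lp[of n]] e[of n] by simp
  then have "(\<lambda>n. norm (embed1 (g n) - L)) \<longlonglongrightarrow> 0"
    by (intro tendsto_sandwich[OF _ _ tendsto_const e0]) (auto simp: norm_minus_commute)
  then have "(\<lambda>n. embed1 (g n)) \<longlonglongrightarrow> L"
    by (simp add: tendsto_norm_zero_iff LIM_zero_iff)
  then show ?thesis by (auto simp: convergent_def)
qed

text \<open>The rate 1/4 leaves, after the square root taken in \<open>step_sequence_limit\<close>,
  the rate 1/2 at which the inner convergence is available.\<close>

lemma embed_complete:
  fixes p :: real
  assumes p: "p > 1" and F: "\<And>n. step2 (F n)"
    and d: "\<And>n. Lp_norm p (embed (F (Suc n)) - embed (F n)) \<le> K * (1 / 4) ^ n"
  shows "\<exists>Z\<in>Lp_space p. (\<lambda>n. Lp_norm p (Z - embed (F n))) \<longlonglongrightarrow> 0"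
proof -
  have K: "0 \<le> K" using order_trans[OF Lp_norm_nonneg[OF p] d[of 0]] by simp
  have sm: "strongly_measurable (\<lambda>s. embed1 (F n (bits s)))" for n
    using F[of n] strongly_measurable_embed by (auto simp: step2_def)
  have Fs: "step_fun (F n x)" for n x
    using F[of n] dep2_section by (auto simp: step2_def step_fun_def)
  have "\<exists>z e. strongly_measurable z \<and> e \<longlonglongrightarrow> 0 \<and> (\<forall>n. 0 \<le> e n \<and>
    (\<integral>\<^sup>+ s. ennreal (norm (z s - embed1 (F n (bits s))) powr p) \<partial>unit_leb) \<le> ennreal (e n powr p))"
  proof (rule step_sequence_limit[where r = "1 / 4" and K = K])
    show "simple_function unit_leb (\<lambda>s. embed1 (F n (bits s)))" for n
      using F[of n] simple_function_dep_bits[OF dep_embed1] by (auto simp: step2_def)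
    show "(\<integral>\<^sup>+ s. ennreal (norm (embed1 (F (Suc n) (bits s)) - embed1 (F n (bits s))) powr p) \<partial>unit_leb) \<le> ennreal ((K * (1 / 4) ^ n) powr p)" for n
    proof -
      have "(\<integral>\<^sup>+ s. ennreal (norm (embed1 (F (Suc n) (bits s)) - embed1 (F n (bits s))) powr p) \<partial>unit_leb)
          = Lp_integral p (embed (F (Suc n)) - embed (F n))"
        unfolding embed_def abs_L0_diff[OF sm sm] by (rule Lp_integral_abs[OF strongly_measurable_diff[OF sm sm], symmetric])
      also have "\<dots> = ennreal (Lp_norm p (embed (F (Suc n)) - embed (F n)) powr p)"
        by (intro Lp_integral_norm Lp_norm_diff p embed_Lp_space F)
      also have "\<dots> \<le> ennreal ((K * (1 / 4) ^ n) powr p)"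
        using p by (intro ennreal_leI powr_mono2 d) auto
      finally show ?thesis .
    qed
    show "convergent (\<lambda>n. embed1 (F n (bits s)))"
      if "\<And>n. norm (embed1 (F (Suc n) (bits s)) - embed1 (F n (bits s))) \<le> D * sqrt (1 / 4) ^ n" for s D
    proof (rule embed1_convergent[OF Fs, where C = D])
      have "sqrt (1 / 4) = 1 / (2::real)" by (simp add: real_sqrt_divide)
      then show "norm (embed1 (F (Suc n) (bits s)) - embed1 (F n (bits s))) \<le> D * (1 / 2) ^ n" for n
        using that[of n] by (simp only:)
    qed
  qed (use K p in auto)
  then obtain z e where z: "strongly_measurable z" and e0: "e \<longlonglongrightarrow> 0" and e: "\<And>n. 0 \<le> e n"
    and I: "\<And>n. (\<integral>\<^sup>+ s. ennreal (norm (z s - embed1 (F n (bits s))) powr p) \<partial>unit_leb) \<le> ennreal (e n powr p)"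
    by blast
  have Lp: "Lp_integral p (abs_L0 z - embed (F n)) \<le> ennreal (e n powr p)" for n
    unfolding embed_def abs_L0_diff[OF z sm] Lp_integral_abs[OF strongly_measurable_diff[OF z sm]] by (rule I)
  have "(\<lambda>n. Lp_norm p (abs_L0 z - embed (F n))) \<longlonglongrightarrow> 0"
    using Lp_norm_leI(2)[OF p Lp e]
    by (intro tendsto_sandwich[OF _ _ tendsto_const e0]) (simp_all add: Lp_norm_nonneg[OF p])
  moreover have "abs_L0 z \<in> Lp_space p"
    using Lp_norm_add(1)[OF p Lp_norm_leI(1)[OF p Lp[of 0] e[of 0]] embed_Lp_space[OF F[of 0], of p]] by simp
  ultimately show ?thesis by blast
qed


section \<open>Extension by continuity from centered step functions\<close>

context
  fixes p :: real
  assumes p: "p > 1"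
begin

lemma X00_iff: "Y \<in> X00 p \<longleftrightarrow> Y \<in> Lp_space p \<and> (\<forall>e>0. \<exists>h. centered h \<and> Lp_norm p (Y - embed h) < e)"
  unfolding X00_def span_haar_tensors by auto

lemma X00_Lp: "Y \<in> X00 p \<Longrightarrow> Y \<in> Lp_space p"
  by (simp add: X00_iff)

lemma X00_approx: "Y \<in> X00 p \<Longrightarrow> e > 0 \<Longrightarrow> \<exists>h. centered h \<and> Lp_norm p (Y - embed h) < e"
  by (simp add: X00_iff)

lemma centered_Lp: "centered h \<Longrightarrow> embed h \<in> Lp_space p"
  by (intro embed_Lp_space centered_step2)

lemma Lp_norm_zero: "Lp_norm p (0 :: L1 L0) = 0"
  by (simp add: Lp_norm_def Lp_integral_zero)

lemma embed_X00: "centered h \<Longrightarrow> embed h \<in> X00 p"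
  unfolding X00_iff by (auto simp: centered_Lp Lp_norm_zero intro!: exI[of _ h])

lemma X00_add:
  assumes "Y \<in> X00 p" "Z \<in> X00 p" shows "Y + Z \<in> X00 p"
  unfolding X00_iff
proof (intro conjI allI impI)
  show "Y + Z \<in> Lp_space p" by (intro Lp_norm_add p X00_Lp assms)
  fix e :: real assume "e > 0"
  then have e: "e / 2 > 0" by simp
  obtain g where g: "centered g" "Lp_norm p (Y - embed g) < e / 2" using X00_approx[OF assms(1) e] by blast
  obtain h where h: "centered h" "Lp_norm p (Z - embed h) < e / 2" using X00_approx[OF assms(2) e] by blast
  have "Y + Z - embed (\<lambda>x y. g x y + h x y) = (Y - embed g) + (Z - embed h)"
    by (simp add: embed_add centered_step2 g h)
  moreover have "Lp_norm p ((Y - embed g) + (Z - embed h)) \<le> Lp_norm p (Y - embed g) + Lp_norm p (Z - embed h)"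
    by (intro Lp_norm_add Lp_norm_diff p X00_Lp centered_Lp assms g h)
  ultimately have "Lp_norm p (Y + Z - embed (\<lambda>x y. g x y + h x y)) \<le> Lp_norm p (Y - embed g) + Lp_norm p (Z - embed h)"
    by (simp only:)
  then show "\<exists>h. centered h \<and> Lp_norm p (Y + Z - embed h) < e"
    using g h by (intro exI[of _ "\<lambda>x y. g x y + h x y"]) (auto intro: centered_add)
qed

lemma X00_scaleR:
  assumes "Y \<in> X00 p" shows "c *\<^sub>R Y \<in> X00 p"
  unfolding X00_iff
proof (intro conjI allI impI)
  show "c *\<^sub>R Y \<in> Lp_space p" by (intro Lp_space_scaleR p X00_Lp assms)
  fix e :: real assume e: "e > 0"
  have "e / (\<bar>c\<bar> + 1) > 0" using e by (intro divide_pos_pos) auto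
  from X00_approx[OF assms this] obtain g where g: "centered g" "Lp_norm p (Y - embed g) < e / (\<bar>c\<bar> + 1)" by blast
  have "c *\<^sub>R Y - embed (\<lambda>x y. c * g x y) = c *\<^sub>R (Y - embed g)"
    by (simp add: embed_cmult centered_step2 g scaleR_diff_right)
  then have "Lp_norm p (c *\<^sub>R Y - embed (\<lambda>x y. c * g x y)) = \<bar>c\<bar> * Lp_norm p (Y - embed g)"
    by (simp add: Lp_norm_scaleR[OF p])
  also have "\<dots> \<le> \<bar>c\<bar> * (e / (\<bar>c\<bar> + 1))" using g by (intro mult_left_mono) auto
  also have "\<dots> < e" using e by (simp add: field_simps)
  finally show "\<exists>h. centered h \<and> Lp_norm p (c *\<^sub>R Y - embed h) < e"
    using centered_cmult[OF g(1)] by blast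
qed

lemma X00_diff: "Y \<in> X00 p \<Longrightarrow> Z \<in> X00 p \<Longrightarrow> Y - Z \<in> X00 p"
  using X00_add[of Y "(-1) *\<^sub>R Z"] X00_scaleR[of Z "-1"] by simp

text \<open>The estimate in the conclusion determines \<open>Z\<close>, since centered functions are dense.\<close>

lemma extension_point:
  assumes T: "\<And>h. centered h \<Longrightarrow> centered (T h)"
    and nonexp: "\<And>g h. centered g \<Longrightarrow> centered h \<Longrightarrow>
      Lp_norm p (embed (T g) - embed (T h)) \<le> Lp_norm p (embed g - embed h)"
    and Y: "Y \<in> X00 p"
  shows "\<exists>Z\<in>X00 p. \<forall>h. centered h \<longrightarrow> Lp_norm p (Z - embed (T h)) \<le> Lp_norm p (Y - embed h)"
proof -
  have "\<exists>h. centered h \<and> Lp_norm p (Y - embed h) < (1 / 4) ^ n" for n :: nat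
    by (rule X00_approx[OF Y]) simp
  then obtain g where g: "\<And>n. centered (g n)" "\<And>n. Lp_norm p (Y - embed (g n)) < (1 / 4) ^ n" by metis
  note Lp = X00_Lp[OF Y] centered_Lp[OF g(1)] centered_Lp[OF T[OF g(1)]]
  have "Lp_norm p (embed (T (g (Suc n))) - embed (T (g n))) \<le> 2 * (1 / 4) ^ n" for n
  proof -
    have "Lp_norm p (embed (T (g (Suc n))) - embed (T (g n))) \<le> Lp_norm p (embed (g (Suc n)) - embed (g n))"
      by (rule nonexp[OF g(1) g(1)])
    also have "\<dots> \<le> Lp_norm p (embed (g (Suc n)) - Y) + Lp_norm p (Y - embed (g n))"
      by (intro Lp_norm_triangle p Lp)
    also have "\<dots> \<le> (1 / 4) ^ Suc n + (1 / 4) ^ n"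
      using g(2)[of "Suc n"] g(2)[of n] Lp_norm_minus_commute[OF p, of Y "embed (g (Suc n))"] by linarith
    also have "\<dots> \<le> 2 * (1 / 4) ^ n" by simp
    finally show ?thesis .
  qed
  from embed_complete[OF p centered_step2[OF T[OF g(1)]] this]
  obtain Z where Z: "Z \<in> Lp_space p" "(\<lambda>n. Lp_norm p (Z - embed (T (g n)))) \<longlonglongrightarrow> 0" by blast
  have "Z \<in> X00 p"
    unfolding X00_iff
  proof (intro conjI allI impI Z(1))
    fix e :: real assume "e > 0"
    with Z(2) have "\<forall>\<^sub>F n in sequentially. Lp_norm p (Z - embed (T (g n))) < e" by (rule order_tendstoD(2))
    then obtain n where "Lp_norm p (Z - embed (T (g n))) < e" by (meson eventually_sequentially order_refl)
    then show "\<exists>h. centered h \<and> Lp_norm p (Z - embed h) < e" using T[OF g(1)] by blast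
  qed
  moreover have "Lp_norm p (Z - embed (T h)) \<le> Lp_norm p (Y - embed h)" if h: "centered h" for h
  proof (rule tendsto_lowerbound)
    have "(\<lambda>n. (1 / 4 :: real) ^ n) \<longlonglongrightarrow> 0" by (rule LIMSEQ_power_zero) simp
    with Z(2) have "(\<lambda>n. Lp_norm p (Z - embed (T (g n))) + ((1 / 4) ^ n + Lp_norm p (Y - embed h))) \<longlonglongrightarrow> 0 + (0 + Lp_norm p (Y - embed h))"
      by (intro tendsto_add tendsto_const)
    then show "(\<lambda>n. Lp_norm p (Z - embed (T (g n))) + ((1 / 4) ^ n + Lp_norm p (Y - embed h))) \<longlonglongrightarrow> Lp_norm p (Y - embed h)" by simp
    have "Lp_norm p (Z - embed (T h)) \<le> Lp_norm p (Z - embed (T (g n))) + ((1 / 4) ^ n + Lp_norm p (Y - embed h))" for n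
    proof -
      have "Lp_norm p (Z - embed (T h)) \<le> Lp_norm p (Z - embed (T (g n))) + Lp_norm p (embed (T (g n)) - embed (T h))"
        by (intro Lp_norm_triangle p Lp Z centered_Lp T h)
      moreover have "Lp_norm p (embed (T (g n)) - embed (T h)) \<le> Lp_norm p (embed (g n) - embed h)"
        by (rule nonexp[OF g(1) h])
      moreover have "Lp_norm p (embed (g n) - embed h) \<le> Lp_norm p (embed (g n) - Y) + Lp_norm p (Y - embed h)"
        by (intro Lp_norm_triangle p Lp centered_Lp h)
      moreover have "Lp_norm p (embed (g n) - Y) < (1 / 4) ^ n"
        using g(2)[of n] Lp_norm_minus_commute[OF p, of Y "embed (g n)"] by simp
      ultimately show ?thesis by linarith
    qed
    then show "\<forall>\<^sub>F n in sequentially. Lp_norm p (Z - embed (T h)) \<le> Lp_norm p (Z - embed (T (g n))) + ((1 / 4) ^ n + Lp_norm p (Y - embed h))"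
      by simp
  qed simp
  ultimately show ?thesis by blast
qed

lemma Lp_norm_small_eq:
  fixes Y Z :: "L1 L0"
  assumes "Y \<in> Lp_space p" "Z \<in> Lp_space p" "\<And>e. e > 0 \<Longrightarrow> Lp_norm p (Y - Z) \<le> e"
  shows "Y = Z"
proof -
  have "Lp_norm p (Y - Z) \<le> 0" using assms(3) by (rule field_le_epsilon[where y = 0, simplified])
  then have "Lp_norm p (Y - Z) = 0" using Lp_norm_nonneg[OF p] by (rule antisym)
  then show ?thesis using Lp_norm_eq_0[OF p Lp_norm_diff(1)[OF p assms(1,2)]] by simp
qed

text \<open>The values supplied by \<open>extension_point\<close> are picked independently of each
  other; linearity can still be recovered, since each value is determined by its estimates against
  the dense set of centered functions.\<close>

lemma extension:
  assumes T: "\<And>h. centered h \<Longrightarrow> centered (T h)"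
    and nonexp: "\<And>h. centered h \<Longrightarrow> Lp_norm p (embed (T h)) \<le> Lp_norm p (embed h)"
    and add: "\<And>g h. centered g \<Longrightarrow> centered h \<Longrightarrow> T (\<lambda>x y. g x y + h x y) = (\<lambda>x y. T g x y + T h x y)"
    and cmult: "\<And>c h. centered h \<Longrightarrow> T (\<lambda>x y. c * h x y) = (\<lambda>x y. c * T h x y)"
  shows "\<exists>E\<in>bounded_operators (X00 p) (Lp_norm p).
    (\<forall>Y\<in>X00 p. \<forall>h. centered h \<longrightarrow> Lp_norm p (E Y - embed (T h)) \<le> Lp_norm p (Y - embed h)) \<and>
    (\<forall>Y\<in>X00 p. Lp_norm p (E Y) \<le> Lp_norm p Y)"
proof -
  have "Lp_norm p (embed (T g) - embed (T h)) \<le> Lp_norm p (embed g - embed h)" if "centered g" "centered h" for g h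
  proof -
    have eq: "T (\<lambda>x y. g x y - h x y) = (\<lambda>x y. T g x y - T h x y)"
      using add[OF that(1) centered_cmult[OF that(2), of "-1"]] cmult[OF that(2), of "-1"] by simp
    show ?thesis
      using nonexp[OF centered_diff[OF that]] unfolding eq
      by (simp add: embed_diff centered_step2 T that)
  qed
  from extension_point[OF T this]
  have "\<forall>Y\<in>X00 p. \<exists>Z\<in>X00 p. \<forall>h. centered h \<longrightarrow> Lp_norm p (Z - embed (T h)) \<le> Lp_norm p (Y - embed h)" by blast
  then obtain E where E: "\<And>Y. Y \<in> X00 p \<Longrightarrow> E Y \<in> X00 p"
    and app: "\<And>Y h. Y \<in> X00 p \<Longrightarrow> centered h \<Longrightarrow> Lp_norm p (E Y - embed (T h)) \<le> Lp_norm p (Y - embed h)"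
    by metis
  have Eadd: "E (Y + Z) = E Y + E Z" if Y: "Y \<in> X00 p" and Z: "Z \<in> X00 p" for Y Z
  proof (rule Lp_norm_small_eq)
    show "E (Y + Z) \<in> Lp_space p" "E Y + E Z \<in> Lp_space p"
      by (intro X00_Lp E X00_add Y Z)+
    fix e :: real assume "e > 0"
    then have e: "e / 4 > 0" by simp
    obtain g where g: "centered g" "Lp_norm p (Y - embed g) < e / 4" using X00_approx[OF Y e] by blast
    obtain h where h: "centered h" "Lp_norm p (Z - embed h) < e / 4" using X00_approx[OF Z e] by blast
    let ?k = "\<lambda>x y. g x y + h x y"
    have k: "centered ?k" by (rule centered_add[OF g(1) h(1)])
    note Lp = X00_Lp[OF Y] X00_Lp[OF Z] X00_Lp[OF E[OF Y]] X00_Lp[OF E[OF Z]] X00_Lp[OF E[OF X00_add[OF Y Z]]]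
      centered_Lp[OF g(1)] centered_Lp[OF h(1)] centered_Lp[OF T[OF g(1)]] centered_Lp[OF T[OF h(1)]] centered_Lp[OF T[OF k]]
    have eT: "embed (T ?k) = embed (T g) + embed (T h)"
      unfolding add[OF g(1) h(1)] by (simp add: embed_add centered_step2 T g h)
    have "Lp_norm p (E (Y + Z) - embed (T ?k)) \<le> Lp_norm p ((Y - embed g) + (Z - embed h))"
      using app[OF X00_add[OF Y Z] k] by (simp add: embed_add centered_step2 g h algebra_simps)
    also have "\<dots> \<le> Lp_norm p (Y - embed g) + Lp_norm p (Z - embed h)"
      by (intro Lp_norm_add Lp_norm_diff p Lp)
    finally have 1: "Lp_norm p (E (Y + Z) - embed (T ?k)) \<le> e / 2" using g h by simp
    have "Lp_norm p (embed (T ?k) - (E Y + E Z)) = Lp_norm p ((E Y - embed (T g)) + (E Z - embed (T h)))"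
      unfolding eT by (subst Lp_norm_minus_commute[OF p]) (simp add: algebra_simps)
    also have "\<dots> \<le> Lp_norm p (E Y - embed (T g)) + Lp_norm p (E Z - embed (T h))"
      by (intro Lp_norm_add Lp_norm_diff p Lp)
    finally have 2: "Lp_norm p (embed (T ?k) - (E Y + E Z)) \<le> e / 2"
      using app[OF Y g(1)] app[OF Z h(1)] g h by simp
    have "Lp_norm p (E (Y + Z) - (E Y + E Z)) \<le> Lp_norm p (E (Y + Z) - embed (T ?k)) + Lp_norm p (embed (T ?k) - (E Y + E Z))"
      by (intro Lp_norm_triangle Lp_norm_add p Lp)
    then show "Lp_norm p (E (Y + Z) - (E Y + E Z)) \<le> e" using 1 2 by simp
  qed
  have Ecmult: "E (c *\<^sub>R Y) = c *\<^sub>R E Y" if Y: "Y \<in> X00 p" for c Y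
  proof (rule Lp_norm_small_eq)
    show "E (c *\<^sub>R Y) \<in> Lp_space p" "c *\<^sub>R E Y \<in> Lp_space p"
      by (intro X00_Lp E X00_scaleR Y)+
    fix e :: real assume "e > 0"
    then have e: "e / (2 * \<bar>c\<bar> + 1) > 0" by (intro divide_pos_pos) auto
    obtain g where g: "centered g" "Lp_norm p (Y - embed g) < e / (2 * \<bar>c\<bar> + 1)" using X00_approx[OF Y e] by blast
    let ?k = "\<lambda>x y. c * g x y"
    have k: "centered ?k" by (rule centered_cmult[OF g(1)])
    note Lp = X00_Lp[OF Y] X00_Lp[OF E[OF Y]] X00_Lp[OF E[OF X00_scaleR[OF Y]]]
      centered_Lp[OF g(1)] centered_Lp[OF T[OF g(1)]] centered_Lp[OF T[OF k]]
    have eT: "embed (T ?k) = c *\<^sub>R embed (T g)"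
      unfolding cmult[OF g(1)] by (simp add: embed_cmult centered_step2 T g)
    have "Lp_norm p (E (c *\<^sub>R Y) - embed (T ?k)) \<le> Lp_norm p (c *\<^sub>R (Y - embed g))"
      using app[OF X00_scaleR[OF Y] k] by (simp add: embed_cmult centered_step2 g scaleR_diff_right)
    then have 1: "Lp_norm p (E (c *\<^sub>R Y) - embed (T ?k)) \<le> \<bar>c\<bar> * Lp_norm p (Y - embed g)"
      by (simp add: Lp_norm_scaleR[OF p])
    have "Lp_norm p (embed (T ?k) - c *\<^sub>R E Y) = Lp_norm p (c *\<^sub>R (E Y - embed (T g)))"
      unfolding eT by (subst Lp_norm_minus_commute[OF p]) (simp add: scaleR_diff_right)
    also have "\<dots> = \<bar>c\<bar> * Lp_norm p (E Y - embed (T g))" by (rule Lp_norm_scaleR[OF p])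
    also have "\<dots> \<le> \<bar>c\<bar> * Lp_norm p (Y - embed g)" by (intro mult_left_mono app Y g) simp
    finally have 2: "Lp_norm p (embed (T ?k) - c *\<^sub>R E Y) \<le> \<bar>c\<bar> * Lp_norm p (Y - embed g)" .
    have "Lp_norm p (E (c *\<^sub>R Y) - c *\<^sub>R E Y) \<le> Lp_norm p (E (c *\<^sub>R Y) - embed (T ?k)) + Lp_norm p (embed (T ?k) - c *\<^sub>R E Y)"
      by (intro Lp_norm_triangle Lp_space_scaleR p Lp)
    also have "\<dots> \<le> 2 * \<bar>c\<bar> * Lp_norm p (Y - embed g)" using 1 2 by simp
    also have "\<dots> \<le> (2 * \<bar>c\<bar> + 1) * (e / (2 * \<bar>c\<bar> + 1))"
      using g(2) Lp_norm_nonneg[OF p] by (intro mult_mono) auto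
    also have "\<dots> = e" by (simp add: add_pos_nonneg field_simps)
    finally show "Lp_norm p (E (c *\<^sub>R Y) - c *\<^sub>R E Y) \<le> e" .
  qed
  have T0: "T (\<lambda>_ _. 0) = (\<lambda>_ _. 0)" using cmult[OF centered_zero, of 0] by simp
  have Enorm: "Lp_norm p (E Y) \<le> Lp_norm p Y" if "Y \<in> X00 p" for Y
    using app[OF that centered_zero] by (simp add: T0 embed_zero)
  have "E \<in> bounded_operators (X00 p) (Lp_norm p)"
    unfolding bounded_operators_def using E Eadd Ecmult Enorm
    by (auto intro!: exI[of _ 1])
  then show ?thesis using app Enorm by blast
qed

end


section \<open>The mean of a biparameter step function\<close>

text \<open>All levels on which F depends give the same average; naming the least one frees
  statements from a level parameter.\<close>

definition mean :: "(nat set \<Rightarrow> nat set \<Rightarrow> real) \<Rightarrow> real" where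
  "mean F = avg2 (LEAST N. dep2 N F) F"

lemma mean_eq:
  assumes "dep2 N F" shows "mean F = avg2 N F"
  unfolding mean_def
  using avg2_level[OF LeastI[of "\<lambda>N. dep2 N F", OF assms] Least_le[of "\<lambda>N. dep2 N F", OF assms]] by simp

lemma mean_add: "step2 F \<Longrightarrow> step2 G \<Longrightarrow> mean (\<lambda>x y. F x y + G x y) = mean F + mean G"
proof -
  assume "step2 F" "step2 G"
  then obtain N where N: "dep2 N F" "dep2 N G" using step2_common by blast
  show ?thesis by (simp add: mean_eq[OF N(1)] mean_eq[OF N(2)] mean_eq[OF dep2_add[OF N]] avg2_add)
qed

lemma mean_cmult: "step2 F \<Longrightarrow> mean (\<lambda>x y. c * F x y) = c * mean F"
proof -
  assume "step2 F"
  then obtain N where N: "dep2 N F" by (auto simp: step2_def)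
  show ?thesis by (simp add: mean_eq[OF N] mean_eq[OF dep2_cmult[OF N]] avg2_cmult)
qed

lemma mean_diff: "step2 F \<Longrightarrow> step2 G \<Longrightarrow> mean (\<lambda>x y. F x y - G x y) = mean F - mean G"
  using mean_add[OF _ step2_cmult, of F G "-1"] mean_cmult[of G "-1"] by simp

lemma mean_sum:
  assumes "finite I" "\<And>i. i \<in> I \<Longrightarrow> step2 (H i)"
  shows "mean (\<lambda>x y. \<Sum>i\<in>I. c i * H i x y) = (\<Sum>i\<in>I. c i * mean (H i))"
  using assms
proof (induction I rule: finite_induct)
  case empty
  then show ?case using mean_cmult[OF step2_const[of 0], of 0] by simp
next
  case (insert i I)
  have "step2 (\<lambda>x y. \<Sum>i\<in>I. c i * H i x y)"
    using insert by (intro step2_sum step2_cmult) auto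
  then have "mean (\<lambda>x y. c i * H i x y + (\<Sum>i\<in>I. c i * H i x y)) = c i * mean (H i) + mean (\<lambda>x y. \<Sum>i\<in>I. c i * H i x y)"
    using insert.prems by (simp add: mean_add mean_cmult step2_cmult)
  then show ?case using insert by simp
qed

lemma avg_square_eq_0:
  assumes g: "dep N g" and 0: "avg {..<N} (\<lambda>x. g x * g x) = (0 :: real)"
  shows "g x = 0"
proof -
  have "(\<Sum>x\<in>Pow {..<N}. g x * g x) = 0" using 0 by (simp add: avg_def)
  then have "\<forall>x\<in>Pow {..<N}. g x * g x = 0" by (subst (asm) sum_nonneg_eq_0_iff) auto
  then have "g (x \<inter> {..<N}) = 0" by auto
  then show ?thesis using g by (simp add: dep_def)
qed

text \<open>The functional norm of G on step functions with the norm of L_p(L_1) is at most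
  k.\<close>

definition dual_bound :: "real \<Rightarrow> real \<Rightarrow> (nat set \<Rightarrow> nat set \<Rightarrow> real) \<Rightarrow> bool" where
  "dual_bound p k G \<longleftrightarrow> (\<forall>F. step2 F \<longrightarrow> \<bar>mean (\<lambda>x y. G x y * F x y)\<bar> \<le> k * Lp_norm p (embed F))"

lemma dual_boundD: "dual_bound p k G \<Longrightarrow> step2 F \<Longrightarrow> \<bar>mean (\<lambda>x y. G x y * F x y)\<bar> \<le> k * Lp_norm p (embed F)"
  by (simp add: dual_bound_def)

lemma dual_bound_mixed:
  assumes "step2 G" "\<And>N F. dep2 N F \<Longrightarrow> dep2 N G \<Longrightarrow> avg2 N (\<lambda>x y. \<bar>G x y\<bar> * \<bar>F x y\<bar>) \<le> k * mixed_norm p N F"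
  shows "dual_bound p k G"
  unfolding dual_bound_def
proof (intro allI impI)
  fix F assume "step2 F"
  then obtain N where N: "dep2 N F" "dep2 N G" using step2_common assms(1) by blast
  have "\<bar>mean (\<lambda>x y. G x y * F x y)\<bar> = \<bar>avg2 N (\<lambda>x y. G x y * F x y)\<bar>"
    by (simp only: mean_eq[OF dep2_mult[OF N(2,1)]])
  also have "\<dots> \<le> avg2 N (\<lambda>x y. \<bar>G x y * F x y\<bar>)" by (rule abs_avg2_le)
  also have "\<dots> \<le> k * mixed_norm p N F" using assms(2)[OF N] by (simp only: abs_mult)
  finally show "\<bar>mean (\<lambda>x y. G x y * F x y)\<bar> \<le> k * Lp_norm p (embed F)"
    by (simp only: Lp_norm_embed[OF N(1)])
qed

lemma dual_bound_sup:
  assumes p: "p > 1" and G: "step2 G" "\<And>x y. \<bar>G x y\<bar> \<le> k"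
  shows "dual_bound p k G"
proof (rule dual_bound_mixed[OF G(1)])
  fix N F assume "dep2 N F"
  have k: "0 \<le> k" using order_trans[OF abs_ge_zero G(2)] .
  have "avg2 N (\<lambda>x y. \<bar>G x y\<bar> * \<bar>F x y\<bar>) \<le> avg2 N (\<lambda>x y. k * \<bar>F x y\<bar>)"
    by (intro avg2_mono mult_right_mono G) simp
  also have "\<dots> = k * avg2 N (\<lambda>x y. \<bar>F x y\<bar>)" by (rule avg2_cmult)
  also have "\<dots> \<le> k * mixed_norm p N F"
    by (intro mult_left_mono avg2_abs_le_mixed_norm p k)
  finally show "avg2 N (\<lambda>x y. \<bar>G x y\<bar> * \<bar>F x y\<bar>) \<le> k * mixed_norm p N F" .
qed

lemma avg2_strip_le:
  assumes "n \<le> N"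
  shows "avg2 N (\<lambda>x y. if y \<inter> {..<n} = b then 1 else 0) \<le> 1 / 2 ^ n"
proof (cases "b \<subseteq> {..<n}")
  case True
  then show ?thesis unfolding avg2_def using avg_cell[OF True assms] by simp
next
  case False
  then have "y \<inter> {..<n} \<noteq> b" for y by auto
  then show ?thesis by (simp add: avg2_def)
qed

text \<open>Hoelder's inequality in s: with q conjugate to p, the indicator of a cell of level n has
  L_q norm 2^(-n/q), and 1/q = 1 - 1/p.\<close>

lemma dual_bound_strip:
  assumes p: "p > 1" and G: "step2 G" "\<And>x y. \<bar>G x y\<bar> \<le> (if x \<inter> {..<n} = a then 1 else 0)"
  shows "dual_bound p (2 powr (- (1 - 1 / p) * real n)) G"
proof (rule dual_bound_mixed[OF G(1)])
  fix N F assume N: "dep2 N F" "dep2 N G"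
  define q where "q = p / (p - 1)"
  have q: "q > 1" "1 / p + 1 / q = 1" "1 / q = 1 - 1 / p" using p by (auto simp: q_def field_simps)
  define M where "M = max n N"
  have N': "N \<le> M" and n: "n \<le> M" by (auto simp: M_def)
  let ?i = "\<lambda>x. if x \<inter> {..<n} = a then 1 else 0 :: real"
  let ?m = "\<lambda>x. avg {..<M} (\<lambda>y. \<bar>F x y\<bar>)"
  have i: "avg {..<M} ?i \<le> 1 / 2 ^ n"
  proof (cases "a \<subseteq> {..<n}")
    case True
    then show ?thesis using avg_cell[OF True n] by simp
  next
    case False
    then have "?i = (\<lambda>_. 0)" by auto
    then show ?thesis by simp
  qed
  have d: "dep2 N (\<lambda>x y. \<bar>G x y\<bar> * \<bar>F x y\<bar>)"
    by (rule dep2_compose2[OF N(2,1), of "\<lambda>a b. \<bar>a\<bar> * \<bar>b\<bar>"])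
  have "avg2 N (\<lambda>x y. \<bar>G x y\<bar> * \<bar>F x y\<bar>) = avg2 M (\<lambda>x y. \<bar>G x y\<bar> * \<bar>F x y\<bar>)"
    by (rule avg2_level[OF d N', symmetric])
  also have "\<dots> \<le> avg2 M (\<lambda>x y. ?i x * \<bar>F x y\<bar>)"
    by (intro avg2_mono mult_right_mono G) simp
  also have "\<dots> = avg {..<M} (\<lambda>x. ?m x * ?i x)"
    unfolding avg2_def avg_cmult by (simp only: mult.commute)
  also have "\<dots> \<le> avg {..<M} (\<lambda>x. ?m x powr p) powr (1 / p) * avg {..<M} (\<lambda>x. ?i x powr q) powr (1 / q)"
    by (intro avg_holder p q avg_nonneg) auto
  also have "avg {..<M} (\<lambda>x. ?m x powr p) powr (1 / p) = mixed_norm p M F" by (simp add: mixed_norm_def)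
  also have "mixed_norm p M F = mixed_norm p N F"
    using Lp_norm_embed[OF N(1), of p] Lp_norm_embed[OF dep2_mono[OF N(1) N'], of p] by simp
  also have "(\<lambda>x. ?i x powr q) = ?i" by auto
  also have "mixed_norm p N F * avg {..<M} ?i powr (1 / q) \<le> mixed_norm p N F * (1 / 2 ^ n) powr (1 / q)"
    using q(1) i p by (intro mult_left_mono powr_mono2 avg_nonneg) auto
  also have "(1 / 2 ^ n) powr (1 / q) = 2 powr (- (1 - 1 / p) * real n)"
  proof -
    have "(1 / 2 ^ n :: real) = 2 powr (- real n)" by (simp add: powr_minus powr_realpow divide_inverse)
    then show ?thesis unfolding q(3) by (simp add: powr_powr algebra_simps)
  qed
  finally show "avg2 N (\<lambda>x y. \<bar>G x y\<bar> * \<bar>F x y\<bar>) \<le> 2 powr (- (1 - 1 / p) * real n) * mixed_norm p N F"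
    by (simp add: mult.commute)
qed

lemma step2_bounded:
  assumes "step2 F" shows "\<exists>K\<ge>0. \<forall>x y. \<bar>F x y\<bar> \<le> K"
proof -
  obtain N where N: "dep2 N F" using assms by (auto simp: step2_def)
  let ?K = "\<Sum>z\<in>Pow {..<N} \<times> Pow {..<N}. \<bar>F (fst z) (snd z)\<bar>"
  have "\<bar>F x y\<bar> \<le> ?K" for x y
  proof -
    have "\<bar>F (fst (x \<inter> {..<N}, y \<inter> {..<N})) (snd (x \<inter> {..<N}, y \<inter> {..<N}))\<bar> \<le> ?K"
      by (rule member_le_sum) auto
    then show ?thesis using dep2D[OF N, of x y] by simp
  qed
  moreover have "0 \<le> ?K" by (intro sum_nonneg) simp
  ultimately show ?thesis by blast
qed


section \<open>Norming functionals\<close>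

text \<open>The functional of norm at most one that attains the norm of F in L_p(L_1): the sign of
  F, weighted by the power p - 1 of the L_1 norm of the slice. For F of norm zero, division by zero
  makes it vanish, which is a correct value.\<close>

definition norming :: "real \<Rightarrow> nat \<Rightarrow> (nat set \<Rightarrow> nat set \<Rightarrow> real) \<Rightarrow> nat set \<Rightarrow> nat set \<Rightarrow> real" where
  "norming p N F x y = sgn (F x y) * avg {..<N} (\<lambda>y. \<bar>F x y\<bar>) powr (p - 1) / mixed_norm p N F powr (p - 1)"

lemma dep2_norming: "dep2 N F \<Longrightarrow> dep2 N (norming p N F)"
  using dep2_row[of N F] by (simp add: dep2_def norming_def)

lemma avg2_norming:
  assumes p: "p > 1"
  shows "avg2 N (\<lambda>x y. norming p N F x y * F x y) = mixed_norm p N F"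
proof -
  let ?m = "\<lambda>x. avg {..<N} (\<lambda>y. \<bar>F x y\<bar>)" and ?c = "mixed_norm p N F"
  have "norming p N F x y * F x y = inverse (?c powr (p - 1)) * (?m x powr (p - 1) * \<bar>F x y\<bar>)" for x y
    by (simp add: norming_def divide_inverse abs_sgn[of "F x y"] mult_ac)
  then have "avg2 N (\<lambda>x y. norming p N F x y * F x y) = inverse (?c powr (p - 1)) * avg {..<N} (\<lambda>x. ?m x powr (p - 1) * ?m x)"
    by (simp only: avg2_cmult) (simp only: avg2_def avg_cmult)
  also have "\<dots> = inverse (?c powr (p - 1)) * avg {..<N} (\<lambda>x. ?m x powr p)"
    by (simp add: powr_pred_mult avg_nonneg)
  also have "avg {..<N} (\<lambda>x. ?m x powr p) = ?c powr p"
    using p avg_nonneg[of "{..<N}" "\<lambda>x. ?m x powr p"] by (simp add: mixed_norm_def powr_powr)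
  also have "?c powr p = ?c powr (p - 1) * ?c" by (simp add: powr_pred_mult)
  finally show ?thesis by (cases "?c = 0") auto
qed

lemma dual_bound_norming:
  assumes p: "p > 1" and F: "dep2 N F"
  shows "dual_bound p 1 (norming p N F)"
proof (rule dual_bound_mixed)
  show "step2 (norming p N F)" by (rule step2I[OF dep2_norming[OF F]])
  fix M H assume H: "dep2 M H" "dep2 M (norming p N F)"
  define q where "q = p / (p - 1)"
  have q: "q > 1" "1 / p + 1 / q = 1" "(p - 1) * q = p" "p * (1 / q) = p - 1"
    using p by (auto simp: q_def field_simps)
  define K where "K = max N M"
  have NK: "N \<le> K" and MK: "M \<le> K" by (auto simp: K_def)
  let ?m = "\<lambda>x. avg {..<N} (\<lambda>y. \<bar>F x y\<bar>)" and ?c = "mixed_norm p N F"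
  let ?h = "\<lambda>x. avg {..<K} (\<lambda>y. \<bar>H x y\<bar>)"
  have m: "0 \<le> ?m x" for x by (rule avg_nonneg) simp
  have "dep N ?m"
    using dep2_row[OF F] by (simp add: dep_def)
  then have dm: "dep N (\<lambda>x. ?m x powr p)" by (rule dep_compose)
  have "avg2 M (\<lambda>x y. \<bar>norming p N F x y\<bar> * \<bar>H x y\<bar>) = avg2 K (\<lambda>x y. \<bar>norming p N F x y\<bar> * \<bar>H x y\<bar>)"
    by (rule avg2_level[OF dep2_compose2[OF H(2,1), of "\<lambda>a b. \<bar>a\<bar> * \<bar>b\<bar>"] MK, symmetric])
  also have "\<dots> \<le> avg2 K (\<lambda>x y. inverse (?c powr (p - 1)) * (?m x powr (p - 1) * \<bar>H x y\<bar>))"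
  proof (rule avg2_mono)
    fix x y
    have "\<bar>norming p N F x y\<bar> \<le> inverse (?c powr (p - 1)) * ?m x powr (p - 1)"
      by (auto simp: norming_def abs_mult divide_inverse sgn_if)
    then show "\<bar>norming p N F x y\<bar> * \<bar>H x y\<bar> \<le> inverse (?c powr (p - 1)) * (?m x powr (p - 1) * \<bar>H x y\<bar>)"
      using mult_right_mono[of _ _ "\<bar>H x y\<bar>"] by (simp add: mult.assoc[symmetric])
  qed
  also have "\<dots> = inverse (?c powr (p - 1)) * avg {..<K} (\<lambda>x. ?h x * ?m x powr (p - 1))"
    unfolding avg2_cmult unfolding avg2_def avg_cmult by (simp only: mult.commute)
  also have "\<dots> \<le> inverse (?c powr (p - 1)) * (avg {..<K} (\<lambda>x. ?h x powr p) powr (1 / p) * avg {..<K} (\<lambda>x. (?m x powr (p - 1)) powr q) powr (1 / q))"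
    by (intro mult_left_mono avg_holder p q avg_nonneg) auto
  also have "avg {..<K} (\<lambda>x. ?h x powr p) powr (1 / p) = mixed_norm p K H" by (simp add: mixed_norm_def)
  also have "mixed_norm p K H = mixed_norm p M H"
    using Lp_norm_embed[OF H(1), of p] Lp_norm_embed[OF dep2_mono[OF H(1) MK], of p] by simp
  also have "avg {..<K} (\<lambda>x. (?m x powr (p - 1)) powr q) powr (1 / q) = ?c powr (p - 1)"
  proof -
    have "avg {..<K} (\<lambda>x. (?m x powr (p - 1)) powr q) = avg {..<N} (\<lambda>x. ?m x powr p)"
      using avg_level[OF dm NK] by (simp add: powr_powr q)
    also have "\<dots> = ?c powr p"
      using p avg_nonneg[of "{..<N}" "\<lambda>x. ?m x powr p"] by (simp add: mixed_norm_def powr_powr)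
    finally show ?thesis using q by (simp add: powr_powr)
  qed
  also have "inverse (?c powr (p - 1)) * (mixed_norm p M H * ?c powr (p - 1)) \<le> 1 * mixed_norm p M H"
    by (cases "?c = 0") (simp_all add: field_simps)
  finally show "avg2 M (\<lambda>x y. \<bar>norming p N F x y\<bar> * \<bar>H x y\<bar>) \<le> 1 * mixed_norm p M H" .
qed


section \<open>Composition with sign maps and its adjoint\<close>

locale sign_pair =
  fixes \<rho> \<sigma> :: "nat \<Rightarrow> nat set \<Rightarrow> real"
  assumes \<rho>: "sign_system \<rho>" and \<sigma>: "sign_system \<sigma>"
begin

abbreviation lift where "lift \<equiv> compose_signs \<rho> \<sigma>"

lemma common_levels:
  assumes "dep2 N F"
  shows "\<exists>M\<ge>N. dep2 M (lift F) \<and>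
    (\<forall>f. dep N f \<longrightarrow> avg {..<M} (\<lambda>x. f (sign_map \<rho> x)) = avg {..<N} f) \<and>
    (\<forall>f. dep N f \<longrightarrow> avg {..<M} (\<lambda>x. f (sign_map \<sigma> x)) = avg {..<N} f)"
proof -
  obtain n Z where n: "strict_mono n" "\<And>r. \<rho> r = signed_rad (n r) (Z r)"
    and dn: "\<And>N (f :: nat set \<Rightarrow> real). dep N f \<Longrightarrow> dep (n N) (\<lambda>x. f (sign_map \<rho> x))"
    using sign_system_levels[OF \<rho>] by metis
  obtain m W where m: "strict_mono m" "\<And>r. \<sigma> r = signed_rad (m r) (W r)"
    and dm: "\<And>N (f :: nat set \<Rightarrow> real). dep N f \<Longrightarrow> dep (m N) (\<lambda>x. f (sign_map \<sigma> x))"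
    using sign_system_levels[OF \<sigma>] by metis
  define M where "M = max N (max (n N) (m N))"
  have le: "N \<le> M" "n N \<le> M" "m N \<le> M" by (auto simp: M_def)
  have "lift F (x \<inter> {..<M}) (y \<inter> {..<M}) = lift F x y" for x y
  proof -
    have "F (sign_map \<rho> (x \<inter> {..<M})) z = F (sign_map \<rho> x) z" for z
      using dep_mono[OF dn[OF dep2_section'[OF assms]] le(2)] by (simp add: dep_def)
    moreover have "F z (sign_map \<sigma> (y \<inter> {..<M})) = F z (sign_map \<sigma> y)" for z
      using dep_mono[OF dm[OF dep2_section[OF assms]] le(3)] by (simp add: dep_def)
    ultimately show ?thesis by (simp add: compose_signs_def)
  qed
  then have "dep2 M (lift F)" by (simp add: dep2_def)
  moreover have "\<forall>f. dep N f \<longrightarrow> avg {..<M} (\<lambda>x. f (sign_map \<rho> x)) = avg {..<N} f"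
    using avg_sign_map[OF n(2,1) \<rho> _ le(2)] by blast
  moreover have "\<forall>f. dep N f \<longrightarrow> avg {..<M} (\<lambda>x. f (sign_map \<sigma> x)) = avg {..<N} f"
    using avg_sign_map[OF m(2,1) \<sigma> _ le(3)] by blast
  ultimately show ?thesis using le(1) by blast
qed

lemma step2_compose: "step2 F \<Longrightarrow> step2 (lift F)"
  using common_levels unfolding step2_def by blast

lemma mean_compose:
  assumes "step2 F" shows "mean (lift F) = mean F"
proof -
  obtain N where N: "dep2 N F" using assms by (auto simp: step2_def)
  obtain M where M: "dep2 M (lift F)"
    "\<And>f. dep N f \<Longrightarrow> avg {..<M} (\<lambda>x. f (sign_map \<rho> x)) = avg {..<N} f"
    "\<And>f. dep N f \<Longrightarrow> avg {..<M} (\<lambda>x. f (sign_map \<sigma> x)) = avg {..<N} f"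
    using common_levels[OF N] by blast
  have d: "dep N (\<lambda>x. avg {..<N} (F x))"
    using dep2_row[OF N] by (simp add: dep_def)
  have "mean (lift F) = avg {..<M} (\<lambda>x. avg {..<N} (F (sign_map \<rho> x)))"
    unfolding mean_eq[OF M(1)] avg2_def compose_signs_def by (simp only: M(3)[OF dep2_section[OF N]])
  also have "\<dots> = mean F" unfolding M(2)[OF d] mean_eq[OF N] avg2_def ..
  finally show ?thesis .
qed

lemma Lp_norm_compose:
  assumes "step2 F" shows "Lp_norm p (embed (lift F)) = Lp_norm p (embed F)"
proof -
  obtain N where N: "dep2 N F" using assms by (auto simp: step2_def)
  obtain M where M: "dep2 M (lift F)"
    "\<And>f. dep N f \<Longrightarrow> avg {..<M} (\<lambda>x. f (sign_map \<rho> x)) = avg {..<N} f"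
    "\<And>f. dep N f \<Longrightarrow> avg {..<M} (\<lambda>x. f (sign_map \<sigma> x)) = avg {..<N} f"
    using common_levels[OF N] by blast
  have d: "dep N (\<lambda>x. avg {..<N} (\<lambda>y. \<bar>F x y\<bar>) powr p)"
    using dep2_row[OF N] by (simp add: dep_def)
  have "mixed_norm p M (lift F) = avg {..<M} (\<lambda>x. avg {..<N} (\<lambda>y. \<bar>F (sign_map \<rho> x) y\<bar>) powr p) powr (1 / p)"
    unfolding mixed_norm_def compose_signs_def
    by (simp only: M(3)[OF dep_compose[OF dep2_section[OF N], of abs]])
  also have "\<dots> = mixed_norm p N F" unfolding mixed_norm_def M(2)[OF d] ..
  finally show ?thesis unfolding Lp_norm_embed[OF M(1)] Lp_norm_embed[OF N] .
qed

lemma centered_compose: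
  assumes "centered F" shows "centered (lift F)"
proof -
  obtain N where F: "mean_zero N F" using assms by (auto simp: centered_def)
  note N = mean_zeroD(1)[OF F]
  obtain M where M: "dep2 M (lift F)"
    "\<And>f. dep N f \<Longrightarrow> avg {..<M} (\<lambda>x. f (sign_map \<rho> x)) = avg {..<N} f"
    "\<And>f. dep N f \<Longrightarrow> avg {..<M} (\<lambda>x. f (sign_map \<sigma> x)) = avg {..<N} f"
    using common_levels[OF N] by blast
  have "mean_zero M (lift F)"
  proof (rule mean_zeroI[OF M(1)])
    show "avg {..<M} (\<lambda>x. lift F x y) = 0" for y
      unfolding compose_signs_def M(2)[OF dep2_section'[OF N]] by (rule mean_zeroD(2)[OF F])
    show "avg {..<M} (lift F x) = 0" for x
      unfolding compose_signs_def M(3)[OF dep2_section[OF N]] by (rule mean_zeroD(3)[OF F])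
  qed
  then show ?thesis by (auto simp: centered_def)
qed

lemma compose_signs_mult:
  "lift (\<lambda>x y. F x y * G x y) = (\<lambda>x y. lift F x y * lift G x y)"
  by (intro ext) (simp add: compose_signs_def)

lemma compose_signs_walsh:
  "lift (\<lambda>x y. walsh A x * walsh B y) = (\<lambda>x y. sign_prod \<rho> A x * sign_prod \<sigma> B y)"
  by (intro ext) (simp add: compose_signs_def sign_prod_walsh[OF \<rho>] sign_prod_walsh[OF \<sigma>])

text \<open>Composition preserves the norms of slices, so the lift of the norming functional of F is
  the norming functional of the lift. Its bound does not pass through the adjoint, whose own norm
  estimate rests on it.\<close>

lemma compose_norming:
  assumes p: "p > 1" and F: "dep2 N F"
  shows "dual_bound p 1 (lift (norming p N F))"
proof -
  obtain M where M: "dep2 M (lift F)"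
    "\<And>f. dep N f \<Longrightarrow> avg {..<M} (\<lambda>x. f (sign_map \<sigma> x)) = avg {..<N} f"
    using common_levels[OF F] by blast
  have "mixed_norm p M (lift F) = mixed_norm p N F"
    using Lp_norm_compose[OF step2I[OF F], of p] unfolding Lp_norm_embed[OF M(1)] Lp_norm_embed[OF F] .
  moreover have "avg {..<M} (\<lambda>y. \<bar>lift F x y\<bar>) = avg {..<N} (\<lambda>y. \<bar>F (sign_map \<rho> x) y\<bar>)" for x
    unfolding compose_signs_def by (rule M(2)[OF dep_compose[OF dep2_section[OF F], of abs]])
  ultimately have "norming p M (lift F) = lift (norming p N F)"
    by (intro ext) (simp add: norming_def, simp add: compose_signs_def norming_def)
  then show ?thesis using dual_bound_norming[OF p M(1)] by simp
qed

text \<open>The sign with index r lives at a level at least r. An index outside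
  \<open>{..<N}\<close> thus brings in a digit that F does not see. This makes the Walsh expansion
  of the adjoint finite.\<close>

lemma mean_sign_prod_eq_0:
  assumes F: "dep2 N F" and AB: "finite A" "finite B" "\<not> A \<subseteq> {..<N} \<or> \<not> B \<subseteq> {..<N}"
  shows "mean (\<lambda>x y. F x y * (sign_prod \<rho> A x * sign_prod \<sigma> B y)) = 0"
proof -
  obtain n Z where n: "strict_mono n" "\<And>r. \<rho> r = signed_rad (n r) (Z r)" "\<And>r. r \<le> n r"
    "\<And>N A. A \<subseteq> {..<N} \<Longrightarrow> dep (n N) (sign_prod \<rho> A)"
    using sign_system_levels[OF \<rho>] by metis
  obtain m W where m: "strict_mono m" "\<And>r. \<sigma> r = signed_rad (m r) (W r)" "\<And>r. r \<le> m r"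
    "\<And>N A. A \<subseteq> {..<N} \<Longrightarrow> dep (m N) (sign_prod \<sigma> A)"
    using sign_system_levels[OF \<sigma>] by metis
  obtain R where R: "A \<subseteq> {..<R}" "B \<subseteq> {..<R}"
  proof -
    obtain R where "\<forall>i\<in>A \<union> B. i < R" using AB(1,2) finite_nat_set_iff_bounded by (metis finite_Un)
    then show ?thesis by (intro that[of R]) auto
  qed
  define K where "K = max N (max (n R) (m R))"
  have le: "N \<le> K" "n R \<le> K" "m R \<le> K" by (auto simp: K_def)
  have dF: "dep2 K F" by (rule dep2_mono[OF F le(1)])
  have dA: "dep K (sign_prod \<rho> A)" by (rule dep_mono[OF n(4)[OF R(1)] le(2)])
  have dB: "dep K (sign_prod \<sigma> B)" by (rule dep_mono[OF m(4)[OF R(2)] le(3)])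
  have eq: "mean (\<lambda>x y. F x y * (sign_prod \<rho> A x * sign_prod \<sigma> B y)) = avg2 K (\<lambda>x y. F x y * (sign_prod \<rho> A x * sign_prod \<sigma> B y))"
    by (intro mean_eq dep2_mult dF dep2_tensor dA dB)
  from AB(3) show ?thesis
  proof
    assume A: "\<not> A \<subseteq> {..<N}"
    then have ne: "A \<noteq> {}" by auto
    obtain i where i: "i \<in> A" "N \<le> i" using A by (meson subsetI lessThan_iff not_le)
    have Max: "N \<le> Max A" "Max A \<in> A" using order_trans[OF i(2) Max_ge[OF AB(1) i(1)]] AB(1) ne by simp_all
    have "n (Max A) < K" using strict_monoD[OF n(1), of "Max A" R] R(1) Max(2) le(2) by auto
    then have "avg {..<K} (\<lambda>x. F x y * sign_prod \<rho> A x) = 0" for y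
      using Max n(3)[of "Max A"] by (intro avg_sign_prod[OF n(2,1) AB(1) ne dep2_section'[OF F]]) auto
    then have "avg {..<K} (\<lambda>x. F x y * (sign_prod \<rho> A x * sign_prod \<sigma> B y)) = 0" for y
      by (simp add: mult.assoc[symmetric] avg_mult_const)
    then show ?thesis unfolding eq avg2_swap by simp
  next
    assume B: "\<not> B \<subseteq> {..<N}"
    then have ne: "B \<noteq> {}" by auto
    obtain i where i: "i \<in> B" "N \<le> i" using B by (meson subsetI lessThan_iff not_le)
    have Max: "N \<le> Max B" "Max B \<in> B" using order_trans[OF i(2) Max_ge[OF AB(2) i(1)]] AB(2) ne by simp_all
    have "m (Max B) < K" using strict_monoD[OF m(1), of "Max B" R] R(2) Max(2) le(3) by auto
    then have "avg {..<K} (\<lambda>y. F x y * sign_prod \<sigma> B y) = 0" for x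
      using Max m(3)[of "Max B"] by (intro avg_sign_prod[OF m(2,1) AB(2) ne dep2_section[OF F]]) auto
    then have "avg {..<K} (\<lambda>y. sign_prod \<rho> A x * (F x y * sign_prod \<sigma> B y)) = 0" for x
      by (simp add: avg_cmult)
    then have "avg {..<K} (\<lambda>y. F x y * (sign_prod \<rho> A x * sign_prod \<sigma> B y)) = 0" for x
      by (simp add: mult_ac)
    then show ?thesis unfolding eq avg2_def by simp
  qed
qed

text \<open>H is the conditional expectation of F given the new signs, transported back along the
  sign maps. Describing it by duality avoids averages over their fibres.\<close>

definition adjoint_of :: "(nat set \<Rightarrow> nat set \<Rightarrow> real) \<Rightarrow> (nat set \<Rightarrow> nat set \<Rightarrow> real) \<Rightarrow> bool" where
  "adjoint_of F H \<longleftrightarrow> step2 H \<and>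
     (\<forall>G. step2 G \<longrightarrow> mean (\<lambda>x y. G x y * H x y) = mean (\<lambda>x y. lift G x y * F x y))"

lemma step2_walsh: "finite A \<Longrightarrow> finite B \<Longrightarrow> step2 (\<lambda>x y. walsh A x * walsh B y)"
proof -
  assume "finite A" "finite B"
  then obtain R where "\<forall>i\<in>A \<union> B. i < R" using finite_nat_set_iff_bounded by (metis finite_Un)
  then have "A \<subseteq> {..<R}" "B \<subseteq> {..<R}" by auto
  then show ?thesis by (intro step2I[of R] dep2_tensor dep_walsh)
qed

lemma mean_walsh_mult:
  assumes "finite A" "finite B" "finite C" "finite D"
  shows "mean (\<lambda>x y. (walsh A x * walsh B y) * (walsh C x * walsh D y)) = (if A = C \<and> B = D then 1 else 0)"
proof -
  have "finite (sdiff A C)" "finite (sdiff B D)" using assms by (auto simp: sdiff_def)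
  then obtain R where R: "\<forall>i\<in>sdiff A C \<union> sdiff B D. i < R" using finite_nat_set_iff_bounded by (metis finite_Un)
  then have sub: "sdiff A C \<subseteq> {..<R}" "sdiff B D \<subseteq> {..<R}" by auto
  have "(\<lambda>x y. (walsh A x * walsh B y) * (walsh C x * walsh D y)) = (\<lambda>x y. walsh (sdiff A C) x * walsh (sdiff B D) y)"
    by (intro ext) (simp add: walsh_mult[symmetric] assms mult_ac)
  then have "mean (\<lambda>x y. (walsh A x * walsh B y) * (walsh C x * walsh D y)) = avg2 R (\<lambda>x y. walsh (sdiff A C) x * walsh (sdiff B D) y)"
    using mean_eq[OF dep2_tensor[OF dep_walsh[OF sub(1)] dep_walsh[OF sub(2)]]] by simp
  also have "\<dots> = avg {..<R} (walsh (sdiff A C)) * avg {..<R} (walsh (sdiff B D))"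
    unfolding avg2_def by (simp only: avg_cmult avg_mult_const)
  also have "\<dots> = (if A = C \<and> B = D then 1 else 0)"
  proof -
    have "sdiff X Y = {} \<longleftrightarrow> X = Y" for X Y :: "nat set" by (auto simp: sdiff_def)
    then show ?thesis by (simp add: avg_walsh sub)
  qed
  finally show ?thesis .
qed

text \<open>The Walsh coefficients are forced to be the means of F against products of signs, and
  only those with indices below N can be nonzero.\<close>

lemma adjoint_exists:
  assumes "step2 F" shows "\<exists>H. adjoint_of F H"
proof -
  obtain N where N: "dep2 N F" using assms by (auto simp: step2_def)
  let ?J = "Pow {..<N} \<times> Pow {..<N}"
  let ?w = "\<lambda>z x y. walsh (fst z) x * walsh (snd z) y"
  let ?s = "\<lambda>z x y. sign_prod \<rho> (fst z) x * sign_prod \<sigma> (snd z) y"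
  define H where "H x y = (\<Sum>z\<in>?J. mean (\<lambda>x y. F x y * ?s z x y) * ?w z x y)" for x y
  have fin: "finite (fst z)" "finite (snd z)" if "z \<in> Pow {..<M} \<times> Pow {..<M}" for z and M :: nat
    using that finite_subset[of _ "{..<M}"] by auto
  have stw: "step2 (?w z)" if "finite (fst z)" "finite (snd z)" for z by (rule step2_walsh[OF that])
  have sts: "step2 (?s z)" if "finite (fst z)" "finite (snd z)" for z
    using step2_compose[OF stw[OF that]] by (simp only: compose_signs_walsh)
  have H: "step2 H" unfolding H_def by (intro step2_sum step2_cmult stw) (rule fin, assumption)+
  have wH: "mean (\<lambda>x y. ?w z x y * H x y) = mean (\<lambda>x y. F x y * ?s z x y)" if z: "finite (fst z)" "finite (snd z)" for z
  proof -
    have "(\<lambda>x y. ?w z x y * H x y) = (\<lambda>x y. \<Sum>u\<in>?J. mean (\<lambda>x y. F x y * ?s u x y) * (?w z x y * ?w u x y))"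
      unfolding H_def by (intro ext) (simp only: sum_distrib_left mult_ac)
    then have "mean (\<lambda>x y. ?w z x y * H x y) = mean (\<lambda>x y. \<Sum>u\<in>?J. mean (\<lambda>x y. F x y * ?s u x y) * (?w z x y * ?w u x y))"
      by (rule arg_cong)
    also have "\<dots> = (\<Sum>u\<in>?J. mean (\<lambda>x y. F x y * ?s u x y) * mean (\<lambda>x y. ?w z x y * ?w u x y))"
      using step2_mult[OF stw[OF z] stw[OF fin]] by (intro mean_sum) simp_all
    also have "\<dots> = (\<Sum>u\<in>?J. if u = z then mean (\<lambda>x y. F x y * ?s u x y) else 0)"
    proof (rule sum.cong[OF refl])
      fix u assume "u \<in> ?J"
      have "mean (\<lambda>x y. ?w z x y * ?w u x y) = (if u = z then 1 else 0)"
        using mean_walsh_mult[OF z fin[OF \<open>u \<in> ?J\<close>]] by (simp add: prod_eq_iff eq_commute)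
      then show "mean (\<lambda>x y. F x y * ?s u x y) * mean (\<lambda>x y. ?w z x y * ?w u x y) = (if u = z then mean (\<lambda>x y. F x y * ?s u x y) else 0)"
        by simp
    qed
    also have "\<dots> = (if z \<in> ?J then mean (\<lambda>x y. F x y * ?s z x y) else 0)"
      by (rule sum.delta) simp
    also have "\<dots> = mean (\<lambda>x y. F x y * ?s z x y)"
    proof (cases "z \<in> ?J")
      case False
      then have "\<not> fst z \<subseteq> {..<N} \<or> \<not> snd z \<subseteq> {..<N}" by (simp add: mem_Times_iff)
      from mean_sign_prod_eq_0[OF N z this] show ?thesis using False by simp
    qed simp
    finally show ?thesis .
  qed
  have "mean (\<lambda>x y. G x y * H x y) = mean (\<lambda>x y. lift G x y * F x y)" if "step2 G" for G
  proof -
    obtain M where M: "dep2 M G" using \<open>step2 G\<close> by (auto simp: step2_def)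
    let ?L = "Pow {..<M} \<times> Pow {..<M}"
    let ?c = "\<lambda>z. coef M G (fst z) (snd z)"
    have "(\<lambda>x y. G x y * H x y) = (\<lambda>x y. \<Sum>z\<in>?L. ?c z * (?w z x y * H x y))"
    proof (intro ext)
      fix x y
      have "G x y = (\<Sum>z\<in>?L. ?c z * ?w z x y)"
        unfolding walsh_expand2[OF M, of x y] by (simp add: sum.cartesian_product case_prod_unfold)
      then show "G x y * H x y = (\<Sum>z\<in>?L. ?c z * (?w z x y * H x y))"
        by (simp only: sum_distrib_right mult.assoc)
    qed
    then have "mean (\<lambda>x y. G x y * H x y) = mean (\<lambda>x y. \<Sum>z\<in>?L. ?c z * (?w z x y * H x y))"
      by (rule arg_cong)
    also have "\<dots> = (\<Sum>z\<in>?L. ?c z * mean (\<lambda>x y. ?w z x y * H x y))"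
      using step2_mult[OF stw[OF fin] H] by (intro mean_sum) simp_all
    also have "\<dots> = (\<Sum>z\<in>?L. ?c z * mean (\<lambda>x y. F x y * ?s z x y))"
    proof (rule sum.cong[OF refl])
      fix z assume "z \<in> ?L"
      show "?c z * mean (\<lambda>x y. ?w z x y * H x y) = ?c z * mean (\<lambda>x y. F x y * ?s z x y)"
        by (simp only: wH[OF fin[OF \<open>z \<in> ?L\<close>]])
    qed
    also have "\<dots> = mean (\<lambda>x y. \<Sum>z\<in>?L. ?c z * (F x y * ?s z x y))"
      using step2_mult[OF assms sts[OF fin]] by (intro mean_sum[symmetric]) simp_all
    also have "(\<lambda>x y. \<Sum>z\<in>?L. ?c z * (F x y * ?s z x y)) = (\<lambda>x y. lift G x y * F x y)"
      unfolding compose_signs_expand[OF \<rho> \<sigma> M] sum_distrib_right by (intro ext sum.cong refl) (simp only: mult_ac)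
    finally show ?thesis .
  qed
  then show ?thesis using H unfolding adjoint_of_def by blast
qed

lemma step2_eq_0:
  assumes "step2 H" "\<And>G. step2 G \<Longrightarrow> mean (\<lambda>x y. G x y * H x y) = 0"
  shows "H x y = 0"
proof -
  obtain N where N: "dep2 N H" using assms(1) by (auto simp: step2_def)
  have "coef N H A B = 0" if "A \<subseteq> {..<N}" "B \<subseteq> {..<N}" for A B
  proof -
    have d: "dep2 N (\<lambda>x y. walsh A x * walsh B y)" by (intro dep2_tensor dep_walsh that)
    have "mean (\<lambda>x y. walsh A x * walsh B y * H x y) = coef N H A B"
      unfolding mean_eq[OF dep2_mult[OF d N]] coef_def by (simp only: mult_ac)
    then show ?thesis using assms(2)[OF step2I[OF d]] by simp
  qed
  then show ?thesis unfolding walsh_expand2[OF N, of x y] by (intro sum.neutral ballI) simp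
qed

lemma adjoint_unique:
  assumes "adjoint_of F H" "adjoint_of F H'" shows "H = H'"
proof (intro ext)
  fix x y
  have st: "step2 H" "step2 H'" using assms by (auto simp: adjoint_of_def)
  have "(\<lambda>x y. H x y - H' x y) x y = 0"
  proof (rule step2_eq_0[OF step2_diff[OF st]])
    fix G assume G: "step2 G"
    have "(\<lambda>x y. G x y * (H x y - H' x y)) = (\<lambda>x y. G x y * H x y - G x y * H' x y)"
      by (simp add: algebra_simps)
    then have "mean (\<lambda>x y. G x y * (H x y - H' x y)) = mean (\<lambda>x y. G x y * H x y) - mean (\<lambda>x y. G x y * H' x y)"
      using mean_diff[OF step2_mult[OF G st(1)] step2_mult[OF G st(2)]] by simp
    then show "mean (\<lambda>x y. G x y * (H x y - H' x y)) = 0"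
      using assms G unfolding adjoint_of_def by simp
  qed
  then show "H x y = H' x y" by simp
qed

definition adjoint :: "(nat set \<Rightarrow> nat set \<Rightarrow> real) \<Rightarrow> nat set \<Rightarrow> nat set \<Rightarrow> real" where
  "adjoint F = (SOME H. adjoint_of F H)"

lemma adjoint: "step2 F \<Longrightarrow> adjoint_of F (adjoint F)"
  unfolding adjoint_def by (rule someI_ex[OF adjoint_exists])

lemma step2_adjoint: "step2 F \<Longrightarrow> step2 (adjoint F)"
  using adjoint[of F] by (simp add: adjoint_of_def)

lemma mean_adjoint:
  "step2 F \<Longrightarrow> step2 G \<Longrightarrow> mean (\<lambda>x y. G x y * adjoint F x y) = mean (\<lambda>x y. lift G x y * F x y)"
  using adjoint[of F] by (simp add: adjoint_of_def)

lemma adjoint_eqI: "step2 F \<Longrightarrow> adjoint_of F H \<Longrightarrow> adjoint F = H"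
  by (rule adjoint_unique[OF adjoint])

lemma adjoint_add:
  assumes "step2 F" "step2 G" shows "adjoint (\<lambda>x y. F x y + G x y) = (\<lambda>x y. adjoint F x y + adjoint G x y)"
proof (rule adjoint_eqI[OF step2_add[OF assms]])
  show "adjoint_of (\<lambda>x y. F x y + G x y) (\<lambda>x y. adjoint F x y + adjoint G x y)"
    unfolding adjoint_of_def
  proof (intro conjI allI impI)
    show "step2 (\<lambda>x y. adjoint F x y + adjoint G x y)" by (intro step2_add step2_adjoint assms)
    fix H assume H: "step2 H"
    show "mean (\<lambda>x y. H x y * (adjoint F x y + adjoint G x y)) = mean (\<lambda>x y. lift H x y * (F x y + G x y))"
      unfolding distrib_left
      using mean_add[OF step2_mult[OF H step2_adjoint[OF assms(1)]] step2_mult[OF H step2_adjoint[OF assms(2)]]]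
        mean_add[OF step2_mult[OF step2_compose[OF H] assms(1)] step2_mult[OF step2_compose[OF H] assms(2)]]
        mean_adjoint[OF assms(1) H] mean_adjoint[OF assms(2) H] by simp
  qed
qed

lemma adjoint_cmult:
  assumes "step2 F" shows "adjoint (\<lambda>x y. c * F x y) = (\<lambda>x y. c * adjoint F x y)"
proof (rule adjoint_eqI[OF step2_cmult[OF assms]])
  show "adjoint_of (\<lambda>x y. c * F x y) (\<lambda>x y. c * adjoint F x y)"
    unfolding adjoint_of_def
  proof (intro conjI allI impI)
    show "step2 (\<lambda>x y. c * adjoint F x y)" by (intro step2_cmult step2_adjoint assms)
    fix H assume H: "step2 H"
    show "mean (\<lambda>x y. H x y * (c * adjoint F x y)) = mean (\<lambda>x y. lift H x y * (c * F x y))"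
      unfolding mult.left_commute[of _ c]
      using mean_cmult[OF step2_mult[OF H step2_adjoint[OF assms]]]
        mean_cmult[OF step2_mult[OF step2_compose[OF H] assms]] mean_adjoint[OF assms H] by simp
  qed
qed

text \<open>The identity AB = Id on step functions; composition with the sign maps respects products
  and means.\<close>

lemma adjoint_compose:
  assumes "step2 F" shows "adjoint (lift F) = F"
proof (rule adjoint_eqI[OF step2_compose[OF assms]])
  show "adjoint_of (lift F) F"
    unfolding adjoint_of_def
  proof (intro conjI allI impI assms)
    fix G assume G: "step2 G"
    show "mean (\<lambda>x y. G x y * F x y) = mean (\<lambda>x y. lift G x y * lift F x y)"
      using mean_compose[OF step2_mult[OF G assms]] by (simp only: compose_signs_mult)
  qed
qed

text \<open>Test the adjoint with its own norming functional and move the composition to the other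
  side, where the lifted functional still has norm at most one.\<close>

lemma Lp_norm_adjoint_le:
  assumes p: "p > 1" and F: "step2 F"
  shows "Lp_norm p (embed (adjoint F)) \<le> Lp_norm p (embed F)"
proof -
  obtain N where N: "dep2 N (adjoint F)" using step2_adjoint[OF F] by (auto simp: step2_def)
  let ?G = "norming p N (adjoint F)"
  have G: "dep2 N ?G" by (rule dep2_norming[OF N])
  have "Lp_norm p (embed (adjoint F)) = mean (\<lambda>x y. ?G x y * adjoint F x y)"
    unfolding Lp_norm_embed[OF N] mean_eq[OF dep2_mult[OF G N]] by (rule avg2_norming[OF p, symmetric])
  also have "\<dots> = mean (\<lambda>x y. lift ?G x y * F x y)"
    by (rule mean_adjoint[OF F step2I[OF G]])
  also have "\<dots> \<le> 1 * Lp_norm p (embed F)"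
    by (rule order_trans[OF abs_ge_self dual_boundD[OF compose_norming[OF p N] F]])
  finally show ?thesis by simp
qed

lemma dual_bound_compose:
  assumes p: "p > 1" and G: "step2 G" "dual_bound p k G" "0 \<le> k"
  shows "dual_bound p k (lift G)"
  unfolding dual_bound_def
proof (intro allI impI)
  fix F assume F: "step2 F"
  have "\<bar>mean (\<lambda>x y. lift G x y * F x y)\<bar> \<le> k * Lp_norm p (embed (adjoint F))"
    unfolding mean_adjoint[OF F G(1), symmetric] by (rule dual_boundD[OF G(2) step2_adjoint[OF F]])
  also have "\<dots> \<le> k * Lp_norm p (embed F)" by (intro mult_left_mono Lp_norm_adjoint_le p F G)
  finally show "\<bar>mean (\<lambda>x y. lift G x y * F x y)\<bar> \<le> k * Lp_norm p (embed F)" .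
qed

text \<open>A partial average g of the adjoint has mean square equal to the mean of F against the
  lift of g. That lift depends on one variable only, and F has mean zero in the other.\<close>

lemma centered_adjoint:
  assumes "centered F" shows "centered (adjoint F)"
proof -
  note F = centered_step2[OF assms]
  obtain N where N: "dep2 N F" "dep2 N (adjoint F)" using step2_common[OF F step2_adjoint[OF F]] by blast
  have z: "mean (\<lambda>x y. lift G x y * F x y) = 0"
    if G: "step2 G" and c: "(\<forall>x x' y. G x y = G x' y) \<or> (\<forall>x y y'. G x y = G x y')" for G
  proof -
    obtain M where M: "dep2 M (lift G)" "dep2 M F"
      using step2_common[OF step2_compose[OF G] F] by blast
    have F0: "mean_zero M F" by (rule centered_mean_zero[OF assms M(2)])
    from c show ?thesis
    proof
      assume "\<forall>x x' y. G x y = G x' y"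
      then have "lift G = (\<lambda>x y. G {} (sign_map \<sigma> y))"
        by (intro ext) (metis compose_signs_def)
      then show ?thesis unfolding mean_eq[OF dep2_mult[OF M]] avg2_swap
        by (simp add: avg_cmult mean_zeroD(2)[OF F0])
    next
      assume "\<forall>x y y'. G x y = G x y'"
      then have "lift G = (\<lambda>x y. G (sign_map \<rho> x) {})"
        by (intro ext) (metis compose_signs_def)
      then show ?thesis unfolding mean_eq[OF dep2_mult[OF M]] avg2_def
        by (simp add: avg_cmult mean_zeroD(3)[OF F0])
    qed
  qed
  have "mean_zero N (adjoint F)"
  proof (rule mean_zeroI[OF N(2)])
    define g where "g y = avg {..<N} (\<lambda>x. adjoint F x y)" for y
    have g: "dep N g" unfolding g_def using dep2_section[OF N(2)] by (simp add: dep_def)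
    have d: "dep2 N (\<lambda>x y. g y)" using dep2_tensor[OF dep_const[of N 1] g] by simp
    have "avg {..<N} (\<lambda>y. g y * g y) = mean (\<lambda>x y. g y * adjoint F x y)"
      unfolding mean_eq[OF dep2_mult[OF d N(2)]] avg2_swap by (simp only: avg_cmult g_def)
    also have "\<dots> = 0"
      unfolding mean_adjoint[OF F step2I[OF d]] by (rule z[OF step2I[OF d]]) simp
    finally show "avg {..<N} (\<lambda>x. adjoint F x y) = 0" for y
      using avg_square_eq_0[OF g, of y] by (simp add: g_def)
  next
    define g where "g x = avg {..<N} (adjoint F x)" for x
    have g: "dep N g"
      using dep2_row[OF N(2)] by (simp add: dep_def g_def)
    have d: "dep2 N (\<lambda>x y. g x)" using dep2_tensor[OF g dep_const[of N 1]] by simp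
    have "avg {..<N} (\<lambda>x. g x * g x) = mean (\<lambda>x y. g x * adjoint F x y)"
      unfolding mean_eq[OF dep2_mult[OF d N(2)]] avg2_def by (simp only: avg_cmult g_def)
    also have "\<dots> = 0"
      unfolding mean_adjoint[OF F step2I[OF d]] by (rule z[OF step2I[OF d]]) simp
    finally show "avg {..<N} (adjoint F x) = 0" for x
      using avg_square_eq_0[OF g, of x] by (simp add: g_def)
  qed
  then show ?thesis by (auto simp: centered_def)
qed

end


section \<open>Projection onto the centered step functions\<close>

text \<open>The product of the two commuting projections that subtract the mean in s and the mean in
  t.\<close>

definition center :: "(nat set \<Rightarrow> nat set \<Rightarrow> real) \<Rightarrow> nat set \<Rightarrow> nat set \<Rightarrow> real" where
  "center F = (let N = LEAST N. dep2 N F in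
     (\<lambda>x y. F x y - avg {..<N} (\<lambda>x. F x y) - avg {..<N} (F x) + avg2 N F))"

lemma center_eq:
  assumes F: "dep2 N F"
  shows "center F = (\<lambda>x y. F x y - avg {..<N} (\<lambda>x. F x y) - avg {..<N} (F x) + avg2 N F)"
proof -
  define M where "M = (LEAST N. dep2 N F)"
  have M: "dep2 M F" "M \<le> N"
    unfolding M_def by (rule LeastI[of "\<lambda>N. dep2 N F", OF F], rule Least_le[of "\<lambda>N. dep2 N F", OF F])
  have "avg {..<N} (F x) = avg {..<M} (F x)" for x
    by (rule avg_level[OF dep2_section[OF M(1)] M(2)])
  moreover have "avg {..<N} (\<lambda>x. F x y) = avg {..<M} (\<lambda>x. F x y)" for y
    by (rule avg_level[OF dep2_section'[OF M(1)] M(2)])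
  moreover have "avg2 N F = avg2 M F" by (rule avg2_level[OF M])
  ultimately show ?thesis by (simp add: center_def Let_def M_def[symmetric])
qed

lemma dep2_averages:
  assumes F: "dep2 N F"
  shows "dep2 N (\<lambda>x y. avg {..<N} (\<lambda>x. F x y))" "dep2 N (\<lambda>x y. avg {..<N} (F x))"
  using dep2_section[OF F] dep2_row[OF F] by (simp_all add: dep2_def dep_def)

lemma centered_center:
  assumes "step2 F" shows "centered (center F)"
proof -
  obtain N where F: "dep2 N F" using assms by (auto simp: step2_def)
  have "mean_zero N (center F)"
  proof (rule mean_zeroI)
    show "dep2 N (center F)"
      unfolding center_eq[OF F] by (intro dep2_add dep2_diff dep2_averages F dep2_const)
    show "avg {..<N} (\<lambda>x. center F x y) = 0" for y
      unfolding center_eq[OF F] by (simp add: avg_add avg_diff avg2_def)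
    show "avg {..<N} (center F x) = 0" for x
      unfolding center_eq[OF F] by (simp add: avg_add avg_diff avg2_swap)
  qed
  then show ?thesis by (auto simp: centered_def)
qed

lemma center_centered:
  assumes "centered F" shows "center F = F"
proof -
  obtain N where F: "mean_zero N F" using assms by (auto simp: centered_def)
  have "avg2 N F = 0" unfolding avg2_def by (simp add: mean_zeroD(3)[OF F])
  then show ?thesis unfolding center_eq[OF mean_zeroD(1)[OF F]] by (simp add: mean_zeroD[OF F])
qed

lemma center_add:
  assumes "step2 F" "step2 G" shows "center (\<lambda>x y. F x y + G x y) = (\<lambda>x y. center F x y + center G x y)"
proof -
  obtain N where N: "dep2 N F" "dep2 N G" using step2_common[OF assms] by blast
  show ?thesis
    unfolding center_eq[OF N(1)] center_eq[OF N(2)] center_eq[OF dep2_add[OF N]]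
    by (intro ext) (simp add: avg_add avg2_add)
qed

lemma center_cmult:
  assumes "step2 F" shows "center (\<lambda>x y. c * F x y) = (\<lambda>x y. c * center F x y)"
proof -
  obtain N where N: "dep2 N F" using assms by (auto simp: step2_def)
  show ?thesis
    unfolding center_eq[OF N] center_eq[OF dep2_cmult[OF N]]
    by (intro ext) (simp add: avg_cmult avg2_cmult algebra_simps)
qed

text \<open>Four terms, each of norm at most that of F: F itself and its averages over s, over t and
  over both.\<close>

lemma Lp_norm_center:
  assumes p: "p > 1" and "step2 F"
  shows "Lp_norm p (embed (center F)) \<le> 4 * Lp_norm p (embed F)"
proof -
  obtain N where F: "dep2 N F" using assms by (auto simp: step2_def)
  let ?X = "\<lambda>x y. avg {..<N} (\<lambda>x. F x y)" and ?Y = "\<lambda>x y. avg {..<N} (F x)" and ?Z = "\<lambda>(x::nat set) (y::nat set). avg2 N F"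
  have d: "dep2 N ?X" "dep2 N ?Y" "dep2 N ?Z" by (intro dep2_averages F dep2_const)+
  note st = step2I[OF F] d[THEN step2I]
  have X: "mixed_norm p N ?X \<le> mixed_norm p N F"
    using mixed_norm_partial_second[OF p, of N "{}" "{}" F "{}"] by simp
  have Y: "mixed_norm p N ?Y \<le> mixed_norm p N F"
    using mixed_norm_partial_first[of p N "{}" "{}" F "{}"] p by simp
  have Z: "mixed_norm p N ?Z \<le> mixed_norm p N F"
    using mixed_norm_partial_second[OF p, of N "{}" "{}" ?Y "{}"] Y by (simp add: avg2_def)
  have "embed (center F) = embed F - embed ?X - embed ?Y + embed ?Z"
    unfolding center_eq[OF F] using st by (simp add: embed_add embed_diff step2_diff)
  also have "Lp_norm p (embed F - embed ?X - embed ?Y + embed ?Z)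
      \<le> Lp_norm p (embed F - embed ?X - embed ?Y) + Lp_norm p (embed ?Z)"
    by (intro Lp_norm_add Lp_norm_diff embed_Lp_space st p)
  also have "Lp_norm p (embed F - embed ?X - embed ?Y) \<le> Lp_norm p (embed F - embed ?X) + Lp_norm p (embed ?Y)"
    by (intro Lp_norm_diff embed_Lp_space st p)
  also have "Lp_norm p (embed F - embed ?X) \<le> Lp_norm p (embed F) + Lp_norm p (embed ?X)"
    by (intro Lp_norm_diff embed_Lp_space st p)
  finally show ?thesis using X Y Z by (simp add: Lp_norm_embed[OF F] d[THEN Lp_norm_embed])
qed

lemma mean_mult_center:
  assumes N: "dep2 N G" "dep2 N F"
  shows "mean (\<lambda>x y. G x y * center F x y) = avg2 N (\<lambda>x y. G x y * F x y)
    - avg {..<N} (\<lambda>y. avg {..<N} (\<lambda>x. G x y) * avg {..<N} (\<lambda>x. F x y))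
    - avg {..<N} (\<lambda>x. avg {..<N} (G x) * avg {..<N} (F x)) + avg2 N G * avg2 N F"
proof -
  have d: "dep2 N (center F)"
    unfolding center_eq[OF N(2)] by (intro dep2_add dep2_diff dep2_averages N dep2_const)
  have "mean (\<lambda>x y. G x y * center F x y) = avg2 N (\<lambda>x y. G x y * F x y - G x y * avg {..<N} (\<lambda>x. F x y)
      - G x y * avg {..<N} (F x) + G x y * avg2 N F)"
    unfolding mean_eq[OF dep2_mult[OF N(1) d]] unfolding center_eq[OF N(2)] by (simp only: distrib_left right_diff_distrib)
  also have "\<dots> = avg2 N (\<lambda>x y. G x y * F x y) - avg2 N (\<lambda>x y. G x y * avg {..<N} (\<lambda>x. F x y))
      - avg2 N (\<lambda>x y. G x y * avg {..<N} (F x)) + avg2 N (\<lambda>x y. G x y * avg2 N F)"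
    by (simp only: avg2_add avg2_diff)
  also have "avg2 N (\<lambda>x y. G x y * avg {..<N} (\<lambda>x. F x y)) = avg {..<N} (\<lambda>y. avg {..<N} (\<lambda>x. G x y) * avg {..<N} (\<lambda>x. F x y))"
    unfolding avg2_swap by (simp only: avg_mult_const)
  also have "avg2 N (\<lambda>x y. G x y * avg {..<N} (F x)) = avg {..<N} (\<lambda>x. avg {..<N} (G x) * avg {..<N} (F x))"
    unfolding avg2_def by (simp only: avg_mult_const)
  also have "avg2 N (\<lambda>x y. G x y * avg2 N F) = avg2 N G * avg2 N F" by (rule avg2_mult_const)
  finally show ?thesis .
qed

text \<open>The projection is self-adjoint: the expression in \<open>mean_mult_center\<close> is
  symmetric in its two functions.\<close>

lemma mean_center_swap:
  assumes "step2 G" "step2 F"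
  shows "mean (\<lambda>x y. center G x y * F x y) = mean (\<lambda>x y. G x y * center F x y)"
proof -
  obtain N where N: "dep2 N G" "dep2 N F" using step2_common[OF assms] by blast
  have "mean (\<lambda>x y. center G x y * F x y) = mean (\<lambda>x y. F x y * center G x y)"
    by (simp only: mult.commute)
  then show ?thesis
    unfolding mean_mult_center[OF N] mean_mult_center[OF N(2,1)] by (simp only: mult.commute)
qed

lemma dual_bound_center:
  assumes p: "p > 1" and G: "step2 G" "dual_bound p k G" "0 \<le> k"
  shows "dual_bound p (4 * k) (center G)"
  unfolding dual_bound_def
proof (intro allI impI)
  fix F assume F: "step2 F"
  have "\<bar>mean (\<lambda>x y. center G x y * F x y)\<bar> \<le> k * Lp_norm p (embed (center F))"
    unfolding mean_center_swap[OF G(1) F] by (rule dual_boundD[OF G(2) centered_step2[OF centered_center[OF F]]])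
  also have "\<dots> \<le> k * (4 * Lp_norm p (embed F))" by (intro mult_left_mono Lp_norm_center p F G)
  finally show "\<bar>mean (\<lambda>x y. center G x y * F x y)\<bar> \<le> 4 * k * Lp_norm p (embed F)" by simp
qed


section \<open>Pairing step functions with elements of the space\<close>

lemma bounded_operatorsD:
  assumes "T \<in> bounded_operators V N"
  shows "Y \<in> V \<Longrightarrow> T Y \<in> V" "Y \<in> V \<Longrightarrow> Z \<in> V \<Longrightarrow> T (Y + Z) = T Y + T Z"
    "Y \<in> V \<Longrightarrow> T (c *\<^sub>R Y) = c *\<^sub>R T Y"
  using assms unfolding bounded_operators_def by auto

lemma bounded_operators_bound:
  assumes "T \<in> bounded_operators V N" "\<And>Y. 0 \<le> N Y"
  shows "\<exists>C\<ge>0. \<forall>Y\<in>V. N (T Y) \<le> C * N Y"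
proof -
  obtain C where C: "\<forall>Y\<in>V. N (T Y) \<le> C * N Y" using assms(1) unfolding bounded_operators_def by auto
  have "N (T Y) \<le> \<bar>C\<bar> * N Y" if "Y \<in> V" for Y
    using C[rule_format, OF that] mult_right_mono[OF abs_ge_self[of C] assms(2)[of Y]] by linarith
  then show ?thesis by (intro exI[of _ "\<bar>C\<bar>"]) simp
qed

context
  fixes p :: real
  assumes p: "p > 1"
begin

lemma X00_sequence:
  assumes "Y \<in> X00 p"
  shows "\<exists>h. (\<forall>n. centered (h n)) \<and> (\<lambda>n. Lp_norm p (Y - embed (h n))) \<longlonglongrightarrow> 0"
proof -
  have "\<forall>n. \<exists>h. centered h \<and> Lp_norm p (Y - embed h) < inverse (real (Suc n))"
    using X00_approx[OF p assms] by (simp del: of_nat_Suc)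
  then obtain h where h: "\<And>n. centered (h n)" "\<And>n. Lp_norm p (Y - embed (h n)) < inverse (real (Suc n))" by metis
  have "(\<lambda>n. Lp_norm p (Y - embed (h n))) \<longlonglongrightarrow> 0"
  proof (rule tendsto_sandwich[OF _ _ tendsto_const LIMSEQ_inverse_real_of_nat])
    show "\<forall>\<^sub>F n in sequentially. 0 \<le> Lp_norm p (Y - embed (h n))" by (simp add: Lp_norm_nonneg[OF p])
    show "\<forall>\<^sub>F n in sequentially. Lp_norm p (Y - embed (h n)) \<le> inverse (real (Suc n))"
      using h(2) by (intro always_eventually allI less_imp_le)
  qed
  then show ?thesis using h(1) by blast
qed

lemma step2_dual_bound: "step2 G \<Longrightarrow> \<exists>k\<ge>0. dual_bound p k G"
  using step2_bounded dual_bound_sup[OF p] by blast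

lemma mean_diff_le:
  assumes G: "step2 G" "dual_bound p k G" and g: "step2 g" and h: "step2 h"
  shows "\<bar>mean (\<lambda>x y. G x y * g x y) - mean (\<lambda>x y. G x y * h x y)\<bar> \<le> k * Lp_norm p (embed g - embed h)"
proof -
  have "mean (\<lambda>x y. G x y * g x y) - mean (\<lambda>x y. G x y * h x y) = mean (\<lambda>x y. G x y * (g x y - h x y))"
    using mean_diff[OF step2_mult[OF G(1) g] step2_mult[OF G(1) h]] by (simp add: right_diff_distrib)
  then show ?thesis
    using dual_boundD[OF G(2) step2_diff[OF g h]] by (simp add: embed_diff g h)
qed

lemma pair_exists:
  assumes Y: "Y \<in> X00 p" and G: "step2 G"
  shows "\<exists>v. \<forall>k h. 0 \<le> k \<longrightarrow> dual_bound p k G \<longrightarrow> centered h \<longrightarrow>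
    \<bar>v - mean (\<lambda>x y. G x y * h x y)\<bar> \<le> k * Lp_norm p (Y - embed h)"
proof -
  obtain g where g: "\<And>n. centered (g n)" "(\<lambda>n. Lp_norm p (Y - embed (g n))) \<longlonglongrightarrow> 0"
    using X00_sequence[OF Y] by blast
  let ?m = "\<lambda>n. mean (\<lambda>x y. G x y * g n x y)"
  have le: "\<bar>?m n - mean (\<lambda>x y. G x y * h x y)\<bar> \<le> k * (Lp_norm p (Y - embed (g n)) + Lp_norm p (Y - embed h))"
    if "0 \<le> k" "dual_bound p k G" "centered h" for k h n
  proof -
    have "\<bar>?m n - mean (\<lambda>x y. G x y * h x y)\<bar> \<le> k * Lp_norm p (embed (g n) - embed h)"
      by (intro mean_diff_le G that centered_step2 g)
    also have "\<dots> \<le> k * (Lp_norm p (embed (g n) - Y) + Lp_norm p (Y - embed h))"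
      by (intro mult_left_mono Lp_norm_triangle p X00_Lp[OF p Y] centered_Lp[OF p] g that)
    finally show ?thesis by (simp add: Lp_norm_minus_commute[OF p, of Y])
  qed
  obtain k0 where k0: "0 \<le> k0" "dual_bound p k0 G" using step2_dual_bound[OF G] by blast
  have "Cauchy ?m"
  proof (rule metric_CauchyI)
    fix e :: real assume "e > 0"
    then have "e / (2 * (k0 + 1)) > 0" using k0 by simp
    with g(2) have "\<forall>\<^sub>F n in sequentially. Lp_norm p (Y - embed (g n)) < e / (2 * (k0 + 1))"
      by (rule order_tendstoD(2))
    then obtain M where M: "\<And>n. n \<ge> M \<Longrightarrow> Lp_norm p (Y - embed (g n)) < e / (2 * (k0 + 1))"
      by (auto simp: eventually_sequentially)
    have "dist (?m a) (?m b) < e" if "a \<ge> M" "b \<ge> M" for a b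
    proof -
      have "dist (?m a) (?m b) \<le> k0 * (Lp_norm p (Y - embed (g a)) + Lp_norm p (Y - embed (g b)))"
        unfolding dist_real_def by (rule le[OF k0 g(1)])
      also have "\<dots> \<le> k0 * (e / (k0 + 1))"
      proof (rule mult_left_mono[OF _ k0(1)])
        have "Lp_norm p (Y - embed (g a)) + Lp_norm p (Y - embed (g b)) \<le> e / (2 * (k0 + 1)) + e / (2 * (k0 + 1))"
          by (intro add_mono less_imp_le M that)
        also have "e / (2 * (k0 + 1)) = e / (k0 + 1) / 2" by simp
        also have "e / (k0 + 1) / 2 + e / (k0 + 1) / 2 = e / (k0 + 1)" by (rule field_sum_of_halves)
        finally show "Lp_norm p (Y - embed (g a)) + Lp_norm p (Y - embed (g b)) \<le> e / (k0 + 1)" .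
      qed
      also have "\<dots> < e" using k0 \<open>e > 0\<close> by (simp add: field_simps)
      finally show ?thesis .
    qed
    then show "\<exists>M. \<forall>m\<ge>M. \<forall>n\<ge>M. dist (?m m) (?m n) < e" by blast
  qed
  then obtain v where v: "?m \<longlonglongrightarrow> v" using Cauchy_convergent_iff convergent_def by blast
  have "\<bar>v - mean (\<lambda>x y. G x y * h x y)\<bar> \<le> k * Lp_norm p (Y - embed h)"
    if that: "0 \<le> k" "dual_bound p k G" "centered h" for k h
  proof (rule tendsto_le[OF sequentially_bot])
    show "(\<lambda>n. k * (Lp_norm p (Y - embed (g n)) + Lp_norm p (Y - embed h))) \<longlonglongrightarrow> k * Lp_norm p (Y - embed h)"
      using tendsto_mult[OF tendsto_const tendsto_add[OF g(2) tendsto_const], of k "Lp_norm p (Y - embed h)"] by simp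
    show "(\<lambda>n. \<bar>?m n - mean (\<lambda>x y. G x y * h x y)\<bar>) \<longlonglongrightarrow> \<bar>v - mean (\<lambda>x y. G x y * h x y)\<bar>"
      by (intro tendsto_rabs tendsto_diff v tendsto_const)
    show "\<forall>\<^sub>F n in sequentially. \<bar>?m n - mean (\<lambda>x y. G x y * h x y)\<bar> \<le> k * (Lp_norm p (Y - embed (g n)) + Lp_norm p (Y - embed h))"
      using le[OF that] by simp
  qed
  then show ?thesis by blast
qed

text \<open>The extension by continuity of h \<mapsto>
  \<open>mean (\<lambda>x y. G x y * h x y)\<close> to the whole space. The estimate is required for
  all admissible k at once, so that whichever dual bound is known for G can be inserted
  afterwards.\<close>

definition pair :: "(nat set \<Rightarrow> nat set \<Rightarrow> real) \<Rightarrow> L1 L0 \<Rightarrow> real" where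
  "pair G Y = (SOME v. \<forall>k h. 0 \<le> k \<longrightarrow> dual_bound p k G \<longrightarrow> centered h \<longrightarrow>
    \<bar>v - mean (\<lambda>x y. G x y * h x y)\<bar> \<le> k * Lp_norm p (Y - embed h))"

lemma pair_approx:
  assumes "Y \<in> X00 p" "step2 G" "0 \<le> k" "dual_bound p k G" "centered h"
  shows "\<bar>pair G Y - mean (\<lambda>x y. G x y * h x y)\<bar> \<le> k * Lp_norm p (Y - embed h)"
  using someI_ex[OF pair_exists[OF assms(1,2)]] assms(3-5) unfolding pair_def by blast

lemma pair_le:
  assumes "Y \<in> X00 p" "step2 G" "0 \<le> k" "dual_bound p k G"
  shows "\<bar>pair G Y\<bar> \<le> k * Lp_norm p Y"
  using pair_approx[OF assms centered_zero] mean_cmult[OF step2_const[of 0], of 0] by (simp add: embed_zero)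

lemma pair_tendsto:
  assumes Y: "Y \<in> X00 p" and G: "step2 G" and h: "\<And>n. centered (h n)" "(\<lambda>n. Lp_norm p (Y - embed (h n))) \<longlonglongrightarrow> 0"
  shows "(\<lambda>n. mean (\<lambda>x y. G x y * h n x y)) \<longlonglongrightarrow> pair G Y"
proof -
  obtain k where k: "0 \<le> k" "dual_bound p k G" using step2_dual_bound[OF G] by blast
  have l: "(\<lambda>n. k * Lp_norm p (Y - embed (h n))) \<longlonglongrightarrow> 0" using tendsto_mult[OF tendsto_const h(2), of k] by simp
  have "(\<lambda>n. \<bar>mean (\<lambda>x y. G x y * h n x y) - pair G Y\<bar>) \<longlonglongrightarrow> 0"
  proof (rule tendsto_sandwich[OF _ _ tendsto_const l])
    show "\<forall>\<^sub>F n in sequentially. \<bar>mean (\<lambda>x y. G x y * h n x y) - pair G Y\<bar> \<le> k * Lp_norm p (Y - embed (h n))"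
      using pair_approx[OF Y G k h(1)] by (simp add: abs_minus_commute)
  qed simp
  then show ?thesis by (simp add: tendsto_rabs_zero_iff LIM_zero_iff)
qed

lemma pair_add1:
  assumes Y: "Y \<in> X00 p" and G: "step2 G" "step2 G'"
  shows "pair (\<lambda>x y. G x y + G' x y) Y = pair G Y + pair G' Y"
proof -
  obtain h where h: "\<And>n. centered (h n)" "(\<lambda>n. Lp_norm p (Y - embed (h n))) \<longlonglongrightarrow> 0"
    using X00_sequence[OF Y] by blast
  have "mean (\<lambda>x y. (G x y + G' x y) * h n x y) = mean (\<lambda>x y. G x y * h n x y) + mean (\<lambda>x y. G' x y * h n x y)" for n
    unfolding distrib_right by (intro mean_add step2_mult G centered_step2 h)
  with pair_tendsto[OF Y step2_add[OF G] h]
  have "(\<lambda>n. mean (\<lambda>x y. G x y * h n x y) + mean (\<lambda>x y. G' x y * h n x y)) \<longlonglongrightarrow> pair (\<lambda>x y. G x y + G' x y) Y" by simp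
  then show ?thesis
    by (rule LIMSEQ_unique) (intro tendsto_add pair_tendsto Y G h)
qed

lemma pair_cmult1:
  assumes Y: "Y \<in> X00 p" and G: "step2 G"
  shows "pair (\<lambda>x y. c * G x y) Y = c * pair G Y"
proof -
  obtain h where h: "\<And>n. centered (h n)" "(\<lambda>n. Lp_norm p (Y - embed (h n))) \<longlonglongrightarrow> 0"
    using X00_sequence[OF Y] by blast
  have "mean (\<lambda>x y. c * G x y * h n x y) = c * mean (\<lambda>x y. G x y * h n x y)" for n
    unfolding mult.assoc by (intro mean_cmult step2_mult G centered_step2 h)
  with pair_tendsto[OF Y step2_cmult[OF G, of c] h]
  have "(\<lambda>n. c * mean (\<lambda>x y. G x y * h n x y)) \<longlonglongrightarrow> pair (\<lambda>x y. c * G x y) Y" by simp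
  then show ?thesis
    by (rule LIMSEQ_unique) (intro tendsto_mult tendsto_const pair_tendsto Y G h)
qed

lemma pair_add2:
  assumes Y: "Y \<in> X00 p" "Z \<in> X00 p" and G: "step2 G"
  shows "pair G (Y + Z) = pair G Y + pair G Z"
proof -
  obtain g where g: "\<And>n. centered (g n)" "(\<lambda>n. Lp_norm p (Y - embed (g n))) \<longlonglongrightarrow> 0"
    using X00_sequence[OF Y(1)] by blast
  obtain h where h: "\<And>n. centered (h n)" "(\<lambda>n. Lp_norm p (Z - embed (h n))) \<longlonglongrightarrow> 0"
    using X00_sequence[OF Y(2)] by blast
  let ?k = "\<lambda>n x y. g n x y + h n x y"
  have k: "centered (?k n)" for n by (intro centered_add g h)
  have "(\<lambda>n. Lp_norm p (Y + Z - embed (?k n))) \<longlonglongrightarrow> 0"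
  proof (rule tendsto_sandwich[OF _ _ tendsto_const])
    show "(\<lambda>n. Lp_norm p (Y - embed (g n)) + Lp_norm p (Z - embed (h n))) \<longlonglongrightarrow> 0"
      using tendsto_add[OF g(2) h(2)] by simp
    have "Lp_norm p (Y + Z - embed (?k n)) \<le> Lp_norm p (Y - embed (g n)) + Lp_norm p (Z - embed (h n))" for n
    proof -
      have "Y + Z - embed (?k n) = (Y - embed (g n)) + (Z - embed (h n))"
        by (simp add: embed_add centered_step2 g h)
      moreover have "Lp_norm p ((Y - embed (g n)) + (Z - embed (h n))) \<le> Lp_norm p (Y - embed (g n)) + Lp_norm p (Z - embed (h n))"
        by (intro Lp_norm_add Lp_norm_diff p X00_Lp[OF p Y(1)] X00_Lp[OF p Y(2)] centered_Lp[OF p] g h)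
      ultimately show ?thesis by (simp only:)
    qed
    then show "\<forall>\<^sub>F n in sequentially. Lp_norm p (Y + Z - embed (?k n)) \<le> Lp_norm p (Y - embed (g n)) + Lp_norm p (Z - embed (h n))"
      by simp
  qed (simp add: Lp_norm_nonneg[OF p])
  from pair_tendsto[OF X00_add[OF p Y] G k this]
  have "(\<lambda>n. mean (\<lambda>x y. G x y * ?k n x y)) \<longlonglongrightarrow> pair G (Y + Z)" .
  moreover have "mean (\<lambda>x y. G x y * ?k n x y) = mean (\<lambda>x y. G x y * g n x y) + mean (\<lambda>x y. G x y * h n x y)" for n
    unfolding distrib_left by (intro mean_add step2_mult G centered_step2 g h)
  ultimately have "(\<lambda>n. mean (\<lambda>x y. G x y * g n x y) + mean (\<lambda>x y. G x y * h n x y)) \<longlonglongrightarrow> pair G (Y + Z)" by simp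
  then show ?thesis
    by (rule LIMSEQ_unique) (intro tendsto_add pair_tendsto Y G g h)
qed

lemma pair_scaleR:
  assumes Y: "Y \<in> X00 p" and G: "step2 G"
  shows "pair G (c *\<^sub>R Y) = c * pair G Y"
proof -
  obtain g where g: "\<And>n. centered (g n)" "(\<lambda>n. Lp_norm p (Y - embed (g n))) \<longlonglongrightarrow> 0"
    using X00_sequence[OF Y] by blast
  let ?k = "\<lambda>n x y. c * g n x y"
  have k: "centered (?k n)" for n by (intro centered_cmult g)
  have "Lp_norm p (c *\<^sub>R Y - embed (?k n)) = \<bar>c\<bar> * Lp_norm p (Y - embed (g n))" for n
  proof -
    have "c *\<^sub>R Y - embed (?k n) = c *\<^sub>R (Y - embed (g n))"
      by (simp add: embed_cmult centered_step2 g scaleR_diff_right)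
    then show ?thesis by (simp only: Lp_norm_scaleR[OF p])
  qed
  then have "(\<lambda>n. Lp_norm p (c *\<^sub>R Y - embed (?k n))) \<longlonglongrightarrow> 0"
    using tendsto_mult[OF tendsto_const g(2), of "\<bar>c\<bar>"] by simp
  from pair_tendsto[OF X00_scaleR[OF p Y] G k this]
  have "(\<lambda>n. mean (\<lambda>x y. G x y * ?k n x y)) \<longlonglongrightarrow> pair G (c *\<^sub>R Y)" .
  moreover have "mean (\<lambda>x y. G x y * ?k n x y) = c * mean (\<lambda>x y. G x y * g n x y)" for n
    unfolding mult.left_commute[of _ c] by (intro mean_cmult step2_mult G centered_step2 g)
  ultimately have "(\<lambda>n. c * mean (\<lambda>x y. G x y * g n x y)) \<longlonglongrightarrow> pair G (c *\<^sub>R Y)" by simp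
  then show ?thesis
    by (rule LIMSEQ_unique) (intro tendsto_mult tendsto_const pair_tendsto Y G g)
qed

text \<open>\<open>S\<close> is meaningful on the space only, so F is centered first, at the cost of
  a factor 4. For \<open>small\<close>, the image under S is approximated by a bounded step
  function, whose integral over a strip of level n is at most K/2^n.\<close>

lemma bounded_form_pair:
  assumes S: "S \<in> bounded_operators (X00 p) (Lp_norm p)"
  shows "\<exists>C. bounded_form p C (\<lambda>G F. pair G (S (embed (center F))))"
proof -
  obtain C where C0: "0 \<le> C" and "\<forall>Y\<in>X00 p. Lp_norm p (S Y) \<le> C * Lp_norm p Y"
    using bounded_operators_bound[OF S Lp_norm_nonneg[OF p]] by blast
  note C = this(2)[rule_format]
  note SX = bounded_operatorsD(1)[OF S] and Sadd = bounded_operatorsD(2)[OF S] and Sscale = bounded_operatorsD(3)[OF S]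
  have eX: "embed (center F) \<in> X00 p" if "step2 F" for F
    by (intro embed_X00 p centered_center that)
  have "bounded_form p (4 * C) (\<lambda>G F. pair G (S (embed (center F))))"
  proof
    fix G G' F F' :: "nat set \<Rightarrow> nat set \<Rightarrow> real" and c :: real
    show "1 < p" by (rule p)
    show "pair (\<lambda>x y. G x y + G' x y) (S (embed (center F))) = pair G (S (embed (center F))) + pair G' (S (embed (center F)))"
      if "step2 G" "step2 G'" "step2 F" by (intro pair_add1 SX eX that)
    show "pair (\<lambda>x y. c * G x y) (S (embed (center F))) = c * pair G (S (embed (center F)))"
      if "step2 G" "step2 F" by (intro pair_cmult1 SX eX that)
    show "pair G (S (embed (center (\<lambda>x y. F x y + F' x y)))) = pair G (S (embed (center F))) + pair G (S (embed (center F')))"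
      if st: "step2 G" "step2 F" "step2 F'"
    proof -
      have "embed (center (\<lambda>x y. F x y + F' x y)) = embed (center F) + embed (center F')"
        unfolding center_add[OF st(2,3)] by (intro embed_add centered_step2 centered_center st)
      then show ?thesis
        using Sadd[OF eX eX, OF st(2,3)] pair_add2[OF SX[OF eX[OF st(2)]] SX[OF eX[OF st(3)]] st(1)] by simp
    qed
    show "pair G (S (embed (center (\<lambda>x y. c * F x y)))) = c * pair G (S (embed (center F)))"
      if st: "step2 G" "step2 F"
    proof -
      have "embed (center (\<lambda>x y. c * F x y)) = c *\<^sub>R embed (center F)"
        unfolding center_cmult[OF st(2)] by (intro embed_cmult centered_step2 centered_center st)
      then show ?thesis
        using Sscale[OF eX[OF st(2)]] pair_scaleR[OF SX[OF eX[OF st(2)]] st(1)] by simp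
    qed
  next
    fix G F :: "nat set \<Rightarrow> nat set \<Rightarrow> real" and n N :: nat and a :: "nat set"
    assume G: "step2 G" "\<And>x y. \<bar>G x y\<bar> \<le> (if x \<inter> {..<n} = a then 1 else 0)" and F: "dep2 N F"
    let ?k = "2 powr (- (1 - 1 / p) * real n)"
    have F': "step2 F" by (rule step2I[OF F])
    have "\<bar>pair G (S (embed (center F)))\<bar> \<le> ?k * Lp_norm p (S (embed (center F)))"
      by (intro pair_le SX eX F' G dual_bound_strip[OF p G]) simp
    also have "\<dots> \<le> ?k * (C * (4 * Lp_norm p (embed F)))"
    proof (rule mult_left_mono)
      have "Lp_norm p (S (embed (center F))) \<le> C * Lp_norm p (embed (center F))" by (intro C eX F')
      also have "\<dots> \<le> C * (4 * Lp_norm p (embed F))"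
        by (intro mult_left_mono Lp_norm_center p F' C0)
      finally show "Lp_norm p (S (embed (center F))) \<le> C * (4 * Lp_norm p (embed F))" .
    qed simp
    finally show "\<bar>pair G (S (embed (center F)))\<bar> \<le> 4 * C * ?k * mixed_norm p N F"
      unfolding Lp_norm_embed[OF F] by (simp only: mult_ac)
  next
    fix F :: "nat set \<Rightarrow> nat set \<Rightarrow> real" and \<epsilon> :: real
    assume F: "step2 F" and \<epsilon>: "\<epsilon> > 0"
    let ?Y = "S (embed (center F))"
    have "\<epsilon> / 2 > 0" using \<epsilon> by simp
    from X00_approx[OF p SX[OF eX[OF F]] this] obtain h where h: "centered h" "Lp_norm p (?Y - embed h) < \<epsilon> / 2" by blast
    obtain K where K: "0 \<le> K" "\<And>x y. \<bar>h x y\<bar> \<le> K" using step2_bounded[OF centered_step2[OF h(1)]] by blast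
    have "(\<lambda>n. K * (1 / 2) ^ n) \<longlonglongrightarrow> K * 0"
      by (intro tendsto_mult tendsto_const LIMSEQ_power_zero) simp
    then have "\<forall>\<^sub>F n in sequentially. K * (1 / 2) ^ n < \<epsilon> / 2"
      using \<epsilon> by (intro order_tendstoD(2)) auto
    then show "\<forall>\<^sub>F n in sequentially. \<forall>b G. step2 G \<longrightarrow>
      (\<forall>x y. \<bar>G x y\<bar> \<le> (if y \<inter> {..<n} = b then 1 else 0)) \<longrightarrow> \<bar>pair G ?Y\<bar> \<le> \<epsilon>"
    proof eventually_elim
      case (elim n)
      show ?case
      proof (intro allI impI)
        fix b G assume G: "step2 G" "\<forall>x y. \<bar>G x y\<bar> \<le> (if y \<inter> {..<n} = b then 1 else 0)"
        have G1: "\<bar>G x y\<bar> \<le> 1" for x y using G(2)[rule_format, of x y] by (simp split: if_splits)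
        have "\<bar>pair G ?Y - mean (\<lambda>x y. G x y * h x y)\<bar> \<le> 1 * Lp_norm p (?Y - embed h)"
          by (intro pair_approx SX eX F G(1) h dual_bound_sup[OF p G(1) G1]) simp
        moreover have "\<bar>mean (\<lambda>x y. G x y * h x y)\<bar> \<le> K * (1 / 2) ^ n"
        proof -
          obtain N where N: "dep2 N G" "dep2 N h" using step2_common[OF G(1) centered_step2[OF h(1)]] by blast
          define M where "M = max N n"
          have M: "dep2 M (\<lambda>x y. G x y * h x y)" "n \<le> M"
            using dep2_mono[OF dep2_mult[OF N], of M] by (auto simp: M_def)
          have "\<bar>mean (\<lambda>x y. G x y * h x y)\<bar> \<le> avg2 M (\<lambda>x y. \<bar>G x y * h x y\<bar>)"
            unfolding mean_eq[OF M(1)] by (rule abs_avg2_le)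
          also have "\<dots> \<le> avg2 M (\<lambda>x y. (if y \<inter> {..<n} = b then 1 else 0) * K)"
            unfolding abs_mult by (intro avg2_mono mult_mono G(2)[rule_format] K) auto
          also have "\<dots> = avg2 M (\<lambda>x y. if y \<inter> {..<n} = b then 1 else 0) * K" by (rule avg2_mult_const)
          also have "\<dots> \<le> 1 / 2 ^ n * K" by (intro mult_right_mono avg2_strip_le M(2) K)
          finally show ?thesis by (simp add: power_divide)
        qed
        ultimately show "\<bar>pair G ?Y\<bar> \<le> \<epsilon>" using elim h(2) by linarith
      qed
    qed
  qed
  then show ?thesis by blast
qed

end

lemma (in bounded_form) compression:
  assumes "\<epsilon> > 0"
  shows "\<exists>c \<rho> \<sigma>. sign_system \<rho> \<and> sign_system \<sigma> \<and>
    (\<forall>k G F. centered G \<longrightarrow> centered F \<longrightarrow> 0 \<le> k \<longrightarrow> dual_bound p k G \<longrightarrow>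
      \<bar>\<Phi> (compose_signs \<rho> \<sigma> G) (compose_signs \<rho> \<sigma> F) - c * mean (\<lambda>x y. G x y * F x y)\<bar>
        \<le> \<epsilon> * (k * Lp_norm p (embed F)))"
proof -
  obtain \<rho> \<sigma> where sys: "sign_system \<rho>" "sign_system \<sigma>"
    and b: "\<forall>N k G F. mean_zero N G \<longrightarrow> mean_zero N F \<longrightarrow> 0 \<le> k \<longrightarrow>
      (\<forall>F'. dep2 N F' \<longrightarrow> \<bar>avg2 N (\<lambda>x y. G x y * F' x y)\<bar> \<le> k * mixed_norm p N F') \<longrightarrow>
      \<bar>\<Phi> (compose_signs \<rho> \<sigma> G) (compose_signs \<rho> \<sigma> F)
        - full_trace \<phi> (\<lambda>_. 1) (\<lambda>_. 1) * avg2 N (\<lambda>x y. G x y * F x y)\<bar> \<le> \<epsilon> * (k * mixed_norm p N F)"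
    using form_compression[OF assms] by (elim exE conjE) (rule that)
  have "\<bar>\<Phi> (compose_signs \<rho> \<sigma> G) (compose_signs \<rho> \<sigma> F) - full_trace \<phi> (\<lambda>_. 1) (\<lambda>_. 1) * mean (\<lambda>x y. G x y * F x y)\<bar>
      \<le> \<epsilon> * (k * Lp_norm p (embed F))"
    if G: "centered G" and F: "centered F" and k: "0 \<le> k" "dual_bound p k G" for k G F
  proof -
    obtain N where N: "dep2 N G" "dep2 N F" using step2_common centered_step2 G F by blast
    have "\<bar>avg2 N (\<lambda>x y. G x y * F' x y)\<bar> \<le> k * mixed_norm p N F'" if "dep2 N F'" for F'
      using dual_boundD[OF k(2) step2I[OF that]] unfolding mean_eq[OF dep2_mult[OF N(1) that]] Lp_norm_embed[OF that] .
    from b[rule_format, OF centered_mean_zero[OF G N(1)] centered_mean_zero[OF F N(2)] k(1) this]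
    show ?thesis unfolding mean_eq[OF dep2_mult[OF N]] Lp_norm_embed[OF N(2)] .
  qed
  then show ?thesis
    using sys by (intro exI[of _ "full_trace \<phi> (\<lambda>_. 1) (\<lambda>_. 1)"] exI[of _ \<rho>] exI[of _ \<sigma>]) simp
qed

section \<open>Operator norms and the factorization of the identity\<close>

lemma op_norm_le:
  assumes "p > 1" "\<And>Y. Y \<in> X00 p \<Longrightarrow> Lp_norm p Y \<le> 1 \<Longrightarrow> Lp_norm p (T Y) \<le> c"
  shows "op_norm (X00 p) (Lp_norm p) T \<le> c"
  unfolding op_norm_def
proof (rule cSUP_least)
  have "0 \<in> X00 p" using embed_X00[OF assms(1) centered_zero] by (simp add: embed_zero)
  then show "{x \<in> X00 p. Lp_norm p x \<le> 1} \<noteq> {}" using Lp_norm_zero[OF assms(1)] by auto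
qed (use assms(2) in auto)

theorem theorem9p35:
  fixes p \<epsilon> :: real and S :: "L1 L0 \<Rightarrow> L1 L0"
  assumes "1 < p"
    and "S \<in> bounded_operators (X00 p) (Lp_norm p)"
    and "\<epsilon> > 0"
  shows "\<exists>A \<in> bounded_operators (X00 p) (Lp_norm p).
         \<exists>B \<in> bounded_operators (X00 p) (Lp_norm p). \<exists>c::real.
           (\<forall>F \<in> X00 p. A (B F) = F) \<and>
           op_norm (X00 p) (Lp_norm p) (\<lambda>F. A (S (B F)) - c *\<^sub>R F) < \<epsilon> \<and>
           op_norm (X00 p) (Lp_norm p) A * op_norm (X00 p) (Lp_norm p) B \<le> 1 + \<epsilon>"
proof -
  note p = assms(1)
  \<comment> \<open>The norming functional has to be centered before the compression applies, which
    costs a factor 4; then 4 \<epsilon>' = \<epsilon>/2 leaves room for the strict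
    inequality.\<close>
  define \<epsilon>' where "\<epsilon>' = \<epsilon> / 8"
  have \<epsilon>': "\<epsilon>' > 0" using assms(3) by (simp add: \<epsilon>'_def)
  obtain C0 where "bounded_form p C0 (\<lambda>G F. pair p G (S (embed (center F))))"
    using bounded_form_pair[OF p assms(2)] by blast
  from bounded_form.compression[OF this \<epsilon>'] obtain c \<rho> \<sigma> where sys: "sign_system \<rho>" "sign_system \<sigma>"
    and compr: "\<forall>k G F. centered G \<longrightarrow> centered F \<longrightarrow> 0 \<le> k \<longrightarrow> dual_bound p k G \<longrightarrow>
      \<bar>pair p (compose_signs \<rho> \<sigma> G) (S (embed (center (compose_signs \<rho> \<sigma> F)))) - c * mean (\<lambda>x y. G x y * F x y)\<bar>
        \<le> \<epsilon>' * (k * Lp_norm p (embed F))"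
    by (elim exE conjE) (rule that)
  interpret sign_pair \<rho> \<sigma> by standard (fact sys)+
  let ?b = "compose_signs \<rho> \<sigma>"
  have "\<exists>B\<in>bounded_operators (X00 p) (Lp_norm p).
    (\<forall>Y\<in>X00 p. \<forall>h. centered h \<longrightarrow> Lp_norm p (B Y - embed (?b h)) \<le> Lp_norm p (Y - embed h)) \<and>
    (\<forall>Y\<in>X00 p. Lp_norm p (B Y) \<le> Lp_norm p Y)"
  proof (rule extension[OF p])
    show "Lp_norm p (embed (?b h)) \<le> Lp_norm p (embed h)" if "centered h" for h
      by (simp add: Lp_norm_compose centered_step2 that)
  qed (rule centered_compose, assumption, (intro ext, simp only: compose_signs_def)+)
  then obtain B where B: "B \<in> bounded_operators (X00 p) (Lp_norm p)"
    and Bapp: "\<And>Y h. Y \<in> X00 p \<Longrightarrow> centered h \<Longrightarrow> Lp_norm p (B Y - embed (?b h)) \<le> Lp_norm p (Y - embed h)"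
    and Bnorm: "\<And>Y. Y \<in> X00 p \<Longrightarrow> Lp_norm p (B Y) \<le> Lp_norm p Y" by blast
  have "\<exists>A\<in>bounded_operators (X00 p) (Lp_norm p).
    (\<forall>Y\<in>X00 p. \<forall>h. centered h \<longrightarrow> Lp_norm p (A Y - embed (adjoint h)) \<le> Lp_norm p (Y - embed h)) \<and>
    (\<forall>Y\<in>X00 p. Lp_norm p (A Y) \<le> Lp_norm p Y)"
    by (intro extension p centered_adjoint Lp_norm_adjoint_le adjoint_add adjoint_cmult centered_step2)
  then obtain A where A: "A \<in> bounded_operators (X00 p) (Lp_norm p)"
    and Aapp: "\<And>Y h. Y \<in> X00 p \<Longrightarrow> centered h \<Longrightarrow> Lp_norm p (A Y - embed (adjoint h)) \<le> Lp_norm p (Y - embed h)"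
    and Anorm: "\<And>Y. Y \<in> X00 p \<Longrightarrow> Lp_norm p (A Y) \<le> Lp_norm p Y" by blast
  note AX = bounded_operatorsD(1)[OF A] and BX = bounded_operatorsD(1)[OF B]
  have AB: "A (B F) = F" if F: "F \<in> X00 p" for F
  proof (rule Lp_norm_small_eq[OF p])
    show "A (B F) \<in> Lp_space p" "F \<in> Lp_space p" by (intro X00_Lp p AX BX F)+
    fix e :: real assume "e > 0"
    then have "e / 2 > 0" by simp
    from X00_approx[OF p F this] obtain h where h: "centered h" "Lp_norm p (F - embed h) < e / 2" by blast
    have "Lp_norm p (A (B F) - embed h) \<le> Lp_norm p (B F - embed (?b h))"
      using Aapp[OF BX[OF F] centered_compose[OF h(1)]] by (simp add: adjoint_compose centered_step2 h)
    also have "\<dots> \<le> Lp_norm p (F - embed h)" by (rule Bapp[OF F h(1)])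
    finally have 1: "Lp_norm p (A (B F) - embed h) \<le> e / 2" using h(2) by linarith
    have "Lp_norm p (A (B F) - F) \<le> Lp_norm p (A (B F) - embed h) + Lp_norm p (embed h - F)"
      by (intro Lp_norm_triangle p X00_Lp[OF p] AX BX F embed_X00[OF p] h)
    then show "Lp_norm p (A (B F) - F) \<le> e"
      using 1 h(2) Lp_norm_minus_commute[OF p, of F "embed h"] by linarith
  qed
  obtain C where C0: "0 \<le> C" and "\<forall>Y\<in>X00 p. Lp_norm p (S Y) \<le> C * Lp_norm p Y"
    using bounded_operators_bound[OF assms(2) Lp_norm_nonneg[OF p]] by blast
  note C = this(2)[rule_format]
  note SX = bounded_operatorsD(1)[OF assms(2)] and Sadd = bounded_operatorsD(2)[OF assms(2)]
    and Sscale = bounded_operatorsD(3)[OF assms(2)]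
  have Sdiff: "S (Y - Z) = S Y - S Z" if "Y \<in> X00 p" "Z \<in> X00 p" for Y Z
    using Sadd[OF that(1) X00_scaleR[OF p that(2), of "-1"]] Sscale[OF that(2), of "-1"] by simp
  have "Lp_norm p (A (S (B F)) - c *\<^sub>R F) \<le> 4 * \<epsilon>'" if F: "F \<in> X00 p" "Lp_norm p F \<le> 1" for F
  proof (rule field_le_epsilon)
    fix e :: real assume e: "e > 0"
    \<comment> \<open>L collects all multiples of the approximation error \<delta> that arise below,
      so that together they amount to e.\<close>
    define L where "L = (C + 1) + (4 + 4 * \<epsilon>') + \<bar>c\<bar>"
    have L: "L > 0" using \<epsilon>' C0 by (simp add: L_def)
    define \<delta> where "\<delta> = e / L"
    have \<delta>: "\<delta> > 0" "L * \<delta> = e" using e L by (simp_all add: \<delta>_def)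
    obtain f where f: "centered f" "Lp_norm p (F - embed f) < \<delta>" using X00_approx[OF p F(1) \<delta>(1)] by blast
    let ?Y = "S (embed (?b f))"
    have bf: "embed (?b f) \<in> X00 p" by (intro embed_X00 p centered_compose f)
    have Y: "?Y \<in> X00 p" by (rule SX[OF bf])
    obtain h where h: "centered h" "Lp_norm p (?Y - embed h) < \<delta>" using X00_approx[OF p Y \<delta>(1)] by blast
    have SB: "S (B F) \<in> X00 p" by (intro SX BX F)
    note Lp = X00_Lp[OF p AX[OF SB]] X00_Lp[OF p SB] X00_Lp[OF p Y] X00_Lp[OF p F(1)]
      centered_Lp[OF p h(1)] centered_Lp[OF p f(1)] centered_Lp[OF p centered_adjoint[OF h(1)]]
    have "Lp_norm p (S (B F) - ?Y) \<le> C * Lp_norm p (B F - embed (?b f))"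
      unfolding Sdiff[OF BX[OF F(1)] bf, symmetric] by (intro C X00_diff p BX F bf)
    also have "\<dots> \<le> C * \<delta>"
      using Bapp[OF F(1) f(1)] f(2) C0 by (intro mult_left_mono) auto
    finally have 1: "Lp_norm p (S (B F) - ?Y) \<le> C * \<delta>" .
    have "Lp_norm p (A (S (B F)) - embed (adjoint h)) \<le> Lp_norm p (S (B F) - embed h)"
      by (rule Aapp[OF SB h(1)])
    also have "\<dots> \<le> Lp_norm p (S (B F) - ?Y) + Lp_norm p (?Y - embed h)"
      by (intro Lp_norm_triangle p Lp)
    also have "\<dots> \<le> C * \<delta> + \<delta>" using 1 h(2) by linarith
    finally have 2: "Lp_norm p (A (S (B F)) - embed (adjoint h)) \<le> C * \<delta> + \<delta>" .
    \<comment> \<open>The model of \<open>A (S (B F)) - c *\<^sub>R F\<close> by step functions: h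
      replaces the image under S, and f replaces F.\<close>
    define H where "H = (\<lambda>x y. adjoint h x y - c * f x y)"
    have Hc: "centered H" unfolding H_def by (intro centered_diff centered_adjoint centered_cmult h f)
    have eH: "embed H = embed (adjoint h) - c *\<^sub>R embed f"
      unfolding H_def by (simp add: embed_diff embed_cmult step2_cmult step2_adjoint centered_step2 h f)
    have 3: "Lp_norm p (embed H) \<le> 4 * \<delta> + \<epsilon>' * (4 * (1 + \<delta>))"
    proof -
      obtain N where N: "dep2 N H" using centered_step2[OF Hc] by (auto simp: step2_def)
      \<comment> \<open>The norm of H is read off from its norming functional. As H is centered,
        centering the functional does not change its value at H.\<close>
      define G where "G = norming p N H"
      have dG: "dep2 N G" unfolding G_def by (rule dep2_norming[OF N])
      have stG: "step2 G" by (rule step2I[OF dG])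
      let ?G = "center G"
      have Gc: "centered ?G" by (rule centered_center[OF stG])
      have st: "step2 ?G" "step2 f" "step2 h" "step2 (adjoint h)" "step2 (?b ?G)"
        using Gc f h by (auto intro: centered_step2 step2_adjoint step2_compose)
      have k: "dual_bound p 4 ?G"
        using dual_bound_center[OF p stG, of 1] dual_bound_norming[OF p N] by (simp add: G_def)
      have "Lp_norm p (embed H) = mean (\<lambda>x y. G x y * H x y)"
        unfolding Lp_norm_embed[OF N] mean_eq[OF dep2_mult[OF dG N]] unfolding G_def by (rule avg2_norming[OF p, symmetric])
      also have "\<dots> = mean (\<lambda>x y. ?G x y * H x y)"
        using mean_center_swap[OF stG centered_step2[OF Hc]] by (simp add: center_centered[OF Hc])
      also have "\<dots> = mean (\<lambda>x y. ?G x y * adjoint h x y - c * (?G x y * f x y))"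
        unfolding H_def by (simp add: algebra_simps)
      also have "\<dots> = mean (\<lambda>x y. ?b ?G x y * h x y) - c * mean (\<lambda>x y. ?G x y * f x y)"
        using mean_diff[OF step2_mult[OF st(1,4)] step2_cmult[OF step2_mult[OF st(1,2)], of c]]
          mean_cmult[OF step2_mult[OF st(1,2)], of c] mean_adjoint[OF st(3,1)] by simp
      finally have eq: "Lp_norm p (embed H) = mean (\<lambda>x y. ?b ?G x y * h x y) - c * mean (\<lambda>x y. ?G x y * f x y)" .
      have "\<bar>pair p (?b ?G) ?Y - mean (\<lambda>x y. ?b ?G x y * h x y)\<bar> \<le> 4 * Lp_norm p (?Y - embed h)"
        by (intro pair_approx p Y st h dual_bound_compose k) simp_all
      moreover have "\<bar>pair p (?b ?G) ?Y - c * mean (\<lambda>x y. ?G x y * f x y)\<bar> \<le> \<epsilon>' * (4 * Lp_norm p (embed f))"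
        using compr[rule_format, OF Gc f(1) _ k] by (simp add: center_centered centered_compose f)
      moreover have "\<epsilon>' * (4 * Lp_norm p (embed f)) \<le> \<epsilon>' * (4 * (1 + \<delta>))"
      proof -
        have "Lp_norm p (embed f) \<le> Lp_norm p (embed f - F) + Lp_norm p F"
          using Lp_norm_add(2)[OF p Lp_norm_diff(1)[OF p Lp(6) Lp(4)] Lp(4)] by simp
        then have "Lp_norm p (embed f) \<le> 1 + \<delta>"
          using F(2) f(2) Lp_norm_minus_commute[OF p, of F "embed f"] by linarith
        then show ?thesis using \<epsilon>' by simp
      qed
      ultimately show ?thesis using eq h(2) by linarith
    qed
    have "A (S (B F)) - c *\<^sub>R F = (A (S (B F)) - embed (adjoint h)) + (embed H + c *\<^sub>R (embed f - F))"
      unfolding eH by (simp add: algebra_simps)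
    also have "Lp_norm p \<dots> \<le> Lp_norm p (A (S (B F)) - embed (adjoint h)) + Lp_norm p (embed H + c *\<^sub>R (embed f - F))"
      by (intro Lp_norm_add Lp_norm_diff Lp_space_scaleR p Lp centered_Lp[OF p Hc])
    also have "Lp_norm p (embed H + c *\<^sub>R (embed f - F)) \<le> Lp_norm p (embed H) + Lp_norm p (c *\<^sub>R (embed f - F))"
      by (intro Lp_norm_add Lp_norm_diff Lp_space_scaleR p Lp centered_Lp[OF p Hc])
    also have "Lp_norm p (c *\<^sub>R (embed f - F)) \<le> \<bar>c\<bar> * \<delta>"
      unfolding Lp_norm_scaleR[OF p] Lp_norm_minus_commute[OF p, of "embed f"] using f(2) by (intro mult_left_mono) auto
    finally have "Lp_norm p (A (S (B F)) - c *\<^sub>R F) \<le> (C * \<delta> + \<delta>) + ((4 * \<delta> + \<epsilon>' * (4 * (1 + \<delta>))) + \<bar>c\<bar> * \<delta>)"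
      using 2 3 by linarith
    also have "\<dots> = 4 * \<epsilon>' + L * \<delta>" by (simp add: L_def algebra_simps)
    finally show "Lp_norm p (A (S (B F)) - c *\<^sub>R F) \<le> 4 * \<epsilon>' + e" by (simp only: \<delta>(2))
  qed
  then have "op_norm (X00 p) (Lp_norm p) (\<lambda>F. A (S (B F)) - c *\<^sub>R F) \<le> 4 * \<epsilon>'" by (rule op_norm_le[OF p])
  also have "\<dots> < \<epsilon>" using assms(3) by (simp add: \<epsilon>'_def)
  finally have small: "op_norm (X00 p) (Lp_norm p) (\<lambda>F. A (S (B F)) - c *\<^sub>R F) < \<epsilon>" .
  have nA: "op_norm (X00 p) (Lp_norm p) A \<le> 1"
    by (rule op_norm_le[OF p]) (rule order_trans[OF Anorm])
  have nB: "op_norm (X00 p) (Lp_norm p) B \<le> 1"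
    by (rule op_norm_le[OF p]) (rule order_trans[OF Bnorm])
  \<comment> \<open>A real supremum is informative only over a bounded set, so boundedness on the
    unit ball is shown along with it.\<close>
  have "0 \<le> op_norm (X00 p) (Lp_norm p) B"
    unfolding op_norm_def
  proof (rule cSUP_upper2[where x = 0])
    show "bdd_above ((\<lambda>x. Lp_norm p (B x)) ` {x \<in> X00 p. Lp_norm p x \<le> 1})"
      using Bnorm by (intro bdd_aboveI2[where M = 1]) (auto intro: order_trans)
    have "0 \<in> X00 p" using embed_X00[OF p centered_zero] by (simp add: embed_zero)
    then show "0 \<in> {x \<in> X00 p. Lp_norm p x \<le> 1}" using Lp_norm_zero[OF p] by simp
  qed (rule Lp_norm_nonneg[OF p])
  then have "op_norm (X00 p) (Lp_norm p) A * op_norm (X00 p) (Lp_norm p) B \<le> 1 * op_norm (X00 p) (Lp_norm p) B"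
    by (rule mult_right_mono[OF nA])
  then have "op_norm (X00 p) (Lp_norm p) A * op_norm (X00 p) (Lp_norm p) B \<le> 1 + \<epsilon>"
    using nB assms(3) by linarith
  then show ?thesis using A B AB small by blast
qed

end
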